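(* Let $\mathcal{K}$ be a decorated braid projection of a knot $K\subset S^3$, with $n$ crossings, and let $S$ be any complete resolution of $\mathcal{K}$. Let $\mathcal{R}=\mathbb{Z}[U_0,\dots,U_{2n}]$, and let $L_S, Q_S\subset\mathcal{R}$, the free $\mathcal{R}$-module $V_S$, and the complex $\mathscr{B}_{\mathrm{KR}}(S)$ be as defined in the context. Then the homology $H_*(\mathscr{B}_{\mathrm{KR}}(S))$ is isomorphic, as an $\mathcal{R}$-module, to $$\mathrm{Tor}^{\mathcal{R}}_*(\mathcal{R}/L_S,\mathcal{R}/Q_S)\otimes_{\mathcal{R}}\Lambda^*V_S .$$
   Context: Decorated braid projections. A decorated braid projection $\mathcal{K}$ of an oriented knot $K\subset S^3$ is a braid diagram drawn vertically, with strands oriented upwards, closed up by taking the top strands around to the right of the braid, so that the resulting planar diagram represents $K$. The top leftmost edge of the braid (one of the strands closed up when taking the braid closure, and hence also the rightmost edge in the planar diagram) is distinguished, and is cut open at a point, so that it is subdivided into two segments. Let $c(\mathcal{K})$ be the set of crossings and $n$ their number. The edges of the diagram (segments between consecutive crossings, with the distinguished edge subdivided in two) are $e_0,\dots,e_{2n}$, where $e_0$ is the second segment of the distinguished edge according to the orientation. Put $\mathcal{R}=\mathbb{Z}[U_0,\dots,U_{2n}]$, where $U_i$ corresponds to $e_i$; for an edge $e=e_i$ write $U_e=U_i$. At a crossing $p$, let $a$ and $b$ be the outgoing edges (upper left and upper right, respectively) and $c$ and $d$ the incoming edges (lower left and lower right, respectively). Put $L(p)=U_a+U_b-U_c-U_d\in\mathcal{R}$.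 Complete resolutions. The smoothing of $\mathcal{K}$ at $p$ is the oriented resolution at $p$, with two two-valent vertices added, one on each side of where the crossing was: the left one joins the incoming edge $c$ to the outgoing edge $a$, the right one joins $d$ to $b$. The singularization at $p$ replaces the crossing by a four-valent vertex (double point). A complete resolution $S$ is obtained by choosing a smoothing or a singularization at every crossing; it is a planar graph with vertices of valence two or four and with edges $e_0,\dots,e_{2n}$ (the point where the distinguished edge is cut open is not a vertex). Let $c(S)\subseteq c(\mathcal{K})$ be the set of singularized crossings. Ideals and modules. $L_S\subset\mathcal{R}$ is the ideal generated by $L(p)$ for $p\in c(S)$. For a four-valent vertex $p$ of $S$ put $Q(p)=U_aU_b-U_cU_d$; for a two-valent vertex $p$ with outgoing edge $e$ and incoming edge $f$ put $Q(p)=U_e-U_f$. On each connected component of $S$ that does not contain the distinguished edge, pick one two-valent vertex coming from the right hand side of a smoothed crossing, and call these chosen vertices special. $Q_S\subset\mathcal{R}$ is the ideal generated by $Q(p)$ for all non-special vertices $p$ of $S$ (so if $S$ is connected, all vertices are used). $V_S$ is the free $\mathcal{R}$-module spanned by the connected components of $S$ that do not contain $e_0$, and $\Lambda^*V_S$ is its exterior algebra over $\mathcal{R}$. The complex $\mathscr{B}_{\mathrm{KR}}(S)$. Let $L_{\mathcal{K}}\subset\mathcal{R}$ be the ideal generated by $L(p)$ for all $p\in c(\mathcal{K})$, and $\mathcal{R}'=\mathcal{R}/L_{\mathcal{K}}$. For $p\in c(\mathcal{K})$ let $\mathcal{Q}_S(p)$ be the two-step complex $\mathcal{R}'\xrightarrow{\,U_a-U_c\,}\mathcal{R}'$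 if $S$ has a smoothing at $p$, and $\mathcal{R}'\xrightarrow{\,(U_a-U_c)(U_a-U_d)\,}\mathcal{R}'$ if $S$ has a singularization at $p$. Then $\mathscr{B}_{\mathrm{KR}}(S)=\bigotimes_{p\in c(\mathcal{K})}\mathcal{Q}_S(p)$ (tensor product over $\mathcal{R}$), whose homology is an $\mathcal{R}$-module. *)

theory Defs
  imports
    "HOL-Library.Poly_Mapping"
    "HOL-Combinatorics.Transposition"
    "HOL-Algebra.QuotRing"
    "HOL-Algebra.Module"
begin

section \<open>Modules over a commutative ring\<close>

text \<open>Modules are records of type \<^typ>\<open>('r, 'm) module\<close>. That record extends the
  ring record; the fields \<^const>\<open>mult\<close> and \<^const>\<open>one\<close> carry no meaning for a module and are
  left unspecified below.\<close>

definition linear_map ::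
  "('r, 'x) ring_scheme \<Rightarrow> ('r, 'm) module \<Rightarrow> ('r, 'n) module \<Rightarrow> ('m \<Rightarrow> 'n) \<Rightarrow> bool"
  where "linear_map R M N f \<longleftrightarrow>
    f \<in> carrier M \<rightarrow> carrier N \<and>
    (\<forall>x\<in>carrier M. \<forall>y\<in>carrier M. f (x \<oplus>\<^bsub>M\<^esub> y) = f x \<oplus>\<^bsub>N\<^esub> f y) \<and>
    (\<forall>r\<in>carrier R. \<forall>x\<in>carrier M. f (r \<odot>\<^bsub>M\<^esub> x) = r \<odot>\<^bsub>N\<^esub> f x)"

definition modules_isomorphic ::
  "('r, 'x) ring_scheme \<Rightarrow> ('r, 'm) module \<Rightarrow> ('r, 'n) module \<Rightarrow> bool"
  where "modules_isomorphic R M N \<longleftrightarrow>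
    (\<exists>f. linear_map R M N f \<and> bij_betw f (carrier M) (carrier N))"

definition regular_module :: "('r, 'x) ring_scheme \<Rightarrow> ('r, 'r) module"
  where "regular_module R =
    \<lparr>carrier = carrier R, mult = undefined, one = undefined, zero = \<zero>\<^bsub>R\<^esub>, add = add R,
     smult = mult R\<rparr>"

definition zero_submodule :: "('r, 'm) module \<Rightarrow> ('r, 'm) module"
  where "zero_submodule M = M\<lparr>carrier := {\<zero>\<^bsub>M\<^esub>}\<rparr>"

text \<open>The union in \<^const>\<open>smult\<close> is a single coset whenever \<open>N\<close> is a submodule.\<close>

definition quotient_module :: "('r, 'm) module \<Rightarrow> 'm set \<Rightarrow> ('r, 'm set) module"
  where "quotient_module M N =
    \<lparr>carrier = a_rcosets\<^bsub>M\<^esub> N, mult = undefined, one = undefined, zero = N, add = set_add M,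
     smult = (\<lambda>r X. \<Union>x\<in>X. N +>\<^bsub>M\<^esub> (r \<odot>\<^bsub>M\<^esub> x))\<rparr>"

definition submodule_span :: "('r, 'x) ring_scheme \<Rightarrow> ('r, 'm) module \<Rightarrow> 'm set \<Rightarrow> 'm set"
  where "submodule_span R M A = \<Inter>{N. submodule N R M \<and> A \<subseteq> N}"

definition direct_sum :: "'i set \<Rightarrow> ('i \<Rightarrow> ('r, 'm) module) \<Rightarrow> ('r, 'i \<Rightarrow> 'm) module"
  where "direct_sum I M =
    \<lparr>carrier = {f \<in> \<Pi>\<^sub>E i\<in>I. carrier (M i). finite {i \<in> I. f i \<noteq> \<zero>\<^bsub>M i\<^esub>}},
     mult = undefined, one = undefined,
     zero = (\<lambda>i\<in>I. \<zero>\<^bsub>M i\<^esub>),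
     add = (\<lambda>f g. \<lambda>i\<in>I. f i \<oplus>\<^bsub>M i\<^esub> g i),
     smult = (\<lambda>r f. \<lambda>i\<in>I. r \<odot>\<^bsub>M i\<^esub> f i)\<rparr>"

definition free_module :: "('r, 'x) ring_scheme \<Rightarrow> 'g set \<Rightarrow> ('r, 'g \<Rightarrow> 'r) module"
  where "free_module R G = direct_sum G (\<lambda>_. regular_module R)"

definition free_gen :: "('r, 'x) ring_scheme \<Rightarrow> 'g set \<Rightarrow> 'g \<Rightarrow> 'g \<Rightarrow> 'r"
  where "free_gen R G g = (\<lambda>h\<in>G. if h = g then \<one>\<^bsub>R\<^esub> else \<zero>\<^bsub>R\<^esub>)"

text \<open>Modules given by generators \<open>G\<close> and relations \<open>A\<close>, the class of a generator, and the
  linear map out of such a module which is prescribed by \<open>\<phi>\<close> on generators. In the last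
  definition the image is a singleton as soon as \<open>\<phi>\<close> respects the relations.\<close>

definition presented_module ::
  "('r, 'x) ring_scheme \<Rightarrow> 'g set \<Rightarrow> ('g \<Rightarrow> 'r) set \<Rightarrow> ('r, ('g \<Rightarrow> 'r) set) module"
  where "presented_module R G A =
    quotient_module (free_module R G) (submodule_span R (free_module R G) A)"

definition presented_gen ::
  "('r, 'x) ring_scheme \<Rightarrow> 'g set \<Rightarrow> ('g \<Rightarrow> 'r) set \<Rightarrow> 'g \<Rightarrow> ('g \<Rightarrow> 'r) set"
  where "presented_gen R G A g =
    submodule_span R (free_module R G) A +>\<^bsub>free_module R G\<^esub> free_gen R G g"

definition presented_map ::
  "('r, 'x) ring_scheme \<Rightarrow> 'g set \<Rightarrow> ('r, 'n) module \<Rightarrow> ('g \<Rightarrow> 'n) \<Rightarrow> ('g \<Rightarrow> 'r) set \<Rightarrow> 'n"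
  where "presented_map R G N \<phi> X =
    the_elem ((\<lambda>f. \<Oplus>\<^bsub>N\<^esub>g\<in>{g \<in> G. f g \<noteq> \<zero>\<^bsub>R\<^esub>}. f g \<odot>\<^bsub>N\<^esub> \<phi> g) ` X)"


subsection \<open>Tensor products and the exterior algebra\<close>

definition tensor_gens :: "('r, 'm) module \<Rightarrow> ('r, 'n) module \<Rightarrow> ('m \<times> 'n) set"
  where "tensor_gens M N = carrier M \<times> carrier N"

definition tensor_rels ::
  "('r, 'x) ring_scheme \<Rightarrow> ('r, 'm) module \<Rightarrow> ('r, 'n) module \<Rightarrow> ('m \<times> 'n \<Rightarrow> 'r) set"
  where "tensor_rels R M N =
    (let F = free_module R (tensor_gens M N); \<delta> = free_gen R (tensor_gens M N) in
      {\<delta> (x \<oplus>\<^bsub>M\<^esub> x', y) \<ominus>\<^bsub>F\<^esub> (\<delta> (x, y) \<oplus>\<^bsub>F\<^esub> \<delta> (x', y)) | x x' y.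
         x \<in> carrier M \<and> x' \<in> carrier M \<and> y \<in> carrier N} \<union>
      {\<delta> (x, y \<oplus>\<^bsub>N\<^esub> y') \<ominus>\<^bsub>F\<^esub> (\<delta> (x, y) \<oplus>\<^bsub>F\<^esub> \<delta> (x, y')) | x y y'.
         x \<in> carrier M \<and> y \<in> carrier N \<and> y' \<in> carrier N} \<union>
      {\<delta> (r \<odot>\<^bsub>M\<^esub> x, y) \<ominus>\<^bsub>F\<^esub> r \<odot>\<^bsub>F\<^esub> \<delta> (x, y) | r x y.
         r \<in> carrier R \<and> x \<in> carrier M \<and> y \<in> carrier N} \<union>
      {\<delta> (x, r \<odot>\<^bsub>N\<^esub> y) \<ominus>\<^bsub>F\<^esub> r \<odot>\<^bsub>F\<^esub> \<delta> (x, y) | r x y.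
         r \<in> carrier R \<and> x \<in> carrier M \<and> y \<in> carrier N})"

definition tensor ::
  "('r, 'x) ring_scheme \<Rightarrow> ('r, 'm) module \<Rightarrow> ('r, 'n) module \<Rightarrow> ('r, ('m \<times> 'n \<Rightarrow> 'r) set) module"
  where "tensor R M N = presented_module R (tensor_gens M N) (tensor_rels R M N)"

definition pure_tensor ::
  "('r, 'x) ring_scheme \<Rightarrow> ('r, 'm) module \<Rightarrow> ('r, 'n) module \<Rightarrow> 'm \<times> 'n \<Rightarrow> ('m \<times> 'n \<Rightarrow> 'r) set"
  where "pure_tensor R M N = presented_gen R (tensor_gens M N) (tensor_rels R M N)"

text \<open>The tensor product of a finite list of modules, by the universal multilinear map. For the
  empty list it is free on the one generator \<^term>\<open>[]\<close>, i.e.\ the ring itself.\<close>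

definition tensor_list_gens :: "('r, 'm) module list \<Rightarrow> 'm list set"
  where "tensor_list_gens Ms =
    {xs. length xs = length Ms \<and> (\<forall>i<length Ms. xs ! i \<in> carrier (Ms ! i))}"

definition tensor_list_rels ::
  "('r, 'x) ring_scheme \<Rightarrow> ('r, 'm) module list \<Rightarrow> ('m list \<Rightarrow> 'r) set"
  where "tensor_list_rels R Ms =
    (let F = free_module R (tensor_list_gens Ms); \<delta> = free_gen R (tensor_list_gens Ms) in
      {\<delta> (xs[i := x \<oplus>\<^bsub>Ms ! i\<^esub> y]) \<ominus>\<^bsub>F\<^esub> (\<delta> (xs[i := x]) \<oplus>\<^bsub>F\<^esub> \<delta> (xs[i := y])) | xs i x y.
         xs \<in> tensor_list_gens Ms \<and> i < length Ms \<and>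
         x \<in> carrier (Ms ! i) \<and> y \<in> carrier (Ms ! i)} \<union>
      {\<delta> (xs[i := r \<odot>\<^bsub>Ms ! i\<^esub> x]) \<ominus>\<^bsub>F\<^esub> r \<odot>\<^bsub>F\<^esub> \<delta> (xs[i := x]) | r xs i x.
         r \<in> carrier R \<and> xs \<in> tensor_list_gens Ms \<and> i < length Ms \<and> x \<in> carrier (Ms ! i)})"

definition tensor_list ::
  "('r, 'x) ring_scheme \<Rightarrow> ('r, 'm) module list \<Rightarrow> ('r, ('m list \<Rightarrow> 'r) set) module"
  where "tensor_list R Ms = presented_module R (tensor_list_gens Ms) (tensor_list_rels R Ms)"

definition pure_tensor_list ::
  "('r, 'x) ring_scheme \<Rightarrow> ('r, 'm) module list \<Rightarrow> 'm list \<Rightarrow> ('m list \<Rightarrow> 'r) set"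
  where "pure_tensor_list R Ms = presented_gen R (tensor_list_gens Ms) (tensor_list_rels R Ms)"

text \<open>The underlying module of the exterior algebra, that is, of the quotient of the tensor
  algebra of \<open>M\<close> by the two-sided ideal generated by the squares \<open>v \<otimes> v\<close>. The list
  \<open>[v\<^sub>1, \<dots>, v\<^sub>k]\<close> stands for the product of \<open>v\<^sub>1, \<dots>, v\<^sub>k\<close>.\<close>

definition exterior_rels ::
  "('r, 'x) ring_scheme \<Rightarrow> ('r, 'm) module \<Rightarrow> ('m list \<Rightarrow> 'r) set"
  where "exterior_rels R M =
    (let L = lists (carrier M); F = free_module R L; \<delta> = free_gen R L in
      {\<delta> (us @ [x \<oplus>\<^bsub>M\<^esub> y] @ vs) \<ominus>\<^bsub>F\<^esub> (\<delta> (us @ [x] @ vs) \<oplus>\<^bsub>F\<^esub> \<delta> (us @ [y] @ vs)) | us vs x y.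
         us \<in> L \<and> vs \<in> L \<and> x \<in> carrier M \<and> y \<in> carrier M} \<union>
      {\<delta> (us @ [r \<odot>\<^bsub>M\<^esub> x] @ vs) \<ominus>\<^bsub>F\<^esub> r \<odot>\<^bsub>F\<^esub> \<delta> (us @ [x] @ vs) | r us vs x.
         r \<in> carrier R \<and> us \<in> L \<and> vs \<in> L \<and> x \<in> carrier M} \<union>
      {\<delta> (us @ [x, x] @ vs) | us vs x. us \<in> L \<and> vs \<in> L \<and> x \<in> carrier M})"

definition exterior_algebra ::
  "('r, 'x) ring_scheme \<Rightarrow> ('r, 'm) module \<Rightarrow> ('r, ('m list \<Rightarrow> 'r) set) module"
  where "exterior_algebra R M = presented_module R (lists (carrier M)) (exterior_rels R M)"


subsection \<open>Chain complexes, homology and Tor\<close>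

text \<open>Complexes in non-negative degrees; the differential \<open>bd C k\<close> goes from degree
  \<open>k + 1\<close> to degree \<open>k\<close>.\<close>

record ('r, 'm) chain_complex =
  obj :: "nat \<Rightarrow> ('r, 'm) module"
  bd :: "nat \<Rightarrow> 'm \<Rightarrow> 'm"

fun chain_cycles :: "('r, 'm) chain_complex \<Rightarrow> nat \<Rightarrow> 'm set"
  where
    "chain_cycles C 0 = carrier (obj C 0)"
  | "chain_cycles C (Suc k) = {x \<in> carrier (obj C (Suc k)). bd C k x = \<zero>\<^bsub>obj C k\<^esub>}"

definition chain_boundaries :: "('r, 'm) chain_complex \<Rightarrow> nat \<Rightarrow> 'm set"
  where "chain_boundaries C k = bd C k ` carrier (obj C (Suc k))"

definition homology_module :: "('r, 'm) chain_complex \<Rightarrow> nat \<Rightarrow> ('r, 'm set) module"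
  where "homology_module C k =
    quotient_module ((obj C k)\<lparr>carrier := chain_cycles C k\<rparr>) (chain_boundaries C k)"

definition total_homology :: "('r, 'm) chain_complex \<Rightarrow> ('r, nat \<Rightarrow> 'm set) module"
  where "total_homology C = direct_sum UNIV (homology_module C)"

definition two_step_complex :: "('r, 'm) module \<Rightarrow> 'r \<Rightarrow> ('r, 'm) chain_complex"
  where "two_step_complex M r =
    \<lparr>obj = (\<lambda>k. if k \<le> 1 then M else zero_submodule M),
     bd = (\<lambda>k x. if k = 0 then r \<odot>\<^bsub>M\<^esub> x else \<zero>\<^bsub>M\<^esub>)\<rparr>"

text \<open>Tensor product of a list of complexes: in degree \<open>k\<close> the direct sum over all multidegrees
  \<open>ks\<close> with total \<open>k\<close>, with the usual Koszul signs in the differential.\<close>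

definition multidegrees :: "nat \<Rightarrow> nat \<Rightarrow> nat list set"
  where "multidegrees m k = {ks. length ks = m \<and> sum_list ks = k}"

definition tensor_summand ::
  "('r, 'm) chain_complex list \<Rightarrow> nat list \<Rightarrow> ('r, 'm) module list"
  where "tensor_summand Cs ks = map2 obj Cs ks"

definition tensor_partial_bd ::
  "('r, 'x) ring_scheme \<Rightarrow> ('r, 'm) chain_complex list \<Rightarrow> nat list \<Rightarrow> nat \<Rightarrow>
    ('m list \<Rightarrow> 'r) set \<Rightarrow> ('m list \<Rightarrow> 'r) set"
  where "tensor_partial_bd R Cs ks i =
    presented_map R (tensor_list_gens (tensor_summand Cs (ks[i := Suc (ks ! i)])))
      (tensor_list R (tensor_summand Cs ks))
      (\<lambda>xs. pure_tensor_list R (tensor_summand Cs ks) (xs[i := bd (Cs ! i) (ks ! i) (xs ! i)]))"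

definition tensor_complex ::
  "('r, 'x) ring_scheme \<Rightarrow> ('r, 'm) chain_complex list \<Rightarrow>
    ('r, nat list \<Rightarrow> ('m list \<Rightarrow> 'r) set) chain_complex"
  where "tensor_complex R Cs =
    \<lparr>obj = (\<lambda>k. direct_sum (multidegrees (length Cs) k)
                 (\<lambda>ks. tensor_list R (tensor_summand Cs ks))),
     bd = (\<lambda>k x. \<lambda>ks\<in>multidegrees (length Cs) k.
            \<Oplus>\<^bsub>tensor_list R (tensor_summand Cs ks)\<^esub>i\<in>{..<length Cs}.
              ((\<ominus>\<^bsub>R\<^esub> \<one>\<^bsub>R\<^esub>) [^]\<^bsub>R\<^esub> sum_list (take i ks))
                \<odot>\<^bsub>tensor_list R (tensor_summand Cs ks)\<^esub>
              tensor_partial_bd R Cs ks i (x (ks[i := Suc (ks ! i)])))\<rparr>"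

definition tensor_complex_module ::
  "('r, 'x) ring_scheme \<Rightarrow> ('r, 'm) chain_complex \<Rightarrow> ('r, 'n) module \<Rightarrow>
    ('r, ('m \<times> 'n \<Rightarrow> 'r) set) chain_complex"
  where "tensor_complex_module R C N =
    \<lparr>obj = (\<lambda>k. tensor R (obj C k) N),
     bd = (\<lambda>k. presented_map R (tensor_gens (obj C (Suc k)) N) (tensor R (obj C k) N)
                 (\<lambda>(x, y). pure_tensor R (obj C k) N (bd C k x, y)))\<rparr>"

definition is_free_resolution ::
  "('r, 'x) ring_scheme \<Rightarrow> ('r, 'm) module \<Rightarrow> ('r, 'g \<Rightarrow> 'r) chain_complex \<Rightarrow> bool"
  where "is_free_resolution R M F \<longleftrightarrow>
    (\<forall>k. \<exists>G. obj F k = free_module R G) \<and>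
    (\<forall>k. linear_map R (obj F (Suc k)) (obj F k) (bd F k)) \<and>
    (\<forall>k. chain_boundaries F (Suc k) = chain_cycles F (Suc k)) \<and>
    (\<exists>\<epsilon>. linear_map R (obj F 0) M \<epsilon> \<and> \<epsilon> ` carrier (obj F 0) = carrier M \<and>
         {x \<in> carrier (obj F 0). \<epsilon> x = \<zero>\<^bsub>M\<^esub>} = chain_boundaries F 0)"

text \<open>Tor is computed from an arbitrarily chosen free resolution of the first argument. The type
  of basis elements is infinite and at least as large as the ring and the module, so for cardinality
  reasons every module has a resolution of this type.\<close>

definition free_resolution ::
  "('r, 'x) ring_scheme \<Rightarrow> ('r, 'm) module \<Rightarrow> ('r, ('m + 'r) list \<Rightarrow> 'r) chain_complex"
  where "free_resolution R M = (SOME F. is_free_resolution R M F)"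

definition Tor ::
  "('r, 'x) ring_scheme \<Rightarrow> ('r, 'm) module \<Rightarrow> ('r, 'n) module \<Rightarrow> nat \<Rightarrow>
    ('r, ((('m + 'r) list \<Rightarrow> 'r) \<times> 'n \<Rightarrow> 'r) set set) module"
  where "Tor R M N = homology_module (tensor_complex_module R (free_resolution R M) N)"

definition total_Tor ::
  "('r, 'x) ring_scheme \<Rightarrow> ('r, 'm) module \<Rightarrow> ('r, 'n) module \<Rightarrow>
    ('r, nat \<Rightarrow> ((('m + 'r) list \<Rightarrow> 'r) \<times> 'n \<Rightarrow> 'r) set set) module"
  where "total_Tor R M N = direct_sum UNIV (Tor R M N)"


section \<open>Decorated braid projections\<close>

text \<open>Strand positions are columns \<open>0, \<dots>, b - 1\<close> from left to right. An entry \<open>(i, s)\<close> of the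
  braid word is a crossing between columns \<open>i\<close> and \<open>i + 1\<close> with sign \<open>s\<close>; the word is read from
  bottom to top, and level \<open>t\<close> is the horizontal line just below the crossing number \<open>t\<close>.
  \<open>edge_at K j t\<close> is the index of the edge passing through column \<open>j\<close> at level \<open>t\<close>.\<close>

record decorated_braid =
  strands :: nat
  braid_word :: "(nat \<times> bool) list"
  edge_at :: "nat \<Rightarrow> nat \<Rightarrow> nat"

definition crossings :: "decorated_braid \<Rightarrow> nat"
  where "crossings K = length (braid_word K)"

definition left_col :: "decorated_braid \<Rightarrow> nat \<Rightarrow> nat"
  where "left_col K t = fst (braid_word K ! t)"

definition braid_perm :: "decorated_braid \<Rightarrow> nat \<Rightarrow> nat"
  where "braid_perm K = fold (\<lambda>(i, s) \<pi>. transpose i (Suc i) \<circ> \<pi>) (braid_word K) id"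

definition closes_to_knot :: "decorated_braid \<Rightarrow> bool"
  where "closes_to_knot K \<longleftrightarrow> (\<forall>j<strands K. \<exists>m. (braid_perm K ^^ m) 0 = j)"

definition diagram_points :: "decorated_braid \<Rightarrow> (nat \<times> nat) set"
  where "diagram_points K = {..<strands K} \<times> {..crossings K}"

text \<open>Two points lie on the same edge if one can pass from one to the other vertically without
  meeting a crossing, or around the braid closure; column 0 is not closed up here, because the
  distinguished edge is cut open. Thus the first segment of that edge passes through
  \<open>(0, n)\<close> and the second one through \<open>(0, 0)\<close>.\<close>

definition arc_steps :: "decorated_braid \<Rightarrow> ((nat \<times> nat) \<times> (nat \<times> nat)) set"
  where "arc_steps K =
    {((j, t), (j, Suc t)) | j t. j < strands K \<and> t < crossings K \<and>
       j \<noteq> left_col K t \<and> j \<noteq> Suc (left_col K t)} \<union>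
    {((j, crossings K), (j, 0)) | j. 0 < j \<and> j < strands K}"

definition same_edge :: "decorated_braid \<Rightarrow> ((nat \<times> nat) \<times> (nat \<times> nat)) set"
  where "same_edge K = (arc_steps K \<union> (arc_steps K)\<inverse>)\<^sup>*"

definition is_edge_numbering :: "decorated_braid \<Rightarrow> bool"
  where "is_edge_numbering K \<longleftrightarrow>
    (\<lambda>(j, t). edge_at K j t) ` diagram_points K = {..2 * crossings K} \<and>
    (\<forall>(j, t)\<in>diagram_points K. \<forall>(j', t')\<in>diagram_points K.
       edge_at K j t = edge_at K j' t' \<longleftrightarrow> ((j, t), (j', t')) \<in> same_edge K) \<and>
    edge_at K 0 0 = 0"

definition decorated_braid_projection :: "decorated_braid \<Rightarrow> bool"
  where "decorated_braid_projection K \<longleftrightarrow>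
    1 \<le> strands K \<and> (\<forall>(i, s)\<in>set (braid_word K). Suc i < strands K) \<and>
    closes_to_knot K \<and> is_edge_numbering K"

text \<open>The edges around a crossing: upper left, upper right, lower left, lower right.\<close>

definition edge_a :: "decorated_braid \<Rightarrow> nat \<Rightarrow> nat"
  where "edge_a K t = edge_at K (left_col K t) (Suc t)"

definition edge_b :: "decorated_braid \<Rightarrow> nat \<Rightarrow> nat"
  where "edge_b K t = edge_at K (Suc (left_col K t)) (Suc t)"

definition edge_c :: "decorated_braid \<Rightarrow> nat \<Rightarrow> nat"
  where "edge_c K t = edge_at K (left_col K t) t"

definition edge_d :: "decorated_braid \<Rightarrow> nat \<Rightarrow> nat"
  where "edge_d K t = edge_at K (Suc (left_col K t)) t"


subsection \<open>The edge ring\<close>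

text \<open>Integer polynomials in \<open>U\<^sub>0, U\<^sub>1, \<dots>\<close>: finitely supported maps from monomials to integers.\<close>

type_synonym zpoly = "(nat \<Rightarrow>\<^sub>0 nat) \<Rightarrow>\<^sub>0 int"

definition U :: "nat \<Rightarrow> zpoly"
  where "U i = Poly_Mapping.single (Poly_Mapping.single i 1) 1"

definition poly_ring :: "nat set \<Rightarrow> zpoly ring"
  where "poly_ring I =
    \<lparr>carrier = {p. \<forall>m\<in>Poly_Mapping.keys p. Poly_Mapping.keys m \<subseteq> I}, mult = (*), one = 1, zero = 0, add = (+)\<rparr>"

definition edge_ring :: "decorated_braid \<Rightarrow> zpoly ring"
  where "edge_ring K = poly_ring {..2 * crossings K}"

definition L_poly :: "decorated_braid \<Rightarrow> nat \<Rightarrow> zpoly"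
  where "L_poly K t = U (edge_a K t) + U (edge_b K t) - U (edge_c K t) - U (edge_d K t)"


subsection \<open>Complete resolutions\<close>

text \<open>A complete resolution is given by the set \<open>S\<close> of its singularized crossings.\<close>

definition complete_resolution :: "decorated_braid \<Rightarrow> nat set \<Rightarrow> bool"
  where "complete_resolution K S \<longleftrightarrow> S \<subseteq> {..<crossings K}"

datatype vertex = Four_Valent nat | Left_Vertex nat | Right_Vertex nat

definition right_vertices :: "decorated_braid \<Rightarrow> nat set \<Rightarrow> vertex set"
  where "right_vertices K S = Right_Vertex ` ({..<crossings K} - S)"

definition vertices :: "decorated_braid \<Rightarrow> nat set \<Rightarrow> vertex set"
  where "vertices K S =
    Four_Valent ` S \<union> Left_Vertex ` ({..<crossings K} - S) \<union> right_vertices K S"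

fun incident_edges :: "decorated_braid \<Rightarrow> vertex \<Rightarrow> nat set"
  where
    "incident_edges K (Four_Valent t) = {edge_a K t, edge_b K t, edge_c K t, edge_d K t}"
  | "incident_edges K (Left_Vertex t) = {edge_a K t, edge_c K t}"
  | "incident_edges K (Right_Vertex t) = {edge_b K t, edge_d K t}"

fun Q_poly :: "decorated_braid \<Rightarrow> vertex \<Rightarrow> zpoly"
  where
    "Q_poly K (Four_Valent t) =
       U (edge_a K t) * U (edge_b K t) - U (edge_c K t) * U (edge_d K t)"
  | "Q_poly K (Left_Vertex t) = U (edge_a K t) - U (edge_c K t)"
  | "Q_poly K (Right_Vertex t) = U (edge_b K t) - U (edge_d K t)"

text \<open>Connected components of the planar graph, as sets of edges. The two segments of the
  distinguished edge are adjacent at the cut point, so a component contains the distinguished edge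
  iff it contains \<open>e\<^sub>0\<close>.\<close>

definition adjacent_edges :: "decorated_braid \<Rightarrow> nat set \<Rightarrow> (nat \<times> nat) set"
  where "adjacent_edges K S =
    (\<Union>v\<in>vertices K S. incident_edges K v \<times> incident_edges K v) \<union>
    {edge_at K 0 0, edge_at K 0 (crossings K)} \<times> {edge_at K 0 0, edge_at K 0 (crossings K)}"

definition components :: "decorated_braid \<Rightarrow> nat set \<Rightarrow> nat set set"
  where "components K S = {..2 * crossings K} // (adjacent_edges K S)\<^sup>*"

definition free_components :: "decorated_braid \<Rightarrow> nat set \<Rightarrow> nat set set"
  where "free_components K S = {C \<in> components K S. 0 \<notin> C}"

text \<open>\<open>pick C\<close> is the special vertex on the component \<open>C\<close>.\<close>

definition special_choice :: "decorated_braid \<Rightarrow> nat set \<Rightarrow> (nat set \<Rightarrow> vertex) \<Rightarrow> bool"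
  where "special_choice K S pick \<longleftrightarrow>
    (\<forall>C\<in>free_components K S. pick C \<in> right_vertices K S \<and> incident_edges K (pick C) \<subseteq> C)"

definition L_ideal :: "decorated_braid \<Rightarrow> nat set \<Rightarrow> zpoly set"
  where "L_ideal K S = Idl\<^bsub>edge_ring K\<^esub> (L_poly K ` S)"

definition Q_ideal :: "decorated_braid \<Rightarrow> nat set \<Rightarrow> (nat set \<Rightarrow> vertex) \<Rightarrow> zpoly set"
  where "Q_ideal K S pick =
    Idl\<^bsub>edge_ring K\<^esub> (Q_poly K ` (vertices K S - pick ` free_components K S))"

definition cyclic_module :: "decorated_braid \<Rightarrow> zpoly set \<Rightarrow> (zpoly, zpoly set) module"
  where "cyclic_module K I = quotient_module (regular_module (edge_ring K)) I"

definition V_module :: "decorated_braid \<Rightarrow> nat set \<Rightarrow> (zpoly, nat set \<Rightarrow> zpoly) module"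
  where "V_module K S = free_module (edge_ring K) (free_components K S)"

definition Q_complex :: "decorated_braid \<Rightarrow> nat set \<Rightarrow> nat \<Rightarrow> (zpoly, zpoly set) chain_complex"
  where "Q_complex K S t =
    two_step_complex (cyclic_module K (L_ideal K {..<crossings K}))
      (if t \<in> S
       then (U (edge_a K t) - U (edge_c K t)) * (U (edge_a K t) - U (edge_d K t))
       else U (edge_a K t) - U (edge_c K t))"

definition B_KR ::
  "decorated_braid \<Rightarrow> nat set \<Rightarrow>
    (zpoly, nat list \<Rightarrow> (zpoly set list \<Rightarrow> zpoly) set) chain_complex"
  where "B_KR K S = tensor_complex (edge_ring K) (map (Q_complex K S) [0..<crossings K])"

end

theory Submission
  imports Defs
begin

text \<open>Both sides are identified with the Koszul homology of one sequence. The basic move is that an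
  entry of a Koszul sequence which is a nonzerodivisor modulo the ideal \<open>I\<close> of the coefficients
  \<open>R / I\<close> may be moved into \<open>I\<close>, or back, without changing the homology, and that only the classes
  of the entries modulo \<open>I\<close> matter. By definition \<open>B\<^sub>K\<^sub>R(S)\<close> is a Koszul complex over \<open>R / L\<^sub>K\<close> with
  one entry for every crossing, and at a singularized crossing this entry is \<open>- Q(p)\<close> modulo
  \<open>L(p)\<close>. First the \<open>L(p)\<close> of the smoothed crossings leave the ideal and the \<open>Q\<close> of the left
  vertices enter it; modulo these, the \<open>L(p)\<close> are the \<open>Q\<close> of the right vertices, which enter it too,
  except for the special ones, whose \<open>Q\<close> is already there because the fluxes through the vertices of a component
  sum to zero. The special vertices thus leave zero entries behind, which produce the exterior
  algebra. Finally the remaining \<open>L(p)\<close> leave the ideal, and the \<open>Q(p)\<close> of the four-valent vertices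
  enter it. What is left is the Koszul complex of the \<open>L(p)\<close> for \<open>p\<close> in \<open>S\<close>, a free resolution of
  \<open>R / L\<^sub>S\<close>, with coefficients in \<open>R / Q\<^sub>S\<close>, i.e. Tor.

  All nonzerodivisors needed come from weights on the edges for which the relations at the
  non-special vertices have squarefree leading monomials in pairwise disjoint sets of variables:
  following a shortest path out of each vertex towards a special vertex or the last edge, the first
  edge of the path gets a weight which dominates the weights of the edges entering the vertex.\<close>

section \<open>Linear maps and quotients\<close>

text \<open>An entry that leaves the ideal must be as regular as one that enters it, and the
  exchanges meet varying sets of relations already present. So regularity is needed over every
  subset of the relations, which is more than a regular sequence offers; leading monomials in
  disjoint variables give it at once. At a four-valent vertex both the linear L(p) and the quadratic
  Q(p) have to work next to the same remaining relations. One choice of weights serves both: a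
  single outgoing edge carries all the weight, it is the leading monomial of L(p), and the product
  of both outgoing edges is that of Q(p). That the closure is a knot enters the count of the edges
  and the regularity of all L(p) together: the fully singular resolution is connected, so no vertex
  of it is special and every L(p) is a flux. The modules to be compared live in different types, and
  Tor comes from an unspecified resolution; therefore each of them is exhibited as cycles modulo
  boundaries in one concrete module of coefficient functions, and an isomorphism is drawn only at
  the end.\<close>

lemma linear_mapI:
  assumes "\<And>x. x \<in> carrier M \<Longrightarrow> f x \<in> carrier N"
    and "\<And>x y. x \<in> carrier M \<Longrightarrow> y \<in> carrier M \<Longrightarrow> f (x \<oplus>\<^bsub>M\<^esub> y) = f x \<oplus>\<^bsub>N\<^esub> f y"
    and "\<And>r x. r \<in> carrier R \<Longrightarrow> x \<in> carrier M \<Longrightarrow> f (r \<odot>\<^bsub>M\<^esub> x) = r \<odot>\<^bsub>N\<^esub> f x"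
  shows "linear_map R M N f"
  using assms unfolding linear_map_def by blast

lemma linear_mapD:
  assumes "linear_map R M N f"
  shows linear_map_closed: "\<And>x. x \<in> carrier M \<Longrightarrow> f x \<in> carrier N"
    and linear_map_add: "\<And>x y. x \<in> carrier M \<Longrightarrow> y \<in> carrier M \<Longrightarrow> f (x \<oplus>\<^bsub>M\<^esub> y) = f x \<oplus>\<^bsub>N\<^esub> f y"
    and linear_map_smult: "\<And>r x. r \<in> carrier R \<Longrightarrow> x \<in> carrier M \<Longrightarrow> f (r \<odot>\<^bsub>M\<^esub> x) = r \<odot>\<^bsub>N\<^esub> f x"
  using assms unfolding linear_map_def by blast+

lemma linear_map_comp:
  assumes f: "linear_map R M N f" and g: "linear_map R N P g"
  shows "linear_map R M P (\<lambda>x. g (f x))"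
  by (rule linear_mapI) (simp_all add: linear_mapD[OF f] linear_mapD[OF g])

lemma linear_map_cong:
  assumes f: "linear_map R M N f" and M: "module R M" and eq: "\<And>x. x \<in> carrier M \<Longrightarrow> f x = g x"
  shows "linear_map R M N g"
proof -
  interpret M: module R M by fact
  show ?thesis
    by (rule linear_mapI) (simp_all add: linear_mapD[OF f] eq[symmetric])
qed

lemma linear_map_id: "linear_map R M M (\<lambda>x. x)"
  by (rule linear_mapI) auto

locale module_pair = M: module R M + N: module R N
  for R :: "('r, 'x) ring_scheme" and M :: "('r, 'm) module" and N :: "('r, 'n) module"
begin

lemma linear_map_zero:
  assumes f: "linear_map R M N f"
  shows "f \<zero>\<^bsub>M\<^esub> = \<zero>\<^bsub>N\<^esub>"
proof -
  have "f \<zero>\<^bsub>M\<^esub> = f \<zero>\<^bsub>M\<^esub> \<oplus>\<^bsub>N\<^esub> f \<zero>\<^bsub>M\<^esub>"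
    using linear_map_add[OF f, of "\<zero>\<^bsub>M\<^esub>" "\<zero>\<^bsub>M\<^esub>"] by simp
  then show ?thesis
    using linear_map_closed[OF f, of "\<zero>\<^bsub>M\<^esub>"] by (metis M.zero_closed N.add.r_cancel_one')
qed

lemma linear_map_a_inv:
  assumes f: "linear_map R M N f" and x: "x \<in> carrier M"
  shows "f (\<ominus>\<^bsub>M\<^esub> x) = \<ominus>\<^bsub>N\<^esub> f x"
proof -
  have "f (\<ominus>\<^bsub>M\<^esub> x) \<oplus>\<^bsub>N\<^esub> f x = \<zero>\<^bsub>N\<^esub>"
    using linear_map_add[OF f, of "\<ominus>\<^bsub>M\<^esub> x" x] linear_map_zero[OF f] x by (simp add: M.l_neg)
  then show ?thesis
    using linear_map_closed[OF f] x by (metis M.a_inv_closed N.minus_equality)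
qed

lemma linear_map_minus:
  assumes f: "linear_map R M N f" and x: "x \<in> carrier M" and y: "y \<in> carrier M"
  shows "f (x \<ominus>\<^bsub>M\<^esub> y) = f x \<ominus>\<^bsub>N\<^esub> f y"
  using linear_map_add[OF f, of x "\<ominus>\<^bsub>M\<^esub> y"] linear_map_a_inv[OF f y] x y by (simp add: a_minus_def)

lemma linear_map_finsum:
  assumes f: "linear_map R M N f" and g: "g \<in> A \<rightarrow> carrier M"
  shows "f (\<Oplus>\<^bsub>M\<^esub>i\<in>A. g i) = (\<Oplus>\<^bsub>N\<^esub>i\<in>A. f (g i))"
proof (cases "finite A")
  case True
  then show ?thesis using g
  proof (induction A rule: finite_induct)
    case empty
    then show ?case by (simp add: linear_map_zero[OF f])
  next
    case (insert a A)
    then have gc: "g a \<in> carrier M" "g \<in> A \<rightarrow> carrier M" by auto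
    then have fc: "f (g a) \<in> carrier N" "(\<lambda>i. f (g i)) \<in> A \<rightarrow> carrier N"
      using linear_map_closed[OF f] by auto
    show ?case using insert gc fc by (simp add: linear_map_add[OF f])
  qed
next
  case False
  then show ?thesis by (simp add: linear_map_zero[OF f] M.finsum_infinite N.finsum_infinite)
qed

lemma linear_map_diff:
  assumes f: "linear_map R M N f" and g: "linear_map R M N g"
  shows "linear_map R M N (\<lambda>x. f x \<ominus>\<^bsub>N\<^esub> g x)"
  by (rule linear_mapI)
     (simp_all add: linear_mapD[OF f] linear_mapD[OF g] N.smult_r_distr N.a_ac a_minus_def
        N.minus_add N.smult_r_minus)

lemma linear_map_finsum_fun:
  assumes f: "\<And>i. i \<in> A \<Longrightarrow> linear_map R M N (f i)"
  shows "linear_map R M N (\<lambda>x. \<Oplus>\<^bsub>N\<^esub>i\<in>A. f i x)"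
proof (rule linear_mapI)
  fix x y assume xy: "x \<in> carrier M" "y \<in> carrier M"
  have "(\<Oplus>\<^bsub>N\<^esub>i\<in>A. f i (x \<oplus>\<^bsub>M\<^esub> y)) = (\<Oplus>\<^bsub>N\<^esub>i\<in>A. f i x \<oplus>\<^bsub>N\<^esub> f i y)"
    by (rule N.finsum_cong') (use xy linear_mapD[OF f] in auto)
  also have "\<dots> = (\<Oplus>\<^bsub>N\<^esub>i\<in>A. f i x) \<oplus>\<^bsub>N\<^esub> (\<Oplus>\<^bsub>N\<^esub>i\<in>A. f i y)"
    by (rule N.finsum_addf) (use xy linear_mapD[OF f] in auto)
  finally show "(\<Oplus>\<^bsub>N\<^esub>i\<in>A. f i (x \<oplus>\<^bsub>M\<^esub> y)) = (\<Oplus>\<^bsub>N\<^esub>i\<in>A. f i x) \<oplus>\<^bsub>N\<^esub> (\<Oplus>\<^bsub>N\<^esub>i\<in>A. f i y)" .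
next
  fix x assume x: "x \<in> carrier M"
  then show "(\<Oplus>\<^bsub>N\<^esub>i\<in>A. f i x) \<in> carrier N"
    by (intro N.finsum_closed) (use linear_mapD[OF f] in auto)
  fix r assume r: "r \<in> carrier R"
  show "(\<Oplus>\<^bsub>N\<^esub>i\<in>A. f i (r \<odot>\<^bsub>M\<^esub> x)) = r \<odot>\<^bsub>N\<^esub> (\<Oplus>\<^bsub>N\<^esub>i\<in>A. f i x)"
  proof (cases "finite A")
    case True
    have "(\<Oplus>\<^bsub>N\<^esub>i\<in>A. f i (r \<odot>\<^bsub>M\<^esub> x)) = (\<Oplus>\<^bsub>N\<^esub>i\<in>A. r \<odot>\<^bsub>N\<^esub> f i x)"
      by (rule N.finsum_cong') (use x r linear_mapD[OF f] in auto)
    also have "\<dots> = r \<odot>\<^bsub>N\<^esub> (\<Oplus>\<^bsub>N\<^esub>i\<in>A. f i x)"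
      by (rule N.finsum_smult_ldistr[symmetric]) (use True x r linear_mapD[OF f] in auto)
    finally show ?thesis .
  qed (simp add: N.finsum_infinite r)
qed

end

section \<open>Submodules\<close>

lemma (in module) module_axioms': "module R M" by unfold_locales

lemma (in module) minus_eq_zero_iff:
  "x \<in> carrier M \<Longrightarrow> y \<in> carrier M \<Longrightarrow> x \<ominus>\<^bsub>M\<^esub> y = \<zero>\<^bsub>M\<^esub> \<longleftrightarrow> x = y"
  by (metis M.minus_equality M.minus_minus M.r_neg a_minus_def M.a_inv_closed)

text \<open>Closure under negation is recovered from multiplication by -1.\<close>

lemma (in module) submoduleI':
  assumes "H \<subseteq> carrier M" "\<zero>\<^bsub>M\<^esub> \<in> H"
    and "\<And>a b. a \<in> H \<Longrightarrow> b \<in> H \<Longrightarrow> a \<oplus>\<^bsub>M\<^esub> b \<in> H"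
    and "\<And>a x. a \<in> carrier R \<Longrightarrow> x \<in> H \<Longrightarrow> a \<odot>\<^bsub>M\<^esub> x \<in> H"
  shows "submodule H R M"
proof (rule submoduleI)
  fix a assume a: "a \<in> H"
  have "(\<ominus>\<^bsub>R\<^esub> \<one>\<^bsub>R\<^esub>) \<odot>\<^bsub>M\<^esub> a \<in> H" using assms(4) a by simp
  then show "\<ominus>\<^bsub>M\<^esub> a \<in> H" using a assms(1) by (subst (asm) smult_l_minus) auto
qed (use assms in auto)

lemma (in module) submodule_minus:
  assumes "submodule H R M" "a \<in> H" "b \<in> H"
  shows "a \<ominus>\<^bsub>M\<^esub> b \<in> H"
  unfolding a_minus_def using submoduleE[OF assms(1)] assms(2,3) by blast

lemma (in module) submodule_zero:
  assumes "submodule H R M"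
  shows "\<zero>\<^bsub>M\<^esub> \<in> H"
  using assms subgroup.one_closed[of H "add_monoid M"] unfolding submodule_def by auto

lemma (in module) submodule_diff_trans:
  assumes H: "submodule H R M" and "a \<ominus>\<^bsub>M\<^esub> b \<in> H" "a \<in> carrier M" "b \<in> carrier M"
  shows "a \<in> H \<longleftrightarrow> b \<in> H"
proof
  assume "b \<in> H"
  then have "(a \<ominus>\<^bsub>M\<^esub> b) \<oplus>\<^bsub>M\<^esub> b \<in> H" using submoduleE(5)[OF H] assms by auto
  then show "a \<in> H" using assms by (simp add: a_minus_def M.a_assoc M.l_neg)
next
  assume "a \<in> H"
  then have "a \<ominus>\<^bsub>M\<^esub> (a \<ominus>\<^bsub>M\<^esub> b) \<in> H" using submodule_minus[OF H] assms by auto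
  then show "b \<in> H" using assms
    by (simp add: a_minus_def M.minus_add M.a_assoc[symmetric] M.r_neg)
qed

lemma (in module_pair) submodule_vimage:
  assumes f: "linear_map R M N f" and H: "submodule H R N"
  shows "submodule {x \<in> carrier M. f x \<in> H} R M"
  by (rule M.submoduleI')
     (auto simp: linear_mapD[OF f] linear_map_zero[OF f] N.submodule_zero[OF H] N.submoduleE[OF H])

lemma (in module) submodule_zero_set: "submodule {\<zero>\<^bsub>M\<^esub>} R M"
  by (rule submoduleI') auto

lemma (in module_pair) submodule_kernel:
  assumes f: "linear_map R M N f"
  shows "submodule {x \<in> carrier M. f x = \<zero>\<^bsub>N\<^esub>} R M"
  using submodule_vimage[OF f N.submodule_zero_set] by simp

lemma (in module) submodule_finsum:
  assumes H: "submodule H R M" and f: "f \<in> A \<rightarrow> H"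
  shows "(\<Oplus>\<^bsub>M\<^esub>i\<in>A. f i) \<in> H"
proof (cases "finite A")
  case True
  then show ?thesis using f
  proof (induction A rule: finite_induct)
    case empty
    then show ?case by (simp add: submodule_zero[OF H])
  next
    case (insert a A)
    then have "f a \<in> carrier M" "f \<in> A \<rightarrow> carrier M" using submoduleE(1)[OF H] by auto
    then show ?case using insert submoduleE(5)[OF H] by auto
  qed
qed (simp add: M.finsum_infinite submodule_zero[OF H])

lemma (in module_pair) submodule_image:
  assumes f: "linear_map R M N f" and H: "submodule H R M"
  shows "submodule (f ` H) R N"
proof (rule N.submoduleI')
  note Hc = subsetD[OF M.submoduleE(1)[OF H]]
  show "f ` H \<subseteq> carrier N" using linear_map_closed[OF f] Hc by auto
  show "\<zero>\<^bsub>N\<^esub> \<in> f ` H"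
    using imageI[OF M.submodule_zero[OF H], of f] unfolding linear_map_zero[OF f] .
  show "a \<oplus>\<^bsub>N\<^esub> b \<in> f ` H" if ab: "a \<in> f ` H" "b \<in> f ` H" for a b
  proof -
    obtain u v where u: "u \<in> H" "v \<in> H" "a = f u" "b = f v" using ab by blast
    show ?thesis unfolding u(3,4) linear_map_add[OF f Hc[OF u(1)] Hc[OF u(2)], symmetric]
      by (rule imageI[OF M.submoduleE(5)[OF H u(1,2)]])
  qed
  show "r \<odot>\<^bsub>N\<^esub> b \<in> f ` H" if r: "r \<in> carrier R" and b: "b \<in> f ` H" for r b
  proof -
    obtain v where u: "v \<in> H" "b = f v" using b by blast
    show ?thesis unfolding u(2) linear_map_smult[OF f r Hc[OF u(1)], symmetric]
      by (rule imageI[OF M.submoduleE(4)[OF H r u(1)]])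
  qed
qed

lemma submodule_restrict:
  assumes M: "module R M" and K: "submodule K R M" and H: "submodule H R M" and HK: "H \<subseteq> K"
  shows "submodule H R (M\<lparr>carrier := K\<rparr>)"
proof -
  interpret M: module R M by fact
  interpret K: module R "M\<lparr>carrier := K\<rparr>" by (rule submodule.submodule_is_module[OF K M])
  show ?thesis
    by (rule K.submoduleI') (use HK M.submodule_zero[OF H] M.submoduleE[OF H] in auto)
qed

lemma submodule_span_submodule:
  assumes M: "module R M" and "A \<subseteq> carrier M"
  shows "submodule (submodule_span R M A) R M"
proof -
  interpret module R M by fact
  show ?thesis
  proof (rule submoduleI')
  show "submodule_span R M A \<subseteq> carrier M"
    using carrier_is_submodule assms unfolding submodule_span_def by auto
qed (auto simp: submodule_span_def submodule_zero submoduleE)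
qed

lemma submodule_span_superset: "A \<subseteq> submodule_span R M A"
  unfolding submodule_span_def by auto

lemma submodule_span_least:
  "submodule N R M \<Longrightarrow> A \<subseteq> N \<Longrightarrow> submodule_span R M A \<subseteq> N"
  unfolding submodule_span_def by auto

text \<open>\<open>covers R W M p B\<close> exhibits \<open>M\<close> as the quotient \<open>W / B\<close> without fixing a model of it.
  Two modules are isomorphic as soon as they are covered by the same \<open>W\<close> with the same \<open>B\<close>.\<close>

definition covers ::
  "('r, 'x) ring_scheme \<Rightarrow> ('r, 'w) module \<Rightarrow> ('r, 'm) module \<Rightarrow> ('w \<Rightarrow> 'm) \<Rightarrow> 'w set \<Rightarrow> bool"
  where "covers R W M p B \<longleftrightarrow> linear_map R W M p \<and> p ` carrier W = carrier M \<and>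
    B = {w \<in> carrier W. p w = \<zero>\<^bsub>M\<^esub>}"

text \<open>Every axiom is an equation between images of elements of \<open>W\<close> and descends
  along the surjection. This supplies the module structure wherever only a cover is at hand.\<close>

lemma covers_module:
  assumes W: "module R W" and p: "linear_map R W M p" and im: "p ` carrier W = carrier M"
    and z: "p \<zero>\<^bsub>W\<^esub> = \<zero>\<^bsub>M\<^esub>"
  shows "module R M"
proof -
  interpret W: module R W by fact
  note l = linear_mapD[OF p]
  have n: "\<exists>v\<in>carrier W. p (u \<oplus>\<^bsub>W\<^esub> v) = p \<zero>\<^bsub>W\<^esub>" if "u \<in> carrier W" for u
    using that by (intro bexI[of _ "\<ominus>\<^bsub>W\<^esub> u"]) (simp_all add: W.r_neg)
  show ?thesis
  proof (rule moduleI)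
    show "abelian_group M"
      by (rule abelian_groupI)
        (auto simp: im[symmetric] z[symmetric] l(2)[symmetric] W.a_ac n)
  qed (auto simp: im[symmetric] l(2,3)[symmetric] W.smult_l_distr W.smult_r_distr W.smult_assoc1 W.is_cring)
qed

text \<open>The premise on zero says that \<open>p\<close> sends zero to the zero field of
  \<open>M\<close>, which is real information as long as the record \<open>M\<close> is not known to
  be a module.\<close>

lemma coversD:
  assumes W: "module R W" and c: "covers R W M p B" and B: "\<zero>\<^bsub>W\<^esub> \<in> B"
  shows covers_imp_module: "module R M"
    and covers_linear: "linear_map R W M p"
    and covers_image: "p ` carrier W = carrier M"
    and covers_kernel: "B = {w \<in> carrier W. p w = \<zero>\<^bsub>M\<^esub>}"
    and covers_submodule: "submodule B R W"
proof -
  show p: "linear_map R W M p" "p ` carrier W = carrier M" "B = {w \<in> carrier W. p w = \<zero>\<^bsub>M\<^esub>}"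
    using c unfolding covers_def by auto
  show M: "module R M" using covers_module[OF W p(1,2)] B p(3) by auto
  interpret module_pair R W M using W M by (rule module_pair.intro)
  show "submodule B R W" unfolding p(3) by (rule submodule_kernel[OF p(1)])
qed

lemma covers_eq_iff:
  assumes W: "module R W" and c: "covers R W M p B" and B: "\<zero>\<^bsub>W\<^esub> \<in> B"
    and xy: "x \<in> carrier W" "y \<in> carrier W"
  shows "p x = p y \<longleftrightarrow> x \<ominus>\<^bsub>W\<^esub> y \<in> B"
proof -
  note c' = coversD[OF W c B]
  interpret module_pair R W M using W c'(1) by (rule module_pair.intro)
  have "x \<ominus>\<^bsub>W\<^esub> y \<in> B \<longleftrightarrow> p x \<ominus>\<^bsub>M\<^esub> p y = \<zero>\<^bsub>M\<^esub>"
    unfolding c'(4) using xy linear_map_minus[OF c'(2)] by auto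
  also have "\<dots> \<longleftrightarrow> p x = p y"
    using xy linear_map_closed[OF c'(2)] by (intro N.minus_eq_zero_iff) auto
  finally show ?thesis by simp
qed

text \<open>Universal property of \<open>W / B\<close>: \<open>h\<close> is evaluated on a chosen
  preimage, and two preimages differ by an element of \<open>B\<close>, which \<open>q\<close>
  kills.\<close>

lemma covers_factor:
  assumes W: "module R W" and c: "covers R W M p B" and B: "\<zero>\<^bsub>W\<^esub> \<in> B"
    and N: "module R N" and q: "linear_map R W N q" and qB: "\<And>w. w \<in> B \<Longrightarrow> q w = \<zero>\<^bsub>N\<^esub>"
  obtains h where "linear_map R M N h" "\<And>w. w \<in> carrier W \<Longrightarrow> h (p w) = q w"
proof -
  note c' = coversD[OF W c B]
  interpret WN: module_pair R W N using W N by (rule module_pair.intro)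
  define h where "h m = q (SOME w. w \<in> carrier W \<and> p w = m)" for m
  have h: "h (p w) = q w" if w: "w \<in> carrier W" for w
  proof -
    define v where "v = (SOME v. v \<in> carrier W \<and> p v = p w)"
    have v: "v \<in> carrier W \<and> p v = p w" unfolding v_def by (rule someI[of _ w]) (use w in auto)
    then have "v \<ominus>\<^bsub>W\<^esub> w \<in> B" using covers_eq_iff[OF W c B] w by blast
    then have "q v \<ominus>\<^bsub>N\<^esub> q w = \<zero>\<^bsub>N\<^esub>" using qB WN.linear_map_minus[OF q] v w by metis
    then have "q v = q w" using v w linear_map_closed[OF q] WN.N.minus_eq_zero_iff by blast
    then show ?thesis unfolding h_def v_def[symmetric] .
  qed
  have "linear_map R M N h"
  proof (rule linear_mapI)
    fix x assume "x \<in> carrier M"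
    then obtain u where u: "u \<in> carrier W" "p u = x" using c'(3) by (metis imageE)
    then show "h x \<in> carrier N" using h linear_map_closed[OF q] by metis
    fix r assume "r \<in> carrier R"
    then show "h (r \<odot>\<^bsub>M\<^esub> x) = r \<odot>\<^bsub>N\<^esub> h x"
      using u h linear_map_smult[OF q] linear_map_smult[OF c'(2)] by (metis WN.M.smult_closed)
  next
    fix x y assume "x \<in> carrier M" "y \<in> carrier M"
    then obtain u v where u: "u \<in> carrier W" "p u = x" "v \<in> carrier W" "p v = y"
      using c'(3) by (metis imageE)
    then show "h (x \<oplus>\<^bsub>M\<^esub> y) = h x \<oplus>\<^bsub>N\<^esub> h y"
      using h linear_map_add[OF q] linear_map_add[OF c'(2)] by (metis WN.M.add.m_closed)
  qed
  then show ?thesis using that h by blast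
qed

lemma covers_isomorphic:
  assumes W: "module R W" and B: "\<zero>\<^bsub>W\<^esub> \<in> B"
    and c: "covers R W M p B" and c': "covers R W N q B"
  shows "modules_isomorphic R M N"
proof -
  note cc = coversD[OF W c B]
  note cc' = coversD[OF W c' B]
  obtain h where h: "linear_map R M N h" "\<And>w. w \<in> carrier W \<Longrightarrow> h (p w) = q w"
    by (rule covers_factor[OF W c B cc'(1,2)]) (use cc'(4) in auto)
  have "inj_on h (carrier M)"
  proof (rule inj_onI)
    fix x y assume "x \<in> carrier M" "y \<in> carrier M" and eq: "h x = h y"
    then obtain u v where u: "u \<in> carrier W" "x = p u" "v \<in> carrier W" "y = p v"
      using cc(3) by (metis imageE)
    then have "q u = q v" using eq h(2) by simp
    then show "x = y" using u covers_eq_iff[OF W c B] covers_eq_iff[OF W c' B] by blast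
  qed
  moreover have "h ` carrier M = carrier N"
    unfolding cc(3)[symmetric] cc'(3)[symmetric] image_image using h(2) by (intro image_cong) auto
  ultimately show ?thesis using h(1) unfolding modules_isomorphic_def bij_betw_def by blast
qed

text \<open>\<open>g\<close> induces a map from \<open>W / B\<close> to \<open>W' / B'\<close>;
  premise \<open>k\<close> makes it injective and \<open>s\<close> makes it surjective. With cycles
  for \<open>W\<close> and boundaries for \<open>B\<close> this is how isomorphisms in homology are
  established below.\<close>

lemma covers_pullback:
  assumes W: "module R W" and W': "module R W'" and g: "linear_map R W W' g"
    and c: "covers R W' M p B'" and B': "\<zero>\<^bsub>W'\<^esub> \<in> B'"
    and k: "\<And>w. w \<in> carrier W \<Longrightarrow> g w \<in> B' \<longleftrightarrow> w \<in> B" and BW: "B \<subseteq> carrier W"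
    and s: "\<And>v. v \<in> carrier W' \<Longrightarrow> \<exists>w\<in>carrier W. v \<ominus>\<^bsub>W'\<^esub> g w \<in> B'"
  shows "covers R W M (\<lambda>w. p (g w)) B"
proof -
  note c' = coversD[OF W' c B']
  have "(\<lambda>w. p (g w)) ` carrier W = carrier M"
  proof
    show "carrier M \<subseteq> (\<lambda>w. p (g w)) ` carrier W"
    proof
      fix m assume "m \<in> carrier M"
      then obtain v where v: "v \<in> carrier W'" "p v = m" using c'(3) by (metis imageE)
      then obtain w where w: "w \<in> carrier W" "v \<ominus>\<^bsub>W'\<^esub> g w \<in> B'" using s by blast
      then have "p v = p (g w)" using covers_eq_iff[OF W' c B'] v linear_map_closed[OF g] by blast
      then show "m \<in> (\<lambda>w. p (g w)) ` carrier W" using w v by blast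
    qed
  qed (use linear_mapD[OF g] linear_mapD[OF c'(2)] in auto)
  moreover have "B = {w \<in> carrier W. p (g w) = \<zero>\<^bsub>M\<^esub>}"
    using k c'(4) BW linear_map_closed[OF g] by auto
  ultimately show ?thesis
    unfolding covers_def using linear_map_comp[OF g c'(2)] by auto
qed

lemma covers_quotient:
  assumes M: "module R M" and N: "submodule N R M"
  shows "covers R M (quotient_module M N) (\<lambda>x. N +>\<^bsub>M\<^esub> x) N"
proof -
  interpret M: module R M by fact
  interpret S: submodule N R M by fact
  have ag: "abelian_group M" by unfold_locales
  have S: "additive_subgroup N M" by (rule additive_subgroupI) (rule S.subgroup_axioms)
  interpret AS: abelian_subgroup N M
    by (rule abelian_subgroupI3[OF S ag])
  let ?q = "quotient_module M N"
  have coset: "N +>\<^bsub>M\<^esub> x = N +>\<^bsub>M\<^esub> y" if "x \<ominus>\<^bsub>M\<^esub> y \<in> N" "x \<in> carrier M" "y \<in> carrier M" for x y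
  proof -
    have "x \<in> N +>\<^bsub>M\<^esub> y" using that by (intro AS.a_rcos_module_rev) (auto simp: a_minus_def)
    then show ?thesis using AS.a_repr_independence' that(3) by simp
  qed
  show ?thesis unfolding covers_def
  proof (intro conjI)
    show "linear_map R M ?q (\<lambda>x. N +>\<^bsub>M\<^esub> x)"
    proof (rule linear_mapI)
      fix x assume x: "x \<in> carrier M"
      then show "N +>\<^bsub>M\<^esub> x \<in> carrier ?q"
        unfolding quotient_module_def using M.a_rcosetsI[OF AS.a_subset] by simp
      fix r assume r: "r \<in> carrier R"
      have "N +>\<^bsub>M\<^esub> (r \<odot>\<^bsub>M\<^esub> y) = N +>\<^bsub>M\<^esub> (r \<odot>\<^bsub>M\<^esub> x)" if y: "y \<in> N +>\<^bsub>M\<^esub> x" for y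
      proof -
        have yc: "y \<in> carrier M" using y x AS.a_elemrcos_carrier by blast
        have "y \<oplus>\<^bsub>M\<^esub> \<ominus>\<^bsub>M\<^esub> x \<in> N" using AS.a_rcos_module_imp[OF x y] .
        then have "r \<odot>\<^bsub>M\<^esub> (y \<oplus>\<^bsub>M\<^esub> \<ominus>\<^bsub>M\<^esub> x) \<in> N" using r by simp
        then have "r \<odot>\<^bsub>M\<^esub> y \<ominus>\<^bsub>M\<^esub> r \<odot>\<^bsub>M\<^esub> x \<in> N" using r x yc
          by (simp add: M.smult_r_distr M.smult_r_minus a_minus_def)
        then show ?thesis using coset r x yc by simp
      qed
      moreover have "x \<in> N +>\<^bsub>M\<^esub> x" by (rule AS.a_rcos_self[OF x])
      ultimately have "(\<Union>y\<in>N +>\<^bsub>M\<^esub> x. N +>\<^bsub>M\<^esub> (r \<odot>\<^bsub>M\<^esub> y)) = N +>\<^bsub>M\<^esub> (r \<odot>\<^bsub>M\<^esub> x)"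
        by blast
      then show "N +>\<^bsub>M\<^esub> (r \<odot>\<^bsub>M\<^esub> x) = r \<odot>\<^bsub>?q\<^esub> (N +>\<^bsub>M\<^esub> x)"
        unfolding quotient_module_def by simp
    next
      fix x y assume "x \<in> carrier M" "y \<in> carrier M"
      then show "N +>\<^bsub>M\<^esub> (x \<oplus>\<^bsub>M\<^esub> y) = (N +>\<^bsub>M\<^esub> x) \<oplus>\<^bsub>?q\<^esub> (N +>\<^bsub>M\<^esub> y)"
        unfolding quotient_module_def using AS.a_rcos_sum by simp
    qed
    show "(\<lambda>x. N +>\<^bsub>M\<^esub> x) ` carrier M = carrier ?q"
      unfolding quotient_module_def A_RCOSETS_def' by auto
    show "N = {x \<in> carrier M. N +>\<^bsub>M\<^esub> x = \<zero>\<^bsub>?q\<^esub>}"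
      unfolding quotient_module_def
      using M.M.a_coset_join2[OF _ S.subgroup_axioms] AS.a_rcos_self AS.a_subset by auto
  qed
qed

lemma quotient_module_module:
  assumes M: "module R M" and N: "submodule N R M"
  shows "module R (quotient_module M N)"
  using covers_imp_module[OF M covers_quotient[OF M N]] module.submodule_zero[OF M N] by blast

lemma coversD':
  assumes "covers R W M p B"
  shows "linear_map R W M p" "p ` carrier W = carrier M"
    "\<And>w. w \<in> carrier W \<Longrightarrow> p w = \<zero>\<^bsub>M\<^esub> \<longleftrightarrow> w \<in> B" "B \<subseteq> carrier W"
    "\<And>m. m \<in> carrier M \<Longrightarrow> \<exists>w\<in>carrier W. p w = m"
proof -
  show "linear_map R W M p" "B \<subseteq> carrier W" using assms unfolding covers_def by blast+
  show im: "p ` carrier W = carrier M" using assms unfolding covers_def by blast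
  show "\<And>w. w \<in> carrier W \<Longrightarrow> p w = \<zero>\<^bsub>M\<^esub> \<longleftrightarrow> w \<in> B" using assms unfolding covers_def by blast
  show "\<And>m. m \<in> carrier M \<Longrightarrow> \<exists>w\<in>carrier W. p w = m" unfolding im[symmetric] by blast
qed

lemma covers_comp:
  assumes p: "covers R W M p B" and q: "covers R M N q B'"
  shows "covers R W N (\<lambda>w. q (p w)) {w \<in> carrier W. p w \<in> B'}"
proof -
  note p' = coversD'[OF p] and q' = coversD'[OF q]
  have "(\<lambda>w. q (p w)) ` carrier W = q ` p ` carrier W" by (simp add: image_image)
  also have "\<dots> = carrier N" unfolding p'(2) q'(2) ..
  finally show ?thesis
    unfolding covers_def using linear_map_comp[OF p'(1) q'(1)] q'(3)[OF linear_map_closed[OF p'(1)]] by blast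
qed

text \<open>\<open>M\<close> and \<open>N\<close> are both \<open>W / B\<close>, hence isomorphic,
  so a cover of \<open>N\<close> by another module becomes one of \<open>M\<close>.\<close>

lemma covers_transfer:
  assumes W: "module R W" and B: "\<zero>\<^bsub>W\<^esub> \<in> B"
    and c: "covers R W M p B" and c': "covers R W N q B" and c'': "covers R W' N q' B'"
  shows "\<exists>p'. covers R W' M p' B'"
proof -
  note NM = covers_imp_module[OF W c' B] covers_imp_module[OF W c B]
  obtain f where f: "linear_map R N M f" "bij_betw f (carrier N) (carrier M)"
    using covers_isomorphic[OF W B c' c] unfolding modules_isomorphic_def by blast
  interpret NM: module_pair R N M by (rule module_pair.intro[OF NM])
  have "w = \<zero>\<^bsub>N\<^esub> \<longleftrightarrow> f w = \<zero>\<^bsub>M\<^esub>" if "w \<in> carrier N" for w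
    using inj_on_eq_iff[OF bij_betw_imp_inj_on[OF f(2)] that NM.M.zero_closed] NM.linear_map_zero[OF f(1)] by simp
  then have "covers R N M f {\<zero>\<^bsub>N\<^esub>}"
    unfolding covers_def using f(1) bij_betw_imp_surj_on[OF f(2)] NM.M.zero_closed by blast
  then have "covers R W' M (\<lambda>w. f (q' w)) {w \<in> carrier W'. q' w \<in> {\<zero>\<^bsub>N\<^esub>}}" by (rule covers_comp[OF c''])
  also have "{w \<in> carrier W'. q' w \<in> {\<zero>\<^bsub>N\<^esub>}} = B'" using c'' unfolding covers_def by simp
  finally show ?thesis by blast
qed

text \<open>The known cover starts at \<open>W\<close> and the wanted one at \<open>W'\<close>, the
  target of \<open>g\<close>. Since \<open>W' / B'\<close> is itself covered by \<open>W\<close>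
  through \<open>g\<close>, it is isomorphic to \<open>M\<close>.\<close>

lemma covers_pushforward:
  assumes W: "module R W" and W': "module R W'" and g: "linear_map R W W' g"
    and c: "covers R W M p B" and B: "\<zero>\<^bsub>W\<^esub> \<in> B" and B': "submodule B' R W'"
    and k: "\<And>w. w \<in> carrier W \<Longrightarrow> g w \<in> B' \<longleftrightarrow> w \<in> B"
    and s: "\<And>v. v \<in> carrier W' \<Longrightarrow> \<exists>w\<in>carrier W. v \<ominus>\<^bsub>W'\<^esub> g w \<in> B'"
  shows "\<exists>p'. covers R W' M p' B'"
proof (rule covers_transfer[OF W B c _ covers_quotient[OF W' B']])
  show "covers R W (quotient_module W' B') (\<lambda>w. B' +>\<^bsub>W'\<^esub> g w) B"
    by (rule covers_pullback[OF W W' g covers_quotient[OF W' B'] module.submodule_zero[OF W' B'] k coversD'(4)[OF c] s])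
qed

lemma image_eq_singletonI: "(\<And>x. x \<in> X \<Longrightarrow> f x = c) \<Longrightarrow> X \<noteq> {} \<Longrightarrow> f ` X = {c}"
  by auto

section \<open>Direct sums, free modules and presentations\<close>

lemma direct_sum_simps:
  "carrier (direct_sum I M) = {f \<in> \<Pi>\<^sub>E i\<in>I. carrier (M i). finite {i \<in> I. f i \<noteq> \<zero>\<^bsub>M i\<^esub>}}"
  "\<zero>\<^bsub>direct_sum I M\<^esub> = (\<lambda>i\<in>I. \<zero>\<^bsub>M i\<^esub>)"
  "f \<oplus>\<^bsub>direct_sum I M\<^esub> g = (\<lambda>i\<in>I. f i \<oplus>\<^bsub>M i\<^esub> g i)"
  "r \<odot>\<^bsub>direct_sum I M\<^esub> f = (\<lambda>i\<in>I. r \<odot>\<^bsub>M i\<^esub> f i)"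
  unfolding direct_sum_def by simp_all

lemma direct_sum_carrierI:
  assumes "\<And>i. i \<in> I \<Longrightarrow> f i \<in> carrier (M i)" "\<And>i. i \<notin> I \<Longrightarrow> f i = undefined"
    and "finite {i \<in> I. f i \<noteq> \<zero>\<^bsub>M i\<^esub>}"
  shows "f \<in> carrier (direct_sum I M)"
  using assms unfolding direct_sum_simps by (auto intro!: PiE_I)

lemma direct_sum_carrierD:
  assumes "f \<in> carrier (direct_sum I M)"
  shows "\<And>i. i \<in> I \<Longrightarrow> f i \<in> carrier (M i)" "\<And>i. i \<notin> I \<Longrightarrow> f i = undefined"
    "finite {i \<in> I. f i \<noteq> \<zero>\<^bsub>M i\<^esub>}" "f \<in> extensional I"
proof -
  have f: "f \<in> (\<Pi>\<^sub>E i\<in>I. carrier (M i))" and "finite {i \<in> I. f i \<noteq> \<zero>\<^bsub>M i\<^esub>}"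
    using assms unfolding direct_sum_simps by simp_all
  then show "finite {i \<in> I. f i \<noteq> \<zero>\<^bsub>M i\<^esub>}" by simp
  show "\<And>i. i \<in> I \<Longrightarrow> f i \<in> carrier (M i)" "\<And>i. i \<notin> I \<Longrightarrow> f i = undefined"
    using PiE_mem[OF f] PiE_arb[OF f] by simp_all
  show "f \<in> extensional I" using f by (simp add: PiE_def)
qed

lemma direct_sum_module:
  assumes R: "cring R" and M: "\<And>i. i \<in> I \<Longrightarrow> module R (M i)"
  shows "module R (direct_sum I M)"
proof -
  interpret R: cring R by fact
  let ?D = "direct_sum I M"
  have ag: "abelian_group (M i)" if "i \<in> I" for i using M[OF that] by (simp add: module_def)
  have fin: "finite {i \<in> I. f i \<oplus>\<^bsub>M i\<^esub> g i \<noteq> \<zero>\<^bsub>M i\<^esub>}"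
    if "f \<in> carrier ?D" "g \<in> carrier ?D" for f g
  proof (rule finite_subset)
    show "{i \<in> I. f i \<oplus>\<^bsub>M i\<^esub> g i \<noteq> \<zero>\<^bsub>M i\<^esub>} \<subseteq> {i \<in> I. f i \<noteq> \<zero>\<^bsub>M i\<^esub>} \<union> {i \<in> I. g i \<noteq> \<zero>\<^bsub>M i\<^esub>}"
      using abelian_groupE(2)[OF ag] abelian_groupE(5)[OF ag] by auto
    show "finite ({i \<in> I. f i \<noteq> \<zero>\<^bsub>M i\<^esub>} \<union> {i \<in> I. g i \<noteq> \<zero>\<^bsub>M i\<^esub>})"
      using direct_sum_carrierD(3)[OF that(1)] direct_sum_carrierD(3)[OF that(2)] by simp
  qed
  have fins: "finite {i \<in> I. r \<odot>\<^bsub>M i\<^esub> f i \<noteq> \<zero>\<^bsub>M i\<^esub>}"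
    if "f \<in> carrier ?D" "r \<in> carrier R" for f r
  proof (rule finite_subset)
    show "{i \<in> I. r \<odot>\<^bsub>M i\<^esub> f i \<noteq> \<zero>\<^bsub>M i\<^esub>} \<subseteq> {i \<in> I. f i \<noteq> \<zero>\<^bsub>M i\<^esub>}"
      using module.smult_r_null[OF M] that(2) by auto
  qed (use direct_sum_carrierD(3)[OF that(1)] in simp)
  show ?thesis
  proof (rule moduleI)
    show "abelian_group ?D"
    proof (rule abelian_groupI)
      show "\<zero>\<^bsub>?D\<^esub> \<in> carrier ?D"
        by (rule direct_sum_carrierI) (auto simp: direct_sum_simps abelian_groupE(2)[OF ag])
    next
      fix f g assume "f \<in> carrier ?D" "g \<in> carrier ?D"
      note f = direct_sum_carrierD[OF this(1)] and g = direct_sum_carrierD[OF this(2)]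
        and fg = this
      show "f \<oplus>\<^bsub>?D\<^esub> g \<in> carrier ?D"
      proof (rule direct_sum_carrierI)
        show "finite {i \<in> I. (f \<oplus>\<^bsub>?D\<^esub> g) i \<noteq> \<zero>\<^bsub>M i\<^esub>}"
          using fin[OF fg] by (simp add: direct_sum_simps cong: conj_cong)
      qed (use f(1) g(1) abelian_groupE(1)[OF ag] in \<open>auto simp: direct_sum_simps\<close>)
      show "f \<oplus>\<^bsub>?D\<^esub> g = g \<oplus>\<^bsub>?D\<^esub> f"
        unfolding direct_sum_simps by (rule restrict_ext) (use f(1) g(1) abelian_groupE(4)[OF ag] in auto)
    next
      fix f g h assume "f \<in> carrier ?D" "g \<in> carrier ?D" "h \<in> carrier ?D"
      note f = direct_sum_carrierD(1)[OF this(1)] and g = direct_sum_carrierD(1)[OF this(2)]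
        and h = direct_sum_carrierD(1)[OF this(3)]
      show "f \<oplus>\<^bsub>?D\<^esub> g \<oplus>\<^bsub>?D\<^esub> h = f \<oplus>\<^bsub>?D\<^esub> (g \<oplus>\<^bsub>?D\<^esub> h)"
        unfolding direct_sum_simps
        by (rule restrict_ext) (use f g h abelian_groupE(3)[OF ag] in auto)
    next
      fix f assume fc: "f \<in> carrier ?D"
      note f = direct_sum_carrierD[OF this]
      show "\<zero>\<^bsub>?D\<^esub> \<oplus>\<^bsub>?D\<^esub> f = f"
        by (rule extensionalityI[of _ I])
          (use f(1,4) abelian_groupE(5)[OF ag] in \<open>auto simp: direct_sum_simps\<close>)
      have "(\<ominus>\<^bsub>R\<^esub> \<one>\<^bsub>R\<^esub>) \<odot>\<^bsub>?D\<^esub> f \<in> carrier ?D"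
      proof (rule direct_sum_carrierI)
        show "finite {i \<in> I. ((\<ominus>\<^bsub>R\<^esub> \<one>\<^bsub>R\<^esub>) \<odot>\<^bsub>?D\<^esub> f) i \<noteq> \<zero>\<^bsub>M i\<^esub>}"
          using fins[OF fc] by (simp add: direct_sum_simps cong: conj_cong)
      qed (use f(1) module.smult_closed[OF M] in \<open>auto simp: direct_sum_simps\<close>)
      moreover have "((\<ominus>\<^bsub>R\<^esub> \<one>\<^bsub>R\<^esub>) \<odot>\<^bsub>?D\<^esub> f) \<oplus>\<^bsub>?D\<^esub> f = \<zero>\<^bsub>?D\<^esub>"
        unfolding direct_sum_simps
      proof (rule restrict_ext)
        fix i assume i: "i \<in> I"
        interpret module R "M i" by (rule M[OF i])
        show "(\<lambda>i\<in>I. (\<ominus>\<^bsub>R\<^esub> \<one>\<^bsub>R\<^esub>) \<odot>\<^bsub>M i\<^esub> f i) i \<oplus>\<^bsub>M i\<^esub> f i = \<zero>\<^bsub>M i\<^esub>"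
          using f(1)[OF i] i by (simp add: smult_l_minus M.l_neg)
      qed
      ultimately show "\<exists>g\<in>carrier ?D. g \<oplus>\<^bsub>?D\<^esub> f = \<zero>\<^bsub>?D\<^esub>" by blast
    qed
  next
    fix r f assume fc: "f \<in> carrier ?D" and r: "r \<in> carrier R"
    note f = direct_sum_carrierD[OF fc]
    show "r \<odot>\<^bsub>?D\<^esub> f \<in> carrier ?D"
    proof (rule direct_sum_carrierI)
      show "finite {i \<in> I. (r \<odot>\<^bsub>?D\<^esub> f) i \<noteq> \<zero>\<^bsub>M i\<^esub>}"
        using fins[OF fc r] by (simp add: direct_sum_simps cong: conj_cong)
    qed (use f(1) module.smult_closed[OF M] r in \<open>auto simp: direct_sum_simps\<close>)
  next
    fix f assume fc: "f \<in> carrier ?D"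
    note f = direct_sum_carrierD[OF fc]
    show "\<one>\<^bsub>R\<^esub> \<odot>\<^bsub>?D\<^esub> f = f"
      by (rule extensionalityI[of _ I])
        (use f(1,4) module.smult_one[OF M] in \<open>auto simp: direct_sum_simps\<close>)
  next
    fix r s f assume fc: "f \<in> carrier ?D" and r: "r \<in> carrier R" and s: "s \<in> carrier R"
    note f = direct_sum_carrierD(1)[OF fc]
    show "(r \<oplus>\<^bsub>R\<^esub> s) \<odot>\<^bsub>?D\<^esub> f = r \<odot>\<^bsub>?D\<^esub> f \<oplus>\<^bsub>?D\<^esub> s \<odot>\<^bsub>?D\<^esub> f"
      unfolding direct_sum_simps
      by (rule restrict_ext) (use f module.smult_l_distr[OF M] r s in auto)
    show "(r \<otimes>\<^bsub>R\<^esub> s) \<odot>\<^bsub>?D\<^esub> f = r \<odot>\<^bsub>?D\<^esub> (s \<odot>\<^bsub>?D\<^esub> f)"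
      unfolding direct_sum_simps
      by (rule restrict_ext) (use f module.smult_assoc1[OF M] r s in auto)
  next
    fix r f g assume fc: "f \<in> carrier ?D" and r: "r \<in> carrier R" and g: "g \<in> carrier ?D"
    note f = direct_sum_carrierD(1)[OF fc] and g = direct_sum_carrierD(1)[OF g]
    show "r \<odot>\<^bsub>?D\<^esub> (f \<oplus>\<^bsub>?D\<^esub> g) = r \<odot>\<^bsub>?D\<^esub> f \<oplus>\<^bsub>?D\<^esub> r \<odot>\<^bsub>?D\<^esub> g"
      unfolding direct_sum_simps
      by (rule restrict_ext) (use f g module.smult_r_distr[OF M] r in auto)
  qed (fact R)
qed

lemma regular_module_simps:
  "carrier (regular_module R) = carrier R" "\<zero>\<^bsub>regular_module R\<^esub> = \<zero>\<^bsub>R\<^esub>"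
  "x \<oplus>\<^bsub>regular_module R\<^esub> y = x \<oplus>\<^bsub>R\<^esub> y" "x \<odot>\<^bsub>regular_module R\<^esub> y = x \<otimes>\<^bsub>R\<^esub> y"
  unfolding regular_module_def by simp_all

context cring
begin

lemma regular_module_module: "module R (regular_module R)"
proof (rule moduleI)
  show "abelian_group (regular_module R)"
    by (rule abelian_groupI) (auto simp: regular_module_simps a_ac intro!: bexI[of _ "\<ominus> x" for x] l_neg)
qed (auto simp: regular_module_simps l_distr r_distr m_assoc is_cring)

lemma free_module_module: "module R (free_module R G)"
  unfolding free_module_def by (rule direct_sum_module) (auto simp: regular_module_module is_cring)

lemma free_module_simps:
  "\<zero>\<^bsub>free_module R G\<^esub> = (\<lambda>i\<in>G. \<zero>)"
  "f \<oplus>\<^bsub>free_module R G\<^esub> g = (\<lambda>i\<in>G. f i \<oplus> g i)"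
  "r \<odot>\<^bsub>free_module R G\<^esub> f = (\<lambda>i\<in>G. r \<otimes> f i)"
  unfolding free_module_def by (simp_all add: direct_sum_simps regular_module_simps)

lemma free_module_carrierI:
  assumes "\<And>i. i \<in> G \<Longrightarrow> f i \<in> carrier R" "\<And>i. i \<notin> G \<Longrightarrow> f i = undefined"
    and "finite {i \<in> G. f i \<noteq> \<zero>}"
  shows "f \<in> carrier (free_module R G)"
  unfolding free_module_def
  by (rule direct_sum_carrierI) (use assms in \<open>auto simp: regular_module_simps\<close>)

lemma free_module_carrierD:
  assumes "f \<in> carrier (free_module R G)"
  shows "\<And>i. i \<in> G \<Longrightarrow> f i \<in> carrier R" "\<And>i. i \<notin> G \<Longrightarrow> f i = undefined"
    "finite {i \<in> G. f i \<noteq> \<zero>}" "f \<in> extensional G"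
  using direct_sum_carrierD[OF assms[unfolded free_module_def]] by (auto simp: regular_module_simps)

lemma free_gen_closed:
  assumes "g \<in> G"
  shows "free_gen R G g \<in> carrier (free_module R G)"
proof (rule free_module_carrierI)
  show "finite {i \<in> G. free_gen R G g i \<noteq> \<zero>}"
    by (rule finite_subset[of _ "{g}"]) (auto simp: free_gen_def)
qed (auto simp: free_gen_def)

text \<open>\<open>G\<close> may be infinite, so the sum is restricted to the support. It is the
  expression inside \<open>presented_map\<close>, which can thus be traced back to a linear map on
  the free module.\<close>

abbreviation lin_ext :: "'g set \<Rightarrow> ('a, 'n) module \<Rightarrow> ('g \<Rightarrow> 'n) \<Rightarrow> ('g \<Rightarrow> 'a) \<Rightarrow> 'n"
  where "lin_ext G N \<phi> f \<equiv> \<Oplus>\<^bsub>N\<^esub>g\<in>{g \<in> G. f g \<noteq> \<zero>}. f g \<odot>\<^bsub>N\<^esub> \<phi> g"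

text \<open>The support varies with \<open>f\<close>; sums for different \<open>f\<close> are
  compared over a common finite set.\<close>

lemma lin_ext_superset:
  assumes N: "module R N" and \<phi>: "\<phi> \<in> G \<rightarrow> carrier N" and f: "f \<in> carrier (free_module R G)"
    and A: "finite A" "{g \<in> G. f g \<noteq> \<zero>} \<subseteq> A" "A \<subseteq> G"
  shows "lin_ext G N \<phi> f = (\<Oplus>\<^bsub>N\<^esub>g\<in>A. f g \<odot>\<^bsub>N\<^esub> \<phi> g)"
proof -
  interpret N: module R N by fact
  note f' = free_module_carrierD[OF f]
  have c: "f x \<in> carrier R" "\<phi> x \<in> carrier N" if "x \<in> A" for x
    using that A(3) \<phi> f'(1) by blast+
  show ?thesis
  proof (rule N.add.finprod_mono_neutral_cong_left)
    show "\<And>i. i \<in> A - {g \<in> G. f g \<noteq> \<zero>} \<Longrightarrow> f i \<odot>\<^bsub>N\<^esub> \<phi> i = \<zero>\<^bsub>N\<^esub>"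
      using c A(3) by auto
  qed (use A c in auto)
qed

lemma lin_ext_linear:
  assumes N: "module R N" and \<phi>: "\<phi> \<in> G \<rightarrow> carrier N"
  shows "linear_map R (free_module R G) N (lin_ext G N \<phi>)"
proof -
  interpret N: module R N by fact
  let ?F = "free_module R G"
  interpret F: module R ?F by (rule free_module_module)
  note sup = lin_ext_superset[OF N \<phi>]
  have \<phi>': "\<phi> g \<in> carrier N" if "g \<in> G" for g using \<phi> that by blast
  show ?thesis
  proof (rule linear_mapI)
    fix f assume f: "f \<in> carrier ?F"
    note f' = free_module_carrierD[OF f]
    show "lin_ext G N \<phi> f \<in> carrier N"
      by (rule N.finsum_closed) (use N.smult_closed[OF f'(1) \<phi>'] in auto)
    fix r assume r: "r \<in> carrier R"
    have "lin_ext G N \<phi> (r \<odot>\<^bsub>?F\<^esub> f) = (\<Oplus>\<^bsub>N\<^esub>g\<in>{g \<in> G. f g \<noteq> \<zero>}. (r \<odot>\<^bsub>?F\<^esub> f) g \<odot>\<^bsub>N\<^esub> \<phi> g)"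
      by (rule sup[OF F.smult_closed[OF r f]]) (use f' r in \<open>auto simp: free_module_simps\<close>)
    also have "\<dots> = (\<Oplus>\<^bsub>N\<^esub>g\<in>{g \<in> G. f g \<noteq> \<zero>}. r \<odot>\<^bsub>N\<^esub> (f g \<odot>\<^bsub>N\<^esub> \<phi> g))"
    proof (rule N.finsum_cong')
      show "\<And>g. g \<in> {g \<in> G. f g \<noteq> \<zero>} \<Longrightarrow> (r \<odot>\<^bsub>?F\<^esub> f) g \<odot>\<^bsub>N\<^esub> \<phi> g = r \<odot>\<^bsub>N\<^esub> (f g \<odot>\<^bsub>N\<^esub> \<phi> g)"
        using N.smult_assoc1[OF r f'(1) \<phi>'] by (simp add: free_module_simps)
    qed (use N.smult_closed[OF r N.smult_closed[OF f'(1) \<phi>']] in auto)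
    also have "\<dots> = r \<odot>\<^bsub>N\<^esub> lin_ext G N \<phi> f"
      by (rule N.finsum_smult_ldistr[symmetric]) (use f' r \<phi> in auto)
    finally show "lin_ext G N \<phi> (r \<odot>\<^bsub>?F\<^esub> f) = r \<odot>\<^bsub>N\<^esub> lin_ext G N \<phi> f" .
  next
    fix f g assume f: "f \<in> carrier ?F" and g: "g \<in> carrier ?F"
    note f' = free_module_carrierD[OF f] and g' = free_module_carrierD[OF g]
    let ?A = "{x \<in> G. f x \<noteq> \<zero>} \<union> {x \<in> G. g x \<noteq> \<zero>}"
    have A: "finite ?A" using f' g' by auto
    have fgc: "f x \<odot>\<^bsub>N\<^esub> \<phi> x \<in> carrier N" "g x \<odot>\<^bsub>N\<^esub> \<phi> x \<in> carrier N" if "x \<in> G" for x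
      using N.smult_closed f'(1)[OF that] g'(1)[OF that] \<phi>'[OF that] by blast+
    have "lin_ext G N \<phi> (f \<oplus>\<^bsub>?F\<^esub> g) = (\<Oplus>\<^bsub>N\<^esub>x\<in>?A. (f \<oplus>\<^bsub>?F\<^esub> g) x \<odot>\<^bsub>N\<^esub> \<phi> x)"
      by (rule sup[OF F.a_closed[OF f g]]) (use A f' g' in \<open>auto simp: free_module_simps\<close>)
    also have "\<dots> = (\<Oplus>\<^bsub>N\<^esub>x\<in>?A. f x \<odot>\<^bsub>N\<^esub> \<phi> x \<oplus>\<^bsub>N\<^esub> g x \<odot>\<^bsub>N\<^esub> \<phi> x)"
    proof (rule N.finsum_cong')
      show "(\<lambda>x. f x \<odot>\<^bsub>N\<^esub> \<phi> x \<oplus>\<^bsub>N\<^esub> g x \<odot>\<^bsub>N\<^esub> \<phi> x) \<in> ?A \<rightarrow> carrier N"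
        using fgc by (auto intro!: N.a_closed)
      fix x assume "x \<in> ?A"
      then have x: "x \<in> G" by blast
      show "(f \<oplus>\<^bsub>?F\<^esub> g) x \<odot>\<^bsub>N\<^esub> \<phi> x = f x \<odot>\<^bsub>N\<^esub> \<phi> x \<oplus>\<^bsub>N\<^esub> g x \<odot>\<^bsub>N\<^esub> \<phi> x"
        using x N.smult_l_distr[OF f'(1)[OF x] g'(1)[OF x] \<phi>'[OF x]] by (simp add: free_module_simps)
    qed simp
    also have "\<dots> = (\<Oplus>\<^bsub>N\<^esub>x\<in>?A. f x \<odot>\<^bsub>N\<^esub> \<phi> x) \<oplus>\<^bsub>N\<^esub> (\<Oplus>\<^bsub>N\<^esub>x\<in>?A. g x \<odot>\<^bsub>N\<^esub> \<phi> x)"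
      by (rule N.finsum_addf) (use fgc in auto)
    also have "(\<Oplus>\<^bsub>N\<^esub>x\<in>?A. f x \<odot>\<^bsub>N\<^esub> \<phi> x) = lin_ext G N \<phi> f" by (rule sup[symmetric]) (use A f in auto)
    also have "(\<Oplus>\<^bsub>N\<^esub>x\<in>?A. g x \<odot>\<^bsub>N\<^esub> \<phi> x) = lin_ext G N \<phi> g" by (rule sup[symmetric]) (use A g in auto)
    finally show "lin_ext G N \<phi> (f \<oplus>\<^bsub>?F\<^esub> g) = lin_ext G N \<phi> f \<oplus>\<^bsub>N\<^esub> lin_ext G N \<phi> g" .
  qed
qed

lemma lin_ext_gen:
  assumes N: "module R N" and \<phi>: "\<phi> \<in> G \<rightarrow> carrier N" and g: "g \<in> G"
  shows "lin_ext G N \<phi> (free_gen R G g) = \<phi> g"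
proof -
  interpret N: module R N by fact
  have gc: "\<phi> g \<in> carrier N" using \<phi> g by auto
  have "lin_ext G N \<phi> (free_gen R G g) = (\<Oplus>\<^bsub>N\<^esub>h\<in>{g}. free_gen R G g h \<odot>\<^bsub>N\<^esub> \<phi> h)"
    by (rule lin_ext_superset[OF N \<phi> free_gen_closed[OF g]]) (use g in \<open>auto simp: free_gen_def\<close>)
  also have "\<dots> = free_gen R G g g \<odot>\<^bsub>N\<^esub> \<phi> g"
    by (simp add: free_gen_def g gc)
  finally show ?thesis by (simp add: free_gen_def g gc)
qed

lemma free_module_expand:
  assumes f: "f \<in> carrier (free_module R G)"
  shows "lin_ext G (free_module R G) (free_gen R G) f = f"
proof -
  let ?F = "free_module R G"
  note f' = free_module_carrierD[OF f]
  interpret F: module R ?F by (rule free_module_module)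
  have gen: "free_gen R G \<in> G \<rightarrow> carrier ?F" using free_gen_closed by auto
  have s: "lin_ext G ?F (free_gen R G) f \<in> carrier ?F"
    using linear_map_closed[OF lin_ext_linear[OF F.module_axioms' gen] f] .
  show ?thesis
  proof (rule extensionalityI[OF free_module_carrierD(4)[OF s] f'(4)])
    fix h assume h: "h \<in> G"
    interpret E: module_pair R ?F "regular_module R"
      by (rule module_pair.intro) (rule free_module_module regular_module_module)+
    \<comment> \<open>Coordinates are linear, so they commute with the sum and the expansion can be
      checked one coordinate at a time.\<close>
    have ev: "linear_map R ?F (regular_module R) (\<lambda>f. f h)"
      by (rule linear_mapI) (use h free_module_carrierD in \<open>auto simp: free_module_simps regular_module_simps\<close>)
    have "lin_ext G ?F (free_gen R G) f h
      = (\<Oplus>\<^bsub>regular_module R\<^esub>g\<in>{g \<in> G. f g \<noteq> \<zero>}. (f g \<odot>\<^bsub>?F\<^esub> free_gen R G g) h)"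
    proof (rule E.linear_map_finsum[OF ev], rule Pi_I)
      fix x assume x: "x \<in> {g \<in> G. f g \<noteq> \<zero>}"
      then have x: "x \<in> G" by simp
      show "f x \<odot>\<^bsub>?F\<^esub> free_gen R G x \<in> carrier ?F"
        by (rule F.smult_closed[OF f'(1)[OF x] free_gen_closed[OF x]])
    qed
    also have "\<dots> = (\<Oplus>\<^bsub>regular_module R\<^esub>g\<in>insert h {g \<in> G. f g \<noteq> \<zero>}. (if h = g then f h else \<zero>\<^bsub>regular_module R\<^esub>))"
      by (rule E.N.add.finprod_mono_neutral_cong)
        (use f' h in \<open>auto simp: free_module_simps free_gen_def regular_module_simps\<close>)
    also have "\<dots> = f h"
      by (subst E.N.add.finprod_singleton) (use f' h in \<open>auto simp: regular_module_simps\<close>)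
    finally show "lin_ext G ?F (free_gen R G) f h = f h" .
  qed
qed

lemma linear_map_free_eq_lin_ext:
  assumes N: "module R N" and h: "linear_map R (free_module R G) N h"
    and f: "f \<in> carrier (free_module R G)"
  shows "h f = lin_ext G N (\<lambda>g. h (free_gen R G g)) f"
proof -
  let ?F = "free_module R G"
  note f' = free_module_carrierD[OF f]
  interpret E: module_pair R ?F N
    by (rule module_pair.intro) (rule free_module_module N)+
  have "h f = h (lin_ext G ?F (free_gen R G) f)" by (simp add: free_module_expand[OF f])
  also have "\<dots> = (\<Oplus>\<^bsub>N\<^esub>g\<in>{g \<in> G. f g \<noteq> \<zero>}. h (f g \<odot>\<^bsub>?F\<^esub> free_gen R G g))"
    by (rule E.linear_map_finsum[OF h]) (use E.M.smult_closed[OF f'(1) free_gen_closed] in auto)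
  also have "\<dots> = lin_ext G N (\<lambda>g. h (free_gen R G g)) f"
  proof (rule E.N.finsum_cong')
    have *: "f g \<in> carrier R" "free_gen R G g \<in> carrier ?F" if "g \<in> {g \<in> G. f g \<noteq> \<zero>}" for g
      using that f'(1)[of g] free_gen_closed[of g G] by (elim CollectE conjE; simp)+
    show "(\<lambda>g. f g \<odot>\<^bsub>N\<^esub> h (free_gen R G g)) \<in> {g \<in> G. f g \<noteq> \<zero>} \<rightarrow> carrier N"
      by (intro Pi_I E.N.smult_closed linear_map_closed[OF h] *)
    show "h (f g \<odot>\<^bsub>?F\<^esub> free_gen R G g) = f g \<odot>\<^bsub>N\<^esub> h (free_gen R G g)"
      if "g \<in> {g \<in> G. f g \<noteq> \<zero>}" for g
      by (rule linear_map_smult[OF h *[OF that]])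
  qed simp
  finally show ?thesis .
qed

lemma free_module_lift:
  assumes N: "module R N" and \<phi>: "\<phi> \<in> G \<rightarrow> carrier N"
  obtains h where "linear_map R (free_module R G) N h" "\<And>g. g \<in> G \<Longrightarrow> h (free_gen R G g) = \<phi> g"
  using lin_ext_linear[OF N \<phi>] lin_ext_gen[OF N \<phi>] by blast

section \<open>Modules given by generators and relations\<close>

lemma presented_covers:
  assumes A: "A \<subseteq> carrier (free_module R G)"
  shows "covers R (free_module R G) (presented_module R G A)
    (\<lambda>f. submodule_span R (free_module R G) A +>\<^bsub>free_module R G\<^esub> f) (submodule_span R (free_module R G) A)"
  unfolding presented_module_def
  by (rule covers_quotient[OF free_module_module submodule_span_submodule[OF free_module_module A]])

lemma presented_module_module:
  assumes A: "A \<subseteq> carrier (free_module R G)"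
  shows "module R (presented_module R G A)"
  unfolding presented_module_def
  by (rule quotient_module_module[OF free_module_module submodule_span_submodule[OF free_module_module A]])

lemma presented_gen_closed:
  assumes A: "A \<subseteq> carrier (free_module R G)" and g: "g \<in> G"
  shows "presented_gen R G A g \<in> carrier (presented_module R G A)"
  unfolding presented_gen_def
  by (rule linear_map_closed[OF coversD'(1)[OF presented_covers[OF A]] free_gen_closed[OF g]])

lemma presented_relation:
  assumes A: "A \<subseteq> carrier (free_module R G)" and a: "a \<in> A"
  shows "lin_ext G (presented_module R G A) (presented_gen R G A) a = \<zero>\<^bsub>presented_module R G A\<^esub>"
proof -
  let ?c = "\<lambda>f. submodule_span R (free_module R G) A +>\<^bsub>free_module R G\<^esub> f"
  note c = presented_covers[OF A]
  have l: "linear_map R (free_module R G) (presented_module R G A) ?c"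
    by (rule coversD'(1)[OF c])
  have "a \<in> submodule_span R (free_module R G) A" using a subsetD[OF submodule_span_superset] by fast
  then have "?c a = \<zero>\<^bsub>presented_module R G A\<^esub>" using coversD'(3)[OF c subsetD[OF A a]] by simp
  moreover have "?c a = lin_ext G (presented_module R G A) (presented_gen R G A) a"
    using linear_map_free_eq_lin_ext[OF presented_module_module[OF A] l subsetD[OF A a]]
    unfolding presented_gen_def .
  ultimately show ?thesis by simp
qed

text \<open>Takes the place of an induction over the elements of a presented module: the property to
  be shown is phrased as a submodule.\<close>

lemma presented_generated:
  assumes A: "A \<subseteq> carrier (free_module R G)"
    and H: "submodule H R (presented_module R G A)"
    and gen: "\<And>g. g \<in> G \<Longrightarrow> presented_gen R G A g \<in> H"
  shows "H = carrier (presented_module R G A)"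
proof
  let ?P = "presented_module R G A"
  let ?c = "\<lambda>f. submodule_span R (free_module R G) A +>\<^bsub>free_module R G\<^esub> f"
  note c = presented_covers[OF A]
  interpret P: module R ?P by (rule presented_module_module[OF A])
  have l: "linear_map R (free_module R G) ?P ?c"
    by (rule coversD'(1)[OF c])
  show "H \<subseteq> carrier ?P" using P.submoduleE(1)[OF H] .
  show "carrier ?P \<subseteq> H"
  proof
    fix x assume "x \<in> carrier ?P"
    then obtain f where f: "f \<in> carrier (free_module R G)" "x = ?c f"
      using coversD'(5)[OF c] by metis
    have "?c f = lin_ext G ?P (presented_gen R G A) f"
      using linear_map_free_eq_lin_ext[OF P.module_axioms' l f(1)] unfolding presented_gen_def .
    also have "\<dots> \<in> H"
      by (rule P.submodule_finsum[OF H])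
        (use gen free_module_carrierD[OF f(1)] P.submoduleE(4)[OF H] in auto)
    finally show "x \<in> H" using f by simp
  qed
qed

lemma presented_map:
  assumes A: "A \<subseteq> carrier (free_module R G)" and N: "module R N" and \<phi>: "\<phi> \<in> G \<rightarrow> carrier N"
    and rel: "\<And>a. a \<in> A \<Longrightarrow> lin_ext G N \<phi> a = \<zero>\<^bsub>N\<^esub>"
  shows presented_map_linear: "linear_map R (presented_module R G A) N (presented_map R G N \<phi>)"
    and presented_map_gen: "\<And>g. g \<in> G \<Longrightarrow> presented_map R G N \<phi> (presented_gen R G A g) = \<phi> g"
proof -
  let ?F = "free_module R G" and ?P = "presented_module R G A"
  let ?S = "submodule_span R ?F A"
  let ?c = "\<lambda>f. ?S +>\<^bsub>?F\<^esub> f"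
  note c = presented_covers[OF A]
  interpret FN: module_pair R ?F N by (rule module_pair.intro) (rule free_module_module N)+
  have S: "submodule ?S R ?F" by (rule submodule_span_submodule[OF free_module_module A])
  then have zS: "\<zero>\<^bsub>?F\<^esub> \<in> ?S" by (rule FN.M.submodule_zero)
  have E: "linear_map R ?F N (lin_ext G N \<phi>)" by (rule lin_ext_linear[OF N \<phi>])
  have "?S \<subseteq> {f \<in> carrier ?F. lin_ext G N \<phi> f = \<zero>\<^bsub>N\<^esub>}"
    by (rule submodule_span_least[OF FN.submodule_kernel[OF E]]) (use A rel in auto)
  then have ES: "lin_ext G N \<phi> w = \<zero>\<^bsub>N\<^esub>" if "w \<in> ?S" for w using that by blast
  obtain h where h: "linear_map R ?P N h" "\<And>w. w \<in> carrier ?F \<Longrightarrow> h (?c w) = lin_ext G N \<phi> w"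
    using covers_factor[OF free_module_module c zS N E ES] by blast
  have eq: "presented_map R G N \<phi> (?c w) = h (?c w)" if w: "w \<in> carrier ?F" for w
  proof -
    \<comment> \<open>The linear extension kills the span of the relations, so it is constant on a
      coset; hence the image in \<open>presented_map\<close> is a singleton and
      \<open>the_elem\<close> returns its member.\<close>
    have "lin_ext G N \<phi> v = lin_ext G N \<phi> w" if v: "v \<in> ?c w" for v
    proof -
      obtain s where s: "s \<in> ?S" "v = s \<oplus>\<^bsub>?F\<^esub> w" using v unfolding a_r_coset_def' by blast
      have sc: "s \<in> carrier ?F" using s(1) FN.M.submoduleE(1)[OF S] by blast
      have "lin_ext G N \<phi> v = lin_ext G N \<phi> s \<oplus>\<^bsub>N\<^esub> lin_ext G N \<phi> w"
        unfolding s(2) by (rule linear_map_add[OF E sc w])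
      also have "\<dots> = lin_ext G N \<phi> w" unfolding ES[OF s(1)] using linear_map_closed[OF E w] by simp
      finally show ?thesis .
    qed
    moreover have "?c w \<noteq> {}" unfolding a_r_coset_def' using zS by blast
    ultimately have "lin_ext G N \<phi> ` ?c w = {lin_ext G N \<phi> w}" by (intro image_eq_singletonI)
    then show ?thesis unfolding presented_map_def h(2)[OF w] by simp
  qed
  interpret P: module R ?P by (rule presented_module_module[OF A])
  show "linear_map R ?P N (presented_map R G N \<phi>)"
  proof (rule linear_map_cong[OF h(1) P.module_axioms'])
    fix x assume "x \<in> carrier ?P"
    then obtain w where "w \<in> carrier ?F" "x = ?c w" using coversD'(5)[OF c] by metis
    then show "h x = presented_map R G N \<phi> x" using eq by simp
  qed
  fix g assume g: "g \<in> G"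
  show "presented_map R G N \<phi> (presented_gen R G A g) = \<phi> g"
    unfolding presented_gen_def eq[OF free_gen_closed[OF g]] h(2)[OF free_gen_closed[OF g]]
    by (rule lin_ext_gen[OF N \<phi> g])
qed

text \<open>These two shapes, a generator being the sum of two others or a multiple of another,
  cover all relations of the tensor products and of the exterior algebra other than the
  squares.\<close>

abbreviation "add_rel G g h k \<equiv>
  free_gen R G g \<ominus>\<^bsub>free_module R G\<^esub> (free_gen R G h \<oplus>\<^bsub>free_module R G\<^esub> free_gen R G k)"
abbreviation "smult_rel G g r h \<equiv> free_gen R G g \<ominus>\<^bsub>free_module R G\<^esub> r \<odot>\<^bsub>free_module R G\<^esub> free_gen R G h"

lemma lin_ext_relations:
  assumes N: "module R N" and \<phi>: "\<phi> \<in> G \<rightarrow> carrier N" and g: "g \<in> G" and h: "h \<in> G"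
  shows "k \<in> G \<Longrightarrow> lin_ext G N \<phi> (add_rel G g h k) = \<zero>\<^bsub>N\<^esub>
      \<longleftrightarrow> \<phi> g = \<phi> h \<oplus>\<^bsub>N\<^esub> \<phi> k"
    and "r \<in> carrier R \<Longrightarrow> lin_ext G N \<phi> (smult_rel G g r h) = \<zero>\<^bsub>N\<^esub>
      \<longleftrightarrow> \<phi> g = r \<odot>\<^bsub>N\<^esub> \<phi> h"
proof -
  let ?F = "free_module R G"
  interpret FN: module_pair R ?F N by (rule module_pair.intro) (rule free_module_module N)+
  note E = lin_ext_linear[OF N \<phi>]
  have c: "\<phi> x \<in> carrier N" "free_gen R G x \<in> carrier ?F" if "x \<in> G" for x
    using \<phi> that free_gen_closed by auto
  note e = lin_ext_gen[OF N \<phi>]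
  show "lin_ext G N \<phi> (add_rel G g h k) = \<zero>\<^bsub>N\<^esub>
      \<longleftrightarrow> \<phi> g = \<phi> h \<oplus>\<^bsub>N\<^esub> \<phi> k" if k: "k \<in> G"
  proof -
    have "lin_ext G N \<phi> (add_rel G g h k)
      = \<phi> g \<ominus>\<^bsub>N\<^esub> (\<phi> h \<oplus>\<^bsub>N\<^esub> \<phi> k)"
      using FN.linear_map_minus[OF E] linear_map_add[OF E] c g h k
      by (simp only: e FN.M.add.m_closed)
    then show ?thesis using FN.N.minus_eq_zero_iff c g h k by simp
  qed
  show "lin_ext G N \<phi> (smult_rel G g r h) = \<zero>\<^bsub>N\<^esub>
      \<longleftrightarrow> \<phi> g = r \<odot>\<^bsub>N\<^esub> \<phi> h" if r: "r \<in> carrier R"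
  proof -
    have "lin_ext G N \<phi> (smult_rel G g r h) = \<phi> g \<ominus>\<^bsub>N\<^esub> r \<odot>\<^bsub>N\<^esub> \<phi> h"
      using FN.linear_map_minus[OF E] linear_map_smult[OF E] c g h r
      by (simp only: e FN.M.smult_closed)
    then show ?thesis using FN.N.minus_eq_zero_iff c g h r by simp
  qed
qed

lemma free_relation_closed:
  assumes "g \<in> G" "h \<in> G"
  shows "k \<in> G \<Longrightarrow> add_rel G g h k \<in> carrier (free_module R G)"
    and "r \<in> carrier R \<Longrightarrow> smult_rel G g r h \<in> carrier (free_module R G)"
proof -
  interpret F: module R "free_module R G" by (rule free_module_module)
  show "k \<in> G \<Longrightarrow> add_rel G g h k \<in> carrier (free_module R G)"
    "r \<in> carrier R \<Longrightarrow> smult_rel G g r h \<in> carrier (free_module R G)"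
    using assms by (simp_all add: free_gen_closed)
qed

lemma presented_relation_add:
  assumes A: "A \<subseteq> carrier (free_module R G)" and g: "g \<in> G" and h: "h \<in> G" and k: "k \<in> G"
    and "add_rel G g h k \<in> A"
  shows "presented_gen R G A g = presented_gen R G A h \<oplus>\<^bsub>presented_module R G A\<^esub> presented_gen R G A k"
proof -
  have \<phi>: "presented_gen R G A \<in> G \<rightarrow> carrier (presented_module R G A)"
    by (rule Pi_I) (rule presented_gen_closed[OF A])
  show ?thesis
    using presented_relation[OF A assms(5)]
    by (rule lin_ext_relations(1)[OF presented_module_module[OF A] \<phi> g h k, THEN iffD1])
qed

lemma presented_relation_smult:
  assumes A: "A \<subseteq> carrier (free_module R G)" and g: "g \<in> G" and h: "h \<in> G" and r: "r \<in> carrier R"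
    and "smult_rel G g r h \<in> A"
  shows "presented_gen R G A g = r \<odot>\<^bsub>presented_module R G A\<^esub> presented_gen R G A h"
proof -
  have \<phi>: "presented_gen R G A \<in> G \<rightarrow> carrier (presented_module R G A)"
    by (rule Pi_I) (rule presented_gen_closed[OF A])
  show ?thesis
    using presented_relation[OF A assms(5)]
    by (rule lin_ext_relations(2)[OF presented_module_module[OF A] \<phi> g h r, THEN iffD1])
qed

lemma presented_relation_gen:
  assumes A: "A \<subseteq> carrier (free_module R G)" and g: "g \<in> G" and "free_gen R G g \<in> A"
  shows "presented_gen R G A g = \<zero>\<^bsub>presented_module R G A\<^esub>"
proof -
  have \<phi>: "presented_gen R G A \<in> G \<rightarrow> carrier (presented_module R G A)"
    by (rule Pi_I) (rule presented_gen_closed[OF A])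
  show ?thesis
    using presented_relation[OF A assms(3)] unfolding lin_ext_gen[OF presented_module_module[OF A] \<phi> g] .
qed

subsection \<open>Tensor products\<close>

context
  fixes M :: "('a, 'm) module" and N :: "('a, 'n) module"
  assumes M: "module R M" and N: "module R N"
begin

interpretation M: module R M by (rule M)
interpretation N: module R N by (rule N)

lemma tensor_rels_closed: "tensor_rels R M N \<subseteq> carrier (free_module R (tensor_gens M N))"
  unfolding tensor_rels_def Let_def
  by (intro Un_least subsetI; elim CollectE exE conjE; hypsubst; intro free_relation_closed)
    (auto simp: tensor_gens_def)

lemma tensor_module: "module R (tensor R M N)"
  unfolding tensor_def by (rule presented_module_module[OF tensor_rels_closed])

lemma pure_tensor_closed:
  "x \<in> carrier M \<Longrightarrow> y \<in> carrier N \<Longrightarrow> pure_tensor R M N (x, y) \<in> carrier (tensor R M N)"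
  unfolding tensor_def pure_tensor_def
  by (rule presented_gen_closed[OF tensor_rels_closed]) (simp add: tensor_gens_def)

lemma pure_tensor_add_left:
  assumes "x \<in> carrier M" "x' \<in> carrier M" "y \<in> carrier N"
  shows "pure_tensor R M N (x \<oplus>\<^bsub>M\<^esub> x', y)
    = pure_tensor R M N (x, y) \<oplus>\<^bsub>tensor R M N\<^esub> pure_tensor R M N (x', y)"
  unfolding tensor_def pure_tensor_def
  by (rule presented_relation_add[OF tensor_rels_closed])
    (use assms in \<open>auto simp: tensor_gens_def tensor_rels_def Let_def\<close>)

lemma pure_tensor_add_right:
  assumes "x \<in> carrier M" "y \<in> carrier N" "y' \<in> carrier N"
  shows "pure_tensor R M N (x, y \<oplus>\<^bsub>N\<^esub> y')
    = pure_tensor R M N (x, y) \<oplus>\<^bsub>tensor R M N\<^esub> pure_tensor R M N (x, y')"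
  unfolding tensor_def pure_tensor_def
  by (rule presented_relation_add[OF tensor_rels_closed])
    (use assms in \<open>auto simp: tensor_gens_def tensor_rels_def Let_def\<close>)

lemma pure_tensor_smult_left:
  assumes "r \<in> carrier R" "x \<in> carrier M" "y \<in> carrier N"
  shows "pure_tensor R M N (r \<odot>\<^bsub>M\<^esub> x, y) = r \<odot>\<^bsub>tensor R M N\<^esub> pure_tensor R M N (x, y)"
  unfolding tensor_def pure_tensor_def
  by (rule presented_relation_smult[OF tensor_rels_closed])
    (use assms in \<open>auto simp: tensor_gens_def tensor_rels_def Let_def\<close>)

lemma pure_tensor_smult_right:
  assumes "r \<in> carrier R" "x \<in> carrier M" "y \<in> carrier N"
  shows "pure_tensor R M N (x, r \<odot>\<^bsub>N\<^esub> y) = r \<odot>\<^bsub>tensor R M N\<^esub> pure_tensor R M N (x, y)"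
  unfolding tensor_def pure_tensor_def
  by (rule presented_relation_smult[OF tensor_rels_closed])
    (use assms in \<open>auto simp: tensor_gens_def tensor_rels_def Let_def\<close>)

lemma tensor_generated:
  assumes "submodule H R (tensor R M N)"
    and "\<And>x y. x \<in> carrier M \<Longrightarrow> y \<in> carrier N \<Longrightarrow> pure_tensor R M N (x, y) \<in> H"
  shows "H = carrier (tensor R M N)"
  using assms unfolding tensor_def pure_tensor_def
  by (intro presented_generated[OF tensor_rels_closed]) (auto simp: tensor_gens_def)

lemma tensor_lift:
  assumes P: "module R P"
    and c: "\<And>x y. x \<in> carrier M \<Longrightarrow> y \<in> carrier N \<Longrightarrow> \<phi> (x, y) \<in> carrier P"
    and "\<And>x x' y. x \<in> carrier M \<Longrightarrow> x' \<in> carrier M \<Longrightarrow> y \<in> carrier N \<Longrightarrow>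
       \<phi> (x \<oplus>\<^bsub>M\<^esub> x', y) = \<phi> (x, y) \<oplus>\<^bsub>P\<^esub> \<phi> (x', y)"
    and "\<And>x y y'. x \<in> carrier M \<Longrightarrow> y \<in> carrier N \<Longrightarrow> y' \<in> carrier N \<Longrightarrow>
       \<phi> (x, y \<oplus>\<^bsub>N\<^esub> y') = \<phi> (x, y) \<oplus>\<^bsub>P\<^esub> \<phi> (x, y')"
    and "\<And>r x y. r \<in> carrier R \<Longrightarrow> x \<in> carrier M \<Longrightarrow> y \<in> carrier N \<Longrightarrow>
       \<phi> (r \<odot>\<^bsub>M\<^esub> x, y) = r \<odot>\<^bsub>P\<^esub> \<phi> (x, y)"
    and "\<And>r x y. r \<in> carrier R \<Longrightarrow> x \<in> carrier M \<Longrightarrow> y \<in> carrier N \<Longrightarrow>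
       \<phi> (x, r \<odot>\<^bsub>N\<^esub> y) = r \<odot>\<^bsub>P\<^esub> \<phi> (x, y)"
  shows "linear_map R (tensor R M N) P (presented_map R (tensor_gens M N) P \<phi>)"
    and "\<And>x y. x \<in> carrier M \<Longrightarrow> y \<in> carrier N \<Longrightarrow>
      presented_map R (tensor_gens M N) P \<phi> (pure_tensor R M N (x, y)) = \<phi> (x, y)"
proof -
  have \<phi>: "\<phi> \<in> tensor_gens M N \<rightarrow> carrier P" using c by (auto simp: tensor_gens_def)
  note re = lin_ext_relations(1,2)[OF P \<phi>, THEN iffD2]
  have rel: "lin_ext (tensor_gens M N) P \<phi> a = \<zero>\<^bsub>P\<^esub>" if "a \<in> tensor_rels R M N" for a
    using that unfolding tensor_rels_def Let_def
    by (elim UnE CollectE exE conjE; hypsubst; intro re) (auto simp: tensor_gens_def assms(3-))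
  show "linear_map R (tensor R M N) P (presented_map R (tensor_gens M N) P \<phi>)"
    unfolding tensor_def by (rule presented_map(1)[OF tensor_rels_closed P \<phi> rel])
  show "presented_map R (tensor_gens M N) P \<phi> (pure_tensor R M N (x, y)) = \<phi> (x, y)"
    if "x \<in> carrier M" "y \<in> carrier N" for x y
    unfolding pure_tensor_def
    by (rule presented_map(2)[OF tensor_rels_closed P \<phi> rel]) (use that in \<open>auto simp: tensor_gens_def\<close>)
qed

end

lemma tensor_map:
  assumes M: "module R M" and M': "module R M'" and N: "module R N" and f: "linear_map R M M' f"
  shows "linear_map R (tensor R M N) (tensor R M' N)
      (presented_map R (tensor_gens M N) (tensor R M' N) (\<lambda>(x, y). pure_tensor R M' N (f x, y)))"
    and "\<And>x y. x \<in> carrier M \<Longrightarrow> y \<in> carrier N \<Longrightarrow>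
      presented_map R (tensor_gens M N) (tensor R M' N) (\<lambda>(x, y). pure_tensor R M' N (f x, y))
        (pure_tensor R M N (x, y)) = pure_tensor R M' N (f x, y)"
  using tensor_lift[OF M N tensor_module[OF M' N], of "\<lambda>(x, y). pure_tensor R M' N (f x, y)"]
  by (simp_all add: linear_mapD[OF f] pure_tensor_closed[OF M' N] pure_tensor_add_left[OF M' N]
    pure_tensor_add_right[OF M' N] pure_tensor_smult_left[OF M' N] pure_tensor_smult_right[OF M' N])

section \<open>Tensor products of finite lists\<close>

context
  fixes Ms :: "('a, 'm) module list"
  assumes Ms: "\<And>M. M \<in> set Ms \<Longrightarrow> module R M"
begin

lemma tensor_list_nth_module: "i < length Ms \<Longrightarrow> module R (Ms ! i)"
  using Ms by simp

lemma tensor_list_gens_update: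
  assumes "xs \<in> tensor_list_gens Ms" "x \<in> carrier (Ms ! i)"
  shows "xs[i := x] \<in> tensor_list_gens Ms"
proof -
  have "xs[i := x] ! j \<in> carrier (Ms ! j)" if "j < length Ms" for j
    using assms that unfolding tensor_list_gens_def by (cases "i = j") auto
  then show ?thesis using assms(1) unfolding tensor_list_gens_def by simp
qed

lemma tensor_list_rels_closed: "tensor_list_rels R Ms \<subseteq> carrier (free_module R (tensor_list_gens Ms))"
proof -
  have "x \<oplus>\<^bsub>Ms ! i\<^esub> y \<in> carrier (Ms ! i)"
    if "x \<in> carrier (Ms ! i)" "y \<in> carrier (Ms ! i)" "i < length Ms" for x y i
    using tensor_list_nth_module[OF that(3)] that(1,2) by (meson abelian_groupE(1) module.axioms(2))
  moreover have "r \<odot>\<^bsub>Ms ! i\<^esub> y \<in> carrier (Ms ! i)"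
    if "r \<in> carrier R" "y \<in> carrier (Ms ! i)" "i < length Ms" for r y i
    using module.smult_closed[OF tensor_list_nth_module[OF that(3)]] that(1,2) .
  ultimately show ?thesis
    unfolding tensor_list_rels_def Let_def
    by (intro Un_least subsetI; elim CollectE exE conjE; hypsubst; intro free_relation_closed)
      (auto intro!: tensor_list_gens_update)
qed

lemma tensor_list_module: "module R (tensor_list R Ms)"
  unfolding tensor_list_def by (rule presented_module_module[OF tensor_list_rels_closed])

lemma pure_tensor_list_closed:
  "xs \<in> tensor_list_gens Ms \<Longrightarrow> pure_tensor_list R Ms xs \<in> carrier (tensor_list R Ms)"
  unfolding tensor_list_def pure_tensor_list_def
  by (rule presented_gen_closed[OF tensor_list_rels_closed])

lemma pure_tensor_list_add:
  assumes "xs \<in> tensor_list_gens Ms" "i < length Ms" "x \<in> carrier (Ms ! i)" "y \<in> carrier (Ms ! i)"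
  shows "pure_tensor_list R Ms (xs[i := x \<oplus>\<^bsub>Ms ! i\<^esub> y])
    = pure_tensor_list R Ms (xs[i := x]) \<oplus>\<^bsub>tensor_list R Ms\<^esub> pure_tensor_list R Ms (xs[i := y])"
proof -
  have "x \<oplus>\<^bsub>Ms ! i\<^esub> y \<in> carrier (Ms ! i)"
    using tensor_list_nth_module[OF assms(2)] assms(3,4) by (meson abelian_groupE(1) module.axioms(2))
  then show ?thesis
    unfolding tensor_list_def pure_tensor_list_def
    by (intro presented_relation_add[OF tensor_list_rels_closed] tensor_list_gens_update)
      (use assms in \<open>auto simp: tensor_list_rels_def Let_def\<close>)
qed

lemma pure_tensor_list_smult:
  assumes "r \<in> carrier R" "xs \<in> tensor_list_gens Ms" "i < length Ms" "x \<in> carrier (Ms ! i)"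
  shows "pure_tensor_list R Ms (xs[i := r \<odot>\<^bsub>Ms ! i\<^esub> x])
    = r \<odot>\<^bsub>tensor_list R Ms\<^esub> pure_tensor_list R Ms (xs[i := x])"
proof -
  have "r \<odot>\<^bsub>Ms ! i\<^esub> x \<in> carrier (Ms ! i)"
    using module.smult_closed[OF tensor_list_nth_module[OF assms(3)]] assms(1,4) .
  then show ?thesis
    unfolding tensor_list_def pure_tensor_list_def
    by (intro presented_relation_smult[OF tensor_list_rels_closed] tensor_list_gens_update)
      (use assms in \<open>auto simp: tensor_list_rels_def Let_def\<close>)
qed

lemma tensor_list_generated:
  assumes "submodule H R (tensor_list R Ms)"
    and "\<And>xs. xs \<in> tensor_list_gens Ms \<Longrightarrow> pure_tensor_list R Ms xs \<in> H"
  shows "H = carrier (tensor_list R Ms)"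
  using assms unfolding tensor_list_def pure_tensor_list_def
  by (intro presented_generated[OF tensor_list_rels_closed]) auto

lemma tensor_list_lift:
  assumes P: "module R P"
    and c: "\<And>xs. xs \<in> tensor_list_gens Ms \<Longrightarrow> \<phi> xs \<in> carrier P"
    and a: "\<And>xs i x y. xs \<in> tensor_list_gens Ms \<Longrightarrow> i < length Ms \<Longrightarrow> x \<in> carrier (Ms ! i) \<Longrightarrow> y \<in> carrier (Ms ! i) \<Longrightarrow>
       \<phi> (xs[i := x \<oplus>\<^bsub>Ms ! i\<^esub> y]) = \<phi> (xs[i := x]) \<oplus>\<^bsub>P\<^esub> \<phi> (xs[i := y])"
    and s: "\<And>r xs i x. r \<in> carrier R \<Longrightarrow> xs \<in> tensor_list_gens Ms \<Longrightarrow> i < length Ms \<Longrightarrow> x \<in> carrier (Ms ! i) \<Longrightarrow>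
       \<phi> (xs[i := r \<odot>\<^bsub>Ms ! i\<^esub> x]) = r \<odot>\<^bsub>P\<^esub> \<phi> (xs[i := x])"
  shows "linear_map R (tensor_list R Ms) P (presented_map R (tensor_list_gens Ms) P \<phi>)"
    and "\<And>xs. xs \<in> tensor_list_gens Ms \<Longrightarrow>
      presented_map R (tensor_list_gens Ms) P \<phi> (pure_tensor_list R Ms xs) = \<phi> xs"
proof -
  have \<phi>: "\<phi> \<in> tensor_list_gens Ms \<rightarrow> carrier P" using c by auto
  note re = lin_ext_relations(1,2)[OF P \<phi>, THEN iffD2]
  have cl: "x \<oplus>\<^bsub>Ms ! i\<^esub> y \<in> carrier (Ms ! i)"
    if "x \<in> carrier (Ms ! i)" "y \<in> carrier (Ms ! i)" "i < length Ms" for x y i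
    using tensor_list_nth_module[OF that(3)] that(1,2) by (meson abelian_groupE(1) module.axioms(2))
  have cl': "r \<odot>\<^bsub>Ms ! i\<^esub> y \<in> carrier (Ms ! i)"
    if "r \<in> carrier R" "y \<in> carrier (Ms ! i)" "i < length Ms" for r y i
    using module.smult_closed[OF tensor_list_nth_module[OF that(3)]] that(1,2) .
  have rel: "lin_ext (tensor_list_gens Ms) P \<phi> a = \<zero>\<^bsub>P\<^esub>" if "a \<in> tensor_list_rels R Ms" for a
    using that unfolding tensor_list_rels_def Let_def
    by (elim UnE CollectE exE conjE; hypsubst; intro re)
      (auto simp: a s intro!: tensor_list_gens_update cl cl')
  show "linear_map R (tensor_list R Ms) P (presented_map R (tensor_list_gens Ms) P \<phi>)"
    unfolding tensor_list_def by (rule presented_map(1)[OF tensor_list_rels_closed P \<phi> rel])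
  show "presented_map R (tensor_list_gens Ms) P \<phi> (pure_tensor_list R Ms xs) = \<phi> xs"
    if "xs \<in> tensor_list_gens Ms" for xs
    unfolding pure_tensor_list_def
    by (rule presented_map(2)[OF tensor_list_rels_closed P \<phi> rel that])
qed

end

section \<open>Exterior algebras\<close>

context
  fixes M :: "('a, 'm) module"
  assumes M: "module R M"
begin

interpretation M: module R M by (rule M)

abbreviation ext_gen :: "'m list \<Rightarrow> ('m list \<Rightarrow> 'a) set"
  where "ext_gen \<equiv> presented_gen R (lists (carrier M)) (exterior_rels R M)"

lemma exterior_rels_closed: "exterior_rels R M \<subseteq> carrier (free_module R (lists (carrier M)))"
  unfolding exterior_rels_def Let_def
  by (intro Un_least subsetI; elim CollectE exE conjE; hypsubst; intro free_relation_closed free_gen_closed) auto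

lemma exterior_module: "module R (exterior_algebra R M)"
  unfolding exterior_algebra_def by (rule presented_module_module[OF exterior_rels_closed])

lemma ext_gen_closed:
  "xs \<in> lists (carrier M) \<Longrightarrow> ext_gen xs \<in> carrier (exterior_algebra R M)"
  unfolding exterior_algebra_def by (rule presented_gen_closed[OF exterior_rels_closed])

lemma ext_gen_add:
  assumes "us \<in> lists (carrier M)" "vs \<in> lists (carrier M)" "x \<in> carrier M" "y \<in> carrier M"
  shows "ext_gen (us @ (x \<oplus>\<^bsub>M\<^esub> y) # vs)
    = ext_gen (us @ x # vs) \<oplus>\<^bsub>exterior_algebra R M\<^esub> ext_gen (us @ y # vs)"
  unfolding exterior_algebra_def
proof (rule presented_relation_add[OF exterior_rels_closed])
  let ?F = "free_module R (lists (carrier M))" and ?d = "free_gen R (lists (carrier M))"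
  have "?d (us @ [x \<oplus>\<^bsub>M\<^esub> y] @ vs) \<ominus>\<^bsub>?F\<^esub> (?d (us @ [x] @ vs) \<oplus>\<^bsub>?F\<^esub> ?d (us @ [y] @ vs)) \<in> exterior_rels R M"
    unfolding exterior_rels_def Let_def using assms by blast
  then show "?d (us @ (x \<oplus>\<^bsub>M\<^esub> y) # vs) \<ominus>\<^bsub>?F\<^esub> (?d (us @ x # vs) \<oplus>\<^bsub>?F\<^esub> ?d (us @ y # vs)) \<in> exterior_rels R M"
    by simp
qed (use assms in auto)

lemma ext_gen_smult:
  assumes "us \<in> lists (carrier M)" "vs \<in> lists (carrier M)" "r \<in> carrier R" "x \<in> carrier M"
  shows "ext_gen (us @ (r \<odot>\<^bsub>M\<^esub> x) # vs) = r \<odot>\<^bsub>exterior_algebra R M\<^esub> ext_gen (us @ x # vs)"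
  unfolding exterior_algebra_def
proof (rule presented_relation_smult[OF exterior_rels_closed])
  let ?F = "free_module R (lists (carrier M))" and ?d = "free_gen R (lists (carrier M))"
  have "?d (us @ [r \<odot>\<^bsub>M\<^esub> x] @ vs) \<ominus>\<^bsub>?F\<^esub> r \<odot>\<^bsub>?F\<^esub> ?d (us @ [x] @ vs) \<in> exterior_rels R M"
    unfolding exterior_rels_def Let_def using assms by blast
  then show "?d (us @ (r \<odot>\<^bsub>M\<^esub> x) # vs) \<ominus>\<^bsub>?F\<^esub> r \<odot>\<^bsub>?F\<^esub> ?d (us @ x # vs) \<in> exterior_rels R M"
    by simp
qed (use assms in auto)

lemma ext_gen_square:
  assumes "us \<in> lists (carrier M)" "vs \<in> lists (carrier M)" "x \<in> carrier M"
  shows "ext_gen (us @ x # x # vs) = \<zero>\<^bsub>exterior_algebra R M\<^esub>"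
  unfolding exterior_algebra_def
proof (rule presented_relation_gen[OF exterior_rels_closed])
  have "free_gen R (lists (carrier M)) (us @ [x, x] @ vs) \<in> exterior_rels R M"
    unfolding exterior_rels_def Let_def using assms by blast
  then show "free_gen R (lists (carrier M)) (us @ x # x # vs) \<in> exterior_rels R M"
    by simp
qed (use assms in auto)

lemma exterior_generated:
  assumes "submodule H R (exterior_algebra R M)"
    and "\<And>xs. xs \<in> lists (carrier M) \<Longrightarrow> ext_gen xs \<in> H"
  shows "H = carrier (exterior_algebra R M)"
  using assms unfolding exterior_algebra_def
  by (intro presented_generated[OF exterior_rels_closed]) auto

lemma exterior_lift:
  assumes P: "module R P"
    and c: "\<And>xs. xs \<in> lists (carrier M) \<Longrightarrow> \<phi> xs \<in> carrier P"
    and a: "\<And>us vs x y. us \<in> lists (carrier M) \<Longrightarrow> vs \<in> lists (carrier M) \<Longrightarrow> x \<in> carrier M \<Longrightarrow> y \<in> carrier M \<Longrightarrow>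
       \<phi> (us @ (x \<oplus>\<^bsub>M\<^esub> y) # vs) = \<phi> (us @ x # vs) \<oplus>\<^bsub>P\<^esub> \<phi> (us @ y # vs)"
    and s: "\<And>r us vs x. r \<in> carrier R \<Longrightarrow> us \<in> lists (carrier M) \<Longrightarrow> vs \<in> lists (carrier M) \<Longrightarrow> x \<in> carrier M \<Longrightarrow>
       \<phi> (us @ (r \<odot>\<^bsub>M\<^esub> x) # vs) = r \<odot>\<^bsub>P\<^esub> \<phi> (us @ x # vs)"
    and q: "\<And>us vs x. us \<in> lists (carrier M) \<Longrightarrow> vs \<in> lists (carrier M) \<Longrightarrow> x \<in> carrier M \<Longrightarrow>
       \<phi> (us @ x # x # vs) = \<zero>\<^bsub>P\<^esub>"
  obtains h where "linear_map R (exterior_algebra R M) P h"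
    and "\<And>xs. xs \<in> lists (carrier M) \<Longrightarrow> h (ext_gen xs) = \<phi> xs"
proof -
  let ?L = "lists (carrier M)"
  have \<phi>: "\<phi> \<in> ?L \<rightarrow> carrier P" using c by auto
  note re = lin_ext_relations(1,2)[OF P \<phi>, THEN iffD2]
  have rel: "lin_ext ?L P \<phi> a = \<zero>\<^bsub>P\<^esub>" if "a \<in> exterior_rels R M" for a
  proof -
    have "lin_ext ?L P \<phi> (free_gen R ?L (us @ [x, x] @ vs)) = \<zero>\<^bsub>P\<^esub>"
      if "us \<in> ?L" "vs \<in> ?L" "x \<in> carrier M" for us vs x
      using that q by (subst lin_ext_gen[OF P \<phi>]) auto
    moreover have "lin_ext ?L P \<phi> (free_gen R ?L (us @ [x \<oplus>\<^bsub>M\<^esub> y] @ vs) \<ominus>\<^bsub>free_module R ?L\<^esub>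
        (free_gen R ?L (us @ [x] @ vs) \<oplus>\<^bsub>free_module R ?L\<^esub> free_gen R ?L (us @ [y] @ vs))) = \<zero>\<^bsub>P\<^esub>"
      if "us \<in> ?L" "vs \<in> ?L" "x \<in> carrier M" "y \<in> carrier M" for us vs x y
      by (intro re) (use that a in auto)
    moreover have "lin_ext ?L P \<phi> (free_gen R ?L (us @ [r \<odot>\<^bsub>M\<^esub> x] @ vs) \<ominus>\<^bsub>free_module R ?L\<^esub>
        r \<odot>\<^bsub>free_module R ?L\<^esub> free_gen R ?L (us @ [x] @ vs)) = \<zero>\<^bsub>P\<^esub>"
      if "us \<in> ?L" "vs \<in> ?L" "x \<in> carrier M" "r \<in> carrier R" for us vs x r
      by (intro re) (use that s in auto)
    ultimately show ?thesis
      using that unfolding exterior_rels_def Let_def by (elim UnE CollectE exE conjE) simp_all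
  qed
  show ?thesis
  proof (rule that)
    show "linear_map R (exterior_algebra R M) P (presented_map R ?L P \<phi>)"
      unfolding exterior_algebra_def by (rule presented_map(1)[OF exterior_rels_closed P \<phi> rel])
    show "\<And>xs. xs \<in> ?L \<Longrightarrow> presented_map R ?L P \<phi> (ext_gen xs) = \<phi> xs"
      by (rule presented_map(2)[OF exterior_rels_closed P \<phi> rel])
  qed
qed

end

end

section \<open>Homology\<close>

text \<open>The chain modules are quotients \<open>W k / B k\<close>, and \<open>\<delta>\<close>
  lifts the differential. Homology is then the quotient of the elements that \<open>\<delta>\<close>
  sends into \<open>B\<close> by the sum of the image of \<open>\<delta>\<close> and
  \<open>B\<close>, and \<open>\<delta>\<close> has to square to zero only modulo \<open>B\<close>.
  The clause \<open>k = Suc j\<close> makes the condition empty in degree 0, where every chain is a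
  cycle.\<close>

lemma homology_covers:
  fixes C :: "('r, 'm) chain_complex" and W :: "nat \<Rightarrow> ('r, 'w) module"
  assumes W: "\<And>k. module R (W k)" and cov: "\<And>k. covers R (W k) (obj C k) (p k) (B k)"
    and zB: "\<And>k. \<zero>\<^bsub>W k\<^esub> \<in> B k"
    and d: "\<And>k. linear_map R (W (Suc k)) (W k) (\<delta> k)"
    and comm: "\<And>k w. w \<in> carrier (W (Suc k)) \<Longrightarrow> bd C k (p (Suc k) w) = p k (\<delta> k w)"
    and dd: "\<And>k w. w \<in> carrier (W (Suc (Suc k))) \<Longrightarrow> \<delta> k (\<delta> (Suc k) w) \<in> B k"
  shows "\<exists>q. covers R ((W k)\<lparr>carrier := {w \<in> carrier (W k). \<forall>j. k = Suc j \<longrightarrow> \<delta> j w \<in> B j}\<rparr>)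
     (homology_module C k) q {\<delta> k v \<oplus>\<^bsub>W k\<^esub> b | v b. v \<in> carrier (W (Suc k)) \<and> b \<in> B k}"
proof -
  define Z where "Z = {w \<in> carrier (W k). \<forall>j. k = Suc j \<longrightarrow> \<delta> j w \<in> B j}"
  let ?O = "(obj C k)\<lparr>carrier := chain_cycles C k\<rparr>"
  have O: "module R (obj C k)" for k by (rule covers_imp_module[OF W cov zB])
  interpret Wk: module R "W k" by (rule W)
  interpret WO: module_pair R "W k" "obj C k" by (rule module_pair.intro[OF W O])
  note c = coversD'[OF cov] and cs = covers_submodule[OF W cov zB]
  have Z: "submodule Z R (W k)"
  proof (cases k)
    case 0
    then show ?thesis unfolding Z_def using module.carrier_is_submodule[OF W] by simp
  next
    case (Suc j)
    interpret WW: module_pair R "W (Suc j)" "W j" by (rule module_pair.intro[OF W W])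
    show ?thesis unfolding Z_def Suc using WW.submodule_vimage[OF d cs] by simp
  qed
  have pZ: "p k ` Z = chain_cycles C k"
  proof (cases k)
    case 0
    then show ?thesis unfolding Z_def using c(2)[of 0] by simp
  next
    case (Suc j)
    have eq: "bd C j (p (Suc j) w) = \<zero>\<^bsub>obj C j\<^esub> \<longleftrightarrow> \<delta> j w \<in> B j" if "w \<in> carrier (W (Suc j))" for w
      using comm[OF that] c(3)[OF linear_map_closed[OF d that]] by simp
    show ?thesis unfolding Z_def Suc
    proof (intro subset_antisym subsetI)
      fix x assume "x \<in> p (Suc j) ` {w \<in> carrier (W (Suc j)). \<forall>ja. Suc j = Suc ja \<longrightarrow> \<delta> ja w \<in> B ja}"
      then obtain w where w: "w \<in> carrier (W (Suc j))" "\<delta> j w \<in> B j" "x = p (Suc j) w" by auto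
      then show "x \<in> chain_cycles C (Suc j)"
        using eq[OF w(1)] linear_map_closed[OF c(1) w(1)] by simp
    next
      fix x assume x: "x \<in> chain_cycles C (Suc j)"
      then obtain w where w: "w \<in> carrier (W (Suc j))" "p (Suc j) w = x" using c(5)[of x "Suc j"] by auto
      then show "x \<in> p (Suc j) ` {w \<in> carrier (W (Suc j)). \<forall>ja. Suc j = Suc ja \<longrightarrow> \<delta> ja w \<in> B ja}"
        using eq[OF w(1)] x by auto
    qed
  qed
  have ZW: "module R ((W k)\<lparr>carrier := Z\<rparr>)" by (rule submodule.submodule_is_module[OF Z W])
  have cyc: "submodule (chain_cycles C k) R (obj C k)"
    unfolding pZ[symmetric] by (rule WO.submodule_image[OF c(1) Z])
  have OO: "module R ?O" by (rule submodule.submodule_is_module[OF cyc O])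
  have bdim: "chain_boundaries C k = (\<lambda>v. p k (\<delta> k v)) ` carrier (W (Suc k))"
    unfolding chain_boundaries_def c(2)[of "Suc k", symmetric] image_image
    by (rule image_cong) (simp_all add: comm)
  have dZ: "\<delta> k v \<in> Z" if "v \<in> carrier (W (Suc k))" for v
    unfolding Z_def using linear_map_closed[OF d that] dd that by auto
  have cov1: "covers R ((W k)\<lparr>carrier := Z\<rparr>) ?O (p k) (B k)"
    unfolding covers_def
  proof (intro conjI)
    show "linear_map R ((W k)\<lparr>carrier := Z\<rparr>) ?O (p k)"
    proof (rule linear_mapI)
      fix x assume "x \<in> carrier ((W k)\<lparr>carrier := Z\<rparr>)"
      then show "p k x \<in> carrier ?O" using pZ by auto
    qed (use linear_mapD[OF c(1)[of k]] in \<open>auto simp: Z_def\<close>)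
    show "p k ` carrier ((W k)\<lparr>carrier := Z\<rparr>) = carrier ?O" using pZ by simp
    \<comment> \<open>\<open>\<delta>\<close> preserves \<open>B\<close>: after projection its value
      at \<open>x\<close> depends only on \<open>p x\<close>, which is zero, so it agrees with the
      value at an element \<open>z\<close> of \<open>Z\<close> that also projects to zero.\<close>
    have "B k \<subseteq> Z"
    proof
      fix x assume x: "x \<in> B k"
      then have xk: "x \<in> carrier (W k)" using c(4) by blast
      have "\<delta> j x \<in> B j" if j: "k = Suc j" for j
      proof -
        interpret P: module_pair R "obj C (Suc j)" "obj C j" by (rule module_pair.intro[OF O O])
        have xj: "x \<in> carrier (W (Suc j))" "p (Suc j) x = \<zero>\<^bsub>obj C (Suc j)\<^esub>"
          using xk c(3)[OF xk] x j by simp_all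
        obtain z where z: "z \<in> Z" "p k z = \<zero>\<^bsub>obj C k\<^esub>"
          using Wk.submodule_zero[OF Z] WO.linear_map_zero[OF c(1)] by blast
        then have zj: "z \<in> carrier (W (Suc j))" "\<delta> j z \<in> B j" using j by (auto simp: Z_def)
        have "p j (\<delta> j x) = p j (\<delta> j z)" using comm[OF xj(1)] comm[OF zj(1)] xj(2) z(2) j by simp
        also have "\<dots> = \<zero>\<^bsub>obj C j\<^esub>" using c(3)[OF linear_map_closed[OF d zj(1)]] zj(2) by simp
        finally show ?thesis using c(3)[OF linear_map_closed[OF d xj(1)]] by simp
      qed
      then show "x \<in> Z" unfolding Z_def using xk by simp
    qed
    then show "B k = {w \<in> carrier ((W k)\<lparr>carrier := Z\<rparr>). p k w = \<zero>\<^bsub>?O\<^esub>}"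
      using c(3)[of _ k] c(4)[of k] unfolding Z_def by auto
  qed
  interpret WO2: module_pair R "W (Suc k)" "obj C k" by (rule module_pair.intro[OF W O])
  have bs: "submodule (chain_boundaries C k) R ?O"
  proof (rule submodule_restrict[OF O cyc])
    show "submodule (chain_boundaries C k) R (obj C k)"
      unfolding bdim by (rule WO2.submodule_image[OF linear_map_comp[OF d c(1)] WO2.M.carrier_is_submodule])
    show "chain_boundaries C k \<subseteq> chain_cycles C k" unfolding bdim using dZ pZ by auto
  qed
  have "{w \<in> Z. p k w \<in> chain_boundaries C k}
    = {\<delta> k v \<oplus>\<^bsub>W k\<^esub> b | v b. v \<in> carrier (W (Suc k)) \<and> b \<in> B k}"
  proof (intro subset_antisym subsetI)
    fix w assume "w \<in> {w \<in> Z. p k w \<in> chain_boundaries C k}"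
    then obtain v where v: "w \<in> carrier (W k)" "v \<in> carrier (W (Suc k))" "p k w = p k (\<delta> k v)"
      unfolding bdim Z_def by auto
    note dv = linear_map_closed[OF d v(2)]
    have "w \<ominus>\<^bsub>W k\<^esub> \<delta> k v \<in> B k" using covers_eq_iff[OF W cov zB v(1) dv] v(3) by simp
    moreover have "w = \<delta> k v \<oplus>\<^bsub>W k\<^esub> (w \<ominus>\<^bsub>W k\<^esub> \<delta> k v)"
      using v(1) dv by (simp add: a_minus_def Wk.a_lcomm Wk.r_neg)
    ultimately show "w \<in> {\<delta> k v \<oplus>\<^bsub>W k\<^esub> b | v b. v \<in> carrier (W (Suc k)) \<and> b \<in> B k}"
      using v(2) by blast
  next
    fix w assume "w \<in> {\<delta> k v \<oplus>\<^bsub>W k\<^esub> b | v b. v \<in> carrier (W (Suc k)) \<and> b \<in> B k}"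
    then obtain v b where v: "v \<in> carrier (W (Suc k))" "b \<in> B k" "w = \<delta> k v \<oplus>\<^bsub>W k\<^esub> b" by blast
    note dv = linear_map_closed[OF d v(1)]
    have bc: "b \<in> carrier (W k)" using c(4) v(2) by blast
    have "b \<in> Z" using coversD'(4)[OF cov1] v(2) by auto
    then have "w \<in> Z" unfolding v(3) by (rule Wk.submoduleE(5)[OF Z dZ[OF v(1)]])
    moreover have "p k w = p k (\<delta> k v)"
      unfolding v(3) linear_map_add[OF c(1) dv bc] using c(3)[OF bc] v(2) linear_map_closed[OF c(1) dv] by simp
    ultimately show "w \<in> {w \<in> Z. p k w \<in> chain_boundaries C k}" unfolding bdim using v(1) by blast
  qed
  then show ?thesis
    using covers_comp[OF cov1 covers_quotient[OF OO bs]]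
    unfolding homology_module_def Z_def by auto
qed

lemma covers_cong:
  assumes W: "module R W" and p: "covers R W M p B" and e: "\<And>w. w \<in> carrier W \<Longrightarrow> q w = p w"
  shows "covers R W M q B"
proof -
  note p' = coversD'[OF p]
  have 1: "linear_map R W M q" by (rule linear_map_cong[OF p'(1) W]) (simp add: e)
  have "q ` carrier W = p ` carrier W" by (rule image_cong) (simp_all add: e)
  then have 2: "q ` carrier W = carrier M" unfolding p'(2) .
  have "w \<in> B \<longleftrightarrow> w \<in> carrier W \<and> q w = \<zero>\<^bsub>M\<^esub>" for w
    using p'(3)[of w] p'(4) e[of w] by auto
  then have 3: "B = {w \<in> carrier W. q w = \<zero>\<^bsub>M\<^esub>}" by blast
  show ?thesis unfolding covers_def by (intro conjI 1 2 3)
qed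

section \<open>Koszul complexes\<close>

text \<open>The rings have a carrier, so that ideals and modules are available for them, but their
  operations are those of a type class. Finite sums and sign computations then become ordinary
  arithmetic.\<close>

locale concrete_ring = cring R for R :: "'r::comm_ring_1 ring" (structure) +
  assumes ops: "mult R = (*)" "one R = 1" "zero R = 0" "add R = (+)"
begin

lemma R_closed:
  "0 \<in> carrier R" "1 \<in> carrier R"
  "x \<in> carrier R \<Longrightarrow> y \<in> carrier R \<Longrightarrow> x + y \<in> carrier R"
  "x \<in> carrier R \<Longrightarrow> y \<in> carrier R \<Longrightarrow> x * y \<in> carrier R"
  using zero_closed one_closed a_closed m_closed by (simp_all add: ops)

lemma R_a_inv:
  assumes "x \<in> carrier R"
  shows "\<ominus> x = - x"
proof -
  have "x + (\<ominus> x) = 0" using r_neg[OF assms] by (simp add: ops)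
  then show ?thesis by (simp add: eq_neg_iff_add_eq_0 add.commute)
qed

lemma R_closed_minus:
  assumes "x \<in> carrier R"
  shows "- x \<in> carrier R" and "y \<in> carrier R \<Longrightarrow> x - y \<in> carrier R"
proof -
  have n: "- x \<in> carrier R" if "x \<in> carrier R" for x
    using a_inv_closed[OF that] by (simp add: R_a_inv[OF that])
  show "- x \<in> carrier R" by (rule n[OF assms])
  show "x - y \<in> carrier R" if "y \<in> carrier R"
    using R_closed(3)[OF assms n[OF that]] by simp
qed

lemma R_sum_closed: "(\<And>i. i \<in> A \<Longrightarrow> f i \<in> carrier R) \<Longrightarrow> sum f A \<in> carrier R"
  by (induction A rule: infinite_finite_induct) (auto simp: R_closed)

lemma idealE:
  assumes "ideal I R"
  shows "0 \<in> I" "x \<in> I \<Longrightarrow> y \<in> I \<Longrightarrow> x + y \<in> I" "x \<in> I \<Longrightarrow> x \<in> carrier R"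
    "x \<in> I \<Longrightarrow> - x \<in> I" "x \<in> I \<Longrightarrow> y \<in> I \<Longrightarrow> x - y \<in> I"
    "r \<in> carrier R \<Longrightarrow> x \<in> I \<Longrightarrow> r * x \<in> I" "r \<in> carrier R \<Longrightarrow> x \<in> I \<Longrightarrow> x * r \<in> I"
proof -
  interpret ideal I R by fact
  show "0 \<in> I" using additive_subgroup.zero_closed[OF is_additive_subgroup] by (simp add: ops)
  have pl: "x + y \<in> I" if "x \<in> I" "y \<in> I" for x y
    using additive_subgroup.a_closed[OF is_additive_subgroup that] by (simp add: ops)
  then show "x \<in> I \<Longrightarrow> y \<in> I \<Longrightarrow> x + y \<in> I" .
  show "x \<in> I \<Longrightarrow> x \<in> carrier R" by (rule additive_subgroup.a_Hcarr[OF is_additive_subgroup])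
  have s: "r * x \<in> I" if "r \<in> carrier R" "x \<in> I" for r x
    using I_l_closed[OF that(2,1)] by (simp add: ops)
  then show "r \<in> carrier R \<Longrightarrow> x \<in> I \<Longrightarrow> r * x \<in> I" .
  then show "r \<in> carrier R \<Longrightarrow> x \<in> I \<Longrightarrow> x * r \<in> I" by (simp add: mult.commute)
  have n: "- x \<in> I" if "x \<in> I" for x using s[OF R_closed_minus(1)[OF R_closed(2)] that] by simp
  then show "x \<in> I \<Longrightarrow> - x \<in> I" .
  show "x - y \<in> I" if "x \<in> I" "y \<in> I" using pl[OF that(1) n[OF that(2)]] by simp
qed

lemma ideal_sum:
  assumes "ideal I R"
  shows "(\<And>i. i \<in> A \<Longrightarrow> f i \<in> I) \<Longrightarrow> sum f A \<in> I"
  by (induction A rule: infinite_finite_induct) (auto simp: idealE[OF assms])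

lemma idealI':
  assumes "I \<subseteq> carrier R" "0 \<in> I" "\<And>x y. x \<in> I \<Longrightarrow> y \<in> I \<Longrightarrow> x + y \<in> I"
    "\<And>r x. r \<in> carrier R \<Longrightarrow> x \<in> I \<Longrightarrow> r * x \<in> I"
  shows "ideal I R"
proof (rule idealI)
  show "ring R" by unfold_locales
  show "subgroup I (add_monoid R)"
  proof (rule add.subgroupI)
    show "\<ominus> a \<in> I" if "a \<in> I" for a
      using assms(4)[OF R_closed_minus(1)[OF R_closed(2)] that] R_a_inv that assms(1) by auto
  qed (use assms in \<open>auto simp: ops\<close>)
  show "r \<otimes> x \<in> I" "x \<otimes> r \<in> I" if "x \<in> I" "r \<in> carrier R" for x r
    using assms(4)[OF that(2,1)] by (simp_all add: ops mult.commute[of x r])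
qed

lemma zero_ideal: "ideal {0} R" by (rule idealI') (auto simp: R_closed)

definition extend_ideal :: "'r set \<Rightarrow> 'r \<Rightarrow> 'r set"
  where "extend_ideal I y = {i + y * r | i r. i \<in> I \<and> r \<in> carrier R}"

lemma extend_ideal_ideal:
  assumes I: "ideal I R" and y: "y \<in> carrier R"
  shows "ideal (extend_ideal I y) R" "I \<subseteq> extend_ideal I y" "y \<in> extend_ideal I y"
proof -
  note i = idealE[OF I]
  show "ideal (extend_ideal I y) R"
  proof (rule idealI')
    show "extend_ideal I y \<subseteq> carrier R" using i(3) y by (auto simp: extend_ideal_def R_closed)
    show "0 \<in> extend_ideal I y" unfolding extend_ideal_def using i(1) R_closed(1) by force
    show "a + b \<in> extend_ideal I y" if "a \<in> extend_ideal I y" "b \<in> extend_ideal I y" for a b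
    proof -
      obtain u r v s where "a = u + y * r" "b = v + y * s" "u \<in> I" "v \<in> I" "r \<in> carrier R" "s \<in> carrier R"
        using \<open>a \<in> _\<close> \<open>b \<in> _\<close> unfolding extend_ideal_def by blast
      then have "a + b = (u + v) + y * (r + s)" "u + v \<in> I" "r + s \<in> carrier R"
        using i(2) R_closed by (simp_all add: algebra_simps)
      then show ?thesis unfolding extend_ideal_def by blast
    qed
    show "q * a \<in> extend_ideal I y" if "q \<in> carrier R" "a \<in> extend_ideal I y" for q a
    proof -
      obtain u r where "a = u + y * r" "u \<in> I" "r \<in> carrier R"
        using \<open>a \<in> _\<close> unfolding extend_ideal_def by blast
      then have "q * a = q * u + y * (q * r)" "q * u \<in> I" "q * r \<in> carrier R"
        using i(6) R_closed that by (simp_all add: algebra_simps)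
      then show ?thesis unfolding extend_ideal_def by blast
    qed
  qed
  show "I \<subseteq> extend_ideal I y"
  proof
    fix a assume "a \<in> I"
    then have "a = a + y * 0 \<and> a \<in> I \<and> 0 \<in> carrier R" by (simp add: R_closed)
    then show "a \<in> extend_ideal I y" unfolding extend_ideal_def by blast
  qed
  have "y = 0 + y * 1 \<and> 0 \<in> I \<and> 1 \<in> carrier R" by (simp add: R_closed i)
  then show "y \<in> extend_ideal I y" unfolding extend_ideal_def by blast
qed

text \<open>The Koszul module with all degrees taken together: \<open>z A\<close> is the coefficient of the wedge of the
  basis vectors in \<open>A\<close>, and functions vanish outside the subsets of \<open>X\<close> in order to be unique.\<close>

definition kos :: "'i set \<Rightarrow> ('r, 'i set \<Rightarrow> 'r) module"
  where "kos X = \<lparr>carrier = {z. (\<forall>A. z A \<in> carrier R) \<and> (\<forall>A. \<not> A \<subseteq> X \<longrightarrow> z A = 0)},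
    mult = undefined, one = undefined, zero = (\<lambda>_. 0), add = (\<lambda>f g A. f A + g A),
    smult = (\<lambda>r f A. r * f A)\<rparr>"

lemma kos_simps:
  "z \<in> carrier (kos X) \<longleftrightarrow> (\<forall>A. z A \<in> carrier R) \<and> (\<forall>A. \<not> A \<subseteq> X \<longrightarrow> z A = 0)"
  "\<zero>\<^bsub>kos X\<^esub> = (\<lambda>_. 0)" "f \<oplus>\<^bsub>kos X\<^esub> g = (\<lambda>A. f A + g A)" "r \<odot>\<^bsub>kos X\<^esub> f = (\<lambda>A. r * f A)"
  unfolding kos_def by simp_all

lemma kos_module: "module R (kos X)"
proof (rule moduleI)
  show "abelian_group (kos X)"
  proof (rule abelian_groupI)
    fix f assume "f \<in> carrier (kos X)"
    then have "(\<lambda>A. - f A) \<in> carrier (kos X) \<and> (\<lambda>A. - f A) \<oplus>\<^bsub>kos X\<^esub> f = \<zero>\<^bsub>kos X\<^esub>"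
      by (auto simp: kos_simps R_closed_minus)
    then show "\<exists>g\<in>carrier (kos X). g \<oplus>\<^bsub>kos X\<^esub> f = \<zero>\<^bsub>kos X\<^esub>" by blast
  qed (auto simp: kos_simps R_closed add_ac)
qed (auto simp: kos_simps R_closed is_cring ops algebra_simps)

lemma kos_diff_closed:
  "f \<in> carrier (kos X) \<Longrightarrow> g \<in> carrier (kos X) \<Longrightarrow> (\<lambda>A. f A - g A) \<in> carrier (kos X)"
  by (auto simp: kos_simps R_closed_minus)

text \<open>The sign of moving the basis vector \<open>g\<close> to the front of the increasing
  wedge product over \<open>insert g A\<close>.\<close>

definition ksgn :: "'i::linorder \<Rightarrow> 'i set \<Rightarrow> 'r"
  where "ksgn g A = (-1) ^ card {h \<in> A. h < g}"

lemma ksgn_closed: "ksgn g A \<in> carrier R"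
proof -
  have "(-1) ^ n \<in> carrier R" for n :: nat
    by (induction n) (auto simp: R_closed_minus R_closed)
  then show ?thesis by (simp add: ksgn_def)
qed

lemma ksgn_square: "ksgn g A * ksgn g A = 1"
  unfolding ksgn_def by (simp flip: power_add)

lemma ksgn_square': "ksgn g A * (ksgn g A * x) = x"
  by (simp add: mult.assoc[symmetric] ksgn_square)

lemma ksgn_insert:
  assumes "finite A" "h \<notin> A"
  shows "ksgn g (insert h A) = (if h < g then - ksgn g A else ksgn g A)"
proof -
  have "{k \<in> insert h A. k < g} = (if h < g then insert h {k \<in> A. k < g} else {k \<in> A. k < g})" by auto
  then show ?thesis using assms unfolding ksgn_def by simp
qed

text \<open>Extracting \<open>g\<close> and \<open>h\<close> in the two possible orders differs by a
  transposition. That the differential squares to zero, the sign in the mapping cone and the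
  vanishing of squares in the exterior algebra all come from this.\<close>

lemma ksgn_swap:
  assumes "finite A" "g \<notin> A" "h \<notin> A" "g \<noteq> h"
  shows "ksgn g A * ksgn h (insert g A) = - (ksgn h A * ksgn g (insert h A))"
proof (cases "g < h")
  case True
  then have "\<not> h < g" by simp
  with True show ?thesis using assms by (simp add: ksgn_insert)
next
  case False
  then have "h < g" using assms(4) by simp
  with False show ?thesis using assms by (simp add: ksgn_insert)
qed

text \<open>Contraction with the linear form whose value on the basis vector \<open>g\<close> is
  \<open>x g\<close>, written for coefficients: \<open>A\<close> receives from the sets with one
  more element.\<close>

definition kd :: "'i::linorder set \<Rightarrow> ('i \<Rightarrow> 'r) \<Rightarrow> ('i set \<Rightarrow> 'r) \<Rightarrow> 'i set \<Rightarrow> 'r"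
  where "kd X x z A = (\<Sum>g\<in>X - A. ksgn g A * x g * z (insert g A))"

text \<open>Swapping the summation variables shows only that twice the sum vanishes, which is too
  weak in a ring with 2-torsion; the induction pairs the terms instead.\<close>

lemma antisymmetric_sum:
  fixes f :: "'i \<Rightarrow> 'i \<Rightarrow> 'r"
  assumes "finite D" "\<And>g h. g \<in> D \<Longrightarrow> h \<in> D \<Longrightarrow> g \<noteq> h \<Longrightarrow> f g h + f h g = 0"
  shows "(\<Sum>g\<in>D. \<Sum>h\<in>D - {g}. f g h) = 0"
  using assms
proof (induction D rule: finite_induct)
  case (insert a D)
  have "(\<Sum>g\<in>insert a D. \<Sum>h\<in>insert a D - {g}. f g h)
    = (\<Sum>h\<in>D. f a h) + (\<Sum>g\<in>D. \<Sum>h\<in>insert a D - {g}. f g h)"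
    using insert by simp
  also have "(\<Sum>g\<in>D. \<Sum>h\<in>insert a D - {g}. f g h) = (\<Sum>g\<in>D. f g a + (\<Sum>h\<in>D - {g}. f g h))"
  proof (rule sum.cong[OF refl])
    fix g assume "g \<in> D"
    then have "insert a D - {g} = insert a (D - {g})" "a \<notin> D - {g}" using insert by auto
    then show "(\<Sum>h\<in>insert a D - {g}. f g h) = f g a + (\<Sum>h\<in>D - {g}. f g h)" using insert by simp
  qed
  also have "(\<Sum>h\<in>D. f a h) + (\<Sum>g\<in>D. f g a + (\<Sum>h\<in>D - {g}. f g h)) = (\<Sum>h\<in>D. f a h + f h a)"
    using insert by (simp add: sum.distrib)
  also have "\<dots> = 0" by (rule sum.neutral) (use insert in auto)
  finally show ?case .
qed simp

context
  fixes X :: "'i::linorder set" and x :: "'i \<Rightarrow> 'r"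
  assumes fX: "finite X" and xc: "x \<in> X \<rightarrow> carrier R"
begin

lemma kd_closed:
  assumes z: "z \<in> carrier (kos X)"
  shows "kd X x z \<in> carrier (kos X)"
  unfolding kos_simps
proof (intro conjI allI impI)
  fix A
  show "kd X x z A \<in> carrier R" unfolding kd_def
    by (rule R_sum_closed) (use z in \<open>auto simp: kos_simps R_closed ksgn_closed Pi_mem[OF xc]\<close>)
  assume "\<not> A \<subseteq> X"
  then show "kd X x z A = 0" using z by (auto simp: kd_def kos_simps)
qed

lemma kd_add: "kd X x (\<lambda>A. f A + g A) = (\<lambda>A. kd X x f A + kd X x g A)"
  by (simp add: kd_def fun_eq_iff algebra_simps sum.distrib)

lemma kd_diff: "kd X x (\<lambda>A. f A - g A) = (\<lambda>A. kd X x f A - kd X x g A)"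
  by (simp add: kd_def fun_eq_iff algebra_simps sum_subtractf)

lemma kd_smult: "kd X x (\<lambda>A. r * f A) = (\<lambda>A. r * kd X x f A)"
  by (simp add: kd_def fun_eq_iff algebra_simps sum_distrib_left)

lemma kd_zero: "kd X x (\<lambda>_. 0) = (\<lambda>_. 0)"
  by (simp add: kd_def fun_eq_iff)

lemma kd_kd:
  assumes z: "z \<in> carrier (kos X)"
  shows "kd X x (kd X x z) = (\<lambda>_. 0)"
proof
  fix A
  show "kd X x (kd X x z) A = 0"
  proof (cases "A \<subseteq> X")
    case True
    then have fA: "finite A" using rev_finite_subset[OF fX] by simp
    let ?f = "\<lambda>g h. ksgn g A * x g * (ksgn h (insert g A) * x h * z (insert h (insert g A)))"
    have "kd X x (kd X x z) A = (\<Sum>g\<in>X - A. \<Sum>h\<in>X - A - {g}. ?f g h)"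
      unfolding kd_def sum_distrib_left
      by (intro sum.cong) auto
    also have "\<dots> = 0"
    proof (rule antisymmetric_sum)
      fix g h assume "g \<in> X - A" "h \<in> X - A" "g \<noteq> h"
      then have s: "ksgn g A * ksgn h (insert g A) = - (ksgn h A * ksgn g (insert h A))"
        by (intro ksgn_swap fA) auto
      have "?f g h = (ksgn g A * ksgn h (insert g A)) * (x g * x h * z (insert h (insert g A)))"
        by (simp add: algebra_simps)
      also have "\<dots> = - ?f h g" unfolding s by (simp add: algebra_simps insert_commute)
      finally show "?f g h + ?f h g = 0" by simp
    qed (use fX in simp)
    finally show ?thesis .
  next
    case False
    then show ?thesis using kd_closed[OF kd_closed[OF z]] by (auto simp: kos_simps)
  qed
qed

lemma kd_ideal:
  assumes I: "ideal I R" and z: "\<And>A. z A \<in> I"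
  shows "kd X x z A \<in> I"
  unfolding kd_def
  by (rule ideal_sum[OF I]) (use z Pi_mem[OF xc] idealE(6)[OF I] in \<open>auto simp: ksgn_closed R_closed\<close>)

end

text \<open>Cycles and boundaries modulo \<open>I\<close>, as elements of the free module \<^term>\<open>kos X\<close>.\<close>

definition HZ :: "'i::linorder set \<Rightarrow> ('i \<Rightarrow> 'r) \<Rightarrow> 'r set \<Rightarrow> ('r, 'i set \<Rightarrow> 'r) module"
  where "HZ X x I = (kos X)\<lparr>carrier := {z \<in> carrier (kos X). \<forall>A. kd X x z A \<in> I}\<rparr>"

definition HB :: "'i::linorder set \<Rightarrow> ('i \<Rightarrow> 'r) \<Rightarrow> 'r set \<Rightarrow> ('i set \<Rightarrow> 'r) set"
  where "HB X x I = {z \<in> carrier (kos X). \<exists>w\<in>carrier (kos X). \<forall>A. z A - kd X x w A \<in> I}"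

text \<open>\<open>M\<close> is the total Koszul homology of the sequence \<open>x\<close> with coefficients in \<open>R / I\<close>.\<close>

definition kh :: "'i::linorder set \<Rightarrow> ('i \<Rightarrow> 'r) \<Rightarrow> 'r set \<Rightarrow> ('r, 'm) module \<Rightarrow> bool"
  where "kh X x I M \<longleftrightarrow> (\<exists>p. covers R (HZ X x I) M p (HB X x I))"

lemma HZ_simps:
  "z \<in> carrier (HZ X x I) \<longleftrightarrow> z \<in> carrier (kos X) \<and> (\<forall>A. kd X x z A \<in> I)"
  "\<zero>\<^bsub>HZ X x I\<^esub> = (\<lambda>_. 0)" "f \<oplus>\<^bsub>HZ X x I\<^esub> g = (\<lambda>A. f A + g A)" "r \<odot>\<^bsub>HZ X x I\<^esub> f = (\<lambda>A. r * f A)"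
  unfolding HZ_def by (simp_all add: kos_simps)

context
  fixes X :: "'i::linorder set" and x :: "'i \<Rightarrow> 'r" and I
  assumes fX: "finite X" and xc: "x \<in> X \<rightarrow> carrier R" and I: "ideal I R"
begin

lemma HZ_submodule: "submodule (carrier (HZ X x I)) R (kos X)"
  by (rule module.submoduleI'[OF kos_module])
    (auto simp: HZ_simps kos_simps R_closed kd_add[OF fX xc] kd_smult[OF fX xc] kd_zero[OF fX xc] idealE[OF I])

lemma HZ_module: "module R (HZ X x I)"
  using submodule.submodule_is_module[OF HZ_submodule kos_module] by (simp add: HZ_def)

lemma HB_subset: "HB X x I \<subseteq> carrier (HZ X x I)"
proof
  fix z assume "z \<in> HB X x I"
  then obtain w where w: "z \<in> carrier (kos X)" "w \<in> carrier (kos X)" "\<And>A. z A - kd X x w A \<in> I"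
    unfolding HB_def by blast
  have "kd X x (\<lambda>A. z A - kd X x w A) A \<in> I" for A by (rule kd_ideal[OF fX xc I w(3)])
  then show "z \<in> carrier (HZ X x I)"
    using w(1) by (simp add: HZ_simps kd_diff[OF fX xc] kd_kd[OF fX xc w(2)])
qed

lemma HB_submodule: "submodule (HB X x I) R (HZ X x I)"
proof (rule module.submoduleI'[OF HZ_module])
  show "\<zero>\<^bsub>HZ X x I\<^esub> \<in> HB X x I"
    unfolding HB_def HZ_simps using kd_zero[OF fX xc] idealE(1)[OF I]
    by (auto simp: kos_simps R_closed intro!: bexI[of _ "\<lambda>_. 0"])
  fix a b assume "a \<in> HB X x I" "b \<in> HB X x I"
  then obtain u v where *: "a \<in> carrier (kos X)" "u \<in> carrier (kos X)" "\<And>A. a A - kd X x u A \<in> I"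
     "b \<in> carrier (kos X)" "v \<in> carrier (kos X)" "\<And>A. b A - kd X x v A \<in> I"
    unfolding HB_def by blast
  have "(\<lambda>A. a A + b A) A - kd X x (\<lambda>A. u A + v A) A \<in> I" for A
    using idealE(2)[OF I *(3)[of A] *(6)[of A]] by (simp add: kd_add[OF fX xc] algebra_simps)
  moreover have "(\<lambda>A. a A + b A) \<in> carrier (kos X)" "(\<lambda>A. u A + v A) \<in> carrier (kos X)"
    using * by (auto simp: kos_simps R_closed)
  ultimately show "a \<oplus>\<^bsub>HZ X x I\<^esub> b \<in> HB X x I" unfolding HZ_simps HB_def by blast
next
  fix r a assume r: "r \<in> carrier R" and "a \<in> HB X x I"
  then obtain u where *: "a \<in> carrier (kos X)" "u \<in> carrier (kos X)" "\<And>A. a A - kd X x u A \<in> I"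
    unfolding HB_def by blast
  have "(\<lambda>A. r * a A) A - kd X x (\<lambda>A. r * u A) A \<in> I" for A
    using idealE(6)[OF I r *(3)[of A]] by (simp add: kd_smult[OF fX xc] algebra_simps)
  moreover have "(\<lambda>A. r * a A) \<in> carrier (kos X)" "(\<lambda>A. r * u A) \<in> carrier (kos X)"
    using * r by (auto simp: kos_simps R_closed)
  ultimately show "r \<odot>\<^bsub>HZ X x I\<^esub> a \<in> HB X x I" unfolding HZ_simps HB_def by blast
qed (rule HB_subset)

lemma HB_zero: "\<zero>\<^bsub>HZ X x I\<^esub> \<in> HB X x I"
  by (rule module.submodule_zero[OF HZ_module HB_submodule])

lemma kh_cong_subset:
  assumes yc: "y \<in> X \<rightarrow> carrier R" and xy: "\<And>g. g \<in> X \<Longrightarrow> x g - y g \<in> I"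
    and w: "w \<in> carrier (kos X)"
  shows "kd X x w A - kd X y w A \<in> I"
proof -
  have "kd X x w A - kd X y w A = (\<Sum>g\<in>X - A. (x g - y g) * (ksgn g A * w (insert g A)))"
    unfolding kd_def sum_subtractf[symmetric] by (rule sum.cong) (auto simp: algebra_simps)
  also have "\<dots> \<in> I"
  proof (rule ideal_sum[OF I])
    fix g assume "g \<in> X - A"
    then show "(x g - y g) * (ksgn g A * w (insert g A)) \<in> I"
      using w by (intro idealE(7)[OF I] xy R_closed ksgn_closed) (auto simp: kos_simps)
  qed
  finally show ?thesis .
qed

text \<open>The two differentials agree modulo \<open>I\<close>, so cycles and boundaries are
  literally the same sets.\<close>

lemma kh_cong:
  assumes yc: "y \<in> X \<rightarrow> carrier R" and xy: "\<And>g. g \<in> X \<Longrightarrow> x g - y g \<in> I"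
  shows "kh X x I M \<longleftrightarrow> kh X y I M"
proof -
  have d: "kd X x w A - kd X y w A \<in> I" if "w \<in> carrier (kos X)" for w A
    by (rule kh_cong_subset[OF yc _ that]) (rule xy)
  have 1: "kd X x w A \<in> I \<longleftrightarrow> kd X y w A \<in> I" if "w \<in> carrier (kos X)" for w A
  proof -
    have "kd X y w A = kd X x w A - (kd X x w A - kd X y w A)" by simp
    moreover have "kd X x w A = kd X y w A + (kd X x w A - kd X y w A)" by simp
    ultimately show ?thesis using idealE(2,5)[OF I] d[OF that, of A] by metis
  qed
  have 2: "z A - kd X x w A \<in> I \<longleftrightarrow> z A - kd X y w A \<in> I" if "w \<in> carrier (kos X)" for w z A
  proof -
    have "z A - kd X y w A = (z A - kd X x w A) + (kd X x w A - kd X y w A)" by simp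
    moreover have "z A - kd X x w A = (z A - kd X y w A) - (kd X x w A - kd X y w A)" by simp
    ultimately show ?thesis using idealE(2,5)[OF I] d[OF that, of A] by metis
  qed
  have "HZ X x I = HZ X y I" unfolding HZ_def
    by (rule arg_cong[of _ _ "\<lambda>C. (kos X)\<lparr>carrier := C\<rparr>"]) (use 1 in blast)
  moreover have "HB X x I = HB X y I" unfolding HB_def using 2 by blast
  ultimately show ?thesis unfolding kh_def by simp
qed

end

section \<open>Adjoining one regular entry to a Koszul sequence\<close>

context
  fixes X :: "'i::linorder set" and x :: "'i \<Rightarrow> 'r" and I and i :: 'i
  assumes fX: "finite X" and xc: "x \<in> X \<rightarrow> carrier R" and I: "ideal I R"
    and iX: "i \<notin> X" and xi: "x i \<in> carrier R"
    and reg: "\<And>a. a \<in> carrier R \<Longrightarrow> x i * a \<in> I \<Longrightarrow> a \<in> I"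
begin

text \<open>The Koszul complex on \<open>insert i X\<close> is the mapping cone of multiplication by \<open>x i\<close> on the
  one on \<open>X\<close>; the sign makes this true whatever the position of \<open>i\<close> in \<open>X\<close>.\<close>

definition cone :: "('i set \<Rightarrow> 'r) \<Rightarrow> ('i set \<Rightarrow> 'r) \<Rightarrow> 'i set \<Rightarrow> 'r"
  where "cone a b A = (if i \<in> A then ksgn i (A - {i}) * b (A - {i}) else a A)"

lemma cone_closed:
  assumes "a \<in> carrier (kos X)" "b \<in> carrier (kos X)"
  shows "cone a b \<in> carrier (kos (insert i X))"
proof -
  have "A - {i} \<subseteq> X \<Longrightarrow> A \<subseteq> insert i X" for A by blast
  then have "b (A - {i}) = 0" if "\<not> A \<subseteq> insert i X" for A using assms(2) that by (auto simp: kos_simps)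
  then show ?thesis using assms by (auto simp: kos_simps cone_def R_closed ksgn_closed)
qed

lemma cone_insert:
  assumes "b \<in> carrier (kos X)" "i \<notin> A"
  shows "cone a b (insert i A) = ksgn i A * b A"
  using assms by (simp add: cone_def insert_absorb)

lemma cone_exists:
  assumes z: "z \<in> carrier (kos (insert i X))"
  obtains a b where "a \<in> carrier (kos X)" "b \<in> carrier (kos X)" "z = cone a b"
proof
  let ?a = "\<lambda>A. if A \<subseteq> X then z A else 0"
  \<comment> \<open>The sign is applied here and once more in \<open>cone\<close>, and so it
    cancels.\<close>
  let ?b = "\<lambda>A. if A \<subseteq> X then ksgn i A * z (insert i A) else 0"
  show "?a \<in> carrier (kos X)" "?b \<in> carrier (kos X)"
    using z by (auto simp: kos_simps R_closed ksgn_closed)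
  show "z = cone ?a ?b"
  proof
    fix A
    show "z A = cone ?a ?b A"
    proof (cases "i \<in> A")
      case True
      then have A: "insert i (A - {i}) = A" by auto
      show ?thesis using z True by (auto simp: cone_def A ksgn_square' kos_simps insert_absorb)
    next
      case False
      then show ?thesis using z by (auto simp: cone_def kos_simps)
    qed
  qed
qed

lemma cone_ideal_iff: "(\<forall>A. cone a b A \<in> I) \<longleftrightarrow> (\<forall>A. i \<notin> A \<longrightarrow> a A \<in> I) \<and> (\<forall>A. i \<notin> A \<longrightarrow> b A \<in> I)"
proof (intro iffI conjI allI impI)
  fix A assume *: "\<forall>A. cone a b A \<in> I" and A: "i \<notin> A"
  show "a A \<in> I" using *[rule_format, of A] A by (simp add: cone_def)
  have "ksgn i A * b A \<in> I" using *[rule_format, of "insert i A"] A by (simp add: cone_def)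
  then have "ksgn i A * (ksgn i A * b A) \<in> I" by (rule idealE(6)[OF I ksgn_closed])
  then show "b A \<in> I" by (simp add: ksgn_square')
qed (auto simp: cone_def idealE(6)[OF I] ksgn_closed)

lemma kd_cone:
  assumes a: "a \<in> carrier (kos X)" and b: "b \<in> carrier (kos X)"
  shows "kd (insert i X) x (cone a b) = cone (\<lambda>A. kd X x a A + x i * b A) (\<lambda>A. - kd X x b A)"
proof
  fix A
  show "kd (insert i X) x (cone a b) A = cone (\<lambda>A. kd X x a A + x i * b A) (\<lambda>A. - kd X x b A) A"
  proof (cases "i \<in> A")
    case False
    have "kd (insert i X) x (cone a b) A
      = ksgn i A * x i * cone a b (insert i A) + (\<Sum>g\<in>X - A. ksgn g A * x g * cone a b (insert g A))"
      unfolding kd_def using False iX fX by (simp add: insert_Diff_if)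
    also have "ksgn i A * x i * cone a b (insert i A) = x i * b A"
      using cone_insert[OF b False] by (simp add: mult.assoc mult.left_commute[of "ksgn i A"] ksgn_square')
    also have "(\<Sum>g\<in>X - A. ksgn g A * x g * cone a b (insert g A)) = kd X x a A"
      unfolding kd_def using False iX by (intro sum.cong) (auto simp: cone_def)
    also have "x i * b A + kd X x a A = cone (\<lambda>A. kd X x a A + x i * b A) (\<lambda>A. - kd X x b A) A"
      using False by (simp add: cone_def)
    finally show ?thesis .
  next
    case True
    define B where "B = A - {i}"
    have B: "A = insert i B" "i \<notin> B" using True by (auto simp: B_def)
    show ?thesis
    proof (cases "B \<subseteq> X")
      case True
      then have fB: "finite B" using rev_finite_subset[OF fX] by simp
      have "kd (insert i X) x (cone a b) A
        = (\<Sum>g\<in>X - B. ksgn g (insert i B) * x g * cone a b (insert i (insert g B)))"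
        unfolding kd_def B using iX by (intro sum.cong) (auto simp: insert_commute)
      also have "\<dots> = (\<Sum>g\<in>X - B. - (ksgn i B * (ksgn g B * x g * b (insert g B))))"
      proof (rule sum.cong[OF refl])
        fix g assume g: "g \<in> X - B"
        then have gi: "g \<noteq> i" using iX by blast
        have "cone a b (insert i (insert g B)) = ksgn i (insert g B) * b (insert g B)"
          by (rule cone_insert[OF b]) (use gi B in auto)
        then have "ksgn g (insert i B) * x g * cone a b (insert i (insert g B))
          = ksgn i B * (ksgn i B * ksgn g (insert i B)) * ksgn i (insert g B) * x g * b (insert g B)"
          by (simp add: ksgn_square' algebra_simps)
        \<comment> \<open>The exchange of \<open>i\<close> and \<open>g\<close> produces the minus
          sign in the second component of the cone.\<close>
        also have "ksgn i B * ksgn g (insert i B) = - (ksgn g B * ksgn i (insert g B))"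
          by (rule ksgn_swap[OF fB]) (use gi g B in auto)
        finally show "ksgn g (insert i B) * x g * cone a b (insert i (insert g B))
          = - (ksgn i B * (ksgn g B * x g * b (insert g B)))"
          by (simp add: algebra_simps ksgn_square ksgn_square')
      qed
      also have "\<dots> = - (ksgn i B * kd X x b B)" by (simp add: kd_def sum_distrib_left sum_negf)
      also have "\<dots> = cone (\<lambda>A. kd X x a A + x i * b A) (\<lambda>A. - kd X x b A) A"
        unfolding cone_def using B by simp
      finally show ?thesis .
    next
      case False
      then have "\<not> insert g A \<subseteq> insert i X" for g unfolding B using B by blast
      moreover have "cone a b C = 0" if "\<not> C \<subseteq> insert i X" for C
        using cone_closed[OF a b] that by (simp add: kos_simps)
      ultimately have "cone a b (insert g A) = 0" for g by simp
      then have "kd (insert i X) x (cone a b) A = 0"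
        unfolding kd_def by simp
      moreover have "kd X x b B = 0" using kd_closed[OF fX xc b] False by (auto simp: kos_simps)
      then have "cone (\<lambda>A. kd X x a A + x i * b A) (\<lambda>A. - kd X x b A) A = 0"
        unfolding cone_def using B by simp
      ultimately show ?thesis by simp
    qed
  qed
qed

lemma kos_i: "a \<in> carrier (kos X) \<Longrightarrow> i \<in> A \<Longrightarrow> a A = 0"
  using iX by (auto simp: kos_simps)

lemma kos_ideal_iff:
  assumes "a \<in> carrier (kos X)"
  shows "(\<forall>A. i \<notin> A \<longrightarrow> a A \<in> I) \<longleftrightarrow> (\<forall>A. a A \<in> I)"
  using kos_i[OF assms] idealE(1)[OF I] by metis

text \<open>Division by \<open>x i\<close> modulo \<open>I\<close>, chosen separately for each
  coefficient and set to zero outside the subsets of \<open>X\<close>.\<close>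

lemma extend_choose:
  assumes a: "a \<in> carrier (kos X)" and aI: "\<And>A. a A \<in> extend_ideal I (x i)"
  obtains e where "e \<in> carrier (kos X)" "\<And>A. a A - x i * e A \<in> I"
proof -
  have "\<exists>r\<in>carrier R. a A - x i * r \<in> I" for A
  proof -
    obtain u r where "a A = u + x i * r" "u \<in> I" "r \<in> carrier R"
      using aI[of A] unfolding extend_ideal_def by blast
    then show ?thesis by (intro bexI[of _ r]) simp_all
  qed
  then obtain f where f: "\<And>A. f A \<in> carrier R" "\<And>A. a A - x i * f A \<in> I" by metis
  let ?e = "\<lambda>A. if A \<subseteq> X then f A else 0"
  show ?thesis
  proof
    show "?e \<in> carrier (kos X)" using f by (auto simp: kos_simps R_closed)
    show "a A - x i * ?e A \<in> I" for A using f(2)[of A] a idealE(1)[OF I] by (auto simp: kos_simps)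
  qed
qed

text \<open>A cone \<open>(a, b)\<close> is a cycle if \<open>d a + x i b \<in> I\<close> and
  \<open>d b \<in> I\<close>; so \<open>a\<close> is a cycle modulo the extended ideal, and
  \<open>(a, b) \<mapsto> a\<close> is the comparison map. Conversely \<open>b\<close> is recovered
  as minus the quotient of \<open>d a\<close> by \<open>x i\<close>. That this quotient is again a
  cycle, and that \<open>a\<close> alone decides whether the pair bounds, holds because
  \<open>x i\<close> is a nonzerodivisor modulo \<open>I\<close>.\<close>

lemma kh_insert:
  assumes p: "covers R (HZ X x (extend_ideal I (x i))) M p (HB X x (extend_ideal I (x i)))"
  shows "covers R (HZ (insert i X) x I) M (\<lambda>z. p (\<lambda>A. if A \<subseteq> X then z A else 0)) (HB (insert i X) x I)"
proof -
  let ?J = "extend_ideal I (x i)"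
  have J: "ideal ?J R" by (rule extend_ideal_ideal(1)[OF I xi])
  have fX': "finite (insert i X)" using fX by simp
  have xc': "x \<in> insert i X \<rightarrow> carrier R" using xc xi by auto
  note W = HZ_module[OF fX' xc' I] and W' = HZ_module[OF fX xc J]
  let ?W = "HZ (insert i X) x I" and ?W' = "HZ X x ?J"
  let ?B = "HB (insert i X) x I" and ?B' = "HB X x ?J"
  define g where "g z A = (if A \<subseteq> X then z A else 0)" for z :: "'i set \<Rightarrow> 'r" and A
  have gcone: "g (cone a b) = a" if "a \<in> carrier (kos X)" for a b
    using that iX by (auto simp: g_def cone_def kos_simps fun_eq_iff)
  have HZc: "cone a b \<in> carrier ?W \<longleftrightarrow> (\<forall>A. kd X x a A + x i * b A \<in> I) \<and> (\<forall>A. kd X x b A \<in> I)"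
    if a: "a \<in> carrier (kos X)" and b: "b \<in> carrier (kos X)" for a b
  proof -
    have 1: "(\<lambda>A. kd X x a A + x i * b A) \<in> carrier (kos X)" "(\<lambda>A. - kd X x b A) \<in> carrier (kos X)"
      using kd_closed[OF fX xc a] kd_closed[OF fX xc b] b xi
      by (auto simp: kos_simps R_closed R_closed_minus)
    have "- r \<in> I \<longleftrightarrow> r \<in> I" for r
      using idealE(4)[OF I, of r] idealE(4)[OF I, of "- r"] by auto
    then have "(\<forall>A. - kd X x b A \<in> I) \<longleftrightarrow> (\<forall>A. kd X x b A \<in> I)" by simp
    then show ?thesis
      unfolding HZ_simps kd_cone[OF a b] cone_ideal_iff kos_ideal_iff[OF 1(1)] kos_ideal_iff[OF 1(2)]
      using cone_closed[OF a b] by simp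
  qed
  have g: "linear_map R ?W ?W' g"
  proof (rule linear_mapI)
    fix z assume z: "z \<in> carrier ?W"
    then obtain a b where ab: "a \<in> carrier (kos X)" "b \<in> carrier (kos X)" "z = cone a b"
      using cone_exists by (auto simp: HZ_simps)
    have "kd X x a A \<in> ?J" for A
    proof -
      have "kd X x a A + x i * b A \<in> I" using HZc[OF ab(1,2)] z[unfolded ab(3)] by blast
      moreover have "kd X x a A = (kd X x a A + x i * b A) + x i * (- b A)" by simp
      moreover have "- b A \<in> carrier R" using ab(2) by (simp add: kos_simps R_closed_minus)
      ultimately show ?thesis unfolding extend_ideal_def by blast
    qed
    then show "g z \<in> carrier ?W'" unfolding ab(3) gcone[OF ab(1)] using ab(1) by (simp add: HZ_simps)
  qed (auto simp: HZ_simps g_def)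
  have k: "g z \<in> ?B' \<longleftrightarrow> z \<in> ?B" if z: "z \<in> carrier ?W" for z
  proof -
    obtain a b where ab: "a \<in> carrier (kos X)" "b \<in> carrier (kos X)" "z = cone a b"
      using z cone_exists by (auto simp: HZ_simps)
    have zI: "kd X x a A + x i * b A \<in> I" for A using HZc[OF ab(1,2)] z[unfolded ab(3)] by blast
    have dec: "(\<forall>A. z A - kd (insert i X) x (cone c e) A \<in> I) \<longleftrightarrow>
      (\<forall>A. a A - kd X x c A - x i * e A \<in> I) \<and> (\<forall>A. b A + kd X x e A \<in> I)"
      if c: "c \<in> carrier (kos X)" and e: "e \<in> carrier (kos X)" for c e
    proof -
      have "(\<lambda>A. z A - kd (insert i X) x (cone c e) A)
        = cone (\<lambda>A. a A - kd X x c A - x i * e A) (\<lambda>A. b A + kd X x e A)"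
        unfolding ab(3) kd_cone[OF c e] by (auto simp: cone_def fun_eq_iff algebra_simps)
      then have "(\<forall>A. z A - kd (insert i X) x (cone c e) A \<in> I) \<longleftrightarrow>
         (\<forall>A. cone (\<lambda>A. a A - kd X x c A - x i * e A) (\<lambda>A. b A + kd X x e A) A \<in> I)"
        by (simp only: fun_eq_iff)
      moreover have "(\<lambda>A. a A - kd X x c A - x i * e A) \<in> carrier (kos X)" "(\<lambda>A. b A + kd X x e A) \<in> carrier (kos X)"
        using kd_closed[OF fX xc c] kd_closed[OF fX xc e] ab e xi
        by (auto simp: kos_simps R_closed R_closed_minus)
      ultimately show ?thesis unfolding cone_ideal_iff by (simp only: kos_ideal_iff)
    qed
    show ?thesis
    proof
      assume "g z \<in> ?B'"
      then obtain c where c: "c \<in> carrier (kos X)" "\<And>A. a A - kd X x c A \<in> ?J"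
        unfolding ab(3) gcone[OF ab(1)] HB_def by blast
      obtain e where e: "e \<in> carrier (kos X)" "\<And>A. (a A - kd X x c A) - x i * e A \<in> I"
        using extend_choose[OF kos_diff_closed[OF ab(1) kd_closed[OF fX xc c(1)]] c(2)] by blast
      \<comment> \<open>Applying the differential to \<open>a - d c - x i e \<in> I\<close> gives
        \<open>d a - x i d e \<in> I\<close>. Subtracted from the cycle condition this leaves
        \<open>x i (b + d e)\<close>, and \<open>x i\<close> cancels.\<close>
      have "b A + kd X x e A \<in> I" for A
      proof (rule reg)
        show "b A + kd X x e A \<in> carrier R"
          using ab(2) kd_closed[OF fX xc e(1)] by (auto simp: kos_simps R_closed)
        have "kd X x (\<lambda>A. (a A - kd X x c A) - x i * e A) A \<in> I" by (rule kd_ideal[OF fX xc I e(2)])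
        then have "kd X x a A - x i * kd X x e A \<in> I"
          by (simp add: kd_diff[OF fX xc] kd_smult[OF fX xc] kd_kd[OF fX xc c(1)])
        then have "(kd X x a A + x i * b A) - (kd X x a A - x i * kd X x e A) \<in> I"
          by (rule idealE(5)[OF I zI])
        then show "x i * (b A + kd X x e A) \<in> I" by (simp add: algebra_simps)
      qed
      then have "\<forall>A. z A - kd (insert i X) x (cone c e) A \<in> I" using dec[OF c(1) e(1)] e(2) by blast
      then show "z \<in> ?B" unfolding HB_def using cone_closed[OF c(1) e(1)] z by (auto simp: HZ_simps)
    next
      assume "z \<in> ?B"
      then obtain w where w: "w \<in> carrier (kos (insert i X))" "\<forall>A. z A - kd (insert i X) x w A \<in> I"
        unfolding HB_def by blast
      obtain c e where ce: "c \<in> carrier (kos X)" "e \<in> carrier (kos X)" "w = cone c e"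
        using cone_exists[OF w(1)] by blast
      have "a A - kd X x c A \<in> ?J" for A
      proof -
        have "a A - kd X x c A - x i * e A \<in> I" using dec[OF ce(1,2)] w(2) ce(3) by blast
        moreover have "a A - kd X x c A = (a A - kd X x c A - x i * e A) + x i * e A" by simp
        moreover have "e A \<in> carrier R" using ce(2) by (simp add: kos_simps)
        ultimately show ?thesis unfolding extend_ideal_def by blast
      qed
      then show "g z \<in> ?B'" unfolding ab(3) gcone[OF ab(1)] HB_def using ab(1) ce(1) by blast
    qed
  qed
  have s: "\<exists>w\<in>carrier ?W. v \<ominus>\<^bsub>?W'\<^esub> g w \<in> ?B'" if v: "v \<in> carrier ?W'" for v
  proof -
    have vk: "v \<in> carrier (kos X)" and vJ: "\<And>A. kd X x v A \<in> ?J" using v by (auto simp: HZ_simps)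
    obtain e where e: "e \<in> carrier (kos X)" "\<And>A. kd X x v A - x i * e A \<in> I"
      using extend_choose[OF kd_closed[OF fX xc vk] vJ] by blast
    \<comment> \<open>Minus the quotient, so that \<open>d v + x i b\<close> lies in
      \<open>I\<close>; applying the differential once more gives
      \<open>x i d b \<in> I\<close>.\<close>
    let ?b = "\<lambda>A. - e A"
    have b: "?b \<in> carrier (kos X)" using e(1) by (auto simp: kos_simps R_closed_minus)
    have vb: "kd X x v A + x i * ?b A \<in> I" for A using e(2)[of A] by simp
    have "kd X x ?b A \<in> I" for A
    proof (rule reg)
      show "kd X x ?b A \<in> carrier R" using kd_closed[OF fX xc b] by (auto simp: kos_simps)
      have "kd X x (\<lambda>A. kd X x v A + x i * ?b A) A \<in> I" by (rule kd_ideal[OF fX xc I vb])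
      then show "x i * kd X x ?b A \<in> I"
        using kd_kd[OF fX xc vk] by (simp only: kd_add[OF fX xc] kd_smult[OF fX xc] add_0)
    qed
    then have w: "cone v ?b \<in> carrier ?W" using HZc[OF vk b] vb by blast
    have "v \<ominus>\<^bsub>?W'\<^esub> g (cone v ?b) = \<zero>\<^bsub>?W'\<^esub>"
      unfolding gcone[OF vk] by (rule module.minus_eq_zero_iff[OF W' v v, THEN iffD2]) simp
    then show ?thesis using w HB_zero[OF fX xc J] by metis
  qed
  have "covers R ?W M (\<lambda>z. p (g z)) ?B"
    by (rule covers_pullback[OF W W' g p HB_zero[OF fX xc J] _ HB_subset[OF fX' xc' I]])
      (rule k, assumption, rule s, assumption)
  then show ?thesis unfolding g_def .
qed

end

section \<open>The Koszul complex degree by degree\<close>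

definition kosk :: "'i set \<Rightarrow> nat \<Rightarrow> ('r, 'i set \<Rightarrow> 'r) module"
  where "kosk X k = (kos X)\<lparr>carrier := {z \<in> carrier (kos X). \<forall>A. card A \<noteq> k \<longrightarrow> z A = 0}\<rparr>"

lemma kosk_simps:
  "z \<in> carrier (kosk X k) \<longleftrightarrow> z \<in> carrier (kos X) \<and> (\<forall>A. card A \<noteq> k \<longrightarrow> z A = 0)"
  "\<zero>\<^bsub>kosk X k\<^esub> = (\<lambda>_. 0)" "f \<oplus>\<^bsub>kosk X k\<^esub> g = (\<lambda>A. f A + g A)" "r \<odot>\<^bsub>kosk X k\<^esub> f = (\<lambda>A. r * f A)"
  unfolding kosk_def by (simp_all add: kos_simps)

lemma kosk_submodule: "submodule (carrier (kosk X k)) R (kos X)"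
  by (rule module.submoduleI'[OF kos_module]) (auto simp: kosk_simps kos_simps R_closed)

lemma kosk_module: "module R (kosk X k)"
  using submodule.submodule_is_module[OF kosk_submodule kos_module] by (simp add: kosk_def)

definition gr :: "nat \<Rightarrow> ('i set \<Rightarrow> 'r) \<Rightarrow> 'i set \<Rightarrow> 'r"
  where "gr k z A = (if card A = k then z A else 0)"

lemma gr_closed: "z \<in> carrier (kos X) \<Longrightarrow> gr k z \<in> carrier (kosk X k)"
  by (auto simp: kosk_simps kos_simps gr_def R_closed)

lemma gr_eq: "z \<in> carrier (kosk X k) \<Longrightarrow> gr k z = z"
  by (auto simp: kosk_simps gr_def fun_eq_iff)

lemma kd_gr:
  assumes fX: "finite X" and z: "z \<in> carrier (kos X)"
  shows "kd X x (gr (Suc k) z) = gr k (kd X x z)"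
proof
  fix A
  show "kd X x (gr (Suc k) z) A = gr k (kd X x z) A"
  proof (cases "A \<subseteq> X")
    case True
    then have "finite A" using rev_finite_subset[OF fX] by simp
    then have "gr (Suc k) z (insert g A) = (if card A = k then z (insert g A) else 0)" if "g \<in> X - A" for g
      using that by (simp add: gr_def)
    then show ?thesis by (simp add: kd_def gr_def[of k])
  next
    case False
    then have "z (insert g A) = 0" for g using z by (auto simp: kos_simps)
    then show ?thesis by (simp add: kd_def gr_def cong: if_cong)
  qed
qed

lemma kd_gr_0:
  assumes fX: "finite X" and z: "z \<in> carrier (kos X)"
  shows "kd X x (gr 0 z) = (\<lambda>_. 0)"
proof
  fix A
  have "gr 0 z (insert g A) = 0" for g
  proof (cases "insert g A \<subseteq> X")
    case True
    then have "finite (insert g A)" using rev_finite_subset[OF fX] by simp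
    then show ?thesis by (simp add: gr_def)
  next
    case False
    then show ?thesis using z by (simp add: kos_simps gr_def)
  qed
  then show "kd X x (gr 0 z) A = 0" by (simp add: kd_def)
qed

lemma kd_closed_kosk:
  assumes fX: "finite X" and xc: "x \<in> X \<rightarrow> carrier R" and z: "z \<in> carrier (kosk X (Suc k))"
  shows "kd X x z \<in> carrier (kosk X k)"
proof -
  have zk: "z \<in> carrier (kos X)" using z by (simp add: kosk_simps)
  have "kd X x z = gr k (kd X x z)" using kd_gr[OF fX zk, of x k] gr_eq[OF z] by simp
  then show ?thesis using gr_closed[OF kd_closed[OF fX xc zk], of k] by simp
qed

text \<open>Kernel of the reduction of degree \<open>k\<close> modulo \<open>I\<close>, in the role
  of \<open>B\<close> in \<open>homology_covers\<close>.\<close>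

definition kBk :: "'i set \<Rightarrow> 'r set \<Rightarrow> nat \<Rightarrow> ('i set \<Rightarrow> 'r) set"
  where "kBk X I k = {b \<in> carrier (kosk X k). \<forall>A. b A \<in> I}"

text \<open>The premise has the form of the conclusion of \<open>homology_covers\<close> for
  \<open>W = kosk X\<close> and \<open>B = kBk X I\<close>. A cycle is cut into its homogeneous
  components; they vanish above \<open>card X\<close>, which puts the family of their classes into
  the direct sum over all degrees.\<close>

lemma kh_total:
  fixes H :: "nat \<Rightarrow> ('r, 'm) module" and X :: "'i::linorder set"
  assumes fX: "finite X" and xc: "x \<in> X \<rightarrow> carrier R" and I: "ideal I R"
    and qex: "\<And>k. \<exists>q. covers R ((kosk X k)\<lparr>carrier := {w \<in> carrier (kosk X k). \<forall>j. k = Suc j \<longrightarrow> kd X x w \<in> kBk X I j}\<rparr>)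
      (H k) q {kd X x v \<oplus>\<^bsub>kosk X k\<^esub> b | v b. v \<in> carrier (kosk X (Suc k)) \<and> b \<in> kBk X I k}"
  shows "kh X x I (direct_sum UNIV H)"
proof -
  let ?Z = "\<lambda>k. (kosk X k)\<lparr>carrier := {w \<in> carrier (kosk X k). \<forall>j. k = Suc j \<longrightarrow> kd X x w \<in> kBk X I j}\<rparr>"
  let ?B = "\<lambda>k. {kd X x v \<oplus>\<^bsub>kosk X k\<^esub> b | v b. v \<in> carrier (kosk X (Suc k)) \<and> b \<in> kBk X I k}"
  have "\<exists>q. \<forall>k. covers R (?Z k) (H k) (q k) (?B k)" using qex by (intro choice allI)
  then obtain q where q: "\<forall>k. covers R (?Z k) (H k) (q k) (?B k)" by (rule exE)
  note q' = coversD'[OF spec[OF q]]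
  note ql = linear_mapD[OF q'(1)]
  define p where "p z k = q k (gr k z)" for z k
  have zB: "(\<lambda>_. 0) \<in> ?B k" for k
  proof -
    have "(\<lambda>_. 0) \<in> carrier (kosk X (Suc k)) \<and> (\<lambda>_. 0) \<in> kBk X I k \<and>
      (\<lambda>_. 0) = kd X x (\<lambda>_. 0) \<oplus>\<^bsub>kosk X k\<^esub> (\<lambda>_. 0)"
      by (simp add: kBk_def kosk_simps kos_simps R_closed idealE(1)[OF I] kd_zero[OF fX xc])
    then show ?thesis by blast
  qed
  have zZ: "(\<lambda>_. 0) \<in> carrier (?Z k)" for k
    by (simp add: kBk_def kosk_simps kos_simps R_closed idealE(1)[OF I] kd_zero[OF fX xc])
  have q0: "q k (\<lambda>_. 0) = \<zero>\<^bsub>H k\<^esub>" for k using q'(3)[OF zZ] zB by blast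
  have grZ: "gr k z \<in> carrier (?Z k)" if z: "z \<in> carrier (HZ X x I)" for k z
  proof -
    have zk: "z \<in> carrier (kos X)" "\<And>A. kd X x z A \<in> I" using z by (auto simp: HZ_simps)
    have "gr j (kd X x z) \<in> kBk X I j" for j
      unfolding kBk_def using gr_closed[OF kd_closed[OF fX xc zk(1)], of j] zk(2) idealE(1)[OF I]
      by (auto simp: gr_def)
    then show ?thesis using gr_closed[OF zk(1), of k] by (auto simp: kd_gr[OF fX zk(1)])
  qed
  have gr0: "gr k z = (\<lambda>_. 0)" if "k > card X" "z \<in> carrier (kos X)" for k z
  proof
    fix A
    have "card A \<noteq> k" if "A \<subseteq> X" using card_mono[OF fX that] \<open>k > card X\<close> by simp
    then show "gr k z A = 0" using that(2) by (auto simp: gr_def kos_simps)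
  qed
  have pc: "p z \<in> carrier (direct_sum UNIV H)" if z: "z \<in> carrier (HZ X x I)" for z
  proof (rule direct_sum_carrierI)
    show "p z k \<in> carrier (H k)" for k unfolding p_def by (rule ql(1)[OF grZ[OF z]])
    have "p z k = \<zero>\<^bsub>H k\<^esub>" if "k > card X" for k
      unfolding p_def using gr0[OF that] z q0 by (simp add: HZ_simps)
    then have "{k \<in> UNIV. p z k \<noteq> \<zero>\<^bsub>H k\<^esub>} \<subseteq> {..card X}" by (auto simp: not_less[symmetric])
    then show "finite {k \<in> UNIV. p z k \<noteq> \<zero>\<^bsub>H k\<^esub>}" by (rule finite_subset) simp
  qed simp
  have lin: "linear_map R (HZ X x I) (direct_sum UNIV H) p"
  proof (rule linear_mapI)
    fix z z' assume z: "z \<in> carrier (HZ X x I)" and z': "z' \<in> carrier (HZ X x I)"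
    have "p (z \<oplus>\<^bsub>HZ X x I\<^esub> z') k = p z k \<oplus>\<^bsub>H k\<^esub> p z' k" for k
    proof -
      have "gr k (z \<oplus>\<^bsub>HZ X x I\<^esub> z') = gr k z \<oplus>\<^bsub>?Z k\<^esub> gr k z'" by (auto simp: HZ_simps kosk_simps gr_def)
      then show ?thesis unfolding p_def by (simp only: ql(2)[OF grZ[OF z] grZ[OF z']])
    qed
    then show "p (z \<oplus>\<^bsub>HZ X x I\<^esub> z') = p z \<oplus>\<^bsub>direct_sum UNIV H\<^esub> p z'"
      by (simp add: direct_sum_simps fun_eq_iff)
  next
    fix r z assume r: "r \<in> carrier R" and z: "z \<in> carrier (HZ X x I)"
    have "p (r \<odot>\<^bsub>HZ X x I\<^esub> z) k = r \<odot>\<^bsub>H k\<^esub> p z k" for k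
    proof -
      have "gr k (r \<odot>\<^bsub>HZ X x I\<^esub> z) = r \<odot>\<^bsub>?Z k\<^esub> gr k z" by (auto simp: HZ_simps kosk_simps gr_def)
      then show ?thesis unfolding p_def by (simp only: ql(3)[OF r grZ[OF z]])
    qed
    then show "p (r \<odot>\<^bsub>HZ X x I\<^esub> z) = r \<odot>\<^bsub>direct_sum UNIV H\<^esub> p z"
      by (simp add: direct_sum_simps fun_eq_iff)
  qed (rule pc)
  \<comment> \<open>A family with one element in each degree is glued to a single function, whose
    coefficient at \<open>A\<close> is taken from degree \<open>card A\<close>.\<close>
  have asm: "(\<lambda>A. if A \<subseteq> X then y (card A) A else 0) \<in> carrier (kos X) \<and>
     (\<forall>k. gr k (\<lambda>A. if A \<subseteq> X then y (card A) A else 0) = y k)"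
    if "\<And>k. y k \<in> carrier (kosk X k)" for y
    using that unfolding kosk_simps kos_simps gr_def fun_eq_iff by (auto simp: R_closed)
  have surj: "p ` carrier (HZ X x I) = carrier (direct_sum UNIV H)"
  proof (intro subset_antisym subsetI)
    fix m assume m: "m \<in> carrier (direct_sum UNIV H)"
    have "\<exists>w. w \<in> carrier (?Z k) \<and> q k w = m k" for k
    proof -
      have mk: "m k \<in> carrier (H k)" by (rule direct_sum_carrierD(1)[OF m UNIV_I])
      obtain w where "w \<in> carrier (?Z k)" "q k w = m k" by (rule bexE[OF q'(5)[OF mk]])
      then show ?thesis by (intro exI[of _ w] conjI)
    qed
    then have "\<exists>y. \<forall>k. y k \<in> carrier (?Z k) \<and> q k (y k) = m k" by (intro choice allI)
    then obtain y where yy: "\<forall>k. y k \<in> carrier (?Z k) \<and> q k (y k) = m k" by (rule exE)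
    have y: "y k \<in> carrier (?Z k)" "q k (y k) = m k" for k
      by (rule conjunct1[OF spec[OF yy]], rule conjunct2[OF spec[OF yy]])
    define z where "z A = (if A \<subseteq> X then y (card A) A else 0)" for A
    have yk: "y k \<in> carrier (kosk X k)" for k using y(1)[of k] by simp
    have z: "z \<in> carrier (kos X)" "\<And>k. gr k z = y k" using asm[OF yk] unfolding z_def by simp_all
    have "kd X x z A \<in> I" for A
    proof -
      have "kd X x z A = gr (card A) (kd X x z) A" by (simp add: gr_def)
      also have "\<dots> = kd X x (y (Suc (card A))) A" using kd_gr[OF fX z(1), of x "card A"] z(2) by simp
      also have "\<dots> \<in> I" using y(1)[of "Suc (card A)"] by (simp add: kBk_def)
      finally show ?thesis .
    qed
    then have "z \<in> carrier (HZ X x I)" using z by (simp add: HZ_simps)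
    moreover have "p z = m" unfolding p_def z(2) y(2) ..
    ultimately show "m \<in> p ` carrier (HZ X x I)" by blast
  qed (use pc in blast)
  have ker: "p z = \<zero>\<^bsub>direct_sum UNIV H\<^esub> \<longleftrightarrow> z \<in> HB X x I" if z: "z \<in> carrier (HZ X x I)" for z
  proof -
    have zk: "z \<in> carrier (kos X)" using z by (simp add: HZ_simps)
    have "p z = \<zero>\<^bsub>direct_sum UNIV H\<^esub> \<longleftrightarrow> (\<forall>k. p z k = \<zero>\<^bsub>H k\<^esub>)"
      by (auto simp: direct_sum_simps fun_eq_iff)
    also have "\<dots> \<longleftrightarrow> (\<forall>k. gr k z \<in> ?B k)" unfolding p_def by (simp only: q'(3)[OF grZ[OF z]])
    also have "\<dots> \<longleftrightarrow> z \<in> HB X x I"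
    proof
      assume "\<forall>k. gr k z \<in> ?B k"
      then have "\<forall>k. \<exists>v b. gr k z = (\<lambda>A. kd X x v A + b A) \<and> v \<in> carrier (kosk X (Suc k)) \<and> b \<in> kBk X I k"
        unfolding kosk_simps(3) by blast
      then obtain v b where v: "\<And>k. gr k z = (\<lambda>A. kd X x (v k) A + b k A)"
        "\<And>k. v k \<in> carrier (kosk X (Suc k))" "\<And>k. b k \<in> kBk X I k"
        unfolding choice_iff by blast
      \<comment> \<open>\<open>v k\<close> has degree \<open>Suc k\<close>, so the family is shifted
        by one to be indexed by degree; degree 0, which no \<open>v\<close> reaches, is filled with
        zero.\<close>
      define y where "y k = (case k of 0 \<Rightarrow> (\<lambda>_. 0) | Suc j \<Rightarrow> v j)" for k
      have yk: "y k \<in> carrier (kosk X k)" for k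
        unfolding y_def using v(2) by (cases k) (auto simp: kosk_simps kos_simps R_closed)
      define w where "w A = (if A \<subseteq> X then y (card A) A else 0)" for A
      have w: "w \<in> carrier (kos X)" "\<And>k. gr k w = y k" using asm[OF yk] unfolding w_def by simp_all
      have "z A - kd X x w A \<in> I" for A
      proof -
        let ?k = "card A"
        have "kd X x w A = gr ?k (kd X x w) A" by (simp add: gr_def)
        also have "\<dots> = kd X x (v ?k) A" using kd_gr[OF fX w(1), of x ?k] w(2)[of "Suc ?k"] by (simp add: y_def)
        finally have "z A - kd X x w A = b ?k A" using fun_cong[OF v(1)[of ?k], of A] by (simp add: gr_def)
        then show ?thesis using v(3)[of ?k] by (simp add: kBk_def)
      qed
      then show "z \<in> HB X x I" unfolding HB_def using zk w(1) by blast
    next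
      assume "z \<in> HB X x I"
      then obtain w where w: "w \<in> carrier (kos X)" "\<And>A. z A - kd X x w A \<in> I" unfolding HB_def by blast
      show "\<forall>k. gr k z \<in> ?B k"
      proof
        fix k
        let ?b = "gr k (\<lambda>A. z A - kd X x w A)"
        have "?b \<in> carrier (kosk X k)" by (rule gr_closed[OF kos_diff_closed[OF zk kd_closed[OF fX xc w(1)]]])
        then have "?b \<in> kBk X I k" unfolding kBk_def using w(2) idealE(1)[OF I] by (auto simp: gr_def)
        moreover have "gr (Suc k) w \<in> carrier (kosk X (Suc k))" by (rule gr_closed[OF w(1)])
        moreover have "gr k z = kd X x (gr (Suc k) w) \<oplus>\<^bsub>kosk X k\<^esub> ?b"
          unfolding kd_gr[OF fX w(1)] kosk_simps by (auto simp: gr_def)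
        ultimately show "gr k z \<in> ?B k" by blast
      qed
    qed
    finally show ?thesis .
  qed
  have "covers R (HZ X x I) (direct_sum UNIV H) p (HB X x I)"
    unfolding covers_def using lin surj ker HB_subset[OF fX xc I] by blast
  then show ?thesis unfolding kh_def by blast
qed

section \<open>Moving several entries at once\<close>

lemma genideal_insert:
  assumes A: "A \<subseteq> carrier R" and y: "y \<in> carrier R"
  shows "Idl (insert y A) = extend_ideal (Idl A) y"
proof
  have A': "insert y A \<subseteq> carrier R" using A y by simp
  note I = genideal_ideal[OF A] and I' = genideal_ideal[OF A']
  note e = extend_ideal_ideal[OF I y]
  show "Idl (insert y A) \<subseteq> extend_ideal (Idl A) y"
    by (rule genideal_minimal[OF e(1)]) (use e(2,3) genideal_self[OF A] in blast)
  have 1: "Idl A \<subseteq> Idl (insert y A)"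
    by (rule genideal_minimal[OF I']) (use genideal_self[OF A'] in blast)
  have 2: "y \<in> Idl (insert y A)" using genideal_self[OF A'] by blast
  show "extend_ideal (Idl A) y \<subseteq> Idl (insert y A)"
  proof
    fix a assume "a \<in> extend_ideal (Idl A) y"
    then obtain i r where ir: "a = i + y * r" "i \<in> Idl A" "r \<in> carrier R" unfolding extend_ideal_def by blast
    show "a \<in> Idl (insert y A)"
      unfolding ir(1) by (rule idealE(2)[OF I' subsetD[OF 1 ir(2)] idealE(7)[OF I' ir(3) 2]])
  qed
qed

lemma genideal_empty: "Idl {} = {0}"
proof
  show "Idl {} \<subseteq> {0}" by (rule genideal_minimal[OF zero_ideal]) simp
  show "{0} \<subseteq> Idl {}" using idealE(1)[OF genideal_ideal[of "{}"]] by simp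
qed

text \<open>\<open>kh_insert\<close> for one element of \<open>Y\<close> after the other, with the
  ideal growing accordingly. The induction takes the elements in an unknown order, so regularity is
  asked over every subset \<open>Z\<close>. The covering map is kept explicit because the
  augmentation of the Koszul resolution is obtained from it.\<close>

lemma kh_union:
  fixes X Y :: "'i::linorder set"
  assumes Y: "finite Y" and X: "finite X" and XY: "X \<inter> Y = {}"
    and B: "B \<subseteq> carrier R" and x: "x \<in> X \<union> Y \<rightarrow> carrier R"
    and reg: "\<And>Z i a. Z \<subseteq> Y \<Longrightarrow> i \<in> Y - Z \<Longrightarrow> a \<in> carrier R \<Longrightarrow>
      x i * a \<in> Idl (B \<union> x ` Z) \<Longrightarrow> a \<in> Idl (B \<union> x ` Z)"
    and p: "covers R (HZ X x (Idl (B \<union> x ` Y))) M p (HB X x (Idl (B \<union> x ` Y)))"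
  shows "covers R (HZ (X \<union> Y) x (Idl B)) M (\<lambda>z. p (\<lambda>A. if A \<subseteq> X then z A else 0)) (HB (X \<union> Y) x (Idl B))"
  using Y XY B x reg p
proof (induction Y arbitrary: B rule: finite_induct)
  case empty
  have W: "module R (HZ X x (Idl B))" by (rule HZ_module[OF X _ genideal_ideal]) (use empty in auto)
  have e: "(\<lambda>A. if A \<subseteq> X then z A else 0) = z" if "z \<in> carrier (HZ X x (Idl B))" for z
    using that by (auto simp: HZ_simps kos_simps fun_eq_iff)
  show ?case using covers_cong[OF W, of M p] empty(5) e by simp
next
  case (insert i Y)
  have xi: "x i \<in> carrier R" using insert.prems by auto
  have XY: "finite (X \<union> Y)" "x \<in> X \<union> Y \<rightarrow> carrier R" "i \<notin> X \<union> Y" using X insert by auto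
  have r: "a \<in> Idl B" if "a \<in> carrier R" "x i * a \<in> Idl B" for a
    using insert.prems(4)[of "{}" i a] that by simp
  have s: "insert (x i) B \<union> x ` Z = B \<union> x ` insert i Z" for Z by auto
  let ?q = "\<lambda>z. p (\<lambda>A. if A \<subseteq> X then z A else 0)"
  have "covers R (HZ (X \<union> Y) x (Idl (insert (x i) B))) M ?q (HB (X \<union> Y) x (Idl (insert (x i) B)))"
  proof (rule insert.IH)
    fix Z j a assume "Z \<subseteq> Y" "j \<in> Y - Z" "a \<in> carrier R" "x j * a \<in> Idl (insert (x i) B \<union> x ` Z)"
    then show "a \<in> Idl (insert (x i) B \<union> x ` Z)"
      unfolding s using insert.prems(4)[of "insert i Z" j a] insert.hyps by auto
  qed (use insert.prems xi in \<open>simp_all only: s, auto\<close>)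
  note c = this[unfolded genideal_insert[OF insert.prems(2) xi]]
  have "covers R (HZ (insert i (X \<union> Y)) x (Idl B)) M (\<lambda>z. ?q (\<lambda>A. if A \<subseteq> X \<union> Y then z A else 0))
    (HB (insert i (X \<union> Y)) x (Idl B))"
    by (rule kh_insert[OF XY(1,2) genideal_ideal[OF insert.prems(2)] XY(3) xi _ c]) (rule r)
  moreover have "(\<lambda>A. if A \<subseteq> X then if A \<subseteq> X \<union> Y then z A else 0 else 0) = (\<lambda>A. if A \<subseteq> X then z A else 0)"
    for z :: "'i set \<Rightarrow> 'r" by (auto simp: fun_eq_iff)
  ultimately show ?case by simp
qed

text \<open>\<open>kh_union\<close> turns a cover for the short sequence into one for the long
  sequence. For the other direction it is applied to the quotient of \<open>HZ\<close> by
  \<open>HB\<close>, and the given module is compared with this quotient.\<close>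

lemma kh_union_iff:
  fixes X Y :: "'i::linorder set"
  assumes Y: "finite Y" and X: "finite X" and XY: "X \<inter> Y = {}"
    and B: "B \<subseteq> carrier R" and x: "x \<in> X \<union> Y \<rightarrow> carrier R"
    and reg: "\<And>Z i a. Z \<subseteq> Y \<Longrightarrow> i \<in> Y - Z \<Longrightarrow> a \<in> carrier R \<Longrightarrow>
      x i * a \<in> Idl (B \<union> x ` Z) \<Longrightarrow> a \<in> Idl (B \<union> x ` Z)"
  shows "kh (X \<union> Y) x (Idl B) M \<longleftrightarrow> kh X x (Idl (B \<union> x ` Y)) M"
proof
  let ?I = "Idl B" and ?J = "Idl (B \<union> x ` Y)"
  have I: "ideal ?I R" "ideal ?J R" by (rule genideal_ideal; use B x in auto)+
  have x': "x \<in> X \<rightarrow> carrier R" and f: "finite (X \<union> Y)" using x X Y by auto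
  note u = kh_union[OF Y X XY B x reg]
  have q: "covers R (HZ X x ?J) (quotient_module (HZ X x ?J) (HB X x ?J)) (\<lambda>z. HB X x ?J +>\<^bsub>HZ X x ?J\<^esub> z) (HB X x ?J)"
    by (rule covers_quotient[OF HZ_module[OF X x' I(2)] HB_submodule[OF X x' I(2)]])
  assume "kh (X \<union> Y) x ?I M"
  then obtain p where p: "covers R (HZ (X \<union> Y) x ?I) M p (HB (X \<union> Y) x ?I)" unfolding kh_def by blast
  show "kh X x ?J M"
    unfolding kh_def by (rule covers_transfer[OF HZ_module[OF f x I(1)] HB_zero[OF f x I(1)] p u[OF _ _ _ _ q] q])
next
  assume "kh X x (Idl (B \<union> x ` Y)) M"
  then obtain p where p: "covers R (HZ X x (Idl (B \<union> x ` Y))) M p (HB X x (Idl (B \<union> x ` Y)))" unfolding kh_def by blast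
  show "kh (X \<union> Y) x (Idl B) M"
    unfolding kh_def by (rule exI, rule kh_union[OF Y X XY B x _ p]) (rule reg)
qed

end

section \<open>Tensor products of two-step complexes\<close>

lemma finite_multidegrees: "finite (multidegrees n k)"
proof (rule finite_subset)
  show "multidegrees n k \<subseteq> {ks. set ks \<subseteq> {..k} \<and> length ks = n}"
    unfolding multidegrees_def using member_le_sum_list by fastforce
  show "finite {ks. set ks \<subseteq> {..k} \<and> length ks = n}" by (rule finite_lists_length_eq) simp
qed

lemma multidegrees_suc:
  assumes "ks \<in> multidegrees n k" "i < n"
  shows "ks[i := Suc (ks ! i)] \<in> multidegrees n (Suc k)"
  using assms unfolding multidegrees_def by (auto simp: sum_list_update)

text \<open>In a tensor product of two-step complexes only multidegrees with entries 0 and 1 carry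
  anything. They correspond to subsets of the positions, that is, to the wedge basis of the Koszul
  complex; \<open>indicator_list\<close> is the inverse.\<close>

definition ones :: "nat list \<Rightarrow> nat set"
  where "ones ks = {i. i < length ks \<and> ks ! i = 1}"

definition indicator_list :: "nat \<Rightarrow> nat set \<Rightarrow> nat list"
  where "indicator_list n A = map (\<lambda>i. if i \<in> A then 1 else 0) [0..<n]"

text \<open>The left side is the exponent of the sign in \<open>tensor_complex\<close>, the right
  side the exponent in \<open>ksgn\<close>.\<close>

lemma sum_list_take_ones:
  "(\<And>i. i < length ks \<Longrightarrow> ks ! i \<le> 1) \<Longrightarrow> i \<le> length ks \<Longrightarrow> sum_list (take i ks) = card {h \<in> ones ks. h < i}"
proof (induction i)
  case 0
  then show ?case by simp
next
  case (Suc i)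
  have "{h \<in> ones ks. h < Suc i} = (if ks ! i = 1 then insert i {h \<in> ones ks. h < i} else {h \<in> ones ks. h < i})"
    using Suc.prems(2) by (auto simp: ones_def less_Suc_eq)
  moreover have "ks ! i \<le> 1" using Suc.prems by simp
  then have "ks ! i = 0 \<or> ks ! i = 1" by linarith
  ultimately show ?case using Suc by (auto simp: take_Suc_conv_app_nth)
qed

lemma sum_list_ones:
  assumes "\<And>i. i < length ks \<Longrightarrow> ks ! i \<le> 1"
  shows "sum_list ks = card (ones ks)"
proof -
  have "{h \<in> ones ks. h < length ks} = ones ks" by (auto simp: ones_def)
  then show ?thesis using sum_list_take_ones[OF assms, of "length ks"] by simp
qed

lemma indicator_list_simps:
  "length (indicator_list n A) = n" "i < n \<Longrightarrow> indicator_list n A ! i = (if i \<in> A then 1 else 0)"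
  by (simp_all add: indicator_list_def)

lemma ones_indicator_list: "A \<subseteq> {..<n} \<Longrightarrow> ones (indicator_list n A) = A"
  by (auto simp: ones_def indicator_list_simps split: if_splits)

lemma indicator_list_ones:
  assumes "\<And>i. i < length ks \<Longrightarrow> ks ! i \<le> 1"
  shows "indicator_list (length ks) (ones ks) = ks"
proof (rule nth_equalityI)
  fix i assume "i < length (indicator_list (length ks) (ones ks))"
  then have i: "i < length ks" by (simp add: indicator_list_simps)
  then have "ks ! i = 0 \<or> ks ! i = 1" using assms[OF i] by linarith
  then show "indicator_list (length ks) (ones ks) ! i = ks ! i"
    using i by (auto simp: indicator_list_simps ones_def)
qed (simp add: indicator_list_simps)

lemma indicator_list_multidegree:
  assumes "A \<subseteq> {..<n}"
  shows "indicator_list n A \<in> multidegrees n (card A)"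
proof -
  have "sum_list (indicator_list n A) = card (ones (indicator_list n A))"
    by (rule sum_list_ones) (simp add: indicator_list_simps)
  then show ?thesis unfolding multidegrees_def by (simp add: ones_indicator_list[OF assms] indicator_list_simps)
qed

text \<open>One summand of the differential of a tensor product of complexes. Multilinearity in slot
  \<open>i\<close> comes from \<open>f\<close>, in the other slots from the target, whose factors
  there are those of the source.\<close>

lemma (in cring) tensor_list_partial_map:
  assumes M: "\<And>M. M \<in> set Ms \<Longrightarrow> module R M" and M': "\<And>M. M \<in> set Ms' \<Longrightarrow> module R M"
    and len: "length Ms' = length Ms" and i: "i < length Ms"
    and eq: "\<And>j. j < length Ms \<Longrightarrow> j \<noteq> i \<Longrightarrow> Ms' ! j = Ms ! j"
    and f: "linear_map R (Ms' ! i) (Ms ! i) f"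
  shows "linear_map R (tensor_list R Ms') (tensor_list R Ms)
      (presented_map R (tensor_list_gens Ms') (tensor_list R Ms) (\<lambda>xs. pure_tensor_list R Ms (xs[i := f (xs ! i)])))"
    and "\<And>xs. xs \<in> tensor_list_gens Ms' \<Longrightarrow>
      presented_map R (tensor_list_gens Ms') (tensor_list R Ms) (\<lambda>xs. pure_tensor_list R Ms (xs[i := f (xs ! i)]))
        (pure_tensor_list R Ms' xs) = pure_tensor_list R Ms (xs[i := f (xs ! i)])"
proof -
  have g: "xs[i := f (xs ! i)] \<in> tensor_list_gens Ms" if xs: "xs \<in> tensor_list_gens Ms'" for xs
  proof -
    have "xs[i := f (xs ! i)] ! j \<in> carrier (Ms ! j)" if "j < length Ms" for j
      using xs that eq[OF that] len i linear_map_closed[OF f] unfolding tensor_list_gens_def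
      by (cases "j = i") (auto simp: nth_list_update)
    then show ?thesis using xs len unfolding tensor_list_gens_def by simp
  qed
  have len': "length xs = length Ms'" if "xs \<in> tensor_list_gens Ms'" for xs
    using that unfolding tensor_list_gens_def by simp
  let ?\<phi> = "\<lambda>xs. pure_tensor_list R Ms (xs[i := f (xs ! i)])"
  have up: "(xs[j := y])[i := f ((xs[j := y]) ! i)] = (if j = i then (xs[i := f (xs ! i)])[i := f y] else (xs[i := f (xs ! i)])[j := y])"
    if "xs \<in> tensor_list_gens Ms'" for xs j y
    using len'[OF that] len i by (auto simp: list_update_swap)
  have a: "?\<phi> (xs[j := x \<oplus>\<^bsub>Ms' ! j\<^esub> y]) = ?\<phi> (xs[j := x]) \<oplus>\<^bsub>tensor_list R Ms\<^esub> ?\<phi> (xs[j := y])"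
    if xs: "xs \<in> tensor_list_gens Ms'" and j: "j < length Ms'" and x: "x \<in> carrier (Ms' ! j)" and y: "y \<in> carrier (Ms' ! j)" for xs j x y
  proof (cases "j = i")
    case True
    then show ?thesis unfolding up[OF xs] using pure_tensor_list_add[OF M g[OF xs] i] x y linear_mapD[OF f] by simp
  next
    case False
    then show ?thesis unfolding up[OF xs] using pure_tensor_list_add[OF M g[OF xs], of j x y] x y j eq len by simp
  qed
  have s: "?\<phi> (xs[j := r \<odot>\<^bsub>Ms' ! j\<^esub> x]) = r \<odot>\<^bsub>tensor_list R Ms\<^esub> ?\<phi> (xs[j := x])"
    if r: "r \<in> carrier R" and xs: "xs \<in> tensor_list_gens Ms'" and j: "j < length Ms'" and x: "x \<in> carrier (Ms' ! j)" for r xs j x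
  proof (cases "j = i")
    case True
    then show ?thesis unfolding up[OF xs] using pure_tensor_list_smult[OF M r g[OF xs] i] x linear_mapD[OF f] r by simp
  next
    case False
    then show ?thesis unfolding up[OF xs] using pure_tensor_list_smult[OF M r g[OF xs], of j x] x j eq len by simp
  qed
  have c: "?\<phi> xs \<in> carrier (tensor_list R Ms)" if "xs \<in> tensor_list_gens Ms'" for xs
    by (rule pure_tensor_list_closed[OF M g[OF that]])
  show "linear_map R (tensor_list R Ms') (tensor_list R Ms) (presented_map R (tensor_list_gens Ms') (tensor_list R Ms) ?\<phi>)"
    by (rule tensor_list_lift(1)[OF M' tensor_list_module[OF M]]; (assumption | rule a s c; assumption))
  show "presented_map R (tensor_list_gens Ms') (tensor_list R Ms) ?\<phi> (pure_tensor_list R Ms' xs) = ?\<phi> xs"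
    if "xs \<in> tensor_list_gens Ms'" for xs
    by (rule tensor_list_lift(2)[OF M' tensor_list_module[OF M] _ _ _ that]; (assumption | rule a s c; assumption))
qed

lemma linear_map_two_step:
  assumes M: "module R M" and r: "r \<in> carrier R"
  shows "linear_map R (obj (two_step_complex M r) (Suc k)) (obj (two_step_complex M r) k) (bd (two_step_complex M r) k)"
proof -
  interpret M: module R M by fact
  have "r \<odot>\<^bsub>M\<^esub> (s \<odot>\<^bsub>M\<^esub> x) = s \<odot>\<^bsub>M\<^esub> (r \<odot>\<^bsub>M\<^esub> x)" if "s \<in> carrier R" "x \<in> carrier M" for s x
    using that r by (simp add: M.smult_assoc1[symmetric] M.m_comm)
  then show ?thesis
    by (intro linear_mapI) (auto simp: two_step_complex_def zero_submodule_def r M.smult_r_distr split: if_splits)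
qed

lemma two_step_module:
  assumes M: "module R M"
  shows "module R (obj (two_step_complex M r) k)"
  using M submodule.submodule_is_module[OF module.submodule_zero_set[OF M] M]
  by (simp add: two_step_complex_def zero_submodule_def)

context concrete_ring
begin

lemma ideal_submodule: "ideal I R \<Longrightarrow> submodule I R (regular_module R)"
  by (rule module.submoduleI'[OF regular_module_module])
    (auto simp: regular_module_simps ops idealE)

lemma regular_minus:
  assumes "x \<in> carrier R" "y \<in> carrier R"
  shows "x \<ominus>\<^bsub>regular_module R\<^esub> y = x - y"
proof -
  interpret M: module R "regular_module R" by (rule regular_module_module)
  have "(\<ominus>\<^bsub>regular_module R\<^esub> y) + y = 0"
    using M.l_neg[of y] assms by (simp add: regular_module_simps ops)
  then have "\<ominus>\<^bsub>regular_module R\<^esub> y = - y" by (simp add: eq_neg_iff_add_eq_0)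
  then show ?thesis by (simp add: a_minus_def regular_module_simps ops)
qed

lemma regular_finsum:
  assumes "finite A" "f \<in> A \<rightarrow> carrier R"
  shows "(\<Oplus>\<^bsub>regular_module R\<^esub>i\<in>A. f i) = sum f A"
proof -
  interpret M: module R "regular_module R" by (rule regular_module_module)
  show ?thesis using assms
    by (induction A rule: finite_induct) (auto simp: regular_module_simps ops Pi_iff)
qed

section \<open>Tensor powers of \<open>R / I\<close>\<close>

context
  fixes I :: "'r set"
  assumes I: "ideal I R"
begin

definition cyc :: "('r, 'r set) module" where "cyc = quotient_module (regular_module R) I"

definition cls :: "'r \<Rightarrow> 'r set" where "cls r = I +>\<^bsub>regular_module R\<^esub> r"

lemma cls_covers: "covers R (regular_module R) cyc cls I"
  using covers_quotient[OF regular_module_module ideal_submodule[OF I]]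
  unfolding cyc_def cls_def .

lemma cyc_module: "module R cyc"
  unfolding cyc_def by (rule quotient_module_module[OF regular_module_module ideal_submodule[OF I]])

lemma cls_closed: "r \<in> carrier R \<Longrightarrow> cls r \<in> carrier cyc"
  using linear_map_closed[OF coversD'(1)[OF cls_covers]] by (simp add: regular_module_simps)

lemma cls_add: "r \<in> carrier R \<Longrightarrow> s \<in> carrier R \<Longrightarrow> cls (r + s) = cls r \<oplus>\<^bsub>cyc\<^esub> cls s"
  using linear_map_add[OF coversD'(1)[OF cls_covers]] by (simp add: regular_module_simps ops)

lemma cls_mult: "r \<in> carrier R \<Longrightarrow> s \<in> carrier R \<Longrightarrow> cls (r * s) = r \<odot>\<^bsub>cyc\<^esub> cls s"
  using linear_map_smult[OF coversD'(1)[OF cls_covers]] by (simp add: regular_module_simps ops)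

lemma cls_eq_iff: "r \<in> carrier R \<Longrightarrow> s \<in> carrier R \<Longrightarrow> cls r = cls s \<longleftrightarrow> r - s \<in> I"
  using covers_eq_iff[OF regular_module_module cls_covers] idealE(1)[OF I]
  by (simp add: regular_module_simps ops regular_minus)

lemma cls_zero_iff: "r \<in> carrier R \<Longrightarrow> cls r = \<zero>\<^bsub>cyc\<^esub> \<longleftrightarrow> r \<in> I"
  using coversD'(3)[OF cls_covers] by (simp add: regular_module_simps)

lemma cls_one_smult: "r \<in> carrier R \<Longrightarrow> cls r = r \<odot>\<^bsub>cyc\<^esub> cls 1"
  using cls_mult[of r 1] by (simp add: R_closed)

definition rep :: "'r set \<Rightarrow> 'r" where "rep x = (SOME r. r \<in> carrier R \<and> cls r = x)"

lemma rep:
  assumes "x \<in> carrier cyc"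
  shows "rep x \<in> carrier R" "cls (rep x) = x"
proof -
  have "\<exists>r. r \<in> carrier R \<and> cls r = x"
    using coversD'(5)[OF cls_covers assms] by (simp add: regular_module_simps Bex_def)
  then have "rep x \<in> carrier R \<and> cls (rep x) = x" unfolding rep_def by (rule someI_ex)
  then show "rep x \<in> carrier R" "cls (rep x) = x" by auto
qed

abbreviation one_tensor :: "nat \<Rightarrow> ('r set list \<Rightarrow> 'r) set"
  where "one_tensor n \<equiv> pure_tensor_list R (replicate n cyc) (replicate n (cls 1))"

lemma cyc_list: "M \<in> set (replicate n cyc) \<Longrightarrow> module R M"
  using cyc_module by simp

lemma ones_gens: "replicate n (cls 1) \<in> tensor_list_gens (replicate n cyc)"
  unfolding tensor_list_gens_def by (simp add: cls_closed R_closed)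

lemma pure_tensor_cyc:
  assumes xs: "xs \<in> tensor_list_gens (replicate n cyc)"
  shows "\<exists>r\<in>carrier R. pure_tensor_list R (replicate n cyc) xs = r \<odot>\<^bsub>tensor_list R (replicate n cyc)\<^esub> one_tensor n"
proof -
  let ?Ms = "replicate n cyc"
  interpret T: module R "tensor_list R ?Ms" by (rule tensor_list_module[OF cyc_list])
  note g = tensor_list_gens_update[OF cyc_list]
  have xsn: "length xs = n" "\<And>j. j < n \<Longrightarrow> xs ! j \<in> carrier cyc" using xs by (auto simp: tensor_list_gens_def)
  have oc: "one_tensor n \<in> carrier (tensor_list R ?Ms)" by (rule pure_tensor_list_closed[OF cyc_list ones_gens])
  \<comment> \<open>Induction on the number \<open>i\<close> of slots that hold the entries of
    \<open>xs\<close>, the remaining ones holding the class of 1. Each new entry is a multiple of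
    that class, and the factor is pulled out.\<close>
  have "\<exists>r\<in>carrier R. pure_tensor_list R ?Ms (take i xs @ replicate (n - i) (cls 1)) = r \<odot>\<^bsub>tensor_list R ?Ms\<^esub> one_tensor n"
    if "i \<le> n" for i using that
  proof (induction i)
    case 0
    show ?case by (rule bexI[of _ 1]) (use T.smult_one[OF oc] in \<open>simp_all add: ops R_closed\<close>)
  next
    case (Suc i)
    then obtain r where r: "r \<in> carrier R"
      "pure_tensor_list R ?Ms (take i xs @ replicate (n - i) (cls 1)) = r \<odot>\<^bsub>tensor_list R ?Ms\<^esub> one_tensor n" by auto
    let ?ys = "take i xs @ replicate (n - i) (cls 1)"
    let ?s = "rep (xs ! i)"
    have i: "i < n" using Suc by simp
    note s = rep[OF xsn(2)[OF i]]
    have ys: "?ys \<in> tensor_list_gens ?Ms"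
      using xsn i by (auto simp: tensor_list_gens_def nth_append cls_closed R_closed)
    have u: "(take i xs @ replicate (n - i) (cls 1))[i := y] = take i xs @ y # replicate (n - Suc i) (cls 1)" for y
    proof -
      have "n - i = Suc (n - Suc i)" using i by simp
      then show ?thesis using xsn i by (simp add: list_update_append)
    qed
    have "take (Suc i) xs @ replicate (n - Suc i) (cls 1) = ?ys[i := ?s \<odot>\<^bsub>?Ms ! i\<^esub> cls 1]"
      unfolding u using i xsn s cls_one_smult[OF s(1)] by (simp add: take_Suc_conv_app_nth)
    also have "pure_tensor_list R ?Ms \<dots> = ?s \<odot>\<^bsub>tensor_list R ?Ms\<^esub> pure_tensor_list R ?Ms (?ys[i := cls 1])"
      by (rule pure_tensor_list_smult[OF cyc_list s(1) ys]) (use i in \<open>auto simp: cls_closed R_closed\<close>)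
    also have "?ys[i := cls 1] = ?ys" by (rule list_update_same_conv[THEN iffD2]) (use i xsn in \<open>auto simp: nth_append\<close>)
    finally have "pure_tensor_list R ?Ms (take (Suc i) xs @ replicate (n - Suc i) (cls 1)) = (?s * r) \<odot>\<^bsub>tensor_list R ?Ms\<^esub> one_tensor n"
      unfolding r(2) using T.smult_assoc1[OF s(1) r(1) oc] by (simp add: ops)
    then show ?case using s(1) r(1) R_closed by blast
  qed
  from this[of n] show ?thesis using xsn by simp
qed

text \<open>Over \<open>R\<close> the tensor powers of \<open>R / I\<close> collapse to
  \<open>R / I\<close>, multiplication being inverse to
  \<open>r \<mapsto> r (1 \<otimes> ... \<otimes> 1)\<close>. The empty tensor product is
  \<open>R\<close>, so for \<open>n = 0\<close>, a diagram without crossings, the ideal has to be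
  zero.\<close>

lemma tensor_list_cyc_covers:
  assumes n0: "n = 0 \<Longrightarrow> I = {0}"
  shows "covers R (regular_module R) (tensor_list R (replicate n cyc))
    (\<lambda>r. r \<odot>\<^bsub>tensor_list R (replicate n cyc)\<^esub> one_tensor n) I"
proof -
  let ?Ms = "replicate n cyc"
  let ?T = "tensor_list R ?Ms"
  interpret C: module R cyc by (rule cyc_module)
  interpret T: module R ?T by (rule tensor_list_module[OF cyc_list])
  have oc: "one_tensor n \<in> carrier ?T" by (rule pure_tensor_list_closed[OF cyc_list ones_gens])
  let ?p = "\<lambda>r. r \<odot>\<^bsub>?T\<^esub> one_tensor n"
  have lin: "linear_map R (regular_module R) ?T ?p"
    by (rule linear_mapI) (use oc in \<open>auto simp: regular_module_simps T.smult_l_distr T.smult_assoc1\<close>)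
  have im: "?p ` carrier R = carrier ?T"
  proof (rule tensor_list_generated[OF cyc_list])
    interpret RT: module_pair R "regular_module R" ?T
      by (rule module_pair.intro) (rule regular_module_module T.module_axioms')+
    show "submodule (?p ` carrier R) R ?T"
      using RT.submodule_image[OF lin RT.M.carrier_is_submodule] by (simp add: regular_module_simps)
    show "pure_tensor_list R ?Ms xs \<in> ?p ` carrier R" if xs: "xs \<in> tensor_list_gens ?Ms" for xs
      using pure_tensor_cyc[OF xs] by blast
  qed
  \<comment> \<open>The multiplication map. Elements of \<open>cyc\<close> are cosets, so
    representatives are multiplied; \<open>ccl\<close> shows that the class of the product is
    independent of them.\<close>
  define \<phi> where "\<phi> xs = cls (\<Prod>j<n. rep (xs ! j))" for xs
  have pc: "(\<Prod>j\<in>J. f j) \<in> carrier R" if "\<And>j. j \<in> J \<Longrightarrow> f j \<in> carrier R" for J :: "nat set" and f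
    using that by (induction J rule: infinite_finite_induct) (auto simp: R_closed)
  have gensD: "length xs = n" "\<And>j. j < n \<Longrightarrow> rep (xs ! j) \<in> carrier R" if "xs \<in> tensor_list_gens ?Ms" for xs
    using that rep by (auto simp: tensor_list_gens_def)
  have upd: "\<phi> (xs[i := x]) = cls (rep x * (\<Prod>j\<in>{..<n} - {i}. rep (xs ! j)))"
    "(\<Prod>j\<in>{..<n} - {i}. rep (xs ! j)) \<in> carrier R"
    if xs: "xs \<in> tensor_list_gens ?Ms" and i: "i < n" for xs i x
  proof -
    have "(\<Prod>j<n. rep (xs[i := x] ! j)) = rep (xs[i := x] ! i) * (\<Prod>j\<in>{..<n} - {i}. rep (xs[i := x] ! j))"
      by (rule prod.remove) (use i in auto)
    also have "(\<Prod>j\<in>{..<n} - {i}. rep (xs[i := x] ! j)) = (\<Prod>j\<in>{..<n} - {i}. rep (xs ! j))"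
      by (rule prod.cong) auto
    finally show "\<phi> (xs[i := x]) = cls (rep x * (\<Prod>j\<in>{..<n} - {i}. rep (xs ! j)))"
      unfolding \<phi>_def using gensD(1)[OF xs] i by simp
    show "(\<Prod>j\<in>{..<n} - {i}. rep (xs ! j)) \<in> carrier R" by (rule pc) (use gensD(2)[OF xs] in auto)
  qed
  have ccl: "cls (a * P) = cls (b * P)" if "cls a = cls b" "a \<in> carrier R" "b \<in> carrier R" "P \<in> carrier R" for a b P
    using that cls_mult[of P a] cls_mult[of P b] by (simp add: mult.commute)
  have \<phi>c: "\<phi> xs \<in> carrier cyc" if "xs \<in> tensor_list_gens ?Ms" for xs
    unfolding \<phi>_def by (intro cls_closed pc) (use gensD[OF that] in auto)
  have \<phi>a: "\<phi> (xs[i := x \<oplus>\<^bsub>?Ms ! i\<^esub> y]) = \<phi> (xs[i := x]) \<oplus>\<^bsub>cyc\<^esub> \<phi> (xs[i := y])"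
    if "xs \<in> tensor_list_gens ?Ms" "i < length ?Ms" "x \<in> carrier (?Ms ! i)" "y \<in> carrier (?Ms ! i)" for xs i x y
  proof -
    from that have xs: "xs \<in> tensor_list_gens ?Ms" and i: "i < n" and x: "x \<in> carrier cyc" and y: "y \<in> carrier cyc"
      by auto
    let ?P = "\<Prod>j\<in>{..<n} - {i}. rep (xs ! j)"
    note r = rep[OF x] rep[OF y] rep[OF C.a_closed[OF x y]]
    have "cls (rep (x \<oplus>\<^bsub>cyc\<^esub> y)) = cls (rep x + rep y)" using r cls_add by simp
    then have "cls (rep (x \<oplus>\<^bsub>cyc\<^esub> y) * ?P) = cls ((rep x + rep y) * ?P)"
      by (rule ccl) (use r upd(2)[OF xs i] R_closed in auto)
    also have "\<dots> = cls (rep x * ?P) \<oplus>\<^bsub>cyc\<^esub> cls (rep y * ?P)"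
      unfolding distrib_right by (rule cls_add) (use r upd(2)[OF xs i] R_closed in auto)
    finally show "\<phi> (xs[i := x \<oplus>\<^bsub>?Ms ! i\<^esub> y]) = \<phi> (xs[i := x]) \<oplus>\<^bsub>cyc\<^esub> \<phi> (xs[i := y])"
      unfolding upd(1)[OF xs i] using i by simp
  qed
  have \<phi>s: "\<phi> (xs[i := a \<odot>\<^bsub>?Ms ! i\<^esub> x]) = a \<odot>\<^bsub>cyc\<^esub> \<phi> (xs[i := x])"
    if "a \<in> carrier R" "xs \<in> tensor_list_gens ?Ms" "i < length ?Ms" "x \<in> carrier (?Ms ! i)" for a xs i x
  proof -
    from that have a: "a \<in> carrier R" and xs: "xs \<in> tensor_list_gens ?Ms" and i: "i < n" and x: "x \<in> carrier cyc"
      by auto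
    let ?P = "\<Prod>j\<in>{..<n} - {i}. rep (xs ! j)"
    note r = rep[OF x] rep[OF C.smult_closed[OF a x]]
    have "cls (rep (a \<odot>\<^bsub>cyc\<^esub> x)) = cls (a * rep x)" using r cls_mult a by simp
    then have "cls (rep (a \<odot>\<^bsub>cyc\<^esub> x) * ?P) = cls ((a * rep x) * ?P)"
      by (rule ccl) (use r a upd(2)[OF xs i] R_closed in auto)
    also have "\<dots> = a \<odot>\<^bsub>cyc\<^esub> cls (rep x * ?P)"
      unfolding mult.assoc by (rule cls_mult) (use r a upd(2)[OF xs i] R_closed in auto)
    finally show "\<phi> (xs[i := a \<odot>\<^bsub>?Ms ! i\<^esub> x]) = a \<odot>\<^bsub>cyc\<^esub> \<phi> (xs[i := x])"
      unfolding upd(1)[OF xs i] using i by simp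
  qed
  define h where "h = presented_map R (tensor_list_gens ?Ms) cyc \<phi>"
  have h: "linear_map R ?T cyc h" "\<And>xs. xs \<in> tensor_list_gens ?Ms \<Longrightarrow> h (pure_tensor_list R ?Ms xs) = \<phi> xs"
    unfolding h_def by (rule tensor_list_lift[OF cyc_list cyc_module]; (assumption | rule \<phi>c \<phi>a \<phi>s; assumption))+
  have "\<phi> (replicate n (cls 1)) = cls 1"
  proof -
    have r1: "rep (cls 1) \<in> carrier R" "cls (rep (cls 1)) = cls 1" using rep[OF cls_closed[OF R_closed(2)]] by auto
    have "cls (rep (cls 1) ^ m) = cls 1 \<and> rep (cls 1) ^ m \<in> carrier R" for m
    proof (induction m)
      case (Suc m)
      then have "cls (rep (cls 1) ^ Suc m) = cls (1 * rep (cls 1) ^ m)"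
        using ccl[OF r1(2) r1(1) R_closed(2), of "rep (cls 1) ^ m"] by simp
      then show ?case using Suc r1 R_closed by simp
    qed (simp add: R_closed)
    then show ?thesis unfolding \<phi>_def by simp
  qed
  then have h1: "h (one_tensor n) = cls 1" using h(2)[OF ones_gens] by simp
  have k1: "r \<in> I" if r: "r \<in> carrier R" and z: "?p r = \<zero>\<^bsub>?T\<^esub>" for r
  proof -
    interpret TC: module_pair R ?T cyc by (rule module_pair.intro) (rule T.module_axioms' cyc_module)+
    have "h (?p r) = cls r" using linear_map_smult[OF h(1) r oc] h1 cls_one_smult[OF r] by simp
    then show ?thesis using z TC.linear_map_zero[OF h(1)] cls_zero_iff[OF r] by simp
  qed
  \<comment> \<open>A factor from \<open>I\<close> is moved into slot 0, where it kills the class of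
    1. For \<open>n = 0\<close> there is no slot, and \<open>n0\<close> makes the factor
    zero.\<close>
  have k2: "?p r = \<zero>\<^bsub>?T\<^esub>" if r: "r \<in> I" for r
  proof (cases "n = 0")
    case True
    then have "r = \<zero>" using n0 r by (simp add: ops)
    then show ?thesis using T.smult_l_null[OF oc] by simp
  next
    case False
    have rc: "r \<in> carrier R" using idealE(3)[OF I] r .
    have cl: "module R M" if "M \<in> set ?Ms" for M using cyc_list that .
    let ?xs = "replicate n (cls 1)"
    have n: "0 < length ?Ms" and c1: "cls 1 \<in> carrier (?Ms ! 0)" and xs0: "?xs[0 := cls 1] = ?xs"
      using False by (auto simp: cls_closed R_closed list_update_same_conv)
    have "r \<odot>\<^bsub>?Ms ! 0\<^esub> cls 1 = \<zero> \<odot>\<^bsub>?Ms ! 0\<^esub> cls 1"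
      using False cls_one_smult[OF rc] cls_zero_iff[OF rc] r C.smult_l_null[OF cls_closed[OF R_closed(2)]] by simp
    then have "r \<odot>\<^bsub>?T\<^esub> pure_tensor_list R ?Ms (?xs[0 := cls 1]) = \<zero> \<odot>\<^bsub>?T\<^esub> pure_tensor_list R ?Ms (?xs[0 := cls 1])"
      using pure_tensor_list_smult[of ?Ms, OF cl rc ones_gens n c1]
        pure_tensor_list_smult[of ?Ms, OF cl zero_closed ones_gens n c1]
      by simp
    then show ?thesis unfolding xs0 using T.smult_l_null[OF oc] by simp
  qed
  show ?thesis unfolding covers_def
  proof (intro conjI)
    show "?p ` carrier (regular_module R) = carrier ?T" using im by (simp add: regular_module_simps)
    show "I = {w \<in> carrier (regular_module R). ?p w = \<zero>\<^bsub>?T\<^esub>}"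
      using k1 k2 idealE(3)[OF I] by (auto simp: regular_module_simps)
  qed (rule lin)
qed

section \<open>The tensor product of two-step complexes as a Koszul complex\<close>

context
  fixes n :: nat and q :: "nat \<Rightarrow> 'r"
  assumes q: "q \<in> {..<n} \<rightarrow> carrier R" and n0: "n = 0 \<Longrightarrow> I = {0}"
begin

definition steps :: "('r, 'r set) chain_complex list"
  where "steps = map (\<lambda>t. two_step_complex cyc (q t)) [0..<n]"

abbreviation summands :: "nat list \<Rightarrow> ('r, 'r set) module list"
  where "summands ks \<equiv> tensor_summand steps ks"

lemma steps_simps: "length steps = n" "t < n \<Longrightarrow> steps ! t = two_step_complex cyc (q t)"
  by (simp_all add: steps_def)

lemma summands_simps:
  assumes "length ks = n"
  shows "length (summands ks) = n" "i < n \<Longrightarrow> summands ks ! i = (if ks ! i \<le> 1 then cyc else zero_submodule cyc)"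
  using assms by (simp_all add: tensor_summand_def steps_simps two_step_complex_def)

lemma summands_obj:
  "length ks = n \<Longrightarrow> i < n \<Longrightarrow> summands ks ! i = obj (two_step_complex cyc (q i)) (ks ! i)"
  by (simp add: tensor_summand_def steps_simps)

lemma summands_module:
  assumes "length ks = n" "M \<in> set (summands ks)"
  shows "module R M"
proof -
  obtain i where "i < n" "M = summands ks ! i"
    using assms(2) unfolding in_set_conv_nth summands_simps(1)[OF assms(1)] by blast
  then show ?thesis using summands_obj[OF assms(1)] two_step_module[OF cyc_module] by simp
qed

lemma summands_small:
  assumes "length ks = n" "\<And>i. i < n \<Longrightarrow> ks ! i \<le> 1"
  shows "summands ks = replicate n cyc"
  by (rule nth_equalityI) (use assms in \<open>auto simp: summands_simps\<close>)

text \<open>A zero factor makes every pure tensor a zero multiple of itself.\<close>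

lemma summands_large:
  assumes ks: "length ks = n" and i: "i < n" "\<not> ks ! i \<le> 1"
  shows "carrier (tensor_list R (summands ks)) = {\<zero>\<^bsub>tensor_list R (summands ks)\<^esub>}"
proof -
  let ?T = "tensor_list R (summands ks)"
  note M = summands_module[OF ks]
  interpret T: module R ?T by (rule tensor_list_module[OF M])
  have "{\<zero>\<^bsub>?T\<^esub>} = carrier ?T"
  proof (rule tensor_list_generated[OF M])
    fix xs assume xs: "xs \<in> tensor_list_gens (summands ks)"
    have i': "i < length (summands ks)" using i ks by (simp add: summands_simps)
    have x: "xs ! i \<in> carrier (summands ks ! i)" using xs i' by (simp add: tensor_list_gens_def)
    interpret Mi: module R "summands ks ! i" by (rule M) (use i' in simp)
    have "carrier (summands ks ! i) = {\<zero>\<^bsub>summands ks ! i\<^esub>}"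
      using i ks by (simp add: summands_simps zero_submodule_def)
    then have "\<zero> \<odot>\<^bsub>summands ks ! i\<^esub> (xs ! i) = xs ! i" using Mi.smult_l_null[OF x] x by simp
    then have "pure_tensor_list R (summands ks) (xs[i := xs ! i]) = \<zero> \<odot>\<^bsub>?T\<^esub> pure_tensor_list R (summands ks) (xs[i := xs ! i])"
      using pure_tensor_list_smult[of "summands ks", OF M zero_closed xs i' x] by simp
    also have "\<dots> = \<zero>\<^bsub>?T\<^esub>"
      by (rule T.smult_l_null) (simp add: pure_tensor_list_closed[of "summands ks", OF M xs])
    finally show "pure_tensor_list R (summands ks) xs \<in> {\<zero>\<^bsub>?T\<^esub>}" by simp
  qed (assumption | rule T.submodule_zero_set)+
  then show ?thesis by simp
qed

text \<open>Sends the coefficient at a subset of the positions to that multiple of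
  \<open>1 \<otimes> ... \<otimes> 1\<close> in the summand with the corresponding multidegree; the
  remaining summands are zero modules.\<close>

definition step_cover :: "nat \<Rightarrow> (nat set \<Rightarrow> 'r) \<Rightarrow> nat list \<Rightarrow> ('r set list \<Rightarrow> 'r) set"
  where "step_cover k z = (\<lambda>ks\<in>multidegrees n k. if \<forall>i<n. ks ! i \<le> 1
    then z (ones ks) \<odot>\<^bsub>tensor_list R (summands ks)\<^esub> one_tensor n else \<zero>\<^bsub>tensor_list R (summands ks)\<^esub>)"

abbreviation "TC \<equiv> tensor_complex R steps"

lemma TC_obj: "obj TC k = direct_sum (multidegrees n k) (\<lambda>ks. tensor_list R (summands ks))"
  by (simp add: tensor_complex_def steps_simps)

lemma multidegreesD: "ks \<in> multidegrees n k \<Longrightarrow> length ks = n" "ks \<in> multidegrees n k \<Longrightarrow> sum_list ks = k"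
  by (simp_all add: multidegrees_def)

lemma T_module: "ks \<in> multidegrees n k \<Longrightarrow> module R (tensor_list R (summands ks))"
  by (rule tensor_list_module[OF summands_module[OF multidegreesD(1)]])

lemma T_covers:
  assumes ks: "ks \<in> multidegrees n k" and s: "\<forall>i<n. ks ! i \<le> 1"
  shows "covers R (regular_module R) (tensor_list R (summands ks)) (\<lambda>r. r \<odot>\<^bsub>tensor_list R (summands ks)\<^esub> one_tensor n) I"
proof -
  have "summands ks = replicate n cyc" by (rule summands_small) (use multidegreesD[OF ks] s in auto)
  then show ?thesis using tensor_list_cyc_covers[OF n0] by simp
qed

lemma step_cover_closed:
  assumes z: "z \<in> carrier (kosk {..<n} k)"
  shows "step_cover k z \<in> carrier (obj TC k)"
  unfolding TC_obj
proof (rule direct_sum_carrierI)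
  fix ks assume ks: "ks \<in> multidegrees n k"
  interpret T: module R "tensor_list R (summands ks)" by (rule T_module[OF ks])
  have "z A \<in> carrier R" for A using z by (simp add: kosk_simps kos_simps)
  then show "step_cover k z ks \<in> carrier (tensor_list R (summands ks))"
    using linear_map_closed[OF coversD'(1)[OF T_covers[OF ks]]] ks
    by (simp add: step_cover_def regular_module_simps)
qed (auto simp: step_cover_def finite_multidegrees)

lemma step_covers: "covers R (kosk {..<n} k) (obj TC k) (step_cover k) (kBk {..<n} I k)"
proof -
  let ?D = "multidegrees n k"
  let ?T = "\<lambda>ks. tensor_list R (summands ks)"
  have zR: "z A \<in> carrier R" if "z \<in> carrier (kosk {..<n} k)" for z A
    using that by (simp add: kosk_simps kos_simps)
  have lin: "linear_map R (kosk {..<n} k) (obj TC k) (step_cover k)"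
  proof (rule linear_mapI)
    show "step_cover k z \<in> carrier (obj TC k)" if "z \<in> carrier (kosk {..<n} k)" for z
      by (rule step_cover_closed[OF that])
  next
    fix z z' assume z: "z \<in> carrier (kosk {..<n} k)" and z': "z' \<in> carrier (kosk {..<n} k)"
    have "step_cover k (z \<oplus>\<^bsub>kosk {..<n} k\<^esub> z') ks = step_cover k z ks \<oplus>\<^bsub>?T ks\<^esub> step_cover k z' ks" if ks: "ks \<in> ?D" for ks
    proof -
      interpret T: module R "?T ks" by (rule T_module[OF ks])
      show ?thesis
      proof (cases "\<forall>i<n. ks ! i \<le> 1")
        case True
        then show ?thesis
          using linear_map_add[OF coversD'(1)[OF T_covers[OF ks True]], of "z (ones ks)" "z' (ones ks)"] ks zR z z'
          by (simp add: step_cover_def regular_module_simps ops kosk_simps)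
      qed (use ks in \<open>auto simp: step_cover_def\<close>)
    qed
    then show "step_cover k (z \<oplus>\<^bsub>kosk {..<n} k\<^esub> z') = step_cover k z \<oplus>\<^bsub>obj TC k\<^esub> step_cover k z'"
      unfolding TC_obj direct_sum_simps by (intro extensionalityI[of _ ?D]) (auto simp: step_cover_def)
  next
    fix r z assume r: "r \<in> carrier R" and z: "z \<in> carrier (kosk {..<n} k)"
    have "step_cover k (r \<odot>\<^bsub>kosk {..<n} k\<^esub> z) ks = r \<odot>\<^bsub>?T ks\<^esub> step_cover k z ks" if ks: "ks \<in> ?D" for ks
    proof -
      interpret T: module R "?T ks" by (rule T_module[OF ks])
      show ?thesis
      proof (cases "\<forall>i<n. ks ! i \<le> 1")
        case True
        then show ?thesis
          using linear_map_smult[OF coversD'(1)[OF T_covers[OF ks True]], of r "z (ones ks)"] ks zR z r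
          by (simp add: step_cover_def regular_module_simps ops kosk_simps)
      qed (use ks r in \<open>auto simp: step_cover_def\<close>)
    qed
    then show "step_cover k (r \<odot>\<^bsub>kosk {..<n} k\<^esub> z) = r \<odot>\<^bsub>obj TC k\<^esub> step_cover k z"
      unfolding TC_obj direct_sum_simps by (intro extensionalityI[of _ ?D]) (auto simp: step_cover_def)
  qed
  have surj: "\<exists>z\<in>carrier (kosk {..<n} k). step_cover k z = m" if m: "m \<in> carrier (obj TC k)" for m
  proof -
    note m' = direct_sum_carrierD[OF m[unfolded TC_obj]]
    have "\<exists>r. r \<in> carrier R \<and> (ks \<in> ?D \<and> (\<forall>i<n. ks ! i \<le> 1) \<longrightarrow> r \<odot>\<^bsub>?T ks\<^esub> one_tensor n = m ks)" for ks
    proof (cases "ks \<in> ?D \<and> (\<forall>i<n. ks ! i \<le> 1)")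
      case True
      then show ?thesis
        using coversD'(5)[OF T_covers[OF conjunct1[OF True] conjunct2[OF True]] m'(1)[OF conjunct1[OF True]]]
        by (simp add: regular_module_simps Bex_def)
    qed (use R_closed in auto)
    then obtain f where f: "\<And>ks. f ks \<in> carrier R"
      "\<And>ks. ks \<in> ?D \<Longrightarrow> \<forall>i<n. ks ! i \<le> 1 \<Longrightarrow> f ks \<odot>\<^bsub>?T ks\<^esub> one_tensor n = m ks" by metis
    let ?z = "\<lambda>A. if A \<subseteq> {..<n} \<and> card A = k then f (indicator_list n A) else 0"
    have z: "?z \<in> carrier (kosk {..<n} k)" by (auto simp: kosk_simps kos_simps f R_closed)
    have "step_cover k ?z ks = m ks" if ks: "ks \<in> ?D" for ks
    proof (cases "\<forall>i<n. ks ! i \<le> 1")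
      case True
      note l = multidegreesD[OF ks]
      have "card (ones ks) = k" using sum_list_ones[of ks] True l by simp
      moreover have "indicator_list n (ones ks) = ks" using indicator_list_ones[of ks] True l by simp
      moreover have "ones ks \<subseteq> {..<n}" using l by (auto simp: ones_def)
      ultimately show ?thesis using True ks f(2) by (simp add: step_cover_def)
    next
      case False
      then obtain i where "i < n" "\<not> ks ! i \<le> 1" by blast
      then show ?thesis using summands_large[OF multidegreesD(1)[OF ks]] m'(1)[OF ks] False ks
        by (auto simp: step_cover_def)
    qed
    then have "step_cover k ?z = m"
      by (intro extensionalityI[of _ ?D]) (auto simp: step_cover_def m'(4))
    then show ?thesis using z by blast
  qed
  have ker: "step_cover k z = \<zero>\<^bsub>obj TC k\<^esub> \<longleftrightarrow> z \<in> kBk {..<n} I k" if z: "z \<in> carrier (kosk {..<n} k)" for z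
  proof -
    have "step_cover k z = \<zero>\<^bsub>obj TC k\<^esub> \<longleftrightarrow> (\<forall>ks\<in>?D. step_cover k z ks = \<zero>\<^bsub>?T ks\<^esub>)"
      unfolding TC_obj direct_sum_simps
      by (auto simp: fun_eq_iff step_cover_def restrict_def)
    also have "\<dots> \<longleftrightarrow> (\<forall>ks\<in>?D. (\<forall>i<n. ks ! i \<le> 1) \<longrightarrow> z (ones ks) \<in> I)"
    proof (rule ball_cong[OF refl])
      fix ks assume ks: "ks \<in> ?D"
      show "step_cover k z ks = \<zero>\<^bsub>?T ks\<^esub> \<longleftrightarrow> ((\<forall>i<n. ks ! i \<le> 1) \<longrightarrow> z (ones ks) \<in> I)"
      proof (cases "\<forall>i<n. ks ! i \<le> 1")
        case True
        then show ?thesis using coversD'(3)[OF T_covers[OF ks True], of "z (ones ks)"] zR[OF z] ks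
          by (simp add: step_cover_def regular_module_simps)
      qed (use ks in \<open>auto simp: step_cover_def\<close>)
    qed
    also have "\<dots> \<longleftrightarrow> (\<forall>A. z A \<in> I)"
    proof (intro iffI allI ballI impI)
      fix A assume *: "\<forall>ks\<in>?D. (\<forall>i<n. ks ! i \<le> 1) \<longrightarrow> z (ones ks) \<in> I"
      show "z A \<in> I"
      proof (cases "A \<subseteq> {..<n} \<and> card A = k")
        case True
        then have "indicator_list n A \<in> ?D" using indicator_list_multidegree by blast
        then have "z (ones (indicator_list n A)) \<in> I" using * by (simp add: indicator_list_simps)
        then show ?thesis using ones_indicator_list True by simp
      next
        case False
        then have "z A = 0" using z by (auto simp: kosk_simps kos_simps)
        then show ?thesis using idealE(1)[OF I] by simp
      qed
    qed simp
    finally show ?thesis using z by (simp add: kBk_def)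
  qed
  have "step_cover k ` carrier (kosk {..<n} k) = carrier (obj TC k)"
    using surj step_cover_closed by (intro subset_antisym subsetI) auto
  then show ?thesis unfolding covers_def using lin ker by (auto simp: kBk_def)
qed

text \<open>If the raised multidegree still has entries at most 1, then slot \<open>i\<close> had
  degree 0, where the differential of the two-step complex multiplies by \<open>q i\<close>.\<close>

lemma partial_bd:
  assumes ks: "ks \<in> multidegrees n k" and i: "i < n"
  shows "linear_map R (tensor_list R (summands (ks[i := Suc (ks ! i)]))) (tensor_list R (summands ks)) (tensor_partial_bd R steps ks i)"
    and "\<forall>j<n. (ks[i := Suc (ks ! i)]) ! j \<le> 1 \<Longrightarrow>
      tensor_partial_bd R steps ks i (one_tensor n) = q i \<odot>\<^bsub>tensor_list R (summands ks)\<^esub> one_tensor n"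
proof -
  note l = multidegreesD(1)[OF ks]
  let ?ks' = "ks[i := Suc (ks ! i)]"
  have l': "length ?ks' = n" using l by simp
  have qi: "q i \<in> carrier R" using q i by auto
  have f: "linear_map R (summands ?ks' ! i) (summands ks ! i) (bd (steps ! i) (ks ! i))"
    using linear_map_two_step[OF cyc_module qi] i l by (simp add: summands_obj[OF l i] summands_obj[OF l' i] steps_simps)
  have eq: "summands ?ks' ! j = summands ks ! j" if "j < length (summands ks)" "j \<noteq> i" for j
    using that l l' by (simp add: summands_simps)
  have len: "length (summands ?ks') = length (summands ks)" and i': "i < length (summands ks)"
    using l l' i by (simp_all add: summands_simps)
  note pm = tensor_list_partial_map[OF summands_module[OF l] summands_module[OF l'] len i' eq f]
  show "linear_map R (tensor_list R (summands ?ks')) (tensor_list R (summands ks)) (tensor_partial_bd R steps ks i)"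
    unfolding tensor_partial_bd_def by (rule pm(1))
  assume s: "\<forall>j<n. ?ks' ! j \<le> 1"
  then have k0: "ks ! i = 0" using i l by fastforce
  have s': "\<forall>j<n. ks ! j \<le> 1"
  proof (intro allI impI)
    fix j assume "j < n"
    then show "ks ! j \<le> 1" using s[rule_format, of j] k0 i l by (cases "j = i") auto
  qed
  have S: "summands ks = replicate n cyc" "summands ?ks' = replicate n cyc"
    by (rule summands_small; use s s' l l' in auto)+
  let ?xs = "replicate n (cls 1)"
  have "tensor_partial_bd R steps ks i (one_tensor n) = pure_tensor_list R (summands ks) (?xs[i := bd (steps ! i) (ks ! i) (?xs ! i)])"
    unfolding tensor_partial_bd_def S(2)[symmetric] by (rule pm(2); (assumption | simp only: S(2) ones_gens))
  also have "bd (steps ! i) (ks ! i) (?xs ! i) = q i \<odot>\<^bsub>replicate n cyc ! i\<^esub> cls 1"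
    using k0 i by (simp add: steps_simps two_step_complex_def)
  also have "pure_tensor_list R (summands ks) (?xs[i := q i \<odot>\<^bsub>replicate n cyc ! i\<^esub> cls 1])
     = q i \<odot>\<^bsub>tensor_list R (replicate n cyc)\<^esub> pure_tensor_list R (replicate n cyc) (?xs[i := cls 1])"
    unfolding S(1) by (rule pure_tensor_list_smult[OF cyc_list qi ones_gens]) (use i in \<open>auto simp: cls_closed R_closed\<close>)
  also have "?xs[i := cls 1] = ?xs" by (rule list_update_same_conv[THEN iffD2]) (use i in auto)
  finally show "tensor_partial_bd R steps ks i (one_tensor n) = q i \<odot>\<^bsub>tensor_list R (summands ks)\<^esub> one_tensor n"
    unfolding S .
qed

lemma minus_one_power: "(\<ominus> \<one>) [^] (m::nat) = (-1) ^ m"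
  by (induction m) (simp_all add: ops R_a_inv[OF R_closed(2)] nat_pow_def)

text \<open>Slots already in degree 1 contribute nothing, since their term would come from degree 2.
  The remaining slots contribute the summands of \<open>kd\<close>, and
  \<open>sum_list_take_ones\<close> matches the signs.\<close>

lemma step_cover_bd:
  assumes z: "z \<in> carrier (kosk {..<n} (Suc k))"
  shows "bd TC k (step_cover (Suc k) z) = step_cover k (kd {..<n} q z)"
proof (rule extensionalityI[of _ "multidegrees n k"])
  show "bd TC k (step_cover (Suc k) z) \<in> extensional (multidegrees n k)"
    by (simp add: tensor_complex_def steps_simps)
  show "step_cover k (kd {..<n} q z) \<in> extensional (multidegrees n k)"
    by (simp add: step_cover_def)
  fix ks assume ks: "ks \<in> multidegrees n k"
  note l = multidegreesD(1)[OF ks]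
  let ?T = "tensor_list R (summands ks)"
  interpret T: module R ?T by (rule T_module[OF ks])
  let ?up = "\<lambda>i. ks[i := Suc (ks ! i)]"
  let ?t = "\<lambda>i. ((\<ominus> \<one>) [^] sum_list (take i ks)) \<odot>\<^bsub>?T\<^esub> tensor_partial_bd R steps ks i (step_cover (Suc k) z (?up i))"
  have b: "bd TC k (step_cover (Suc k) z) ks = (\<Oplus>\<^bsub>?T\<^esub>i\<in>{..<n}. ?t i)"
    using ks by (simp add: tensor_complex_def steps_simps)
  have mc: "(\<ominus> \<one>) [^] (m::nat) \<in> carrier R" for m by (rule nat_pow_closed) simp
  have zR: "z A \<in> carrier R" for A using z by (simp add: kosk_simps kos_simps)
  have sc: "step_cover (Suc k) z (?up i) \<in> carrier (tensor_list R (summands (?up i)))" if "i < n" for i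
    using direct_sum_carrierD(1)[OF step_cover_closed[OF z, unfolded TC_obj] multidegrees_suc[OF ks that]] .
  have tc: "?t i \<in> carrier ?T" if i: "i < n" for i
    by (rule T.smult_closed[OF mc linear_map_closed[OF partial_bd(1)[OF ks i] sc[OF i]]])
  show "bd TC k (step_cover (Suc k) z) ks = step_cover k (kd {..<n} q z) ks"
  proof (cases "\<forall>i<n. ks ! i \<le> 1")
    case False
    then obtain i where i: "i < n" "\<not> ks ! i \<le> 1" by blast
    have "(\<Oplus>\<^bsub>?T\<^esub>i\<in>{..<n}. ?t i) \<in> carrier ?T" by (rule T.finsum_closed) (use tc in auto)
    then have "(\<Oplus>\<^bsub>?T\<^esub>i\<in>{..<n}. ?t i) = \<zero>\<^bsub>?T\<^esub>" using summands_large[OF l i] by simp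
    then show ?thesis unfolding b using False ks by (auto simp: step_cover_def)
  next
    case True
    let ?e = "one_tensor n"
    note c = T_covers[OF ks True]
    have S: "summands ks = replicate n cyc" by (rule summands_small) (use True l in auto)
    have e: "?e \<in> carrier ?T" unfolding S by (rule pure_tensor_list_closed[OF cyc_list ones_gens])
    interpret RT: module_pair R "regular_module R" ?T
      by (rule module_pair.intro) (rule regular_module_module T.module_axioms')+
    let ?A = "ones ks"
    \<comment> \<open>Zero on \<open>?A\<close>, so that the sum over all slots becomes the sum over
      the complement of \<open>?A\<close> in \<open>kd\<close>.\<close>
    let ?c = "\<lambda>i. if i \<in> ?A then 0 else ksgn i ?A * q i * z (insert i ?A)"
    have cR: "?c i \<in> carrier R" if "i < n" for i
      using q that zR by (auto intro!: R_closed ksgn_closed)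
    have t: "?t i = ?c i \<odot>\<^bsub>?T\<^esub> ?e" if i: "i < n" for i
    proof (cases "i \<in> ?A")
      case True
      interpret T': module R "tensor_list R (summands (?up i))" by (rule T_module[OF multidegrees_suc[OF ks i]])
      interpret TT: module_pair R "tensor_list R (summands (?up i))" ?T
        by (rule module_pair.intro) (rule T'.module_axioms' T.module_axioms')+
      have "\<not> (\<forall>j<n. ?up i ! j \<le> 1)" using True i l by (auto simp: ones_def intro!: exI[of _ i])
      then have "step_cover (Suc k) z (?up i) = \<zero>\<^bsub>tensor_list R (summands (?up i))\<^esub>"
        using multidegrees_suc[OF ks i] by (auto simp: step_cover_def)
      then have "?t i = \<zero>\<^bsub>?T\<^esub>"
        using TT.linear_map_zero[OF partial_bd(1)[OF ks i]] T.smult_r_null[OF mc] by simp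
      moreover have "0 \<odot>\<^bsub>?T\<^esub> ?e = \<zero>\<^bsub>?T\<^esub>" using T.smult_l_null[OF e] by (simp add: ops)
      ultimately show ?thesis using True by simp
    next
      case F: False
      then have k0: "ks ! i = 0" using True i l by (auto simp: ones_def)
      have s: "\<forall>j<n. ?up i ! j \<le> 1"
      proof (intro allI impI)
        fix j assume "j < n"
        then show "?up i ! j \<le> 1" using True k0 l by (cases "j = i") auto
      qed
      have S': "summands (?up i) = replicate n cyc" by (rule summands_small) (use s l in auto)
      have on: "ones (?up i) = insert i ?A"
        using i l k0 by (auto simp: ones_def nth_list_update)
      have "step_cover (Suc k) z (?up i) = z (insert i ?A) \<odot>\<^bsub>tensor_list R (summands (?up i))\<^esub> ?e"
        using multidegrees_suc[OF ks i] s by (simp add: step_cover_def on)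
      then have "tensor_partial_bd R steps ks i (step_cover (Suc k) z (?up i))
        = z (insert i ?A) \<odot>\<^bsub>?T\<^esub> tensor_partial_bd R steps ks i ?e"
        using linear_map_smult[OF partial_bd(1)[OF ks i] zR, of ?e] e by (simp add: S S')
      also have "tensor_partial_bd R steps ks i ?e = q i \<odot>\<^bsub>?T\<^esub> ?e" by (rule partial_bd(2)[OF ks i s])
      finally have pb: "tensor_partial_bd R steps ks i (step_cover (Suc k) z (?up i))
        = z (insert i ?A) \<odot>\<^bsub>?T\<^esub> (q i \<odot>\<^bsub>?T\<^esub> ?e)" .
      have sg: "(\<ominus> \<one>) [^] sum_list (take i ks) = ksgn i ?A"
        using sum_list_take_ones[of ks i] True l i by (simp add: minus_one_power ksgn_def)
      have qi: "q i \<in> carrier R" using q i by auto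
      have "?t i = (ksgn i ?A \<otimes> (z (insert i ?A) \<otimes> q i)) \<odot>\<^bsub>?T\<^esub> ?e"
        unfolding pb sg T.smult_assoc1[OF ksgn_closed m_closed[OF zR qi] e] T.smult_assoc1[OF zR qi e] ..
      then show ?thesis using F by (simp add: ops algebra_simps)
    qed
    have "(\<Oplus>\<^bsub>?T\<^esub>i\<in>{..<n}. ?t i) = (\<Oplus>\<^bsub>?T\<^esub>i\<in>{..<n}. ?c i \<odot>\<^bsub>?T\<^esub> ?e)"
      by (rule T.finsum_cong') (use t T.smult_closed[OF cR e] in auto)
    also have "\<dots> = (\<Oplus>\<^bsub>regular_module R\<^esub>i\<in>{..<n}. ?c i) \<odot>\<^bsub>?T\<^esub> ?e"
      by (rule RT.linear_map_finsum[OF coversD'(1)[OF c], symmetric]) (use cR in \<open>auto simp: regular_module_simps\<close>)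
    also have "(\<Oplus>\<^bsub>regular_module R\<^esub>i\<in>{..<n}. ?c i) = (\<Sum>i<n. ?c i)"
      by (rule regular_finsum) (use cR in auto)
    also have "\<dots> = (\<Sum>i\<in>{..<n} - ?A. ?c i)" by (rule sum.mono_neutral_right) auto
    also have "\<dots> = kd {..<n} q z ?A" unfolding kd_def by (rule sum.cong) auto
    finally show ?thesis unfolding b using True ks by (simp add: step_cover_def)
  qed
qed

theorem kh_tensor_complex: "kh {..<n} q I (total_homology TC)"
  unfolding total_homology_def
proof (rule kh_total[OF _ q I])
  fix k
  show "\<exists>p. covers R ((kosk {..<n} k)\<lparr>carrier := {w \<in> carrier (kosk {..<n} k). \<forall>j. k = Suc j \<longrightarrow> kd {..<n} q w \<in> kBk {..<n} I j}\<rparr>)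
    (homology_module TC k) p
     {kd {..<n} q v \<oplus>\<^bsub>kosk {..<n} k\<^esub> b | v b. v \<in> carrier (kosk {..<n} (Suc k)) \<and> b \<in> kBk {..<n} I k}"
  proof (rule homology_covers[where \<delta> = "\<lambda>_. kd {..<n} q"])
    show "\<zero>\<^bsub>kosk {..<n} k\<^esub> \<in> kBk {..<n} I k" for k
      by (simp add: kBk_def kosk_simps kos_simps R_closed idealE(1)[OF I])
    show "linear_map R (kosk {..<n} (Suc k)) (kosk {..<n} k) (kd {..<n} q)" for k
    proof (rule linear_mapI)
      show "kd {..<n} q w \<in> carrier (kosk {..<n} k)" if "w \<in> carrier (kosk {..<n} (Suc k))" for w
        by (rule kd_closed_kosk[OF _ q that]) simp
    qed (simp_all add: kosk_simps kd_add[OF _ q] kd_smult[OF _ q])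
    show "kd {..<n} q (kd {..<n} q w) \<in> kBk {..<n} I k" if "w \<in> carrier (kosk {..<n} (Suc (Suc k)))" for k w
      using that kd_kd[OF _ q, of w]
      by (simp add: kBk_def kosk_simps kos_simps R_closed idealE(1)[OF I])
  qed (rule kosk_module step_covers step_cover_bd, assumption?)+
qed simp

end

end

end

section \<open>Tor\<close>

text \<open>Negatives are defined by description over the carrier, so they have to be compared when
  the carrier shrinks.\<close>

lemma submodule_minus_restrict:
  assumes M: "module R M" and K: "submodule K R M" and x: "x \<in> K" and y: "y \<in> K"
  shows "x \<ominus>\<^bsub>M\<lparr>carrier := K\<rparr>\<^esub> y = x \<ominus>\<^bsub>M\<^esub> y"
proof -
  interpret M: module R M by fact
  let ?K = "M\<lparr>carrier := K\<rparr>"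
  interpret K: module R ?K by (rule submodule.submodule_is_module[OF K M])
  have yc: "y \<in> carrier M" using M.submoduleE(1)[OF K] y by blast
  have c: "\<ominus>\<^bsub>?K\<^esub> y \<in> carrier ?K" by (rule K.a_inv_closed) (use y in simp)
  then have c: "\<ominus>\<^bsub>?K\<^esub> y \<in> carrier M" using M.submoduleE(1)[OF K] by auto
  have "\<ominus>\<^bsub>?K\<^esub> y \<oplus>\<^bsub>?K\<^esub> y = \<zero>\<^bsub>?K\<^esub>" by (rule K.l_neg) (use y in simp)
  then have "\<ominus>\<^bsub>?K\<^esub> y \<oplus>\<^bsub>M\<^esub> y = \<zero>\<^bsub>M\<^esub>" by simp
  then have "\<ominus>\<^bsub>M\<^esub> y = \<ominus>\<^bsub>?K\<^esub> y" by (rule M.minus_equality[OF _ yc c])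
  then show ?thesis by (simp add: a_minus_def)
qed

section \<open>Comparison of free resolutions\<close>

context cring
begin

text \<open>Free modules are projective. The condition concerns the image of \<open>g\<close> only,
  because \<open>s\<close> will be a differential, which is not onto in general.\<close>

lemma free_lift_through:
  assumes P: "module R P" and N: "module R N" and s: "linear_map R P N s"
    and g: "linear_map R (free_module R G) N g"
    and im: "\<And>x. x \<in> carrier (free_module R G) \<Longrightarrow> g x \<in> s ` carrier P"
  shows "\<exists>h. linear_map R (free_module R G) P h \<and> (\<forall>x\<in>carrier (free_module R G). s (h x) = g x)"
proof -
  let ?F = "free_module R G"
  interpret N: module R N by (rule N)
  define \<phi> where "\<phi> i = (SOME p. p \<in> carrier P \<and> s p = g (free_gen R G i))" for i
  have \<phi>: "\<phi> i \<in> carrier P \<and> s (\<phi> i) = g (free_gen R G i)" if i: "i \<in> G" for i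
  proof -
    obtain p where p: "g (free_gen R G i) = s p" "p \<in> carrier P" by (rule imageE[OF im[OF free_gen_closed[OF i]]])
    show ?thesis unfolding \<phi>_def by (rule someI_ex) (intro exI[of _ p] conjI p(2) p(1)[symmetric])
  qed
  then have "\<phi> \<in> G \<rightarrow> carrier P" by auto
  then obtain h where h: "linear_map R ?F P h" "\<And>i. i \<in> G \<Longrightarrow> h (free_gen R G i) = \<phi> i"
    using free_module_lift[OF P] by blast
  note sh = linear_map_comp[OF h(1) s]
  have "s (h x) = g x" if x: "x \<in> carrier ?F" for x
  proof -
    note xc = free_module_carrierD(1)[OF x]
    have "s (h x) = lin_ext G N (\<lambda>i. s (h (free_gen R G i))) x"
      by (rule linear_map_free_eq_lin_ext[OF N sh x])
    also have "\<dots> = lin_ext G N (\<lambda>i. g (free_gen R G i)) x"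
    proof (rule N.finsum_cong')
      show "(\<lambda>i. x i \<odot>\<^bsub>N\<^esub> g (free_gen R G i)) \<in> {i \<in> G. x i \<noteq> \<zero>} \<rightarrow> carrier N"
        using N.smult_closed[OF xc linear_map_closed[OF g free_gen_closed]] by auto
    qed (use h(2) \<phi> in auto)
    also have "\<dots> = g x" by (rule linear_map_free_eq_lin_ext[OF N g x, symmetric])
    finally show ?thesis .
  qed
  then show ?thesis using h(1) by blast
qed

definition augmentation :: "('a, 'm) module \<Rightarrow> ('a, 'c) chain_complex \<Rightarrow> ('c \<Rightarrow> 'm) \<Rightarrow> bool"
  where "augmentation M F \<epsilon> \<longleftrightarrow> linear_map R (obj F 0) M \<epsilon> \<and> \<epsilon> ` carrier (obj F 0) = carrier M \<and>
         {x \<in> carrier (obj F 0). \<epsilon> x = \<zero>\<^bsub>M\<^esub>} = chain_boundaries F 0"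

definition chain_map :: "('a, 'c) chain_complex \<Rightarrow> ('a, 'd) chain_complex \<Rightarrow> (nat \<Rightarrow> 'c \<Rightarrow> 'd) \<Rightarrow> bool"
  where "chain_map F P \<phi> \<longleftrightarrow> (\<forall>k. linear_map R (obj F k) (obj P k) (\<phi> k)) \<and>
    (\<forall>k. \<forall>x\<in>carrier (obj F (Suc k)). bd P k (\<phi> (Suc k) x) = \<phi> k (bd F k x))"

lemma chain_mapD:
  assumes "chain_map F P \<phi>"
  shows "linear_map R (obj F k) (obj P k) (\<phi> k)"
    "x \<in> carrier (obj F (Suc k)) \<Longrightarrow> bd P k (\<phi> (Suc k) x) = \<phi> k (bd F k x)"
  using assms unfolding chain_map_def by blast+

lemma resolutionD:
  assumes F: "is_free_resolution R M F"
  shows "\<exists>G. obj F k = free_module R G" "module R (obj F k)" "linear_map R (obj F (Suc k)) (obj F k) (bd F k)"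
    "x \<in> carrier (obj F (Suc (Suc k))) \<Longrightarrow> bd F k (bd F (Suc k) x) = \<zero>\<^bsub>obj F k\<^esub>"
    "x \<in> carrier (obj F (Suc k)) \<Longrightarrow> bd F k x = \<zero>\<^bsub>obj F k\<^esub> \<Longrightarrow> x \<in> bd F (Suc k) ` carrier (obj F (Suc (Suc k)))"
    "\<exists>\<epsilon>. augmentation M F \<epsilon>"
proof -
  show G: "\<exists>G. obj F k = free_module R G" using F unfolding is_free_resolution_def by blast
  then obtain G where "obj F k = free_module R G" by blast
  then show "module R (obj F k)" using free_module_module by simp
  show "linear_map R (obj F (Suc k)) (obj F k) (bd F k)" using F unfolding is_free_resolution_def by blast
  have e: "chain_boundaries F (Suc k) = chain_cycles F (Suc k)" using F unfolding is_free_resolution_def by blast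
  show "bd F k (bd F (Suc k) x) = \<zero>\<^bsub>obj F k\<^esub>" if "x \<in> carrier (obj F (Suc (Suc k)))"
  proof -
    have "bd F (Suc k) x \<in> chain_cycles F (Suc k)" unfolding e[symmetric] chain_boundaries_def using that by blast
    then show ?thesis by simp
  qed
  show "x \<in> bd F (Suc k) ` carrier (obj F (Suc (Suc k)))" if "x \<in> carrier (obj F (Suc k))" "bd F k x = \<zero>\<^bsub>obj F k\<^esub>"
    using that e[unfolded chain_boundaries_def] by simp
  show "\<exists>\<epsilon>. augmentation M F \<epsilon>" using F unfolding is_free_resolution_def augmentation_def by blast
qed

lemma free_resolution_lift:
  assumes F: "is_free_resolution R M F" and P: "module R P" and N: "module R N" and s: "linear_map R P N s"
    and g: "linear_map R (obj F k) N g"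
    and im: "\<And>x. x \<in> carrier (obj F k) \<Longrightarrow> g x \<in> s ` carrier P"
  shows "\<exists>h. linear_map R (obj F k) P h \<and> (\<forall>x\<in>carrier (obj F k). s (h x) = g x)"
proof -
  obtain G where G: "obj F k = free_module R G" using resolutionD(1)[OF F] by blast
  show ?thesis using free_lift_through[OF P N s g[unfolded G] im[unfolded G]] unfolding G .
qed

lemma comparison_exists:
  assumes M: "module R M" and F: "is_free_resolution R M F" and P: "is_free_resolution R M P"
    and e: "augmentation M F \<epsilon>" and e': "augmentation M P \<epsilon>'"
  obtains \<phi> where "chain_map F P \<phi>" "\<And>x. x \<in> carrier (obj F 0) \<Longrightarrow> \<epsilon>' (\<phi> 0 x) = \<epsilon> x"
proof -
  note f = resolutionD[OF F] and p = resolutionD[OF P]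
  have el: "linear_map R (obj F 0) M \<epsilon>" "linear_map R (obj P 0) M \<epsilon>'" "\<epsilon>' ` carrier (obj P 0) = carrier M"
    using e e' by (auto simp: augmentation_def)
  have eb: "\<epsilon> (bd F 0 x) = \<zero>\<^bsub>M\<^esub>" if "x \<in> carrier (obj F (Suc 0))" for x
  proof -
    have "bd F 0 x \<in> chain_boundaries F 0" unfolding chain_boundaries_def using that by blast
    then show ?thesis using e unfolding augmentation_def by blast
  qed
  have eb': "x \<in> bd P 0 ` carrier (obj P (Suc 0))" if "x \<in> carrier (obj P 0)" "\<epsilon>' x = \<zero>\<^bsub>M\<^esub>" for x
    using that e' unfolding augmentation_def chain_boundaries_def by blast
  \<comment> \<open>\<open>A\<close> carries along the condition for the next lift, that
    \<open>h\<close> after the differential lands in the image of the differential of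
    \<open>P\<close>; in degree 0 it also asks for compatibility with the augmentations.
    \<open>B\<close> links consecutive choices.\<close>
  define A where "A k h \<longleftrightarrow> linear_map R (obj F k) (obj P k) h \<and>
    (\<forall>x\<in>carrier (obj F (Suc k)). h (bd F k x) \<in> bd P k ` carrier (obj P (Suc k))) \<and>
    (k = 0 \<longrightarrow> (\<forall>x\<in>carrier (obj F 0). \<epsilon>' (h x) = \<epsilon> x))" for k h
  define B where "B k h h' \<longleftrightarrow> (\<forall>x\<in>carrier (obj F (Suc k)). bd P k (h' x) = h (bd F k x))" for k h h'
  have "\<exists>\<phi>. \<forall>k. A k (\<phi> k) \<and> B k (\<phi> k) (\<phi> (Suc k))"
  proof (rule dependent_nat_choice)
    have "\<exists>h. linear_map R (obj F 0) (obj P 0) h \<and> (\<forall>x\<in>carrier (obj F 0). \<epsilon>' (h x) = \<epsilon> x)"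
      by (rule free_resolution_lift[OF F p(2) M el(2,1)]) (simp add: el(3) linear_map_closed[OF el(1)])
    then obtain h where h: "linear_map R (obj F 0) (obj P 0) h" "\<And>x. x \<in> carrier (obj F 0) \<Longrightarrow> \<epsilon>' (h x) = \<epsilon> x"
      by blast
    have "h (bd F 0 x) \<in> bd P 0 ` carrier (obj P (Suc 0))" if x: "x \<in> carrier (obj F (Suc 0))" for x
    proof -
      have bx: "bd F 0 x \<in> carrier (obj F 0)" by (rule linear_map_closed[OF f(3) x])
      show ?thesis by (rule eb'[OF linear_map_closed[OF h(1) bx]]) (simp add: h(2)[OF bx] eb[OF x])
    qed
    then show "\<exists>h. A 0 h" unfolding A_def using h by blast
  next
    fix h k assume "A k h"
    then have h: "linear_map R (obj F k) (obj P k) h"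
      "\<And>x. x \<in> carrier (obj F (Suc k)) \<Longrightarrow> h (bd F k x) \<in> bd P k ` carrier (obj P (Suc k))"
      unfolding A_def by blast+
    interpret hp: module_pair R "obj F k" "obj P k" by (rule module_pair.intro) (rule f(2) p(2))+
    obtain h' where h': "linear_map R (obj F (Suc k)) (obj P (Suc k)) h'"
      "\<And>x. x \<in> carrier (obj F (Suc k)) \<Longrightarrow> bd P k (h' x) = h (bd F k x)"
      using free_resolution_lift[OF F p(2) p(2) p(3) linear_map_comp[OF f(3) h(1)] h(2)] by blast
    have "h' (bd F (Suc k) x) \<in> bd P (Suc k) ` carrier (obj P (Suc (Suc k)))"
      if x: "x \<in> carrier (obj F (Suc (Suc k)))" for x
    proof -
      have bx: "bd F (Suc k) x \<in> carrier (obj F (Suc k))" by (rule linear_map_closed[OF f(3) x])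
      show ?thesis
        by (rule p(5)[OF linear_map_closed[OF h'(1) bx]])
          (simp add: h'(2)[OF bx] f(4)[OF x] hp.linear_map_zero[OF h(1)])
    qed
    then show "\<exists>h'. A (Suc k) h' \<and> B k h h'" unfolding A_def B_def using h' by blast
  qed
  then obtain \<phi> where \<phi>: "\<And>k. A k (\<phi> k)" "\<And>k. B k (\<phi> k) (\<phi> (Suc k))" by blast
  show ?thesis
  proof (rule that)
    show "chain_map F P \<phi>" unfolding chain_map_def using \<phi> unfolding A_def B_def by blast
    show "\<epsilon>' (\<phi> 0 x) = \<epsilon> x" if "x \<in> carrier (obj F 0)" for x
      using \<phi>(1)[of 0] that unfolding A_def by blast
  qed
qed

text \<open>The homotopy between two lifts of the same augmentation. Its term that starts with the
  differential of \<open>F\<close> has no meaning in degree 0; the family \<open>g\<close> stands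
  for this term and is zero there.\<close>

lemma homotopy_exists:
  assumes M: "module R M" and F: "is_free_resolution R M F" and P: "is_free_resolution R M P"
    and e': "augmentation M P \<epsilon>"
    and u: "chain_map F P u" and v: "chain_map F P v"
    and uv: "\<And>x. x \<in> carrier (obj F 0) \<Longrightarrow> \<epsilon> (u 0 x) = \<epsilon> (v 0 x)"
  obtains h g where "\<And>k. linear_map R (obj F k) (obj P (Suc k)) (h k)"
    "\<And>k x. x \<in> carrier (obj F k) \<Longrightarrow> u k x \<ominus>\<^bsub>obj P k\<^esub> v k x = bd P k (h k x) \<oplus>\<^bsub>obj P k\<^esub> g k x"
    "\<And>x. g 0 x = \<zero>\<^bsub>obj P 0\<^esub>" "\<And>k x. g (Suc k) x = h k (bd F k x)"
proof -
  note f = resolutionD[OF F] and p = resolutionD[OF P]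
  define D where "D k x = u k x \<ominus>\<^bsub>obj P k\<^esub> v k x" for k x
  have D: "linear_map R (obj F k) (obj P k) (D k)" for k
  proof -
    interpret hp: module_pair R "obj F k" "obj P k" by (rule module_pair.intro) (rule f(2) p(2))+
    show ?thesis unfolding D_def by (rule hp.linear_map_diff[OF chain_mapD(1)[OF u] chain_mapD(1)[OF v]])
  qed
  have Dbd: "bd P k (D (Suc k) x) = D k (bd F k x)" if x: "x \<in> carrier (obj F (Suc k))" for k x
  proof -
    interpret pp: module_pair R "obj P (Suc k)" "obj P k" by (rule module_pair.intro) (rule p(2))+
    show ?thesis unfolding D_def
      using pp.linear_map_minus[OF p(3) linear_map_closed[OF chain_mapD(1)[OF u] x] linear_map_closed[OF chain_mapD(1)[OF v] x]]
      by (simp add: chain_mapD(2)[OF u x] chain_mapD(2)[OF v x])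
  qed
  \<comment> \<open>The recursion runs over \<open>g\<close> rather than \<open>h\<close>: the
    difference of the chain maps minus \<open>g\<close> can be lifted through the differential of
    \<open>P\<close>, and \<open>g\<close> vanishes on boundaries, so that the next difference is a
    cycle.\<close>
  define A where "A k g \<longleftrightarrow> linear_map R (obj F k) (obj P k) g \<and>
    (\<forall>x\<in>carrier (obj F k). D k x \<ominus>\<^bsub>obj P k\<^esub> g x \<in> bd P k ` carrier (obj P (Suc k))) \<and>
    (\<forall>x\<in>carrier (obj F (Suc k)). g (bd F k x) = \<zero>\<^bsub>obj P k\<^esub>) \<and> (k = 0 \<longrightarrow> g = (\<lambda>_. \<zero>\<^bsub>obj P 0\<^esub>))" for k g
  define H where "H k g h \<longleftrightarrow> linear_map R (obj F k) (obj P (Suc k)) h \<and>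
    (\<forall>x\<in>carrier (obj F k). bd P k (h x) = D k x \<ominus>\<^bsub>obj P k\<^esub> g x)" for k g h
  have "\<exists>g. \<forall>k. A k (g k) \<and> (\<exists>h. H k (g k) h \<and> g (Suc k) = (\<lambda>x. h (bd F k x)))"
  proof (rule dependent_nat_choice)
    interpret P0: module_pair R "obj P 0" M by (rule module_pair.intro) (rule p(2) M)+
    interpret F0: module R "obj F 0" by (rule f(2))
    have el: "linear_map R (obj P 0) M \<epsilon>" using e' by (auto simp: augmentation_def)
    have "D 0 x \<in> bd P 0 ` carrier (obj P (Suc 0))" if x: "x \<in> carrier (obj F 0)" for x
    proof -
      note ux = linear_map_closed[OF chain_mapD(1)[OF u] x] and vx = linear_map_closed[OF chain_mapD(1)[OF v] x]
      have "\<epsilon> (D 0 x) = \<zero>\<^bsub>M\<^esub>"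
        unfolding D_def P0.linear_map_minus[OF el ux vx] uv[OF x]
        using P0.N.minus_eq_zero_iff linear_map_closed[OF el vx] by blast
      then show ?thesis using e' linear_map_closed[OF D x] unfolding augmentation_def chain_boundaries_def by blast
    qed
    moreover have "linear_map R (obj F 0) (obj P 0) (\<lambda>_. \<zero>\<^bsub>obj P 0\<^esub>)" by (rule linear_mapI) simp_all
    moreover have "D 0 x \<ominus>\<^bsub>obj P 0\<^esub> \<zero>\<^bsub>obj P 0\<^esub> = D 0 x" if "x \<in> carrier (obj F 0)" for x
      using linear_map_closed[OF D that] by (simp add: a_minus_def)
    ultimately have "A 0 (\<lambda>_. \<zero>\<^bsub>obj P 0\<^esub>)"
      unfolding A_def by simp
    then show "\<exists>g. A 0 g" by blast
  next
    fix g k assume "A k g"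
    then have g: "linear_map R (obj F k) (obj P k) g"
      "\<And>x. x \<in> carrier (obj F k) \<Longrightarrow> D k x \<ominus>\<^bsub>obj P k\<^esub> g x \<in> bd P k ` carrier (obj P (Suc k))"
      "\<And>x. x \<in> carrier (obj F (Suc k)) \<Longrightarrow> g (bd F k x) = \<zero>\<^bsub>obj P k\<^esub>"
      unfolding A_def by blast+
    interpret fp: module_pair R "obj F k" "obj P k" by (rule module_pair.intro) (rule f(2) p(2))+
    interpret fp': module_pair R "obj F k" "obj P (Suc k)" by (rule module_pair.intro) (rule f(2) p(2))+
    interpret pp: module_pair R "obj P (Suc k)" "obj P k" by (rule module_pair.intro) (rule p(2))+
    obtain h where h: "linear_map R (obj F k) (obj P (Suc k)) h"
      "\<And>x. x \<in> carrier (obj F k) \<Longrightarrow> bd P k (h x) = D k x \<ominus>\<^bsub>obj P k\<^esub> g x"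
      using free_resolution_lift[OF F p(2) p(2) p(3) fp.linear_map_diff[OF D g(1)] g(2)] by blast
    have 1: "D (Suc k) x \<ominus>\<^bsub>obj P (Suc k)\<^esub> h (bd F k x) \<in> bd P (Suc k) ` carrier (obj P (Suc (Suc k)))"
      if x: "x \<in> carrier (obj F (Suc k))" for x
    proof -
      note bx = linear_map_closed[OF f(3) x]
      note Dx = linear_map_closed[OF D x] and hb = linear_map_closed[OF h(1) bx]
      have "bd P k (h (bd F k x)) = D k (bd F k x)"
        unfolding h(2)[OF bx] g(3)[OF x] using linear_map_closed[OF D bx] by (simp add: a_minus_def)
      then have "bd P k (D (Suc k) x \<ominus>\<^bsub>obj P (Suc k)\<^esub> h (bd F k x)) = \<zero>\<^bsub>obj P k\<^esub>"
        unfolding pp.linear_map_minus[OF p(3) Dx hb] Dbd[OF x]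
        using fp.N.minus_eq_zero_iff linear_map_closed[OF D bx] by simp
      then show ?thesis by (rule p(5)[OF fp'.N.minus_closed[OF Dx hb]])
    qed
    have "h (bd F k (bd F (Suc k) x)) = \<zero>\<^bsub>obj P (Suc k)\<^esub>" if "x \<in> carrier (obj F (Suc (Suc k)))" for x
      unfolding f(4)[OF that] by (rule fp'.linear_map_zero[OF h(1)])
    then have "A (Suc k) (\<lambda>x. h (bd F k x))"
      unfolding A_def using linear_map_comp[OF f(3) h(1)] 1 by simp
    then show "\<exists>g'. A (Suc k) g' \<and> (\<exists>h. H k g h \<and> g' = (\<lambda>x. h (bd F k x)))" unfolding H_def using h by blast
  qed
  then obtain g where g: "\<And>k. A k (g k)" "\<forall>k. \<exists>h. H k (g k) h \<and> g (Suc k) = (\<lambda>x. h (bd F k x))" by blast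
  then obtain h where h: "\<And>k. H k (g k) (h k)" "\<And>k. g (Suc k) = (\<lambda>x. h k (bd F k x))" unfolding choice_iff by blast
  show ?thesis
  proof (rule that)
    show "linear_map R (obj F k) (obj P (Suc k)) (h k)" for k using h(1)[of k] unfolding H_def by blast
    show "u k x \<ominus>\<^bsub>obj P k\<^esub> v k x = bd P k (h k x) \<oplus>\<^bsub>obj P k\<^esub> g k x" if x: "x \<in> carrier (obj F k)" for k x
    proof -
      interpret P: module R "obj P k" by (rule p(2))
      have e: "bd P k (h k x) = D k x \<ominus>\<^bsub>obj P k\<^esub> g k x" using h(1)[of k] x unfolding H_def by blast
      have "linear_map R (obj F k) (obj P k) (g k)" using g(1)[of k] unfolding A_def by blast
      then have "g k x \<in> carrier (obj P k)" by (rule linear_map_closed[OF _ x])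
      then show ?thesis unfolding e D_def[symmetric] using linear_map_closed[OF D x]
        by (simp add: a_minus_def P.a_assoc P.l_neg)
    qed
    show "g 0 x = \<zero>\<^bsub>obj P 0\<^esub>" for x using g(1)[of 0] unfolding A_def by simp
    show "g (Suc k) x = h k (bd F k x)" for k x unfolding h(2) ..
  qed
qed

section \<open>Homology of a resolution modulo an ideal\<close>

definition ideal_mult :: "'a set \<Rightarrow> ('a, 'm) module \<Rightarrow> 'm set"
  where "ideal_mult J M = submodule_span R M {j \<odot>\<^bsub>M\<^esub> m | j m. j \<in> J \<and> m \<in> carrier M}"

lemma ideal_mult_submodule:
  assumes M: "module R M" and J: "J \<subseteq> carrier R"
  shows "submodule (ideal_mult J M) R M"
  unfolding ideal_mult_def
  by (rule submodule_span_submodule[OF M]) (use module.smult_closed[OF M] J in auto)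

lemma ideal_mult_map:
  assumes M: "module R M" and N: "module R N" and J: "J \<subseteq> carrier R" and f: "linear_map R M N f"
    and x: "x \<in> ideal_mult J M"
  shows "f x \<in> ideal_mult J N"
proof -
  interpret module_pair R M N by (rule module_pair.intro[OF M N])
  have "ideal_mult J M \<subseteq> {x \<in> carrier M. f x \<in> ideal_mult J N}"
    unfolding ideal_mult_def[of J M]
  proof (rule submodule_span_least[OF submodule_vimage[OF f ideal_mult_submodule[OF N J]]])
    show "{j \<odot>\<^bsub>M\<^esub> m |j m. j \<in> J \<and> m \<in> carrier M} \<subseteq> {x \<in> carrier M. f x \<in> ideal_mult J N}"
    proof
      fix y assume "y \<in> {j \<odot>\<^bsub>M\<^esub> m |j m. j \<in> J \<and> m \<in> carrier M}"
      then obtain j m where y: "y = j \<odot>\<^bsub>M\<^esub> m" "j \<in> J" "m \<in> carrier M" by blast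
      have jc: "j \<in> carrier R" using y(2) J by blast
      have "f y = j \<odot>\<^bsub>N\<^esub> f m" unfolding y(1) by (rule linear_map_smult[OF f jc y(3)])
      moreover have "j \<odot>\<^bsub>N\<^esub> f m \<in> {j \<odot>\<^bsub>N\<^esub> m |j m. j \<in> J \<and> m \<in> carrier N}"
        using y(2) linear_map_closed[OF f y(3)] by blast
      ultimately have "f y \<in> ideal_mult J N" unfolding ideal_mult_def
        by (simp only:) (rule subsetD[OF submodule_span_superset])
      then show "y \<in> {x \<in> carrier M. f x \<in> ideal_mult J N}" using y jc by simp
    qed
  qed
  then show ?thesis using x by blast
qed

text \<open>\<open>F k\<close> modulo \<open>J F k\<close> is the tensor product of
  \<open>F k\<close> with \<open>R / J\<close>. Cycles and boundaries of that complex are pulled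
  back to \<open>F\<close>, so resolutions can be compared without tensor products.\<close>

definition mod_cycles :: "'a set \<Rightarrow> ('a, 'c) chain_complex \<Rightarrow> nat \<Rightarrow> 'c set"
  where "mod_cycles J F k = {w \<in> carrier (obj F k). \<forall>j. k = Suc j \<longrightarrow> bd F j w \<in> ideal_mult J (obj F j)}"

definition mod_boundaries :: "'a set \<Rightarrow> ('a, 'c) chain_complex \<Rightarrow> nat \<Rightarrow> 'c set"
  where "mod_boundaries J F k = {bd F k v \<oplus>\<^bsub>obj F k\<^esub> b | v b. v \<in> carrier (obj F (Suc k)) \<and> b \<in> ideal_mult J (obj F k)}"

context
  fixes J :: "'a set" and F :: "('a, 'g \<Rightarrow> 'a) chain_complex" and M :: "('a, 'm) module"
  assumes J: "J \<subseteq> carrier R" and F: "is_free_resolution R M F"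
begin

lemma mod_cycles_submodule: "submodule (mod_cycles J F k) R (obj F k)"
proof (cases k)
  case 0
  then show ?thesis unfolding mod_cycles_def using module.carrier_is_submodule[OF resolutionD(2)[OF F]] by simp
next
  case (Suc j)
  interpret module_pair R "obj F (Suc j)" "obj F j" by (rule module_pair.intro) (rule resolutionD(2)[OF F])+
  show ?thesis unfolding mod_cycles_def Suc
    using submodule_vimage[OF resolutionD(3)[OF F] ideal_mult_submodule[OF resolutionD(2)[OF F] J]] by simp
qed

lemma mod_boundaries_submodule: "submodule (mod_boundaries J F k) R (obj F k)"
proof -
  interpret module_pair R "obj F (Suc k)" "obj F k" by (rule module_pair.intro) (rule resolutionD(2)[OF F])+
  note l = linear_mapD[OF resolutionD(3)[OF F, of k]]
  note s = ideal_mult_submodule[OF resolutionD(2)[OF F, of k] J]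
  note sc = subsetD[OF N.submoduleE(1)[OF s]]
  show ?thesis
  proof (rule N.submoduleI')
    show "mod_boundaries J F k \<subseteq> carrier (obj F k)" unfolding mod_boundaries_def using l(1) sc by auto
    have "\<zero>\<^bsub>obj F k\<^esub> = bd F k \<zero>\<^bsub>obj F (Suc k)\<^esub> \<oplus>\<^bsub>obj F k\<^esub> \<zero>\<^bsub>obj F k\<^esub>"
      using linear_map_zero[OF resolutionD(3)[OF F]] by simp
    then show "\<zero>\<^bsub>obj F k\<^esub> \<in> mod_boundaries J F k" unfolding mod_boundaries_def
      using N.submodule_zero[OF s] M.zero_closed by blast
    show "a \<oplus>\<^bsub>obj F k\<^esub> b \<in> mod_boundaries J F k" if ab: "a \<in> mod_boundaries J F k" "b \<in> mod_boundaries J F k" for a b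
    proof -
      obtain u c v d where *: "a = bd F k u \<oplus>\<^bsub>obj F k\<^esub> c" "b = bd F k v \<oplus>\<^bsub>obj F k\<^esub> d"
        "u \<in> carrier (obj F (Suc k))" "v \<in> carrier (obj F (Suc k))" "c \<in> ideal_mult J (obj F k)" "d \<in> ideal_mult J (obj F k)"
        using ab unfolding mod_boundaries_def by blast
      have "a \<oplus>\<^bsub>obj F k\<^esub> b = bd F k (u \<oplus>\<^bsub>obj F (Suc k)\<^esub> v) \<oplus>\<^bsub>obj F k\<^esub> (c \<oplus>\<^bsub>obj F k\<^esub> d)"
        unfolding *(1,2) l(2)[OF *(3,4)] using l(1)[OF *(3)] l(1)[OF *(4)] sc[OF *(5)] sc[OF *(6)]
        by (simp add: N.a_ac)
      then show ?thesis unfolding mod_boundaries_def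
        using M.a_closed[OF *(3,4)] N.submoduleE(5)[OF s *(5,6)] by blast
    qed
    show "r \<odot>\<^bsub>obj F k\<^esub> b \<in> mod_boundaries J F k" if r: "r \<in> carrier R" and b: "b \<in> mod_boundaries J F k" for r b
    proof -
      obtain v d where *: "b = bd F k v \<oplus>\<^bsub>obj F k\<^esub> d"
        "v \<in> carrier (obj F (Suc k))" "d \<in> ideal_mult J (obj F k)"
        using b unfolding mod_boundaries_def by blast
      have "r \<odot>\<^bsub>obj F k\<^esub> b = bd F k (r \<odot>\<^bsub>obj F (Suc k)\<^esub> v) \<oplus>\<^bsub>obj F k\<^esub> (r \<odot>\<^bsub>obj F k\<^esub> d)"
        unfolding *(1) l(3)[OF r *(2)] by (rule N.smult_r_distr[OF r l(1)[OF *(2)] sc[OF *(3)]])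
      then show ?thesis unfolding mod_boundaries_def
        using M.smult_closed[OF r *(2)] N.submoduleE(4)[OF s r *(3)] by blast
    qed
  qed
qed

lemma mod_boundaries_cycles: "mod_boundaries J F k \<subseteq> mod_cycles J F k"
proof
  fix w assume w: "w \<in> mod_boundaries J F k"
  then obtain v b where v: "w = bd F k v \<oplus>\<^bsub>obj F k\<^esub> b" "v \<in> carrier (obj F (Suc k))" "b \<in> ideal_mult J (obj F k)"
    unfolding mod_boundaries_def by blast
  have "w \<in> carrier (obj F k)"
    using module.submoduleE(1)[OF resolutionD(2)[OF F] mod_boundaries_submodule] w by blast
  moreover have "bd F j w \<in> ideal_mult J (obj F j)" if k: "k = Suc j" for j
  proof -
    interpret module_pair R "obj F (Suc j)" "obj F j" by (rule module_pair.intro) (rule resolutionD(2)[OF F])+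
    note l = linear_mapD[OF resolutionD(3)[OF F]]
    have b: "b \<in> carrier (obj F (Suc j))"
      using v(3) M.submoduleE(1)[OF ideal_mult_submodule[OF resolutionD(2)[OF F] J]] unfolding k by blast
    have bb: "bd F j b \<in> ideal_mult J (obj F j)"
      by (rule ideal_mult_map[OF resolutionD(2)[OF F] resolutionD(2)[OF F] J resolutionD(3)[OF F] v(3)[unfolded k]])
    have v': "v \<in> carrier (obj F (Suc (Suc j)))" using v(2) unfolding k .
    have "bd F j w = bd F j b"
      unfolding v(1) k l(2)[OF l(1)[OF v'] b] resolutionD(4)[OF F v'] using l(1)[OF b] by simp
    then show ?thesis using bb by simp
  qed
  ultimately show "w \<in> mod_cycles J F k" unfolding mod_cycles_def by blast
qed

end

text \<open>On a cycle modulo \<open>J\<close> the differential has values in \<open>J F\<close>, so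
  the term \<open>g\<close> lies in \<open>J P\<close> and the homotopy formula leaves a boundary
  modulo \<open>J\<close>.\<close>

lemma homotopic_mod_boundaries:
  assumes J: "J \<subseteq> carrier R" and F: "is_free_resolution R M F" and P: "is_free_resolution R M' P"
    and hl: "\<And>k. linear_map R (obj F k) (obj P (Suc k)) (h k)"
    and D: "\<And>k x. x \<in> carrier (obj F k) \<Longrightarrow> D k x = bd P k (h k x) \<oplus>\<^bsub>obj P k\<^esub> g k x"
    and g: "\<And>x. g 0 x = \<zero>\<^bsub>obj P 0\<^esub>" "\<And>k x. g (Suc k) x = h k (bd F k x)"
    and w: "w \<in> mod_cycles J F k"
  shows "D k w \<in> mod_boundaries J P k"
proof -
  have wc: "w \<in> carrier (obj F k)" using w by (simp add: mod_cycles_def)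
  have "g k w \<in> ideal_mult J (obj P k)"
  proof (cases k)
    case 0
    then show ?thesis
      using module.submodule_zero[OF resolutionD(2)[OF P] ideal_mult_submodule[OF resolutionD(2)[OF P] J]] g(1) by simp
  next
    case (Suc j)
    have "bd F j w \<in> ideal_mult J (obj F j)" using w Suc by (simp add: mod_cycles_def)
    then show ?thesis unfolding Suc g(2)
      by (rule ideal_mult_map[OF resolutionD(2)[OF F] resolutionD(2)[OF P] J hl])
  qed
  then show ?thesis unfolding mod_boundaries_def using D[OF wc] linear_map_closed[OF hl wc] by blast
qed

lemma chain_map_mod:
  assumes J: "J \<subseteq> carrier R" and F: "is_free_resolution R M F" and P: "is_free_resolution R M' P"
    and \<phi>: "chain_map F P \<phi>"
  shows "w \<in> mod_cycles J F k \<Longrightarrow> \<phi> k w \<in> mod_cycles J P k"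
    and "w \<in> mod_boundaries J F k \<Longrightarrow> \<phi> k w \<in> mod_boundaries J P k"
proof -
  note m = resolutionD(2)[OF F] resolutionD(2)[OF P]
  show "\<phi> k w \<in> mod_cycles J P k" if w: "w \<in> mod_cycles J F k"
  proof -
    have wc: "w \<in> carrier (obj F k)" using w by (simp add: mod_cycles_def)
    have "bd P j (\<phi> k w) \<in> ideal_mult J (obj P j)" if k: "k = Suc j" for j
    proof -
      have "bd F j w \<in> ideal_mult J (obj F j)" using w k by (simp add: mod_cycles_def)
      then have "\<phi> j (bd F j w) \<in> ideal_mult J (obj P j)"
        by (rule ideal_mult_map[OF m J chain_mapD(1)[OF \<phi>]])
      then show ?thesis using chain_mapD(2)[OF \<phi>] wc k by simp
    qed
    then show ?thesis unfolding mod_cycles_def using linear_map_closed[OF chain_mapD(1)[OF \<phi>] wc] by blast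
  qed
  show "\<phi> k w \<in> mod_boundaries J P k" if w: "w \<in> mod_boundaries J F k"
  proof -
    obtain v b where v: "w = bd F k v \<oplus>\<^bsub>obj F k\<^esub> b" "v \<in> carrier (obj F (Suc k))" "b \<in> ideal_mult J (obj F k)"
      using w unfolding mod_boundaries_def by blast
    have b: "b \<in> carrier (obj F k)"
      using v(3) module.submoduleE(1)[OF m(1) ideal_mult_submodule[OF m(1) J]] by blast
    have "\<phi> k w = bd P k (\<phi> (Suc k) v) \<oplus>\<^bsub>obj P k\<^esub> \<phi> k b"
      unfolding v(1) chain_mapD(2)[OF \<phi> v(2)]
      by (rule linear_map_add[OF chain_mapD(1)[OF \<phi>] linear_map_closed[OF resolutionD(3)[OF F] v(2)] b])
    moreover have "\<phi> k b \<in> ideal_mult J (obj P k)" by (rule ideal_mult_map[OF m J chain_mapD(1)[OF \<phi>] v(3)])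
    ultimately show ?thesis
      unfolding mod_boundaries_def using linear_map_closed[OF chain_mapD(1)[OF \<phi>] v(2)] by blast
  qed
qed

lemma chain_map_comp: "chain_map F P \<phi> \<Longrightarrow> chain_map P Q \<psi> \<Longrightarrow> is_free_resolution R M F \<Longrightarrow> chain_map F Q (\<lambda>k x. \<psi> k (\<phi> k x))"
  unfolding chain_map_def
proof (intro conjI allI ballI)
  fix k assume *: "(\<forall>k. linear_map R (obj F k) (obj P k) (\<phi> k)) \<and> (\<forall>k. \<forall>x\<in>carrier (obj F (Suc k)). bd P k (\<phi> (Suc k) x) = \<phi> k (bd F k x))"
    "(\<forall>k. linear_map R (obj P k) (obj Q k) (\<psi> k)) \<and> (\<forall>k. \<forall>x\<in>carrier (obj P (Suc k)). bd Q k (\<psi> (Suc k) x) = \<psi> k (bd P k x))"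
  then show "linear_map R (obj F k) (obj Q k) (\<lambda>x. \<psi> k (\<phi> k x))" using linear_map_comp by blast
  fix x assume x: "x \<in> carrier (obj F (Suc k))"
  then have "\<phi> (Suc k) x \<in> carrier (obj P (Suc k))" using * linear_map_closed by metis
  then show "bd Q k (\<psi> (Suc k) (\<phi> (Suc k) x)) = \<psi> k (\<phi> k (bd F k x))" using * x by simp
qed

lemma chain_map_id: "chain_map F F (\<lambda>k x. x)"
  unfolding chain_map_def using linear_map_id by blast

text \<open>\<open>Tor\<close> is computed from a resolution chosen by description, and this allows
  any other to take its place. The chain maps \<open>\<phi>\<close> and \<open>\<psi>\<close> are
  inverse up to homotopy, hence bijective on homology modulo \<open>J\<close>, and the cover is
  pushed along \<open>\<phi>\<close>.\<close>

lemma resolution_transfer: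
  assumes M: "module R M" and J: "J \<subseteq> carrier R" and F: "is_free_resolution R M F" and P: "is_free_resolution R M P"
    and c: "covers R ((obj F k)\<lparr>carrier := mod_cycles J F k\<rparr>) T q (mod_boundaries J F k)"
  shows "\<exists>q'. covers R ((obj P k)\<lparr>carrier := mod_cycles J P k\<rparr>) T q' (mod_boundaries J P k)"
proof -
  obtain \<epsilon> \<epsilon>' where e: "augmentation M F \<epsilon>" "augmentation M P \<epsilon>'" using resolutionD(6)[OF F] resolutionD(6)[OF P] by blast
  obtain \<phi> where \<phi>: "chain_map F P \<phi>" "\<And>x. x \<in> carrier (obj F 0) \<Longrightarrow> \<epsilon>' (\<phi> 0 x) = \<epsilon> x"
    using comparison_exists[OF M F P e] by blast
  obtain \<psi> where \<psi>: "chain_map P F \<psi>" "\<And>x. x \<in> carrier (obj P 0) \<Longrightarrow> \<epsilon> (\<psi> 0 x) = \<epsilon>' x"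
    using comparison_exists[OF M P F e(2,1)] by blast
  have \<phi>0: "\<phi> 0 x \<in> carrier (obj P 0)" if "x \<in> carrier (obj F 0)" for x by (rule linear_map_closed[OF chain_mapD(1)[OF \<phi>(1)] that])
  have \<psi>0: "\<psi> 0 x \<in> carrier (obj F 0)" if "x \<in> carrier (obj P 0)" for x by (rule linear_map_closed[OF chain_mapD(1)[OF \<psi>(1)] that])
  have 1: "\<epsilon> (\<psi> 0 (\<phi> 0 x)) = \<epsilon> x" if "x \<in> carrier (obj F 0)" for x using \<phi>(2) \<psi>(2) \<phi>0 that by simp
  have 2: "\<epsilon>' x = \<epsilon>' (\<phi> 0 (\<psi> 0 x))" if "x \<in> carrier (obj P 0)" for x using \<phi>(2) \<psi>(2) \<psi>0 that by simp
  obtain h g where h: "\<And>k. linear_map R (obj F k) (obj F (Suc k)) (h k)"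
    "\<And>k x. x \<in> carrier (obj F k) \<Longrightarrow> \<psi> k (\<phi> k x) \<ominus>\<^bsub>obj F k\<^esub> x = bd F k (h k x) \<oplus>\<^bsub>obj F k\<^esub> g k x"
    "\<And>x. g 0 x = \<zero>\<^bsub>obj F 0\<^esub>" "\<And>k x. g (Suc k) x = h k (bd F k x)"
    by (rule homotopy_exists[where u = "\<lambda>k x. \<psi> k (\<phi> k x)" and v = "\<lambda>k x. x",
        OF M F F e(1) chain_map_comp[OF \<phi>(1) \<psi>(1) F] chain_map_id]) (erule 1, blast)
  obtain h' g' where h': "\<And>k. linear_map R (obj P k) (obj P (Suc k)) (h' k)"
    "\<And>k x. x \<in> carrier (obj P k) \<Longrightarrow> x \<ominus>\<^bsub>obj P k\<^esub> \<phi> k (\<psi> k x) = bd P k (h' k x) \<oplus>\<^bsub>obj P k\<^esub> g' k x"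
    "\<And>x. g' 0 x = \<zero>\<^bsub>obj P 0\<^esub>" "\<And>k x. g' (Suc k) x = h' k (bd P k x)"
    by (rule homotopy_exists[where v = "\<lambda>k x. \<phi> k (\<psi> k x)" and u = "\<lambda>k x. x",
        OF M P P e(2) chain_map_id chain_map_comp[OF \<psi>(1) \<phi>(1) P]]) (erule 2, blast)
  note m = resolutionD(2)[OF F] resolutionD(2)[OF P]
  note ZF = mod_cycles_submodule[OF J F, of k] and ZP = mod_cycles_submodule[OF J P, of k]
  note BF = mod_boundaries_submodule[OF J F, of k] and BP = mod_boundaries_submodule[OF J P, of k]
  let ?WF = "(obj F k)\<lparr>carrier := mod_cycles J F k\<rparr>" and ?WP = "(obj P k)\<lparr>carrier := mod_cycles J P k\<rparr>"
  note WF = submodule.submodule_is_module[OF ZF m(1)] and WP = submodule.submodule_is_module[OF ZP m(2)]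
  have BF0: "\<zero>\<^bsub>?WF\<^esub> \<in> mod_boundaries J F k" using module.submodule_zero[OF m(1) BF] by simp
  have BP': "submodule (mod_boundaries J P k) R ?WP"
    by (rule submodule_restrict[OF m(2) ZP BP mod_boundaries_cycles[OF J P]])
  have g: "linear_map R ?WF ?WP (\<phi> k)"
  proof (rule linear_mapI)
    note Fc = subsetD[OF module.submoduleE(1)[OF m(1) ZF]]
    note l = linear_mapD[OF chain_mapD(1)[OF \<phi>(1), of k]]
    show "\<phi> k x \<in> carrier ?WP" if "x \<in> carrier ?WF" for x using chain_map_mod(1)[OF J F P \<phi>(1), of x k] that by simp
    show "\<phi> k (x \<oplus>\<^bsub>?WF\<^esub> y) = \<phi> k x \<oplus>\<^bsub>?WP\<^esub> \<phi> k y" if "x \<in> carrier ?WF" "y \<in> carrier ?WF" for x y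
      using l(2)[of x y] Fc that by simp
    show "\<phi> k (r \<odot>\<^bsub>?WF\<^esub> x) = r \<odot>\<^bsub>?WP\<^esub> \<phi> k x" if "r \<in> carrier R" "x \<in> carrier ?WF" for r x
      using l(3)[of r x] Fc that by simp
  qed
  show ?thesis
  proof (rule covers_pushforward[OF WF WP g c BF0 BP'])
    fix w assume "w \<in> carrier ?WF"
    then have w: "w \<in> mod_cycles J F k" by simp
    then have wc: "w \<in> carrier (obj F k)" by (simp add: mod_cycles_def)
    note pw = linear_map_closed[OF chain_mapD(1)[OF \<phi>(1)] wc]
    note ppw = linear_map_closed[OF chain_mapD(1)[OF \<psi>(1)] pw]
    have "\<psi> k (\<phi> k w) \<ominus>\<^bsub>obj F k\<^esub> w \<in> mod_boundaries J F k"
      by (rule homotopic_mod_boundaries[OF J F F h(1), of "\<lambda>k w. \<psi> k (\<phi> k w) \<ominus>\<^bsub>obj F k\<^esub> w", OF h(2,3,4) w])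
    then have "\<psi> k (\<phi> k w) \<in> mod_boundaries J F k \<longleftrightarrow> w \<in> mod_boundaries J F k"
      by (rule module.submodule_diff_trans[OF m(1) BF _ ppw wc])
    then show "\<phi> k w \<in> mod_boundaries J P k \<longleftrightarrow> w \<in> mod_boundaries J F k"
      using chain_map_mod(2)[OF J F P \<phi>(1)] chain_map_mod(2)[OF J P F \<psi>(1)] by blast
  next
    fix v assume "v \<in> carrier ?WP"
    then have v: "v \<in> mod_cycles J P k" by simp
    note pv = chain_map_mod(1)[OF J P F \<psi>(1) v]
    have "v \<ominus>\<^bsub>obj P k\<^esub> \<phi> k (\<psi> k v) \<in> mod_boundaries J P k"
      by (rule homotopic_mod_boundaries[OF J P P h'(1), of "\<lambda>k v. v \<ominus>\<^bsub>obj P k\<^esub> \<phi> k (\<psi> k v)", OF h'(2,3,4) v])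
    then have "v \<ominus>\<^bsub>?WP\<^esub> \<phi> k (\<psi> k v) \<in> mod_boundaries J P k"
      unfolding submodule_minus_restrict[OF m(2) ZP v chain_map_mod(1)[OF J F P \<phi>(1) pv]] .
    then show "\<exists>w\<in>carrier ?WF. v \<ominus>\<^bsub>?WP\<^esub> \<phi> k w \<in> mod_boundaries J P k" using pv by (intro bexI[of _ "\<psi> k v"]) simp_all
  qed
qed

end

section \<open>Tor as Koszul homology\<close>

context concrete_ring
begin

text \<open>\<open>M \<otimes> R / I\<close> is \<open>M / I M\<close>. For surjectivity the second
  factor is moved into the first; for the kernel a map back to \<open>M / I M\<close> is built that
  multiplies by a representative of the second factor.\<close>

lemma tensor_cyc_covers:
  assumes I: "ideal I R" and M: "module R M"
  shows "covers R M (tensor R M (cyc I)) (\<lambda>m. pure_tensor R M (cyc I) (m, cls I 1)) (ideal_mult I M)"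
proof -
  note N = cyc_module[OF I]
  let ?T = "tensor R M (cyc I)"
  let ?p = "\<lambda>m. pure_tensor R M (cyc I) (m, cls I 1)"
  interpret M: module R M by (rule M)
  interpret C: module R "cyc I" by (rule N)
  interpret T: module R ?T by (rule tensor_module[OF M N])
  interpret MT: module_pair R M ?T by (rule module_pair.intro[OF M T.module_axioms'])
  note Ic = idealE(3)[OF I]
  have IR: "I \<subseteq> carrier R" using Ic by blast
  have c1: "cls I 1 \<in> carrier (cyc I)" by (rule cls_closed[OF I R_closed(2)])
  have lin: "linear_map R M ?T ?p"
    by (rule linear_mapI)
      (simp_all add: pure_tensor_closed[OF M N _ c1] pure_tensor_add_left[OF M N _ _ c1] pure_tensor_smult_left[OF M N _ _ c1])
  have sw: "pure_tensor R M (cyc I) (m, cls I r) = ?p (r \<odot>\<^bsub>M\<^esub> m)" if "m \<in> carrier M" "r \<in> carrier R" for m r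
    unfolding cls_one_smult[OF I that(2)] pure_tensor_smult_right[OF M N that(2,1) c1] pure_tensor_smult_left[OF M N that(2,1) c1] ..
  have im: "?p ` carrier M = carrier ?T"
  proof (rule tensor_generated[OF M N])
    show "submodule (?p ` carrier M) R ?T" by (rule MT.submodule_image[OF lin M.carrier_is_submodule])
    fix m y assume m: "m \<in> carrier M" and y: "y \<in> carrier (cyc I)"
    note r = rep[OF I y]
    have "pure_tensor R M (cyc I) (m, y) = ?p (rep I y \<odot>\<^bsub>M\<^esub> m)" using sw[OF m r(1)] unfolding r(2) .
    then show "pure_tensor R M (cyc I) (m, y) \<in> ?p ` carrier M" using M.smult_closed[OF r(1) m] by (rule image_eqI)
  qed
  have k1: "ideal_mult I M \<subseteq> {m \<in> carrier M. ?p m = \<zero>\<^bsub>?T\<^esub>}"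
    unfolding ideal_mult_def
  proof (rule submodule_span_least[OF MT.submodule_kernel[OF lin]], rule subsetI)
    fix y assume "y \<in> {j \<odot>\<^bsub>M\<^esub> m |j m. j \<in> I \<and> m \<in> carrier M}"
    then obtain j m where y: "y = j \<odot>\<^bsub>M\<^esub> m" "j \<in> I" "m \<in> carrier M" by blast
    note jc = Ic[OF y(2)]
    have "cls I j = \<zero> \<odot>\<^bsub>cyc I\<^esub> cls I 1"
      using cls_zero_iff[OF I jc] y(2) C.smult_l_null[OF c1] by simp
    then have "?p y = pure_tensor R M (cyc I) (m, \<zero> \<odot>\<^bsub>cyc I\<^esub> cls I 1)"
      unfolding y(1) sw[OF y(3) jc, symmetric] by simp
    also have "\<dots> = \<zero>\<^bsub>?T\<^esub>"
      unfolding pure_tensor_smult_right[OF M N zero_closed y(3) c1] by (rule T.smult_l_null[OF pure_tensor_closed[OF M N y(3) c1]])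
    finally show "y \<in> {m \<in> carrier M. ?p m = \<zero>\<^bsub>?T\<^esub>}" using y jc by simp
  qed
  note JM = ideal_mult_submodule[OF M IR]
  let ?Q = "quotient_module M (ideal_mult I M)"
  let ?c = "\<lambda>m. ideal_mult I M +>\<^bsub>M\<^esub> m"
  note cQ = covers_quotient[OF M JM]
  note Q = quotient_module_module[OF M JM]
  interpret Q: module R ?Q by (rule Q)
  note cl = linear_mapD[OF coversD'(1)[OF cQ]]
  have ceq: "?c (r \<odot>\<^bsub>M\<^esub> m) = ?c (s \<odot>\<^bsub>M\<^esub> m)" if "cls I r = cls I s" "r \<in> carrier R" "s \<in> carrier R" "m \<in> carrier M" for r s m
  proof -
    have "r - s \<in> I" using cls_eq_iff[OF I that(2,3)] that(1) by simp
    then have "(r - s) \<odot>\<^bsub>M\<^esub> m \<in> {j \<odot>\<^bsub>M\<^esub> m |j m. j \<in> I \<and> m \<in> carrier M}" using that(4) by blast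
    then have 1: "(r - s) \<odot>\<^bsub>M\<^esub> m \<in> ideal_mult I M" unfolding ideal_mult_def by (rule subsetD[OF submodule_span_superset])
    have "r \<oplus> (\<ominus> s) = r - s" by (simp add: ops R_a_inv[OF that(3)])
    then have "(r - s) \<odot>\<^bsub>M\<^esub> m = (r \<odot>\<^bsub>M\<^esub> m) \<ominus>\<^bsub>M\<^esub> (s \<odot>\<^bsub>M\<^esub> m)"
      using M.smult_l_distr[OF that(2) a_inv_closed[OF that(3)] that(4)] M.smult_l_minus[OF that(3,4)]
      by (simp add: a_minus_def)
    then show ?thesis
      using 1 covers_eq_iff[OF M cQ M.submodule_zero[OF JM] M.smult_closed[OF that(2,4)] M.smult_closed[OF that(3,4)]] by simp
  qed
  define \<phi> where "\<phi> = (\<lambda>(m, y). ?c (rep I y \<odot>\<^bsub>M\<^esub> m))"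
  have \<phi>c: "\<phi> (m, y) \<in> carrier ?Q" if "m \<in> carrier M" "y \<in> carrier (cyc I)" for m y
    unfolding \<phi>_def using cl(1)[OF M.smult_closed[OF rep(1)[OF I that(2)] that(1)]] by simp
  note sm = M.smult_closed
  have 1: "\<phi> (m \<oplus>\<^bsub>M\<^esub> m', y) = \<phi> (m, y) \<oplus>\<^bsub>?Q\<^esub> \<phi> (m', y)"
    if "m \<in> carrier M" "m' \<in> carrier M" "y \<in> carrier (cyc I)" for m m' y
  proof -
    note r = rep(1)[OF I that(3)]
    show ?thesis unfolding \<phi>_def prod.case M.smult_r_distr[OF r that(1,2)] by (rule cl(2)[OF sm[OF r that(1)] sm[OF r that(2)]])
  qed
  have 2: "\<phi> (m, y \<oplus>\<^bsub>cyc I\<^esub> y') = \<phi> (m, y) \<oplus>\<^bsub>?Q\<^esub> \<phi> (m, y')"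
    if "m \<in> carrier M" "y \<in> carrier (cyc I)" "y' \<in> carrier (cyc I)" for m y y'
  proof -
    note r = rep[OF I that(2)] rep[OF I that(3)] rep[OF I C.a_closed[OF that(2,3)]]
    have "cls I (rep I (y \<oplus>\<^bsub>cyc I\<^esub> y')) = cls I (rep I y + rep I y')" unfolding cls_add[OF I r(1,3)] r(2,4,6) ..
    then have "?c (rep I (y \<oplus>\<^bsub>cyc I\<^esub> y') \<odot>\<^bsub>M\<^esub> m) = ?c ((rep I y + rep I y') \<odot>\<^bsub>M\<^esub> m)"
      by (rule ceq[OF _ r(5) R_closed(3)[OF r(1,3)] that(1)])
    also have "(rep I y + rep I y') \<odot>\<^bsub>M\<^esub> m = (rep I y \<odot>\<^bsub>M\<^esub> m) \<oplus>\<^bsub>M\<^esub> (rep I y' \<odot>\<^bsub>M\<^esub> m)"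
      using M.smult_l_distr[OF r(1,3) that(1)] by (simp add: ops)
    also have "?c \<dots> = ?c (rep I y \<odot>\<^bsub>M\<^esub> m) \<oplus>\<^bsub>?Q\<^esub> ?c (rep I y' \<odot>\<^bsub>M\<^esub> m)"
      by (rule cl(2)[OF sm[OF r(1) that(1)] sm[OF r(3) that(1)]])
    finally show ?thesis unfolding \<phi>_def prod.case .
  qed
  have 3: "\<phi> (r \<odot>\<^bsub>M\<^esub> m, y) = r \<odot>\<^bsub>?Q\<^esub> \<phi> (m, y)"
    if "r \<in> carrier R" "m \<in> carrier M" "y \<in> carrier (cyc I)" for r m y
  proof -
    note s = rep(1)[OF I that(3)]
    have "rep I y \<odot>\<^bsub>M\<^esub> (r \<odot>\<^bsub>M\<^esub> m) = r \<odot>\<^bsub>M\<^esub> (rep I y \<odot>\<^bsub>M\<^esub> m)"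
      unfolding M.smult_assoc1[OF s that(1,2), symmetric] M.smult_assoc1[OF that(1) s that(2), symmetric] m_comm[OF s that(1)] ..
    then show ?thesis unfolding \<phi>_def prod.case using cl(3)[OF that(1) sm[OF s that(2)]] by simp
  qed
  have 4: "\<phi> (m, r \<odot>\<^bsub>cyc I\<^esub> y) = r \<odot>\<^bsub>?Q\<^esub> \<phi> (m, y)"
    if "r \<in> carrier R" "m \<in> carrier M" "y \<in> carrier (cyc I)" for r m y
  proof -
    note s = rep[OF I that(3)] rep[OF I C.smult_closed[OF that(1,3)]]
    have "cls I (rep I (r \<odot>\<^bsub>cyc I\<^esub> y)) = cls I (r * rep I y)" unfolding cls_mult[OF I that(1) s(1)] s(2,4) ..
    then have "?c (rep I (r \<odot>\<^bsub>cyc I\<^esub> y) \<odot>\<^bsub>M\<^esub> m) = ?c ((r * rep I y) \<odot>\<^bsub>M\<^esub> m)"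
      by (rule ceq[OF _ s(3) R_closed(4)[OF that(1) s(1)] that(2)])
    also have "(r * rep I y) \<odot>\<^bsub>M\<^esub> m = r \<odot>\<^bsub>M\<^esub> (rep I y \<odot>\<^bsub>M\<^esub> m)"
      using M.smult_assoc1[OF that(1) s(1) that(2)] by (simp add: ops)
    also have "?c \<dots> = r \<odot>\<^bsub>?Q\<^esub> ?c (rep I y \<odot>\<^bsub>M\<^esub> m)" by (rule cl(3)[OF that(1) sm[OF s(1) that(2)]])
    finally show ?thesis unfolding \<phi>_def prod.case .
  qed
  note L = tensor_lift[OF M N Q, of \<phi>, OF \<phi>c 1 2 3 4]
  define h where "h = presented_map R (tensor_gens M (cyc I)) ?Q \<phi>"
  have h: "linear_map R ?T ?Q h" unfolding h_def by (rule L(1)) assumption+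
  have hp: "h (?p m) = ?c m" if m: "m \<in> carrier M" for m
  proof -
    have "h (?p m) = \<phi> (m, cls I 1)" unfolding h_def by (rule L(2)[OF _ _ _ _ _ _ _ _ _ _ _ _ _ _ m c1]) assumption+
    also have "\<dots> = ?c (\<one> \<odot>\<^bsub>M\<^esub> m)" unfolding \<phi>_def prod.case
      by (rule ceq[OF _ rep(1)[OF I c1] one_closed m]) (simp add: rep(2)[OF I c1] ops)
    finally show ?thesis using m by simp
  qed
  interpret TQ: module_pair R ?T ?Q by (rule module_pair.intro[OF T.module_axioms' Q])
  have k2: "m \<in> ideal_mult I M" if "m \<in> carrier M" "?p m = \<zero>\<^bsub>?T\<^esub>" for m
    using hp[OF that(1)] coversD'(3)[OF cQ that(1)] unfolding that(2) TQ.linear_map_zero[OF h] by simp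
  show ?thesis unfolding covers_def using lin im k1 k2 by blast
qed

text \<open>The basis elements of the resolution in \<open>Tor\<close> have a prescribed type, so
  the subsets of \<open>X\<close> enter through an injection \<open>enc\<close> into that
  type.\<close>

definition koszul_gens :: "'i set \<Rightarrow> ('i set \<Rightarrow> 'g) \<Rightarrow> nat \<Rightarrow> 'g set"
  where "koszul_gens X enc k = enc ` {A. A \<subseteq> X \<and> card A = k}"

definition to_kos :: "'i set \<Rightarrow> ('i set \<Rightarrow> 'g) \<Rightarrow> nat \<Rightarrow> ('g \<Rightarrow> 'r) \<Rightarrow> 'i set \<Rightarrow> 'r"
  where "to_kos X enc k f A = (if A \<subseteq> X \<and> card A = k then f (enc A) else 0)"

definition of_kos :: "'i set \<Rightarrow> ('i set \<Rightarrow> 'g) \<Rightarrow> nat \<Rightarrow> ('i set \<Rightarrow> 'r) \<Rightarrow> 'g \<Rightarrow> 'r"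
  where "of_kos X enc k z = (\<lambda>g\<in>koszul_gens X enc k. z (inv_into (Pow X) enc g))"

definition koszul_resolution ::
  "'i::linorder set \<Rightarrow> ('i \<Rightarrow> 'r) \<Rightarrow> ('i set \<Rightarrow> 'g) \<Rightarrow> ('r, 'g \<Rightarrow> 'r) chain_complex"
  where "koszul_resolution X x enc = \<lparr>obj = (\<lambda>k. free_module R (koszul_gens X enc k)),
    bd = (\<lambda>k f. of_kos X enc k (kd X x (to_kos X enc (Suc k) f)))\<rparr>"

context
  fixes X :: "'i::linorder set" and x :: "'i \<Rightarrow> 'r" and enc :: "'i set \<Rightarrow> 'g"
  assumes fX: "finite X" and xc: "x \<in> X \<rightarrow> carrier R" and enc: "inj_on enc (Pow X)"
begin

abbreviation "kgens \<equiv> koszul_gens X enc"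
abbreviation "tok \<equiv> to_kos X enc"
abbreviation "unk \<equiv> of_kos X enc"
abbreviation "kres \<equiv> koszul_resolution X x enc"

lemma kres_simps: "obj kres k = free_module R (kgens k)" "bd kres k f = unk k (kd X x (tok (Suc k) f))"
  by (simp_all add: koszul_resolution_def)

lemma finite_kgens: "finite (kgens k)"
  unfolding koszul_gens_def by (rule finite_imageI) (rule finite_subset[of _ "Pow X"]; use fX in auto)

lemma inv_enc: "A \<subseteq> X \<Longrightarrow> inv_into (Pow X) enc (enc A) = A"
  using enc by (simp add: inv_into_f_f)

lemma unk_closed:
  assumes "z \<in> carrier (kosk X k)"
  shows "unk k z \<in> carrier (free_module R (kgens k))"
  by (rule free_module_carrierI) (use assms finite_kgens in \<open>simp_all add: of_kos_def kosk_simps kos_simps\<close>)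

lemma tok_closed:
  assumes "f \<in> carrier (free_module R (kgens k))"
  shows "tok k f \<in> carrier (kosk X k)"
  using free_module_carrierD(1)[OF assms]
  by (auto simp: to_kos_def kosk_simps kos_simps R_closed koszul_gens_def)

lemma tok_unk:
  assumes "z \<in> carrier (kosk X k)"
  shows "tok k (unk k z) = z"
proof
  fix A
  show "tok k (unk k z) A = z A"
    using assms inv_enc[of A] by (auto simp: to_kos_def of_kos_def koszul_gens_def kosk_simps kos_simps)
qed

lemma unk_tok:
  assumes "f \<in> carrier (free_module R (kgens k))"
  shows "unk k (tok k f) = f"
proof (rule extensionalityI[of _ "kgens k"])
  show "f \<in> extensional (kgens k)" by (rule free_module_carrierD(4)[OF assms])
  fix g assume g: "g \<in> kgens k"
  then obtain A where "g = enc A" "A \<subseteq> X" "card A = k" unfolding koszul_gens_def by blast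
  then show "unk k (tok k f) g = f g" using g inv_enc by (simp add: of_kos_def to_kos_def)
qed (simp add: of_kos_def)

lemma tok_linear: "linear_map R (free_module R (kgens k)) (kosk X k) (tok k)"
proof (rule linear_mapI)
  have e: "enc A \<in> kgens k" if "A \<subseteq> X" "card A = k" for A using that unfolding koszul_gens_def by blast
  show "tok k (f \<oplus>\<^bsub>free_module R (kgens k)\<^esub> g) = tok k f \<oplus>\<^bsub>kosk X k\<^esub> tok k g" for f g
    by (auto simp: to_kos_def kosk_simps free_module_simps ops fun_eq_iff e)
  show "tok k (r \<odot>\<^bsub>free_module R (kgens k)\<^esub> f) = r \<odot>\<^bsub>kosk X k\<^esub> tok k f" for r f
    by (auto simp: to_kos_def kosk_simps free_module_simps ops fun_eq_iff e)
qed (rule tok_closed)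

lemma unk_linear: "linear_map R (kosk X k) (free_module R (kgens k)) (unk k)"
  by (rule linear_mapI, erule unk_closed)
    (auto simp: of_kos_def kosk_simps(2-) free_module_simps ops fun_eq_iff restrict_def)

lemma kd_linear_kosk: "linear_map R (kosk X (Suc k)) (kosk X k) (kd X x)"
  by (rule linear_mapI) (auto simp: kd_closed_kosk[OF fX xc] kosk_simps(2-) kd_add[OF fX xc] kd_smult[OF fX xc])

lemma kres_bd_linear: "linear_map R (obj kres (Suc k)) (obj kres k) (bd kres k)"
  unfolding koszul_resolution_def chain_complex.simps
  by (rule linear_map_comp[OF linear_map_comp[OF tok_linear kd_linear_kosk] unk_linear])

lemma tok_bd:
  assumes "f \<in> carrier (obj kres (Suc k))"
  shows "tok k (bd kres k f) = kd X x (tok (Suc k) f)"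
  unfolding kres_simps
  by (rule tok_unk[OF kd_closed_kosk[OF fX xc tok_closed]]) (use assms in \<open>simp add: kres_simps\<close>)

lemma tok_eq_iff:
  assumes "f \<in> carrier (obj kres k)" "g \<in> carrier (obj kres k)"
  shows "tok k f = tok k g \<longleftrightarrow> f = g"
  using unk_tok[of f k] unk_tok[of g k] assms unfolding kres_simps by metis

lemma tok_zero: "tok k \<zero>\<^bsub>obj kres k\<^esub> = (\<lambda>_. 0)"
  by (auto simp: to_kos_def kres_simps free_module_simps ops fun_eq_iff koszul_gens_def)

text \<open>The premise says that the total Koszul homology is \<open>R / L\<close>, read off at the
  coefficient of \<open>{}\<close>: a cycle bounds if and only if that coefficient lies in
  \<open>L\<close>. In positive degree the coefficient is zero, which yields exactness; in degree 0
  it yields the augmentation.\<close>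

lemma kres_resolution:
  assumes L: "ideal L R"
    and cov: "covers R (HZ X x {0}) (cyc L) (\<lambda>z. cls L (z {})) (HB X x {0})"
  shows "is_free_resolution R (cyc L) kres"
proof -
  have ex: "\<exists>w\<in>carrier (kos X). z = kd X x w" if z: "z \<in> carrier (kos X)" "kd X x z = (\<lambda>_. 0)" "z {} \<in> L" for z
  proof -
    have "z \<in> carrier (HZ X x {0})" using z by (simp add: HZ_simps)
    moreover have "z {} \<in> carrier R" using z(1) by (simp add: kos_simps)
    ultimately have "z \<in> HB X x {0}" using coversD'(3)[OF cov, of z] cls_zero_iff[OF L, of "z {}"] z(3) by simp
    then show ?thesis unfolding HB_def by (auto simp: fun_eq_iff)
  qed
  have bdL: "kd X x w {} \<in> L" if w: "w \<in> carrier (kos X)" for w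
  proof -
    have kw: "kd X x w \<in> carrier (kos X)" by (rule kd_closed[OF fX xc w])
    have "kd X x w \<in> HB X x {0}" unfolding HB_def using kw w by auto
    then have "cls L (kd X x w {}) = \<zero>\<^bsub>cyc L\<^esub>"
      using coversD'(3)[OF cov, of "kd X x w"] coversD'(4)[OF cov] by blast
    then show ?thesis using cls_zero_iff[OF L, of "kd X x w {}"] kw by (simp add: kos_simps)
  qed
  have cb: "f \<in> chain_boundaries kres k \<longleftrightarrow> (\<exists>w\<in>carrier (kos X). tok k f = kd X x w)"
    if f: "f \<in> carrier (obj kres k)" for f k
  proof
    assume "f \<in> chain_boundaries kres k"
    then obtain v where v: "v \<in> carrier (obj kres (Suc k))" "f = bd kres k v" unfolding chain_boundaries_def by blast
    have "tok k f = kd X x (tok (Suc k) v)" unfolding v(2) by (rule tok_bd[OF v(1)])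
    moreover have "tok (Suc k) v \<in> carrier (kos X)" using tok_closed[of v "Suc k"] v(1) by (simp add: kres_simps kosk_simps)
    ultimately show "\<exists>w\<in>carrier (kos X). tok k f = kd X x w" by blast
  next
    assume "\<exists>w\<in>carrier (kos X). tok k f = kd X x w"
    then obtain w where w: "w \<in> carrier (kos X)" "tok k f = kd X x w" by blast
    have tf: "tok k f \<in> carrier (kosk X k)" using tok_closed f by (simp add: kres_simps)
    \<comment> \<open>\<open>w\<close> comes from the total complex and may be inhomogeneous; only
      its part of degree \<open>Suc k\<close> contributes to degree \<open>k\<close>.\<close>
    note gw = gr_closed[OF w(1), of "Suc k"]
    let ?v = "unk (Suc k) (gr (Suc k) w)"
    have v: "?v \<in> carrier (obj kres (Suc k))" unfolding kres_simps by (rule unk_closed[OF gw])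
    have "tok k (bd kres k ?v) = kd X x (gr (Suc k) w)" unfolding tok_bd[OF v] tok_unk[OF gw] ..
    also have "\<dots> = gr k (tok k f)" unfolding kd_gr[OF fX w(1)] w(2) ..
    also have "\<dots> = tok k f" by (rule gr_eq[OF tf])
    finally have "f = bd kres k ?v"
      using tok_eq_iff[OF linear_map_closed[OF kres_bd_linear v] f] by simp
    then show "f \<in> chain_boundaries kres k" unfolding chain_boundaries_def using v by blast
  qed
  have sub: "chain_boundaries kres k \<subseteq> carrier (obj kres k)" for k
    unfolding chain_boundaries_def using linear_map_closed[OF kres_bd_linear] by blast
  have cyc: "f \<in> chain_cycles kres (Suc k) \<longleftrightarrow> kd X x (tok (Suc k) f) = (\<lambda>_. 0)"
    if f: "f \<in> carrier (obj kres (Suc k))" for f k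
  proof -
    interpret Fk: module R "obj kres k" unfolding kres_simps by (rule free_module_module)
    have "f \<in> chain_cycles kres (Suc k) \<longleftrightarrow> bd kres k f = \<zero>\<^bsub>obj kres k\<^esub>" using f by simp
    also have "\<dots> \<longleftrightarrow> tok k (bd kres k f) = tok k \<zero>\<^bsub>obj kres k\<^esub>"
      using tok_eq_iff[OF linear_map_closed[OF kres_bd_linear f] Fk.zero_closed] by simp
    finally show ?thesis unfolding tok_bd[OF f] tok_zero .
  qed
  have tk: "tok k f \<in> carrier (kos X)" if "f \<in> carrier (obj kres k)" for f k
    using tok_closed[of f k] that by (simp add: kres_simps kosk_simps)
  have exact: "chain_boundaries kres (Suc k) = chain_cycles kres (Suc k)" for k
  proof (rule Set.set_eqI)
    fix f
    have "f \<in> chain_boundaries kres (Suc k) \<longleftrightarrow> f \<in> chain_cycles kres (Suc k)" if f: "f \<in> carrier (obj kres (Suc k))"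
    proof -
      have t0: "tok (Suc k) f {} \<in> L" by (simp add: to_kos_def idealE(1)[OF L])
      have "(\<exists>w\<in>carrier (kos X). tok (Suc k) f = kd X x w) \<longleftrightarrow> kd X x (tok (Suc k) f) = (\<lambda>_. 0)"
        using ex[OF tk[OF f] _ t0] kd_kd[OF fX xc] by metis
      then show ?thesis unfolding cb[OF f] cyc[OF f] .
    qed
    then show "f \<in> chain_boundaries kres (Suc k) \<longleftrightarrow> f \<in> chain_cycles kres (Suc k)"
      using sub[of "Suc k"] by (auto simp del: chain_cycles.simps) (auto)
  qed
  have augmented: "\<exists>\<epsilon>. linear_map R (obj kres 0) (cyc L) \<epsilon> \<and> \<epsilon> ` carrier (obj kres 0) = carrier (cyc L) \<and>
         {f \<in> carrier (obj kres 0). \<epsilon> f = \<zero>\<^bsub>cyc L\<^esub>} = chain_boundaries kres 0"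
  proof (intro exI[of _ "\<lambda>f. cls L (tok 0 f {})"] conjI)
    have l: "linear_map R (obj kres 0) (regular_module R) (\<lambda>f. tok 0 f {})"
      unfolding kres_simps
    proof (rule linear_mapI)
      note t = linear_mapD[OF tok_linear[of 0]]
      show "tok 0 f {} \<in> carrier (regular_module R)" if "f \<in> carrier (free_module R (kgens 0))" for f
        using t(1)[OF that] by (simp add: kosk_simps kos_simps regular_module_simps)
    qed (simp_all add: linear_map_add[OF tok_linear] linear_map_smult[OF tok_linear] kosk_simps regular_module_simps ops)
    show "linear_map R (obj kres 0) (cyc L) (\<lambda>f. cls L (tok 0 f {}))"
      by (rule linear_map_comp[OF l coversD'(1)[OF cls_covers[OF L]]])
    show "(\<lambda>f. cls L (tok 0 f {})) ` carrier (obj kres 0) = carrier (cyc L)"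
    proof (intro subset_antisym subsetI)
      fix y assume y: "y \<in> carrier (cyc L)"
      note r = rep[OF L y]
      have z: "(\<lambda>A. if A = {} then rep L y else 0) \<in> carrier (kosk X 0)"
        using r(1) by (auto simp: kosk_simps kos_simps R_closed)
      have "y = cls L (tok 0 (unk 0 (\<lambda>A. if A = {} then rep L y else 0)) {})" unfolding tok_unk[OF z] using r(2) by simp
      then show "y \<in> (\<lambda>f. cls L (tok 0 f {})) ` carrier (obj kres 0)"
        unfolding kres_simps using unk_closed[OF z] by blast
    next
      fix y assume "y \<in> (\<lambda>f. cls L (tok 0 f {})) ` carrier (obj kres 0)"
      then obtain f where f: "y = cls L (tok 0 f {})" "f \<in> carrier (obj kres 0)" by blast
      have "tok 0 f {} \<in> carrier R" using tk[OF f(2)] by (simp add: kos_simps)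
      then show "y \<in> carrier (cyc L)" unfolding f(1) by (rule cls_closed[OF L])
    qed
    show "{f \<in> carrier (obj kres 0). cls L (tok 0 f {}) = \<zero>\<^bsub>cyc L\<^esub>} = chain_boundaries kres 0"
    proof (rule Set.set_eqI)
      fix f
      have "f \<in> chain_boundaries kres 0 \<longleftrightarrow> cls L (tok 0 f {}) = \<zero>\<^bsub>cyc L\<^esub>" if f: "f \<in> carrier (obj kres 0)"
      proof -
        have tR: "tok 0 f {} \<in> carrier R" using tk[OF f] by (simp add: kos_simps)
        have tf: "tok 0 f \<in> carrier (kosk X 0)" using tok_closed f by (simp add: kres_simps)
        have d0: "kd X x (tok 0 f) = (\<lambda>_. 0)" using kd_gr_0[OF fX tk[OF f]] gr_eq[OF tf] by simp
        show ?thesis unfolding cb[OF f] cls_zero_iff[OF L tR] using ex[OF tk[OF f] d0] bdL by (intro iffI) (auto simp: fun_eq_iff)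
      qed
      then show "f \<in> {f \<in> carrier (obj kres 0). cls L (tok 0 f {}) = \<zero>\<^bsub>cyc L\<^esub>} \<longleftrightarrow> f \<in> chain_boundaries kres 0"
        using sub[of 0] by auto
    qed
  qed
  show ?thesis
    unfolding is_free_resolution_def
  proof (intro conjI allI)
    show "\<exists>G. obj kres k = free_module R G" for k by (rule exI) (rule kres_simps(1))
  qed (rule kres_bd_linear exact augmented)+
qed

text \<open>In a free module the multiples by \<open>J\<close> span the elements with all
  coordinates in \<open>J\<close>; for the converse direction the element is expanded in the
  basis.\<close>

lemma ideal_mult_kres:
  assumes J: "ideal J R" and f: "f \<in> carrier (obj kres k)"
  shows "f \<in> ideal_mult J (obj kres k) \<longleftrightarrow> tok k f \<in> kBk X J k"
proof
  let ?F = "free_module R (kgens k)"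
  interpret F: module R ?F by (rule free_module_module)
  note Jc = idealE[OF J]
  have JR: "J \<subseteq> carrier R" using Jc(3) by blast
  have fF: "f \<in> carrier ?F" using f by (simp add: kres_simps)
  have fc: "tok k f \<in> carrier (kosk X k)" by (rule tok_closed[OF fF])
  {
    assume m: "f \<in> ideal_mult J (obj kres k)"
    have "ideal_mult J ?F \<subseteq> {f \<in> carrier ?F. \<forall>g\<in>kgens k. f g \<in> J}"
      unfolding ideal_mult_def
    proof (rule submodule_span_least)
      show "submodule {f \<in> carrier ?F. \<forall>g\<in>kgens k. f g \<in> J} R ?F"
      proof (rule F.submoduleI')
        fix a b assume "a \<in> {f \<in> carrier ?F. \<forall>g\<in>kgens k. f g \<in> J}" "b \<in> {f \<in> carrier ?F. \<forall>g\<in>kgens k. f g \<in> J}"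
        then show "a \<oplus>\<^bsub>?F\<^esub> b \<in> {f \<in> carrier ?F. \<forall>g\<in>kgens k. f g \<in> J}"
          using F.a_closed[of a b] Jc(2) by (simp add: free_module_simps ops)
      next
        fix a b assume "a \<in> carrier R" "b \<in> {f \<in> carrier ?F. \<forall>g\<in>kgens k. f g \<in> J}"
        then show "a \<odot>\<^bsub>?F\<^esub> b \<in> {f \<in> carrier ?F. \<forall>g\<in>kgens k. f g \<in> J}"
          using F.smult_closed[of a b] Jc(6) by (simp add: free_module_simps ops)
      next
        show "\<zero>\<^bsub>?F\<^esub> \<in> {f \<in> carrier ?F. \<forall>g\<in>kgens k. f g \<in> J}"
          using F.zero_closed Jc(1) by (simp add: free_module_simps ops)
      qed simp
      show "{j \<odot>\<^bsub>?F\<^esub> m |j m. j \<in> J \<and> m \<in> carrier ?F} \<subseteq> {f \<in> carrier ?F. \<forall>g\<in>kgens k. f g \<in> J}"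
      proof
        fix y assume "y \<in> {j \<odot>\<^bsub>?F\<^esub> m |j m. j \<in> J \<and> m \<in> carrier ?F}"
        then obtain j m where y: "y = j \<odot>\<^bsub>?F\<^esub> m" "j \<in> J" "m \<in> carrier ?F" by blast
        have "y \<in> carrier ?F" unfolding y(1) by (rule F.smult_closed[OF Jc(3)[OF y(2)] y(3)])
        moreover have "\<forall>g\<in>kgens k. y g \<in> J"
          unfolding y(1) using Jc(7) free_module_carrierD(1)[OF y(3)] y(2) by (simp add: free_module_simps ops)
        ultimately show "y \<in> {f \<in> carrier ?F. \<forall>g\<in>kgens k. f g \<in> J}" by blast
      qed
    qed
    then have "\<forall>g\<in>kgens k. f g \<in> J" using m unfolding kres_simps by blast
    then show "tok k f \<in> kBk X J k" using fc Jc(1) by (simp add: kBk_def to_kos_def koszul_gens_def)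
  }
  assume t: "tok k f \<in> kBk X J k"
  have fJ: "f g \<in> J" if "g \<in> kgens k" for g
  proof -
    obtain A where A: "g = enc A" "A \<subseteq> X" "card A = k" using \<open>g \<in> kgens k\<close> unfolding koszul_gens_def by blast
    then have "tok k f A = f g" by (simp add: to_kos_def)
    then show ?thesis using t unfolding kBk_def by (simp add: kosk_simps) metis
  qed
  have gc: "f g \<odot>\<^bsub>?F\<^esub> free_gen R (kgens k) g \<in> ideal_mult J ?F" if "g \<in> kgens k" for g
  proof -
    have "f g \<odot>\<^bsub>?F\<^esub> free_gen R (kgens k) g \<in> {j \<odot>\<^bsub>?F\<^esub> m |j m. j \<in> J \<and> m \<in> carrier ?F}"
      using fJ[OF that] free_gen_closed[OF that] by blast
    then show ?thesis unfolding ideal_mult_def by (rule subsetD[OF submodule_span_superset])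
  qed
  have "lin_ext (kgens k) ?F (free_gen R (kgens k)) f \<in> ideal_mult J ?F"
    by (rule F.submodule_finsum[OF ideal_mult_submodule[OF F.module_axioms' JR]]) (use gc in auto)
  then show "f \<in> ideal_mult J (obj kres k)" unfolding free_module_expand[OF fF] kres_simps .
qed

end

text \<open>Finitely many sets can be told apart by the length of a list, whatever the type of its
  entries.\<close>

lemma exists_list_encoding:
  assumes "finite X"
  shows "\<exists>enc :: 'i set \<Rightarrow> ('a + 'b) list. inj_on enc (Pow X)"
proof -
  have "finite (Pow X)" using assms by simp
  then obtain e :: "'i set \<Rightarrow> nat" where e: "inj_on e (Pow X)"
    using finite_imp_inj_to_nat_seg by metis
  have "inj_on (\<lambda>A. replicate (e A) (undefined :: 'a + 'b)) (Pow X)"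
    by (rule inj_onI) (metis e inj_onD length_replicate)
  then show ?thesis by blast
qed

text \<open>The Koszul resolution shows that the choice in \<open>free_resolution\<close> succeeds.
  Homology computed from the chosen \<open>F\<close> is transferred to the Koszul resolution, where
  cycles and boundaries modulo \<open>J\<close> are those of the Koszul complex.\<close>

theorem kh_total_Tor:
  fixes X :: "'i::linorder set"
  assumes fX: "finite X" and xc: "x \<in> X \<rightarrow> carrier R" and L: "ideal L R" and J: "ideal J R"
    and cov: "covers R (HZ X x {0}) (cyc L) (\<lambda>z. cls L (z {})) (HB X x {0})"
  shows "kh X x J (total_Tor R (cyc L) (cyc J))"
  unfolding total_Tor_def
proof (rule kh_total[OF fX xc J])
  fix k
  obtain enc :: "'i set \<Rightarrow> ('r set + 'r) list" where enc: "inj_on enc (Pow X)"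
    using exists_list_encoding[OF fX] by blast
  let ?P = "koszul_resolution X x enc"
  have P: "is_free_resolution R (cyc L) ?P" by (rule kres_resolution[OF fX xc enc L cov])
  define F where "F = free_resolution R (cyc L)"
  have F: "is_free_resolution R (cyc L) F" unfolding F_def free_resolution_def by (rule someI[of _ ?P]) (rule P)
  have JR: "J \<subseteq> carrier R" using idealE(3)[OF J] by blast
  note f = resolutionD[OF F]
  note im = ideal_mult_submodule[OF f(2) JR]
  let ?C = "tensor_complex_module R F (cyc J)"
  have "\<exists>q. covers R ((obj F k)\<lparr>carrier := {w \<in> carrier (obj F k). \<forall>j. k = Suc j \<longrightarrow> bd F j w \<in> ideal_mult J (obj F j)}\<rparr>)
     (homology_module ?C k) q {bd F k v \<oplus>\<^bsub>obj F k\<^esub> b | v b. v \<in> carrier (obj F (Suc k)) \<and> b \<in> ideal_mult J (obj F k)}"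
  proof (rule homology_covers[where p = "\<lambda>k m. pure_tensor R (obj F k) (cyc J) (m, cls J 1)"])
    show "covers R (obj F k) (obj ?C k) (\<lambda>m. pure_tensor R (obj F k) (cyc J) (m, cls J 1)) (ideal_mult J (obj F k))" for k
      unfolding tensor_complex_module_def chain_complex.simps by (rule tensor_cyc_covers[OF J f(2)])
    show "\<zero>\<^bsub>obj F k\<^esub> \<in> ideal_mult J (obj F k)" for k by (rule module.submodule_zero[OF f(2) im])
    show "bd ?C k (pure_tensor R (obj F (Suc k)) (cyc J) (w, cls J 1)) = pure_tensor R (obj F k) (cyc J) (bd F k w, cls J 1)"
      if "w \<in> carrier (obj F (Suc k))" for k w
      unfolding tensor_complex_module_def chain_complex.simps
      by (rule tensor_map(2)[OF f(2) f(2) cyc_module[OF J] f(3) that cls_closed[OF J R_closed(2)]])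
    show "bd F k (bd F (Suc k) w) \<in> ideal_mult J (obj F k)" if "w \<in> carrier (obj F (Suc (Suc k)))" for k w
      unfolding f(4)[OF that] by (rule module.submodule_zero[OF f(2) im])
  qed (rule f)+
  then obtain q where q: "covers R ((obj F k)\<lparr>carrier := mod_cycles J F k\<rparr>) (homology_module ?C k) q (mod_boundaries J F k)"
    unfolding mod_cycles_def mod_boundaries_def by blast
  obtain q' where q': "covers R ((obj ?P k)\<lparr>carrier := mod_cycles J ?P k\<rparr>) (homology_module ?C k) q' (mod_boundaries J ?P k)"
    using resolution_transfer[OF cyc_module[OF L] JR F P q] by blast
  note p = resolutionD[OF P]
  note simps = kres_simps[OF fX xc enc]
  note ZP = mod_cycles_submodule[OF JR P, of k] and BP = mod_boundaries_submodule[OF JR P, of k]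
  let ?t = "to_kos X enc"
  let ?W = "(obj ?P k)\<lparr>carrier := mod_cycles J ?P k\<rparr>"
  let ?Z' = "{w \<in> carrier (kosk X k). \<forall>j. k = Suc j \<longrightarrow> kd X x w \<in> kBk X J j}"
  let ?B' = "{kd X x v \<oplus>\<^bsub>kosk X k\<^esub> b | v b. v \<in> carrier (kosk X (Suc k)) \<and> b \<in> kBk X J k}"
  interpret PK: module_pair R "obj ?P k" "kosk X k" by (rule module_pair.intro) (rule p(2) kosk_module)+
  have tl: "linear_map R (obj ?P k) (kosk X k) (?t k)" for k unfolding simps by (rule tok_linear[OF fX xc enc])
  have tc: "?t k f \<in> carrier (kosk X k)" if "f \<in> carrier (obj ?P k)" for k f by (rule linear_map_closed[OF tl that])
  have uc: "of_kos X enc k z \<in> carrier (obj ?P k)" "?t k (of_kos X enc k z) = z" if "z \<in> carrier (kosk X k)" for k z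
    using unk_closed[OF fX xc enc that] tok_unk[OF fX xc enc that] unfolding simps by auto
  have Z: "?t k ` mod_cycles J ?P k = ?Z'"
  proof -
    have *: "f \<in> mod_cycles J ?P k \<longleftrightarrow> ?t k f \<in> ?Z'" if f: "f \<in> carrier (obj ?P k)" for f
    proof -
      have "bd ?P j f \<in> ideal_mult J (obj ?P j) \<longleftrightarrow> kd X x (?t k f) \<in> kBk X J j" if k: "k = Suc j" for j
        using ideal_mult_kres[OF fX xc enc J linear_map_closed[OF p(3) f[unfolded k]]] tok_bd[OF fX xc enc f[unfolded k]]
        unfolding k by simp
      then show ?thesis unfolding mod_cycles_def using f tc[OF f] by auto
    qed
    show ?thesis
    proof (intro subset_antisym subsetI)
      fix z assume "z \<in> ?t k ` mod_cycles J ?P k"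
      then obtain f where "f \<in> mod_cycles J ?P k" "z = ?t k f" by blast
      then show "z \<in> ?Z'" using * PK.M.submoduleE(1)[OF ZP] by blast
    next
      fix z assume z: "z \<in> ?Z'"
      then have zk: "z \<in> carrier (kosk X k)" by simp
      have "of_kos X enc k z \<in> mod_cycles J ?P k" using *[OF uc(1)[OF zk]] z unfolding uc(2)[OF zk] by blast
      then show "z \<in> ?t k ` mod_cycles J ?P k" using uc(2)[OF zk] by (metis imageI)
    qed
  qed
  have B: "?t k ` mod_boundaries J ?P k = ?B'"
  proof (intro subset_antisym subsetI)
    fix z assume "z \<in> ?t k ` mod_boundaries J ?P k"
    then obtain v b where v: "z = ?t k (bd ?P k v \<oplus>\<^bsub>obj ?P k\<^esub> b)" "v \<in> carrier (obj ?P (Suc k))" "b \<in> ideal_mult J (obj ?P k)"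
      unfolding mod_boundaries_def by blast
    have b: "b \<in> carrier (obj ?P k)" using v(3) PK.M.submoduleE(1)[OF ideal_mult_submodule[OF p(2) JR]] by blast
    have "z = kd X x (?t (Suc k) v) \<oplus>\<^bsub>kosk X k\<^esub> ?t k b"
      unfolding v(1) linear_map_add[OF tl linear_map_closed[OF p(3) v(2)] b] tok_bd[OF fX xc enc v(2)] ..
    moreover have "?t k b \<in> kBk X J k" using ideal_mult_kres[OF fX xc enc J b] v(3) by blast
    ultimately show "z \<in> ?B'" using tc[OF v(2)] by blast
  next
    fix z assume "z \<in> ?B'"
    then obtain v b where v: "z = kd X x v \<oplus>\<^bsub>kosk X k\<^esub> b" "v \<in> carrier (kosk X (Suc k))" "b \<in> kBk X J k" by blast
    have b: "b \<in> carrier (kosk X k)" using v(3) by (simp add: kBk_def)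
    let ?v = "of_kos X enc (Suc k) v" and ?b = "of_kos X enc k b"
    note uv = uc[OF v(2)] and ub = uc[OF b]
    have "?t k (bd ?P k ?v \<oplus>\<^bsub>obj ?P k\<^esub> ?b) = z"
      unfolding v(1) linear_map_add[OF tl linear_map_closed[OF p(3) uv(1)] ub(1)] tok_bd[OF fX xc enc uv(1)] uv(2) ub(2) ..
    moreover have "?b \<in> ideal_mult J (obj ?P k)" using ideal_mult_kres[OF fX xc enc J ub(1)] v(3) unfolding ub(2) by blast
    then have "bd ?P k ?v \<oplus>\<^bsub>obj ?P k\<^esub> ?b \<in> mod_boundaries J ?P k" unfolding mod_boundaries_def using uv(1) by blast
    ultimately show "z \<in> ?t k ` mod_boundaries J ?P k" by (metis imageI)
  qed
  have Z's: "submodule ?Z' R (kosk X k)" unfolding Z[symmetric] by (rule PK.submodule_image[OF tl ZP])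
  have B's: "submodule ?B' R (kosk X k)" unfolding B[symmetric] by (rule PK.submodule_image[OF tl BP])
  have BZ: "?B' \<subseteq> ?Z'" unfolding B[symmetric] Z[symmetric] by (rule image_mono[OF mod_boundaries_cycles[OF JR P]])
  let ?W' = "(kosk X k)\<lparr>carrier := ?Z'\<rparr>"
  note W = submodule.submodule_is_module[OF ZP p(2)] and W' = submodule.submodule_is_module[OF Z's kosk_module]
  have g: "linear_map R ?W ?W' (?t k)"
  proof (rule linear_mapI)
    note Pc = subsetD[OF PK.M.submoduleE(1)[OF ZP]]
    show "?t k x \<in> carrier ?W'" if "x \<in> carrier ?W" for x using Z that by auto
    show "?t k (x \<oplus>\<^bsub>?W\<^esub> y) = ?t k x \<oplus>\<^bsub>?W'\<^esub> ?t k y" if "x \<in> carrier ?W" "y \<in> carrier ?W" for x y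
      using linear_map_add[OF tl Pc Pc, of x y] that by simp
    show "?t k (r \<odot>\<^bsub>?W\<^esub> x) = r \<odot>\<^bsub>?W'\<^esub> ?t k x" if "r \<in> carrier R" "x \<in> carrier ?W" for r x
      using linear_map_smult[OF tl that(1) Pc, of x] that by simp
  qed
  have z0: "\<zero>\<^bsub>?W\<^esub> \<in> mod_boundaries J ?P k" using PK.M.submodule_zero[OF BP] by simp
  have "\<exists>p'. covers R ?W' (homology_module ?C k) p' ?B'"
  proof (rule covers_pushforward[OF W W' g q' z0 submodule_restrict[OF kosk_module Z's B's BZ]])
    fix w assume "w \<in> carrier ?W"
    then have w: "w \<in> carrier (obj ?P k)" using PK.M.submoduleE(1)[OF ZP] by auto
    show "?t k w \<in> ?B' \<longleftrightarrow> w \<in> mod_boundaries J ?P k"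
      unfolding B[symmetric]
    proof
      assume "?t k w \<in> ?t k ` mod_boundaries J ?P k"
      then obtain u where u: "u \<in> mod_boundaries J ?P k" "?t k w = ?t k u" by blast
      have "u \<in> carrier (obj ?P k)" using u(1) PK.M.submoduleE(1)[OF BP] by blast
      then show "w \<in> mod_boundaries J ?P k" using tok_eq_iff[OF fX xc enc w] u by blast
    qed (rule imageI)
  next
    interpret W': module R ?W' by (rule W')
    fix v assume v: "v \<in> carrier ?W'"
    then have "v \<in> ?t k ` mod_cycles J ?P k" unfolding Z by simp
    then obtain w where w: "w \<in> mod_cycles J ?P k" "v = ?t k w" by blast
    have "v \<ominus>\<^bsub>?W'\<^esub> ?t k w = \<zero>\<^bsub>?W'\<^esub>" using W'.minus_eq_zero_iff[OF v v] w(2) by simp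
    also have "\<dots> \<in> ?B'" using PK.N.submodule_zero[OF B's] by simp
    finally show "\<exists>w\<in>carrier ?W. v \<ominus>\<^bsub>?W'\<^esub> ?t k w \<in> ?B'" using w(1) by (intro bexI[of _ w]) simp_all
  qed
  then show "\<exists>q. covers R ?W' (Tor R (cyc L) (cyc J) k) q ?B'"
    unfolding Tor_def F_def .
qed

end

section \<open>The exterior algebra of a free module\<close>

context concrete_ring
begin

text \<open>Left exterior multiplication by the vector with coordinates \<open>a\<close>. The
  coefficient functions \<open>kos F\<close>, which served as Koszul chains so far, are here a model
  of the exterior algebra of a free module with basis \<open>F\<close>.\<close>

definition wedge :: "'i::linorder set \<Rightarrow> ('i \<Rightarrow> 'r) \<Rightarrow> ('i set \<Rightarrow> 'r) \<Rightarrow> 'i set \<Rightarrow> 'r"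
  where "wedge F a z B = (\<Sum>i\<in>B \<inter> F. ksgn i (B - {i}) * a i * z (B - {i}))"

context
  fixes F :: "'i::linorder set"
  assumes fF: "finite F"
begin

lemma wedge_closed:
  assumes a: "a \<in> F \<rightarrow> carrier R" and z: "z \<in> carrier (kos F)"
  shows "wedge F a z \<in> carrier (kos F)"
  unfolding kos_simps
proof (intro conjI allI impI)
  fix B
  show "wedge F a z B \<in> carrier R" unfolding wedge_def
    by (rule R_sum_closed) (use z Pi_mem[OF a] in \<open>auto simp: kos_simps R_closed ksgn_closed\<close>)
  assume B: "\<not> B \<subseteq> F"
  have "z (B - {i}) = 0" if "i \<in> F" for i
  proof -
    have "\<not> B - {i} \<subseteq> F" using B that by blast
    then show ?thesis using z by (simp add: kos_simps)
  qed
  then show "wedge F a z B = 0" unfolding wedge_def by (intro sum.neutral) auto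
qed

lemma wedge_add: "wedge F a (\<lambda>B. z B + z' B) = (\<lambda>B. wedge F a z B + wedge F a z' B)"
  by (simp add: wedge_def fun_eq_iff algebra_simps sum.distrib)

lemma wedge_smult: "wedge F a (\<lambda>B. r * z B) = (\<lambda>B. r * wedge F a z B)"
  by (simp add: wedge_def fun_eq_iff algebra_simps sum_distrib_left)

lemma wedge_add_left: "wedge F (\<lambda>i. a i + b i) z = (\<lambda>B. wedge F a z B + wedge F b z B)"
  by (simp add: wedge_def fun_eq_iff algebra_simps sum.distrib)

lemma wedge_smult_left: "wedge F (\<lambda>i. r * a i) z = (\<lambda>B. r * wedge F a z B)"
  by (simp add: wedge_def fun_eq_iff algebra_simps sum_distrib_left)

lemma wedge_cong: "(\<And>i. i \<in> F \<Longrightarrow> a i = b i) \<Longrightarrow> wedge F a z = wedge F b z"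
  by (simp add: wedge_def fun_eq_iff)

text \<open>Dual to \<open>kd_kd\<close>: two elements are removed from \<open>B\<close> instead of
  being added, with the same cancellation in pairs.\<close>

lemma wedge_wedge:
  assumes z: "z \<in> carrier (kos F)"
  shows "wedge F a (wedge F a z) = (\<lambda>_. 0)"
proof
  fix B
  let ?D = "B \<inter> F"
  let ?f = "\<lambda>i j. ksgn i (B - {i}) * a i * (ksgn j (B - {i} - {j}) * a j * z (B - {i} - {j}))"
  have "wedge F a (wedge F a z) B = (\<Sum>i\<in>?D. \<Sum>j\<in>?D - {i}. ?f i j)"
    unfolding wedge_def sum_distrib_left by (intro sum.cong) auto
  also have "\<dots> = 0"
  proof (rule antisymmetric_sum)
    show "finite ?D" using fF by simp
    fix i j assume ij: "i \<in> ?D" "j \<in> ?D" "i \<noteq> j"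
    define A where "A = B - {i, j}"
    have A: "i \<notin> A" "j \<notin> A" "B - {i} = insert j A" "B - {j} = insert i A" "insert j A - {j} = A" "insert i A - {i} = A"
      using ij by (auto simp: A_def)
    show "?f i j + ?f j i = 0"
    proof (cases "A \<subseteq> F")
      case True
      then have fA: "finite A" using rev_finite_subset[OF fF] by simp
      have "?f i j = (ksgn j A * ksgn i (insert j A)) * (a i * a j * z A)"
        unfolding A by (simp add: algebra_simps)
      also have "ksgn j A * ksgn i (insert j A) = - (ksgn i A * ksgn j (insert i A))"
        by (rule ksgn_swap[OF fA A(2,1)]) (use ij in auto)
      finally show ?thesis unfolding A by (simp add: algebra_simps)
    next
      case False
      then show ?thesis using z unfolding A by (simp add: kos_simps)
    qed
  qed
  finally show "wedge F a (wedge F a z) B = 0" .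
qed

definition kunit :: "'i set \<Rightarrow> 'i set \<Rightarrow> 'r"
  where "kunit B C = (if C = B then 1 else 0)"

lemma kunit_closed: "B \<subseteq> F \<Longrightarrow> kunit B \<in> carrier (kos F)"
  by (auto simp: kunit_def kos_simps R_closed)

lemma wedge_kunit:
  assumes B: "B \<subseteq> F" and i: "i \<in> F" and lt: "\<And>j. j \<in> B \<Longrightarrow> i < j"
  shows "wedge F (\<lambda>j. if j = i then 1 else 0) (kunit B) = kunit (insert i B)"
proof
  fix C
  have "wedge F (\<lambda>j. if j = i then 1 else 0) (kunit B) C
    = (\<Sum>j\<in>C \<inter> F. if j = i then ksgn i (C - {i}) * kunit B (C - {i}) else 0)"
    unfolding wedge_def by (rule sum.cong) auto
  also have "\<dots> = (if i \<in> C then ksgn i (C - {i}) * kunit B (C - {i}) else 0)"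
    using i fF by (simp add: sum.delta)
  also have "\<dots> = kunit (insert i B) C"
  proof -
    have iB: "i \<notin> B" using lt by blast
    have "{h \<in> B. h < i} = {}" using lt by fastforce
    then have "ksgn i B = 1" by (simp only: ksgn_def card.empty power_0)
    moreover have "C - {i} = B \<longleftrightarrow> C = insert i B" if "i \<in> C" using that iB by auto
    ultimately show ?thesis using iB by (auto simp: kunit_def)
  qed
  finally show "wedge F (\<lambda>j. if j = i then 1 else 0) (kunit B) C = kunit (insert i B) C" .
qed

section \<open>A basis of the exterior algebra\<close>

context
  fixes G :: "'g set" and g :: "'i \<Rightarrow> 'g"
  assumes g: "bij_betw g F G"
begin

abbreviation "V \<equiv> free_module R G"

definition wedges :: "('g \<Rightarrow> 'r) list \<Rightarrow> ('i set \<Rightarrow> 'r) \<Rightarrow> 'i set \<Rightarrow> 'r"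
  where "wedges vs z = foldr (\<lambda>v. wedge F (\<lambda>i. v (g i))) vs z"

lemma V_module: "module R V" by (rule free_module_module)

lemma gG: "i \<in> F \<Longrightarrow> g i \<in> G" using g by (auto simp: bij_betw_def)

lemma coef_closed: "v \<in> carrier V \<Longrightarrow> (\<lambda>i. v (g i)) \<in> F \<rightarrow> carrier R"
  by (intro Pi_I free_module_carrierD(1)[where G = G] gG)

lemma wedges_closed:
  "vs \<in> lists (carrier V) \<Longrightarrow> z \<in> carrier (kos F) \<Longrightarrow> wedges vs z \<in> carrier (kos F)"
  by (induction vs) (auto simp: wedges_def intro!: wedge_closed dest: coef_closed)

lemma wedges_add: "wedges vs (\<lambda>B. z B + z' B) = (\<lambda>B. wedges vs z B + wedges vs z' B)"
  by (induction vs) (simp_all add: wedges_def wedge_add)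

lemma wedges_smult: "wedges vs (\<lambda>B. r * z B) = (\<lambda>B. r * wedges vs z B)"
  by (induction vs) (simp_all add: wedges_def wedge_smult)

lemma wedges_append: "wedges (us @ v # vs) z = wedges us (wedge F (\<lambda>i. v (g i)) (wedges vs z))"
  by (simp add: wedges_def)

lemma wedges_zero: "wedges vs (\<lambda>_. 0) = (\<lambda>_. 0)"
  using wedges_smult[of vs 0 "\<lambda>_. 0"] by simp

abbreviation "Ext \<equiv> exterior_algebra R V"
abbreviation "eg \<equiv> presented_gen R (lists (carrier V)) (exterior_rels R V)"

lemma Ext_module: "module R Ext" by (rule exterior_module[OF V_module])

text \<open>A list of vectors acts on the unit of \<open>kos F\<close> by successive multiplication.
  These coordinates are what shows that the increasing wedges of basis vectors are
  independent.\<close>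

lemma ext_coordinates:
  obtains h where "linear_map R Ext (kos F) h" "\<And>vs. vs \<in> lists (carrier V) \<Longrightarrow> h (eg vs) = wedges vs (kunit {})"
proof -
  have u: "kunit {} \<in> carrier (kos F)" by (rule kunit_closed) simp
  show ?thesis
  proof (rule exterior_lift[OF V_module kos_module[of F], of "\<lambda>vs. wedges vs (kunit {})"])
    show "wedges vs (kunit {}) \<in> carrier (kos F)" if "vs \<in> lists (carrier V)" for vs
      by (rule wedges_closed[OF that u])
  next
    fix us vs x y assume "us \<in> lists (carrier V)" "vs \<in> lists (carrier V)" "x \<in> carrier V" "y \<in> carrier V"
    have "wedge F (\<lambda>i. (x \<oplus>\<^bsub>V\<^esub> y) (g i)) z = (\<lambda>B. wedge F (\<lambda>i. x (g i)) z B + wedge F (\<lambda>i. y (g i)) z B)" for z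
      unfolding wedge_add_left[symmetric] by (rule wedge_cong) (simp add: free_module_simps ops gG)
    then show "wedges (us @ (x \<oplus>\<^bsub>V\<^esub> y) # vs) (kunit {}) = wedges (us @ x # vs) (kunit {}) \<oplus>\<^bsub>kos F\<^esub> wedges (us @ y # vs) (kunit {})"
      by (simp add: wedges_append wedges_add kos_simps)
  next
    fix r us vs x assume "r \<in> carrier R" "us \<in> lists (carrier V)" "vs \<in> lists (carrier V)" "x \<in> carrier V"
    have "wedge F (\<lambda>i. (r \<odot>\<^bsub>V\<^esub> x) (g i)) z = (\<lambda>B. r * wedge F (\<lambda>i. x (g i)) z B)" for z
      unfolding wedge_smult_left[symmetric] by (rule wedge_cong) (simp add: free_module_simps ops gG)
    then show "wedges (us @ (r \<odot>\<^bsub>V\<^esub> x) # vs) (kunit {}) = r \<odot>\<^bsub>kos F\<^esub> wedges (us @ x # vs) (kunit {})"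
      by (simp add: wedges_append wedges_smult kos_simps)
  next
    fix us vs x assume "us \<in> lists (carrier V)" and vs: "vs \<in> lists (carrier V)" and "x \<in> carrier V"
    have "wedges (us @ x # x # vs) (kunit {}) = wedges us (wedge F (\<lambda>i. x (g i)) (wedge F (\<lambda>i. x (g i)) (wedges vs (kunit {}))))"
      by (simp add: wedges_def)
    also have "\<dots> = \<zero>\<^bsub>kos F\<^esub>" unfolding wedge_wedge[OF wedges_closed[OF vs u]] wedges_zero kos_simps ..
    finally show "wedges (us @ x # x # vs) (kunit {}) = \<zero>\<^bsub>kos F\<^esub>" .
  qed (use that in blast)
qed

definition dvec :: "'i \<Rightarrow> 'g \<Rightarrow> 'r" where "dvec i = free_gen R G (g i)"

lemma dvec_closed: "i \<in> F \<Longrightarrow> dvec i \<in> carrier V"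
  unfolding dvec_def by (rule free_gen_closed[OF gG])

lemma dvec_list: "set is \<subseteq> F \<Longrightarrow> map dvec is \<in> lists (carrier V)"
  unfolding in_lists_conv_set using dvec_closed by fastforce

lemma dvec_coef:
  assumes "i \<in> F" "j \<in> F"
  shows "dvec i (g j) = (if j = i then 1 else 0)"
proof -
  have "g j = g i \<longleftrightarrow> j = i" using g assms unfolding bij_betw_def by (auto dest: inj_onD)
  then show ?thesis using gG[OF assms(2)] by (simp add: dvec_def free_gen_def ops)
qed

lemma wedges_dvec:
  assumes "sorted_wrt (<) is" "set is \<subseteq> F"
  shows "wedges (map dvec is) (kunit {}) = kunit (set is)"
  using assms
proof (induction "is")
  case (Cons i "is")
  have "wedges (map dvec (i # is)) (kunit {}) = wedge F (\<lambda>j. dvec i (g j)) (kunit (set is))"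
    using Cons by (simp add: wedges_def)
  also have "\<dots> = wedge F (\<lambda>j. if j = i then 1 else 0) (kunit (set is))"
    by (rule wedge_cong) (use Cons dvec_coef in auto)
  also have "\<dots> = kunit (insert i (set is))" by (rule wedge_kunit) (use Cons in auto)
  finally show ?case by simp
qed (simp add: wedges_def)

definition ebasis :: "'i set \<Rightarrow> (('g \<Rightarrow> 'r) list \<Rightarrow> 'r) set"
  where "ebasis B = eg (map dvec (sorted_list_of_set B))"

lemma ebasis_closed: "B \<subseteq> F \<Longrightarrow> ebasis B \<in> carrier Ext"
  unfolding ebasis_def using finite_subset[OF _ fF] by (intro ext_gen_closed[OF V_module] dvec_list) simp

text \<open>Expand the square of \<open>x + y\<close>.\<close>

lemma ext_gen_swap:
  assumes us: "us \<in> lists (carrier V)" and vs: "vs \<in> lists (carrier V)" and x: "x \<in> carrier V" and y: "y \<in> carrier V"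
  shows "eg (us @ x # y # vs) = \<ominus>\<^bsub>Ext\<^esub> eg (us @ y # x # vs)"
proof -
  interpret E: module R Ext by (rule Ext_module)
  interpret V: module R V by (rule V_module)
  note a = ext_gen_add[OF V_module] and q = ext_gen_square[OF V_module]
  have c: "eg (us @ p # r # vs) \<in> carrier Ext" if "p \<in> carrier V" "r \<in> carrier V" for p r
    by (rule ext_gen_closed[OF V_module]) (use us vs that in auto)
  have usx: "us @ [p] \<in> lists (carrier V)" if "p \<in> carrier V" for p using us that by simp
  have xvs: "p # vs \<in> lists (carrier V)" if "p \<in> carrier V" for p using vs that by simp
  have 1: "eg (us @ p # (x \<oplus>\<^bsub>V\<^esub> y) # vs) = eg (us @ p # x # vs) \<oplus>\<^bsub>Ext\<^esub> eg (us @ p # y # vs)" if "p \<in> carrier V" for p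
    using a[OF usx[OF that] vs x y] by simp
  have "\<zero>\<^bsub>Ext\<^esub> = eg (us @ (x \<oplus>\<^bsub>V\<^esub> y) # (x \<oplus>\<^bsub>V\<^esub> y) # vs)"
    by (rule q[OF us vs V.a_closed[OF x y], symmetric])
  also have "\<dots> = eg (us @ x # (x \<oplus>\<^bsub>V\<^esub> y) # vs) \<oplus>\<^bsub>Ext\<^esub> eg (us @ y # (x \<oplus>\<^bsub>V\<^esub> y) # vs)"
    by (rule a[OF us xvs[OF V.a_closed[OF x y]] x y])
  also have "\<dots> = eg (us @ x # y # vs) \<oplus>\<^bsub>Ext\<^esub> eg (us @ y # x # vs)"
    unfolding 1[OF x] 1[OF y] q[OF us vs x] q[OF us vs y] using c[OF x y] c[OF y x] by simp
  finally have "eg (us @ x # y # vs) \<oplus>\<^bsub>Ext\<^esub> eg (us @ y # x # vs) = \<zero>\<^bsub>Ext\<^esub>" by simp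
  then show ?thesis by (rule E.minus_equality[OF _ c[OF y x] c[OF x y], symmetric])
qed

text \<open>Insertion sort: \<open>i\<close> moves to the right past smaller elements, each move
  costing a sign, until the list is increasing or \<open>i\<close> meets itself and the product
  vanishes. \<open>us\<close> holds the elements already passed.\<close>

lemma insert_in_submodule:
  assumes H: "submodule H R Ext" and eb: "\<And>B. B \<subseteq> F \<Longrightarrow> ebasis B \<in> H" and i: "i \<in> F"
  shows "sorted_wrt (<) (us @ xs) \<Longrightarrow> set (us @ xs) \<subseteq> F \<Longrightarrow> (\<And>u. u \<in> set us \<Longrightarrow> u < i) \<Longrightarrow>
    eg (map dvec (us @ i # xs)) \<in> H"
proof (induction xs arbitrary: us)
  interpret E: module R Ext by (rule Ext_module)
  have so: "eg (map dvec is) \<in> H" if "sorted_wrt (<) is" "set is \<subseteq> F" for "is"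
    using eb[OF that(2)] that(1) unfolding ebasis_def
    by (simp add: sorted_list_of_set.idem_if_sorted_distinct strict_sorted_iff)
  {
    case Nil
    then show ?case using i by (intro so) (auto simp: sorted_wrt_append)
  next
    case (Cons x xs)
    have x: "x \<in> F" using Cons.prems by simp
    have us: "map dvec us \<in> lists (carrier V)" and xs: "map dvec xs \<in> lists (carrier V)"
      by (rule dvec_list; use Cons.prems in simp)+
    consider "i < x" | "i = x" | "x < i" by fastforce
    then show ?case
    proof cases
      case 1
      then show ?thesis using i Cons.prems by (intro so) (fastforce simp: sorted_wrt_append)+
    next
      case 2
      then show ?thesis
        using ext_gen_square[OF V_module us xs dvec_closed[OF x]] E.submodule_zero[OF H] by simp
    next
      case 3
      have "eg (map dvec ((us @ [x]) @ i # xs)) \<in> H"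
        by (rule Cons.IH) (use Cons.prems 3 in auto)
      then have "eg (map dvec us @ dvec x # dvec i # map dvec xs) \<in> H" by simp
      then show ?thesis
        using ext_gen_swap[OF us xs dvec_closed[OF i] dvec_closed[OF x]] E.submoduleE(3)[OF H] by simp
    qed
  }
qed

text \<open>The span \<open>S\<close> of the increasing wedges is stable under left multiplication
  by basis vectors, by \<open>insert_in_submodule\<close>, hence by linearity under multiplication
  by any vector, and so it contains the class of every list.\<close>

lemma ebasis_spans:
  assumes H: "submodule H R Ext" and eb: "\<And>B. B \<subseteq> F \<Longrightarrow> ebasis B \<in> H"
  shows "H = carrier Ext"
proof -
  interpret E: module R Ext by (rule Ext_module)
  interpret V: module R V by (rule V_module)
  define S where "S = submodule_span R Ext (ebasis ` Pow F)"
  have Sc: "ebasis ` Pow F \<subseteq> carrier Ext" using ebasis_closed by auto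
  have S: "submodule S R Ext" unfolding S_def by (rule submodule_span_submodule[OF Ext_module Sc])
  have Se: "ebasis B \<in> S" if "B \<subseteq> F" for B
    unfolding S_def by (rule subsetD[OF submodule_span_superset]) (use that in blast)
  \<comment> \<open>Left multiplication by \<open>v\<close> as a linear endomorphism, so that
    stability of \<open>S\<close> can be tested on the wedges that span it.\<close>
  have mult: "\<exists>L. linear_map R Ext Ext L \<and> (\<forall>vs\<in>lists (carrier V). L (eg vs) = eg (v # vs))" if v: "v \<in> carrier V" for v
  proof (rule exterior_lift[OF V_module Ext_module, of "\<lambda>vs. eg (v # vs)"])
    note vv = Cons_in_lists_iff[THEN iffD2, OF conjI[OF v]]
    show "eg (v # xs) \<in> carrier Ext" if "xs \<in> lists (carrier V)" for xs
      by (rule ext_gen_closed[OF V_module vv[OF that]])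
    show "eg (v # us @ (x \<oplus>\<^bsub>V\<^esub> y) # vs) = eg (v # us @ x # vs) \<oplus>\<^bsub>Ext\<^esub> eg (v # us @ y # vs)"
      if "us \<in> lists (carrier V)" "vs \<in> lists (carrier V)" "x \<in> carrier V" "y \<in> carrier V" for us vs x y
      using ext_gen_add[OF V_module vv[OF that(1)] that(2-4)] by simp
    show "eg (v # us @ (r \<odot>\<^bsub>V\<^esub> x) # vs) = r \<odot>\<^bsub>Ext\<^esub> eg (v # us @ x # vs)"
      if "r \<in> carrier R" "us \<in> lists (carrier V)" "vs \<in> lists (carrier V)" "x \<in> carrier V" for r us vs x
      using ext_gen_smult[OF V_module vv[OF that(2)] that(3,1,4)] by simp
    show "eg (v # us @ x # x # vs) = \<zero>\<^bsub>Ext\<^esub>"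
      if "us \<in> lists (carrier V)" "vs \<in> lists (carrier V)" "x \<in> carrier V" for us vs x
      using ext_gen_square[OF V_module vv[OF that(1)] that(2,3)] by simp
  qed blast
  have cons: "eg (free_gen R G b # vs) \<in> S" if b: "b \<in> G" and vs: "vs \<in> lists (carrier V)" "eg vs \<in> S" for b vs
  proof -
    obtain i where i: "i \<in> F" "b = g i" using b g unfolding bij_betw_def by blast
    obtain L where L: "linear_map R Ext Ext L" "\<And>vs. vs \<in> lists (carrier V) \<Longrightarrow> L (eg vs) = eg (dvec i # vs)"
      using mult[OF dvec_closed[OF i(1)]] by blast
    interpret EE: module_pair R Ext Ext by (rule module_pair.intro[OF Ext_module Ext_module])
    have "S \<subseteq> {s \<in> carrier Ext. L s \<in> S}"
      unfolding S_def
    proof (rule submodule_span_least)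
      show "submodule {s \<in> carrier Ext. L s \<in> submodule_span R Ext (ebasis ` Pow F)} R Ext"
        using EE.submodule_vimage[OF L(1) S] unfolding S_def .
      show "ebasis ` Pow F \<subseteq> {s \<in> carrier Ext. L s \<in> submodule_span R Ext (ebasis ` Pow F)}"
        unfolding S_def[symmetric]
      proof (rule image_subsetI, rule CollectI, rule conjI)
        fix B assume "B \<in> Pow F"
        then have B: "B \<subseteq> F" by simp
        then have fB: "finite B" using finite_subset[OF _ fF] by simp
        show "ebasis B \<in> carrier Ext" by (rule ebasis_closed[OF B])
        let ?l = "sorted_list_of_set B"
        have "map dvec ?l \<in> lists (carrier V)" by (rule dvec_list) (use fB B in simp)
        then have "L (ebasis B) = eg (map dvec ([] @ i # ?l))" unfolding ebasis_def using L(2) by simp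
        also have "\<dots> \<in> S" by (rule insert_in_submodule[OF S Se i(1)]) (use fB B in auto)
        finally show "L (ebasis B) \<in> S" .
      qed
    qed
    then have "L (eg vs) \<in> S" using vs(2) by blast
    then show ?thesis using L(2)[OF vs(1)] i(2) by (simp add: dvec_def)
  qed
  have all: "eg vs \<in> S" if "vs \<in> lists (carrier V)" for vs
    using that
  proof (induction vs)
    case Nil
    have "ebasis {} \<in> S" by (rule Se) simp
    then show ?case by (simp add: ebasis_def)
  next
    case (Cons v vs)
    have vs: "vs \<in> lists (carrier V)" using Cons by simp
    have l: "linear_map R V Ext (\<lambda>v. eg (v # vs))"
    proof (rule linear_mapI)
      show "eg (x # vs) \<in> carrier Ext" if "x \<in> carrier V" for x
        by (rule ext_gen_closed[OF V_module]) (use that vs in simp)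
      show "eg ((x \<oplus>\<^bsub>V\<^esub> y) # vs) = eg (x # vs) \<oplus>\<^bsub>Ext\<^esub> eg (y # vs)" if "x \<in> carrier V" "y \<in> carrier V" for x y
        using ext_gen_add[OF V_module _ vs that, of "[]"] by simp
      show "eg ((r \<odot>\<^bsub>V\<^esub> x) # vs) = r \<odot>\<^bsub>Ext\<^esub> eg (x # vs)" if "r \<in> carrier R" "x \<in> carrier V" for r x
        using ext_gen_smult[OF V_module _ vs that, of "[]"] by simp
    qed
    have v: "v \<in> carrier V" using Cons by simp
    have "eg (v # vs) = lin_ext G Ext (\<lambda>b. eg (free_gen R G b # vs)) v"
      by (rule linear_map_free_eq_lin_ext[OF Ext_module l v])
    also have "\<dots> \<in> S"
      by (rule E.submodule_finsum[OF S])
        (use E.submoduleE(4)[OF S free_module_carrierD(1)[OF v] cons[OF _ vs Cons.IH]] in auto)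
    finally show ?case .
  qed
  have "S = carrier Ext" by (rule exterior_generated[OF V_module S all])
  moreover have "S \<subseteq> H" unfolding S_def by (rule submodule_span_least[OF H]) (use eb in auto)
  ultimately show ?thesis using E.submoduleE(1)[OF H] by blast
qed

subsection \<open>Zero entries of a Koszul sequence\<close>

context
  fixes X :: "'i set" and x :: "'i \<Rightarrow> 'r" and J
  assumes fX: "finite X" and xc: "x \<in> X \<rightarrow> carrier R" and J: "ideal J R"
    and lt: "\<And>i f. i \<in> X \<Longrightarrow> f \<in> F \<Longrightarrow> i < f" and x0: "\<And>f. f \<in> F \<Longrightarrow> x f = 0"
begin

text \<open>Grouping the subsets of \<open>X \<union> F\<close> by their part \<open>B\<close> in
  \<open>F\<close> splits the Koszul module into copies of \<open>kos X\<close>, one for every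
  \<open>B \<subseteq> F\<close>; \<open>assemble\<close> is the inverse.\<close>

definition slice :: "'i set \<Rightarrow> ('i set \<Rightarrow> 'r) \<Rightarrow> 'i set \<Rightarrow> 'r"
  where "slice B z A = (if A \<subseteq> X then z (A \<union> B) else 0)"

definition assemble :: "('i set \<Rightarrow> 'i set \<Rightarrow> 'r) \<Rightarrow> 'i set \<Rightarrow> 'r"
  where "assemble w A = (if A \<subseteq> X \<union> F then w (A \<inter> F) (A \<inter> X) else 0)"

lemma XF: "X \<inter> F = {}" using lt by blast

lemma slice_closed: "z \<in> carrier (kos (X \<union> F)) \<Longrightarrow> slice B z \<in> carrier (kos X)"
  by (auto simp: slice_def kos_simps R_closed)

lemma assemble_closed: "(\<And>B. B \<subseteq> F \<Longrightarrow> w B \<in> carrier (kos X)) \<Longrightarrow> assemble w \<in> carrier (kos (X \<union> F))"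
  by (auto simp: assemble_def kos_simps R_closed)

lemma slice_assemble:
  assumes "B \<subseteq> F" "w B \<in> carrier (kos X)"
  shows "slice B (assemble w) = w B"
proof
  fix A
  have "A \<subseteq> X \<Longrightarrow> (A \<union> B) \<inter> F = B \<and> (A \<union> B) \<inter> X = A \<and> A \<union> B \<subseteq> X \<union> F" using assms(1) XF by blast
  then show "slice B (assemble w) A = w B A" using assms(2) by (auto simp: slice_def assemble_def kos_simps)
qed

text \<open>The entries at \<open>F\<close> are zero, and since \<open>F\<close> lies above
  \<open>X\<close> the elements of \<open>B\<close> leave the sign at an index in \<open>X\<close>
  unchanged. So the differential acts on each slice separately.\<close>

lemma kd_slice:
  assumes B: "B \<subseteq> F" and A: "A \<subseteq> X"
  shows "kd (X \<union> F) x z (A \<union> B) = kd X x (slice B z) A"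
proof -
  have "kd (X \<union> F) x z (A \<union> B) = (\<Sum>i\<in>(X \<union> F) - (A \<union> B). ksgn i (A \<union> B) * x i * z (insert i (A \<union> B)))"
    by (simp add: kd_def)
  also have "\<dots> = (\<Sum>i\<in>X - A. ksgn i (A \<union> B) * x i * z (insert i (A \<union> B)))"
    by (rule sum.mono_neutral_right) (use fX fF B XF x0 in auto)
  also have "\<dots> = kd X x (slice B z) A"
    unfolding kd_def
  proof (rule sum.cong[OF refl])
    fix i assume i: "i \<in> X - A"
    have "{h \<in> A \<union> B. h < i} = {h \<in> A. h < i}" using lt i B by (auto dest: less_asym)
    then have "ksgn i (A \<union> B) = ksgn i A" by (simp add: ksgn_def)
    then show "ksgn i (A \<union> B) * x i * z (insert i (A \<union> B)) = ksgn i A * x i * slice B z (insert i A)"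
      using i A by (simp add: slice_def)
  qed
  finally show ?thesis .
qed

lemma all_slices:
  assumes "z \<in> carrier (kos (X \<union> F))" and J0: "0 \<in> J"
  shows "(\<forall>A. z A \<in> J) \<longleftrightarrow> (\<forall>B\<subseteq>F. \<forall>A. slice B z A \<in> J)"
proof
  assume *: "\<forall>B\<subseteq>F. \<forall>A. slice B z A \<in> J"
  show "\<forall>A. z A \<in> J"
  proof
    fix A
    show "z A \<in> J"
    proof (cases "A \<subseteq> X \<union> F")
      case True
      then have "A \<inter> X \<union> A \<inter> F = A" by blast
      then have "slice (A \<inter> F) z (A \<inter> X) = z A" by (simp add: slice_def)
      then show ?thesis using *[rule_format, of "A \<inter> F" "A \<inter> X"] by simp
    next
      case False
      then show ?thesis using assms by (simp add: kos_simps)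
    qed
  qed
qed (use J0 in \<open>auto simp: slice_def\<close>)

lemma fXF: "finite (X \<union> F)" using fX fF by simp

lemma xcF: "x \<in> X \<union> F \<rightarrow> carrier R" using xc x0 R_closed by auto

lemma kd_slice_fun:
  assumes B: "B \<subseteq> F" and z: "z \<in> carrier (kos (X \<union> F))"
  shows "slice B (kd (X \<union> F) x z) = kd X x (slice B z)"
proof
  fix A
  show "slice B (kd (X \<union> F) x z) A = kd X x (slice B z) A"
  proof (cases "A \<subseteq> X")
    case True
    then show ?thesis using kd_slice[OF B True] by (simp add: slice_def)
  next
    case False
    then show ?thesis using kd_closed[OF fX xc slice_closed[OF z, of B]] by (simp add: slice_def kos_simps)
  qed
qed

lemma HZ_slice: "z \<in> carrier (HZ (X \<union> F) x J) \<longleftrightarrow> z \<in> carrier (kos (X \<union> F)) \<and> (\<forall>B\<subseteq>F. slice B z \<in> carrier (HZ X x J))"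
proof (cases "z \<in> carrier (kos (X \<union> F))")
  case True
  then show ?thesis
    using all_slices[OF kd_closed[OF fXF xcF True] idealE(1)[OF J]] kd_slice_fun[OF _ True] slice_closed[OF True]
    by (simp add: HZ_simps)
qed (simp add: HZ_simps)

lemma HB_slice:
  assumes z: "z \<in> carrier (kos (X \<union> F))"
  shows "z \<in> HB (X \<union> F) x J \<longleftrightarrow> (\<forall>B\<subseteq>F. slice B z \<in> HB X x J)"
proof -
  have eq: "(\<forall>A. z A - kd (X \<union> F) x w A \<in> J) \<longleftrightarrow> (\<forall>B\<subseteq>F. \<forall>A. slice B z A - kd X x (slice B w) A \<in> J)"
    if w: "w \<in> carrier (kos (X \<union> F))" for w
  proof -
    have "slice B (\<lambda>A. z A - kd (X \<union> F) x w A) = (\<lambda>A. slice B z A - slice B (kd (X \<union> F) x w) A)" for B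
      by (auto simp: slice_def fun_eq_iff)
    then show ?thesis
      using all_slices[OF kos_diff_closed[OF z kd_closed[OF fXF xcF w]] idealE(1)[OF J]] kd_slice_fun[OF _ w] by simp
  qed
  show ?thesis
  proof
    assume "z \<in> HB (X \<union> F) x J"
    then obtain w where w: "w \<in> carrier (kos (X \<union> F))" "\<forall>A. z A - kd (X \<union> F) x w A \<in> J" unfolding HB_def by blast
    show "\<forall>B\<subseteq>F. slice B z \<in> HB X x J"
      unfolding HB_def using slice_closed[OF z] slice_closed[OF w(1)] w(2)[unfolded eq[OF w(1)]] by blast
  next
    assume "\<forall>B\<subseteq>F. slice B z \<in> HB X x J"
    then have "\<forall>B. \<exists>w. B \<subseteq> F \<longrightarrow> w \<in> carrier (kos X) \<and> (\<forall>A. slice B z A - kd X x w A \<in> J)"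
      unfolding HB_def by blast
    then obtain w where w: "\<And>B. B \<subseteq> F \<Longrightarrow> w B \<in> carrier (kos X)" "\<And>B A. B \<subseteq> F \<Longrightarrow> slice B z A - kd X x (w B) A \<in> J"
      unfolding choice_iff by blast
    have wa: "assemble w \<in> carrier (kos (X \<union> F))" by (rule assemble_closed[OF w(1)])
    have "\<forall>A. z A - kd (X \<union> F) x (assemble w) A \<in> J"
      unfolding eq[OF wa] using slice_assemble[OF _ w(1)] w(2) by simp
    then show "z \<in> HB (X \<union> F) x J" unfolding HB_def using z wa by blast
  qed
qed

text \<open>\<open>P\<close> sends a cycle to the sum over \<open>B\<close> of the class of its
  slice at \<open>B\<close> tensored with the wedge over \<open>B\<close>. The wedges span, so
  \<open>P\<close> is onto; their coordinates separate them, so \<open>P\<close> vanishes only if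
  every slice bounds.\<close>

theorem kh_exterior:
  assumes T: "kh X x J T"
  shows "kh (X \<union> F) x J (tensor R T Ext)"
proof -
  obtain p where p: "covers R (HZ X x J) T p (HB X x J)" using T unfolding kh_def by blast
  note WX = HZ_module[OF fX xc J] and W = HZ_module[OF fXF xcF J]
  note p' = coversD'[OF p]
  have Tm: "module R T" by (rule covers_imp_module[OF WX p HB_zero[OF fX xc J]])
  let ?T = "tensor R T Ext"
  let ?W = "HZ (X \<union> F) x J"
  have TT: "module R ?T" by (rule tensor_module[OF Tm Ext_module])
  interpret T: module R T by (rule Tm)
  interpret E: module R Ext by (rule Ext_module)
  interpret TT: module R ?T by (rule TT)
  interpret WT: module_pair R ?W ?T by (rule module_pair.intro[OF W TT])
  interpret XT: module_pair R "HZ X x J" T by (rule module_pair.intro[OF WX Tm])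
  define P where "P z = (\<Oplus>\<^bsub>?T\<^esub>B\<in>Pow F. pure_tensor R T Ext (p (slice B z), ebasis B))" for z
  have sl: "linear_map R ?W (HZ X x J) (slice B)" if B: "B \<subseteq> F" for B
    by (rule linear_mapI) (use HZ_slice B in \<open>auto simp: HZ_simps(2-) slice_def fun_eq_iff\<close>)
  have pl: "linear_map R T ?T (\<lambda>t. pure_tensor R T Ext (t, e))" if e: "e \<in> carrier Ext" for e
    by (rule linear_mapI)
      (simp_all add: e pure_tensor_closed[OF Tm Ext_module] pure_tensor_add_left[OF Tm Ext_module] pure_tensor_smult_left[OF Tm Ext_module])
  have lin: "linear_map R ?W ?T P"
    unfolding P_def
    by (rule WT.linear_map_finsum_fun) (use linear_map_comp[OF linear_map_comp[OF sl p'(1)] pl[OF ebasis_closed]] in auto)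
  have pc: "p (slice B z) \<in> carrier T" if "B \<subseteq> F" "z \<in> carrier ?W" for B z
    using linear_map_closed[OF p'(1) linear_map_closed[OF sl]] that by blast
  obtain h where h: "linear_map R Ext (kos F) h" "\<And>vs. vs \<in> lists (carrier V) \<Longrightarrow> h (eg vs) = wedges vs (kunit {})"
    using ext_coordinates by blast
  have he: "h (ebasis B) = kunit B" if B: "B \<subseteq> F" for B
  proof -
    have fB: "finite B" using finite_subset[OF B fF] .
    let ?l = "sorted_list_of_set B"
    have l: "set ?l \<subseteq> F" "sorted_wrt (<) ?l" using fB B by auto
    show ?thesis unfolding ebasis_def h(2)[OF dvec_list[OF l(1)]] wedges_dvec[OF l(2,1)] using fB by simp
  qed
  have hR: "h e B \<in> carrier R" if "e \<in> carrier Ext" for e B using linear_map_closed[OF h(1) that] by (simp add: kos_simps)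
  have k1: "p (slice B z) = \<zero>\<^bsub>T\<^esub>" if z: "z \<in> carrier ?W" "P z = \<zero>\<^bsub>?T\<^esub>" and B: "B \<subseteq> F" for z B
  proof -
    \<comment> \<open>The coordinate at \<open>B\<close>, applied to the second factor, extracts
      from \<open>P z\<close> the class of the slice at \<open>B\<close>.\<close>
    define \<phi> where "\<phi> = (\<lambda>(t, e). h e B \<odot>\<^bsub>T\<^esub> t)"
    have hadd: "h (e \<oplus>\<^bsub>Ext\<^esub> e') B = h e B \<oplus> h e' B" if "e \<in> carrier Ext" "e' \<in> carrier Ext" for e e'
      using linear_map_add[OF h(1) that] by (simp add: kos_simps ops)
    have hsm: "h (r \<odot>\<^bsub>Ext\<^esub> e) B = r \<otimes> h e B" if "r \<in> carrier R" "e \<in> carrier Ext" for r e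
      using linear_map_smult[OF h(1) that] by (simp add: kos_simps ops)
    define f where "f = presented_map R (tensor_gens T Ext) T \<phi>"
    have f: "linear_map R ?T T f" "\<And>t e. t \<in> carrier T \<Longrightarrow> e \<in> carrier Ext \<Longrightarrow> f (pure_tensor R T Ext (t, e)) = h e B \<odot>\<^bsub>T\<^esub> t"
    proof -
      have c: "\<phi> (t, e) \<in> carrier T" if "t \<in> carrier T" "e \<in> carrier Ext" for t e
        unfolding \<phi>_def using T.smult_closed[OF hR[OF that(2)] that(1)] by simp
      have a1: "\<phi> (t \<oplus>\<^bsub>T\<^esub> t', e) = \<phi> (t, e) \<oplus>\<^bsub>T\<^esub> \<phi> (t', e)" if "t \<in> carrier T" "t' \<in> carrier T" "e \<in> carrier Ext" for t t' e
        unfolding \<phi>_def using T.smult_r_distr[OF hR[OF that(3)] that(1,2)] by simp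
      have a2: "\<phi> (t, e \<oplus>\<^bsub>Ext\<^esub> e') = \<phi> (t, e) \<oplus>\<^bsub>T\<^esub> \<phi> (t, e')" if "t \<in> carrier T" "e \<in> carrier Ext" "e' \<in> carrier Ext" for t e e'
        unfolding \<phi>_def prod.case hadd[OF that(2,3)] by (rule T.smult_l_distr[OF hR[OF that(2)] hR[OF that(3)] that(1)])
      have a3: "\<phi> (r \<odot>\<^bsub>T\<^esub> t, e) = r \<odot>\<^bsub>T\<^esub> \<phi> (t, e)" if "r \<in> carrier R" "t \<in> carrier T" "e \<in> carrier Ext" for r t e
        unfolding \<phi>_def prod.case T.smult_assoc1[OF hR[OF that(3)] that(1,2), symmetric] T.smult_assoc1[OF that(1) hR[OF that(3)] that(2), symmetric]
          m_comm[OF that(1) hR[OF that(3)]] ..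
      have a4: "\<phi> (t, r \<odot>\<^bsub>Ext\<^esub> e) = r \<odot>\<^bsub>T\<^esub> \<phi> (t, e)" if "r \<in> carrier R" "t \<in> carrier T" "e \<in> carrier Ext" for r t e
        unfolding \<phi>_def prod.case hsm[OF that(1,3)] by (rule T.smult_assoc1[OF that(1) hR[OF that(3)] that(2)])
      show "linear_map R ?T T f" unfolding f_def
        by (rule tensor_lift(1)[OF Tm Ext_module Tm]; rule c a1 a2 a3 a4; assumption)
      show "f (pure_tensor R T Ext (t, e)) = h e B \<odot>\<^bsub>T\<^esub> t" if "t \<in> carrier T" "e \<in> carrier Ext" for t e
      proof -
        have "f (pure_tensor R T Ext (t, e)) = \<phi> (t, e)" unfolding f_def
          by (rule tensor_lift(2)[OF Tm Ext_module Tm _ _ _ _ _ that]; rule c a1 a2 a3 a4; assumption)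
        then show ?thesis by (simp add: \<phi>_def)
      qed
    qed
    interpret FT: module_pair R ?T T by (rule module_pair.intro[OF TT Tm])
    have "f (P z) = (\<Oplus>\<^bsub>T\<^esub>C\<in>Pow F. f (pure_tensor R T Ext (p (slice C z), ebasis C)))"
      unfolding P_def
      by (rule FT.linear_map_finsum[OF f(1)]) (use pure_tensor_closed[OF Tm Ext_module pc[OF _ z(1)] ebasis_closed] in auto)
    also have "\<dots> = (\<Oplus>\<^bsub>T\<^esub>C\<in>Pow F. if B = C then p (slice B z) else \<zero>\<^bsub>T\<^esub>)"
    proof (rule T.finsum_cong')
      fix C assume "C \<in> Pow F"
      then have C: "C \<subseteq> F" by simp
      have "f (pure_tensor R T Ext (p (slice C z), ebasis C)) = kunit C B \<odot>\<^bsub>T\<^esub> p (slice C z)"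
        using f(2)[OF pc[OF C z(1)] ebasis_closed[OF C]] he[OF C] by simp
      also have "\<dots> = (if B = C then p (slice B z) else \<zero>\<^bsub>T\<^esub>)"
        using T.smult_l_null[OF pc[OF C z(1)]] T.smult_one[OF pc[OF C z(1)]] by (auto simp: kunit_def ops)
      finally show "f (pure_tensor R T Ext (p (slice C z), ebasis C)) = (if B = C then p (slice B z) else \<zero>\<^bsub>T\<^esub>)" .
    qed (use pc[OF _ z(1)] B in auto)
    also have "\<dots> = p (slice B z)"
      by (rule T.add.finprod_singleton) (use B fF pc[OF _ z(1)] in auto)
    finally show ?thesis using z(2) FT.linear_map_zero[OF f(1)] by simp
  qed
  have "P ` carrier ?W = carrier ?T"
  proof (rule tensor_generated[OF Tm Ext_module])
    show H: "submodule (P ` carrier ?W) R ?T" by (rule WT.submodule_image[OF lin WT.M.carrier_is_submodule])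
    fix t e assume t: "t \<in> carrier T" and e: "e \<in> carrier Ext"
    interpret ET: module_pair R Ext ?T by (rule module_pair.intro[OF Ext_module TT])
    have rl: "linear_map R Ext ?T (\<lambda>e. pure_tensor R T Ext (t, e))"
      by (rule linear_mapI)
        (simp_all add: t pure_tensor_closed[OF Tm Ext_module] pure_tensor_add_right[OF Tm Ext_module] pure_tensor_smult_right[OF Tm Ext_module])
    have "{e \<in> carrier Ext. pure_tensor R T Ext (t, e) \<in> P ` carrier ?W} = carrier Ext"
    proof (rule ebasis_spans[OF ET.submodule_vimage[OF rl H]])
      fix B assume B: "B \<subseteq> F"
      obtain w where w: "w \<in> carrier (HZ X x J)" "p w = t" using p'(5)[OF t] by blast
      \<comment> \<open>A family of slices concentrated at \<open>B\<close>, so that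
        \<open>P\<close> of its assembly is the one tensor wanted.\<close>
      define u where "u C = (if C = B then w else (\<lambda>_. 0))" for C
      have u: "u C \<in> carrier (HZ X x J)" for C
        unfolding u_def using w(1) WX module.submodule_zero[OF WX module.carrier_is_submodule[OF WX]] by (simp add: HZ_simps(2))
      then have uk: "u C \<in> carrier (kos X)" for C by (simp add: HZ_simps)
      let ?z = "assemble u"
      have s: "slice C ?z = u C" if "C \<subseteq> F" for C by (rule slice_assemble[OF that uk])
      have z: "?z \<in> carrier ?W" unfolding HZ_slice using assemble_closed[OF uk] s u by simp
      have p0: "p (\<lambda>_. 0) = \<zero>\<^bsub>T\<^esub>" using XT.linear_map_zero[OF p'(1)] by (simp add: HZ_simps)
      interpret TTT: module_pair R T ?T by (rule module_pair.intro[OF Tm TT])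
      have "P ?z = (\<Oplus>\<^bsub>?T\<^esub>C\<in>Pow F. if B = C then pure_tensor R T Ext (t, ebasis B) else \<zero>\<^bsub>?T\<^esub>)"
        unfolding P_def
      proof (rule TT.finsum_cong')
        fix C assume "C \<in> Pow F"
        then have C: "C \<subseteq> F" by simp
        show "pure_tensor R T Ext (p (slice C ?z), ebasis C) = (if B = C then pure_tensor R T Ext (t, ebasis B) else \<zero>\<^bsub>?T\<^esub>)"
          unfolding s[OF C] u_def using w(2) p0 TTT.linear_map_zero[OF pl[OF ebasis_closed[OF C]]] by simp
      qed (use pure_tensor_closed[OF Tm Ext_module t ebasis_closed[OF B]] in auto)
      also have "\<dots> = pure_tensor R T Ext (t, ebasis B)"
        by (rule TT.add.finprod_singleton) (use B fF pure_tensor_closed[OF Tm Ext_module t ebasis_closed[OF B]] in auto)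
      finally have "pure_tensor R T Ext (t, ebasis B) \<in> P ` carrier ?W" using z by (metis imageI)
      then show "ebasis B \<in> {e \<in> carrier Ext. pure_tensor R T Ext (t, e) \<in> P ` carrier ?W}" using ebasis_closed[OF B] by blast
    qed
    then show "pure_tensor R T Ext (t, e) \<in> P ` carrier ?W" using e by blast
  qed
  moreover have "P z = \<zero>\<^bsub>?T\<^esub> \<longleftrightarrow> z \<in> HB (X \<union> F) x J" if z: "z \<in> carrier ?W" for z
  proof -
    have zk: "z \<in> carrier (kos (X \<union> F))" using z by (simp add: HZ_simps)
    have sW: "slice B z \<in> carrier (HZ X x J)" if "B \<subseteq> F" for B by (rule linear_map_closed[OF sl[OF that] z])
    have "P z = \<zero>\<^bsub>?T\<^esub> \<longleftrightarrow> (\<forall>B\<subseteq>F. p (slice B z) = \<zero>\<^bsub>T\<^esub>)"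
    proof
      assume *: "\<forall>B\<subseteq>F. p (slice B z) = \<zero>\<^bsub>T\<^esub>"
      interpret TTT: module_pair R T ?T by (rule module_pair.intro[OF Tm TT])
      have "P z = (\<Oplus>\<^bsub>?T\<^esub>B\<in>Pow F. \<zero>\<^bsub>?T\<^esub>)"
        unfolding P_def by (rule TT.finsum_cong') (use * TTT.linear_map_zero[OF pl[OF ebasis_closed]] in auto)
      then show "P z = \<zero>\<^bsub>?T\<^esub>" by simp
    qed (use k1[OF z] in blast)
    also have "\<dots> \<longleftrightarrow> (\<forall>B\<subseteq>F. slice B z \<in> HB X x J)" using p'(3)[OF sW] by simp
    finally show ?thesis unfolding HB_slice[OF zk] .
  qed
  ultimately have "covers R ?W ?T P (HB (X \<union> F) x J)"
    unfolding covers_def using lin HB_subset[OF fXF xcF J] by blast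
  then show ?thesis unfolding kh_def by blast
qed

end

end

end

end

section \<open>Regular sequences from disjoint leading monomials\<close>

abbreviation "supp \<equiv> Poly_Mapping.keys"
abbreviation "coef \<equiv> Poly_Mapping.lookup"
abbreviation "single \<equiv> Poly_Mapping.single"

lemma poly_ring_simps:
  "p \<in> carrier (poly_ring I) \<longleftrightarrow> (\<forall>m\<in>supp p. supp m \<subseteq> I)"
  "mult (poly_ring I) = (*)" "one (poly_ring I) = 1" "zero (poly_ring I) = 0" "add (poly_ring I) = (+)"
  by (simp_all add: poly_ring_def)

lemma concrete_ring_poly_ring: "concrete_ring (poly_ring I)"
proof -
  have add: "p + q \<in> carrier (poly_ring I)" if "p \<in> carrier (poly_ring I)" "q \<in> carrier (poly_ring I)" for p q
    using that Poly_Mapping.keys_add[of p q] unfolding poly_ring_simps by blast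
  have mult: "p * q \<in> carrier (poly_ring I)" if "p \<in> carrier (poly_ring I)" "q \<in> carrier (poly_ring I)" for p q
  proof -
    have "supp m \<subseteq> I" if "m \<in> supp (p * q)" for m
    proof -
      have "m \<in> {a + b | a b. a \<in> supp p \<and> b \<in> supp q}" using that keys_mult[of p q] by blast
      then obtain a b where "m = a + b" "a \<in> supp p" "b \<in> supp q" by blast
      then show ?thesis using Poly_Mapping.keys_add[of a b] \<open>p \<in> _\<close> \<open>q \<in> _\<close> unfolding poly_ring_simps by blast
    qed
    then show ?thesis unfolding poly_ring_simps by blast
  qed
  have neg: "- p \<in> carrier (poly_ring I)" if "p \<in> carrier (poly_ring I)" for p
    using that by (simp add: poly_ring_simps(1))
  have "cring (poly_ring I)"
  proof (rule cringI)
    have z: "0 \<in> carrier (poly_ring I)" "1 \<in> carrier (poly_ring I)" by (simp_all add: poly_ring_simps(1))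
    show "abelian_group (poly_ring I)"
    proof (rule abelian_groupI)
      fix p assume "p \<in> carrier (poly_ring I)"
      then show "\<exists>q\<in>carrier (poly_ring I). q \<oplus>\<^bsub>poly_ring I\<^esub> p = \<zero>\<^bsub>poly_ring I\<^esub>"
        by (intro bexI[OF _ neg]) (simp_all add: poly_ring_simps(2-))
    qed (simp_all add: poly_ring_simps(2-) add z add_ac)
    show "comm_monoid (poly_ring I)"
      by (rule comm_monoidI) (simp_all add: poly_ring_simps(2-) mult z mult_ac)
  qed (simp add: poly_ring_simps(2-) distrib_right)
  then show ?thesis by (intro concrete_ring.intro concrete_ring_axioms.intro) (simp_all add: poly_ring_simps(2-))
qed

section \<open>Weights and leading monomials\<close>

definition wt :: "(nat \<Rightarrow> nat) \<Rightarrow> (nat \<Rightarrow>\<^sub>0 nat) \<Rightarrow> nat"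
  where "wt w m = (\<Sum>i\<in>supp m. coef m i * w i)"

lemma wt_superset:
  assumes "finite A" "supp m \<subseteq> A"
  shows "wt w m = (\<Sum>i\<in>A. coef m i * w i)"
  unfolding wt_def by (rule sum.mono_neutral_left) (use assms in \<open>auto simp: in_keys_iff\<close>)

lemma wt_add: "wt w (m + n) = wt w m + wt w n"
proof -
  let ?A = "supp m \<union> supp n"
  have "wt w (m + n) = (\<Sum>i\<in>?A. coef (m + n) i * w i)"
    by (rule wt_superset) (use Poly_Mapping.keys_add[of m n] in auto)
  also have "\<dots> = (\<Sum>i\<in>?A. coef m i * w i) + (\<Sum>i\<in>?A. coef n i * w i)"
    by (simp add: lookup_add algebra_simps sum.distrib)
  finally show ?thesis by (simp add: wt_superset[of ?A])
qed

lemma wt_single: "wt w (single i k) = k * w i"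
  by (simp add: wt_def)

lemma wt_zero: "wt w 0 = 0"
  by (simp add: wt_def)

lemma wt_sum: "wt w (sum f A) = (\<Sum>i\<in>A. wt w (f i))"
  by (induction A rule: infinite_finite_induct) (auto simp: wt_zero wt_add)

text \<open>\<open>frag_of m\<close> is the monomial \<open>m\<close> with coefficient 1. Different
  monomials may have equal weight, so instead of using a monomial order \<open>m\<close> is required
  to be strictly heavier than all other terms; in particular its coefficient in \<open>p\<close> is
  1.\<close>

definition leads :: "(nat \<Rightarrow> nat) \<Rightarrow> zpoly \<Rightarrow> (nat \<Rightarrow>\<^sub>0 nat) \<Rightarrow> bool"
  where "leads w p m \<longleftrightarrow> (\<forall>k\<in>supp (p - frag_of m). wt w k < wt w m)"

lemma leads_frag_of: "leads w (frag_of m) m"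
  by (simp add: leads_def)

lemma frag_of_mult: "frag_of m * frag_of n = frag_of (m + n)" for m n :: "nat \<Rightarrow>\<^sub>0 nat"
  by (simp add: mult_single)

lemma leads_mult:
  assumes p: "leads w p m" and q: "leads w q n"
  shows "leads w (p * q) (m + n)"
  unfolding leads_def
proof
  fix k assume k: "k \<in> supp (p * q - frag_of (m + n))"
  let ?p = "p - frag_of m" and ?q = "q - frag_of n"
  have "p * q - frag_of (m + n) = ?p * q + frag_of m * ?q"
    by (simp add: algebra_simps frag_of_mult)
  then have "k \<in> supp (?p * q) \<or> k \<in> supp (frag_of m * ?q)"
    using k Poly_Mapping.keys_add[of "?p * q" "frag_of m * ?q"] by auto
  then show "wt w k < wt w (m + n)"
  proof
    assume "k \<in> supp (?p * q)"
    then obtain a b where ab: "k = a + b" "a \<in> supp ?p" "b \<in> supp q" using keys_mult[of ?p q] by blast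
    have "supp q \<subseteq> supp ?q \<union> {n}"
      using Poly_Mapping.keys_add[of ?q "frag_of n"] by simp
    then have "wt w b \<le> wt w n" using ab(3) q unfolding leads_def by (auto intro: less_imp_le)
    moreover have "wt w a < wt w m" using ab(2) p unfolding leads_def by blast
    ultimately show ?thesis by (simp add: ab(1) wt_add)
  next
    assume "k \<in> supp (frag_of m * ?q)"
    then obtain b where "k = m + b" "b \<in> supp ?q" using keys_mult[of "frag_of m" ?q] by auto
    then show ?thesis using q unfolding leads_def by (simp add: wt_add)
  qed
qed

definition sqf :: "nat set \<Rightarrow> nat \<Rightarrow>\<^sub>0 nat"
  where "sqf A = (\<Sum>i\<in>A. single i 1)"

lemma lookup_sqf: "finite A \<Longrightarrow> coef (sqf A) i = (if i \<in> A then 1 else 0)"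
  unfolding sqf_def lookup_sum lookup_single by (simp add: when_def)

text \<open>The leading monomials are squarefree and given by their sets of variables
  \<open>D v\<close>; disjointness of these sets makes the monomials pairwise coprime.\<close>

locale leading_monomials =
  fixes I :: "nat set" and w :: "nat \<Rightarrow> nat" and V :: "'v set" and f :: "'v \<Rightarrow> zpoly" and D :: "'v \<Rightarrow> nat set"
  assumes fV: "finite V" and fD: "\<And>v. v \<in> V \<Longrightarrow> finite (D v)" and neD: "\<And>v. v \<in> V \<Longrightarrow> D v \<noteq> {}"
    and DI: "\<And>v. v \<in> V \<Longrightarrow> D v \<subseteq> I" and disj: "\<And>u v. u \<in> V \<Longrightarrow> v \<in> V \<Longrightarrow> u \<noteq> v \<Longrightarrow> D u \<inter> D v = {}"
    and fR: "\<And>v. v \<in> V \<Longrightarrow> f v \<in> carrier (poly_ring I)"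
    and lead: "\<And>v. v \<in> V \<Longrightarrow> leads w (f v) (sqf (D v))"
begin

sublocale R: concrete_ring "poly_ring I" by (rule concrete_ring_poly_ring)

text \<open>The exponent of the highest power of \<open>sqf (D v)\<close> that divides the monomial
  \<open>m\<close>. The product of such powers is \<open>vpart\<close>, written additively as an
  exponent vector.\<close>

definition \<beta> :: "'v \<Rightarrow> (nat \<Rightarrow>\<^sub>0 nat) \<Rightarrow> nat"
  where "\<beta> v m = Min (coef m ` D v)"

definition vpart :: "'v set \<Rightarrow> ('v \<Rightarrow> nat) \<Rightarrow> nat \<Rightarrow>\<^sub>0 nat"
  where "vpart W b = (\<Sum>v\<in>W. \<Sum>i\<in>D v. single i (b v))"

lemma lookup_vpart:
  assumes W: "W \<subseteq> V"
  shows "coef (vpart W b) i = (\<Sum>v\<in>W. if i \<in> D v then b v else 0)"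
  unfolding vpart_def lookup_sum
  by (rule sum.cong[OF refl]) (use W fD in \<open>auto simp: lookup_single when_def\<close>)

lemma lookup_vpart_in:
  assumes "v \<in> V" "i \<in> D v"
  shows "coef (vpart V b) i = b v"
proof -
  have "(\<Sum>u\<in>V. if i \<in> D u then b u else 0) = (\<Sum>u\<in>V. if u = v then b v else 0)"
    by (rule sum.cong) (use assms disj in auto)
  then show ?thesis using assms fV by (simp add: lookup_vpart sum.delta)
qed

lemma leads_power:
  assumes v: "v \<in> V"
  shows "leads w (f v ^ k) (\<Sum>i\<in>D v. single i k)"
proof (induction k)
  case 0
  show ?case using leads_frag_of[of w 0] by simp
next
  case (Suc k)
  have "(\<Sum>i\<in>D v. single i (Suc k)) = sqf (D v) + (\<Sum>i\<in>D v. single i k)"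
    unfolding sqf_def sum.distrib[symmetric] single_add[symmetric] by simp
  then show ?case using leads_mult[OF lead[OF v] Suc] by simp
qed

lemma leads_prod: "finite W \<Longrightarrow> W \<subseteq> V \<Longrightarrow> leads w (\<Prod>v\<in>W. f v ^ b v) (vpart W b)"
proof (induction W rule: finite_induct)
  case empty
  show ?case using leads_frag_of[of w 0] by (simp add: vpart_def)
next
  case (insert v W)
  then show ?case using leads_mult[OF leads_power] by (simp add: vpart_def)
qed

text \<open>\<open>\<theta>\<close> replaces every factor \<open>sqf (D v)\<close> of a monomial by \<open>f v\<close>. Its linear extension is unitriangular with
  respect to \<^const>\<open>wt\<close>, hence bijective, and it turns multiplication by \<open>sqf (D v)\<close> into
  multiplication by \<open>f v\<close>. This reduces regularity to the case of monomials.\<close>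

definition \<theta> :: "(nat \<Rightarrow>\<^sub>0 nat) \<Rightarrow> zpoly"
  where "\<theta> m = frag_of (m - vpart V (\<lambda>v. \<beta> v m)) * (\<Prod>v\<in>V. f v ^ \<beta> v m)"

abbreviation \<Theta> :: "zpoly \<Rightarrow> zpoly"
  where "\<Theta> \<equiv> frag_extend \<theta>"

lemma vpart_le: "coef (vpart V (\<lambda>v. \<beta> v m)) i \<le> coef m i"
proof (cases "\<exists>v\<in>V. i \<in> D v")
  case True
  then obtain v where v: "v \<in> V" "i \<in> D v" by blast
  show ?thesis unfolding lookup_vpart_in[OF v] \<beta>_def by (rule Min_le) (use v fD in auto)
next
  case False
  then have "(\<Sum>u\<in>V. if i \<in> D u then \<beta> u m else 0) = 0" by (intro sum.neutral) auto
  then show ?thesis by (simp add: lookup_vpart)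
qed

lemma \<theta>_leads: "leads w (\<theta> m) m"
proof -
  let ?s = "vpart V (\<lambda>v. \<beta> v m)"
  have "m - ?s + ?s = m"
    by (rule poly_mapping_eqI) (use vpart_le in \<open>simp add: lookup_add lookup_minus\<close>)
  then show ?thesis
    unfolding \<theta>_def using leads_mult[OF leads_frag_of[of w "m - ?s"] leads_prod[OF fV order.refl, of "\<lambda>v. \<beta> v m"]] by simp
qed

lemma \<beta>_shift:
  assumes v: "v \<in> V" and u: "u \<in> V"
  shows "\<beta> u (sqf (D v) + m) = (if u = v then Suc (\<beta> v m) else \<beta> u m)"
proof (cases "u = v")
  case True
  have "coef (sqf (D v) + m) ` D v = Suc ` coef m ` D v"
    unfolding image_image by (rule image_cong) (auto simp: lookup_add lookup_sqf fD[OF v])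
  then have "\<beta> v (sqf (D v) + m) = Min (Suc ` coef m ` D v)" by (simp add: \<beta>_def)
  also have "\<dots> = Suc (\<beta> v m)" unfolding \<beta>_def
    by (rule mono_Min_commute[symmetric]) (use fD[OF v] neD[OF v] in \<open>auto simp: mono_def\<close>)
  finally show ?thesis using True by simp
next
  case False
  have "coef (sqf (D v) + m) ` D u = coef m ` D u"
    by (rule image_cong) (use disj[OF u v False] in \<open>auto simp: lookup_add lookup_sqf fD[OF v]\<close>)
  then show ?thesis using False by (simp add: \<beta>_def)
qed

text \<open>Multiplying \<open>m\<close> by \<open>sqf (D v)\<close> raises the exponent at
  \<open>v\<close> by one and, the sets of variables being disjoint, changes neither the other
  exponents nor the cofactor \<open>m - vpart\<close>.\<close>

lemma \<theta>_shift:
  assumes v: "v \<in> V"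
  shows "\<theta> (sqf (D v) + m) = f v * \<theta> m"
proof -
  let ?b = "\<lambda>u. \<beta> u (sqf (D v) + m)"
  have "vpart V ?b = sqf (D v) + vpart V (\<lambda>u. \<beta> u m)"
  proof (rule poly_mapping_eqI)
    fix i
    show "coef (vpart V ?b) i = coef (sqf (D v) + vpart V (\<lambda>u. \<beta> u m)) i"
    proof (cases "\<exists>u\<in>V. i \<in> D u")
      case True
      then obtain u where u: "u \<in> V" "i \<in> D u" by blast
      have "i \<in> D v \<longleftrightarrow> u = v" using disj[OF u(1) v] u by blast
      then show ?thesis using \<beta>_shift[OF v u(1)] by (simp add: lookup_add lookup_vpart_in[OF u] lookup_sqf fD[OF v])
    next
      case False
      then have "(\<Sum>u\<in>V. if i \<in> D u then c u else 0) = 0" for c :: "'v \<Rightarrow> nat" by (intro sum.neutral) auto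
      then show ?thesis using False v by (simp add: lookup_add lookup_vpart lookup_sqf fD[OF v])
    qed
  qed
  then have "sqf (D v) + m - vpart V ?b = m - vpart V (\<lambda>u. \<beta> u m)"
    by (intro poly_mapping_eqI) (simp add: lookup_add lookup_minus)
  moreover have "(\<Prod>u\<in>V. f u ^ ?b u) = f v * (\<Prod>u\<in>V. f u ^ \<beta> u m)"
  proof -
    have "(\<Prod>u\<in>V. f u ^ ?b u) = (\<Prod>u\<in>V. (if u = v then f v else 1) * f u ^ \<beta> u m)"
      by (rule prod.cong) (use \<beta>_shift[OF v] in auto)
    also have "\<dots> = (\<Prod>u\<in>V. if u = v then f v else 1) * (\<Prod>u\<in>V. f u ^ \<beta> u m)" by (rule prod.distrib)
    finally show ?thesis using v fV by (simp add: prod.delta)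
  qed
  ultimately show ?thesis by (simp add: \<theta>_def algebra_simps)
qed

lemma \<Theta>_shift:
  assumes v: "v \<in> V"
  shows "\<Theta> (frag_of (sqf (D v)) * p) = f v * \<Theta> p"
  by (induction p rule: frag_induction[OF subset_UNIV])
    (simp_all add: right_diff_distrib frag_extend_diff frag_of_mult \<theta>_shift[OF v])

abbreviation P :: "zpoly set" where "P \<equiv> carrier (poly_ring I)"
abbreviation "idl W \<equiv> Idl\<^bsub>poly_ring I\<^esub> (f ` W)"

lemma frag_of_closed: "supp m \<subseteq> I \<Longrightarrow> frag_of m \<in> P"
  by (simp add: poly_ring_simps(1))

lemma \<theta>_closed:
  assumes m: "supp m \<subseteq> I"
  shows "\<theta> m \<in> P"
proof -
  have "supp (m - vpart V (\<lambda>v. \<beta> v m)) \<subseteq> supp m"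
    by (auto simp: in_keys_iff lookup_minus)
  then have "frag_of (m - vpart V (\<lambda>v. \<beta> v m)) \<in> P" by (intro frag_of_closed) (use m in blast)
  moreover have pw: "f v ^ k \<in> P" if "v \<in> V" for v k
    by (induction k) (use fR[OF that] R.R_closed in auto)
  then have "(\<Prod>v\<in>W. f v ^ b v) \<in> P" if "W \<subseteq> V" for W b
    using that by (induction W rule: infinite_finite_induct) (auto simp: R.R_closed)
  ultimately show ?thesis unfolding \<theta>_def by (intro R.R_closed(4)) auto
qed

lemma P_induct [consumes 1, case_names zero monomial diff]:
  assumes "p \<in> P" "Q 0" "\<And>m. supp m \<subseteq> I \<Longrightarrow> Q (frag_of m)" "\<And>a b. Q a \<Longrightarrow> Q b \<Longrightarrow> Q (a - b)"
  shows "Q p"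
  by (rule frag_induction[of p "{m. supp m \<subseteq> I}" Q]) (use assms in \<open>auto simp: poly_ring_simps(1)\<close>)

lemma \<Theta>_closed: "p \<in> P \<Longrightarrow> \<Theta> p \<in> P"
  by (induction p rule: P_induct)
    (simp_all add: frag_extend_diff R.R_closed R.R_closed_minus \<theta>_closed)

lemma \<Theta>_image_diff:
  assumes "a \<in> \<Theta> ` P" "b \<in> \<Theta> ` P"
  shows "a - b \<in> \<Theta> ` P"
proof -
  obtain c d where "a = \<Theta> c" "b = \<Theta> d" "c \<in> P" "d \<in> P" using assms by blast
  then have "a - b = \<Theta> (c - d)" "c - d \<in> P" by (auto simp: frag_extend_diff R.R_closed_minus)
  then show ?thesis by blast
qed

text \<open>Induction on the weight: \<open>m\<close> is \<open>\<theta> m\<close> minus terms of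
  smaller weight.\<close>

lemma \<Theta>_surj_monomial: "supp m \<subseteq> I \<Longrightarrow> frag_of m \<in> \<Theta> ` P"
proof (induction "wt w m" arbitrary: m rule: less_induct)
  case less
  let ?l = "\<theta> m - frag_of m"
  have "?l \<in> P" by (rule R.R_closed_minus(2)[OF \<theta>_closed frag_of_closed]) (use less in auto)
  then have "supp ?l \<subseteq> {k. supp k \<subseteq> I \<and> wt w k < wt w m}"
    using \<theta>_leads[of m] by (auto simp: leads_def poly_ring_simps(1))
  then have "?l \<in> \<Theta> ` P"
  proof (rule frag_induction)
    show "0 \<in> \<Theta> ` P" by (rule image_eqI[of _ _ 0]) (simp_all add: R.R_closed)
  qed (use less.hyps \<Theta>_image_diff in auto)
  moreover have "\<theta> m \<in> \<Theta> ` P"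
    by (rule image_eqI[of _ _ "frag_of m"]) (simp_all add: frag_of_closed less.prems)
  ultimately have "\<theta> m - ?l \<in> \<Theta> ` P" by (rule \<Theta>_image_diff[rotated])
  then show ?case by simp
qed

lemma \<Theta>_surj:
  assumes "p \<in> P"
  obtains q where "q \<in> P" "p = \<Theta> q"
proof -
  have "p \<in> \<Theta> ` P" using assms
  proof (induction p rule: P_induct)
    case zero
    show ?case by (rule image_eqI[of _ _ 0]) (simp_all add: R.R_closed)
  next
    case (monomial m)
    then show ?case by (rule \<Theta>_surj_monomial)
  next
    case (diff a b)
    then show ?case by (rule \<Theta>_image_diff)
  qed
  then show ?thesis using that by blast
qed

text \<open>A monomial of maximal weight in the difference \<open>r\<close> keeps its coefficient in
  \<open>\<Theta> r\<close>, because every \<open>\<theta> k\<close> contributes besides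
  \<open>k\<close> only monomials lighter than \<open>k\<close>.\<close>

lemma \<Theta>_inj:
  assumes "\<Theta> p = \<Theta> q"
  shows "p = q"
proof (rule ccontr)
  assume "p \<noteq> q"
  define r where "r = p - q"
  have r: "r \<noteq> 0" "\<Theta> r = 0" using \<open>p \<noteq> q\<close> assms by (simp_all add: r_def frag_extend_diff)
  have "supp r \<noteq> {}" using r(1) by simp
  then have "Max (wt w ` supp r) \<in> wt w ` supp r" by (intro Max_in) auto
  then obtain m where m: "m \<in> supp r" "wt w m = Max (wt w ` supp r)" by (metis imageE)
  have mx: "wt w k \<le> wt w m" if "k \<in> supp r" for k unfolding m(2) by (rule Max_ge) (use that in auto)
  have l: "coef (\<theta> k) m = (if k = m then 1 else 0)" if k: "k \<in> supp r" for k
  proof -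
    have "m \<notin> supp (\<theta> k - frag_of k)"
      using \<theta>_leads[of k] mx[OF k] unfolding leads_def by (metis not_le)
    then have "coef (\<theta> k - frag_of k) m = 0" by (simp add: in_keys_iff)
    then show ?thesis by (simp add: lookup_minus split: if_splits)
  qed
  have "coef (\<Theta> r) m = (\<Sum>k\<in>supp r. coef r k * coef (\<theta> k) m)"
    by (simp add: frag_extend_def lookup_sum)
  also have "\<dots> = (\<Sum>k\<in>supp r. if k = m then coef r m else 0)"
    by (rule sum.cong) (simp_all add: l)
  also have "\<dots> = coef r m" using m(1) by (simp add: sum.delta)
  finally show False using r(2) m(1) by (simp add: in_keys_iff)
qed

section \<open>Monomial ideals and regularity\<close>

definition monomial_ideal :: "'v set \<Rightarrow> zpoly set"
  where "monomial_ideal W = {p \<in> P. \<forall>m\<in>supp p. \<exists>u\<in>W. D u \<subseteq> supp m}"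

lemma sqf_mult_keys:
  "supp (frag_of n * q) = (+) n ` supp q" for n :: "nat \<Rightarrow>\<^sub>0 nat" and q :: zpoly
proof
  show "supp (frag_of n * q) \<subseteq> (+) n ` supp q"
    using keys_mult[of "frag_of n" q] by auto
  have l: "coef (frag_of n * q) (n + m) = coef q m" for m
    by (induction q rule: frag_induction[OF subset_UNIV])
      (simp_all add: right_diff_distrib lookup_minus frag_of_mult)
  show "(+) n ` supp q \<subseteq> supp (frag_of n * q)"
    by (auto simp: in_keys_iff l)
qed

lemma keys_sqf_add: "v \<in> V \<Longrightarrow> supp (sqf (D v) + m) = D v \<union> supp m"
  using lookup_sqf[OF fD] by (auto simp: in_keys_iff lookup_add split: if_splits)

lemma sqf_mult_closed: "v \<in> V \<Longrightarrow> q \<in> P \<Longrightarrow> frag_of (sqf (D v)) * q \<in> P"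
  using keys_sqf_add[of v 0] DI by (intro R.R_closed(4) frag_of_closed) auto

text \<open>\<open>\<Theta>\<close> is additive and turns multiplication by \<open>sqf (D v)\<close>
  into multiplication by \<open>f v\<close>, but is not multiplicative in general. The ideals are
  therefore compared through their generators: an element of the larger ideal is
  \<open>i + f v * r\<close>, and \<open>r\<close> is pulled back by surjectivity.\<close>

lemma \<Theta>_monomial_ideal:
  assumes W: "W \<subseteq> V"
  shows "idl W = \<Theta> ` monomial_ideal W"
proof
  have fW: "f ` W \<subseteq> P" using W fR by blast
  note ie = R.idealE[OF R.genideal_ideal[OF fW]]
  show "\<Theta> ` monomial_ideal W \<subseteq> idl W"
  proof
    fix a assume "a \<in> \<Theta> ` monomial_ideal W"
    then obtain q where q: "a = \<Theta> q" "q \<in> P" "\<forall>m\<in>supp q. \<exists>u\<in>W. D u \<subseteq> supp m"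
      unfolding monomial_ideal_def by blast
    have "supp q \<subseteq> {m. supp m \<subseteq> I \<and> (\<exists>u\<in>W. D u \<subseteq> supp m)}"
      using q(2,3) by (auto simp: poly_ring_simps(1))
    then have "\<Theta> q \<in> idl W"
    proof (rule frag_induction)
      fix m :: "nat \<Rightarrow>\<^sub>0 nat" assume "m \<in> {m. supp m \<subseteq> I \<and> (\<exists>u\<in>W. D u \<subseteq> supp m)}"
      then obtain u where m: "supp m \<subseteq> I" "u \<in> W" "D u \<subseteq> supp m" by blast
      have u: "u \<in> V" using W m(2) by blast
      define k where "k = m - sqf (D u)"
      have "sqf (D u) + k = m"
        unfolding k_def using m(3) lookup_sqf[OF fD[OF u]]
        by (intro poly_mapping_eqI) (force simp: lookup_add lookup_minus in_keys_iff)
      then have "\<Theta> (frag_of m) = f u * \<theta> k" using \<theta>_shift[OF u, of k] by simp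
      moreover have "supp k \<subseteq> supp m" unfolding k_def by (auto simp: in_keys_iff lookup_minus)
      then have "\<theta> k \<in> P" using m(1) by (intro \<theta>_closed) blast
      moreover have "f u \<in> idl W" using R.genideal_self[OF fW] m(2) by blast
      ultimately show "\<Theta> (frag_of m) \<in> idl W" using ie(7) by simp
    qed (simp_all add: ie frag_extend_diff)
    then show "a \<in> idl W" using q(1) by simp
  qed
  have "finite W" using W fV finite_subset by blast
  then show "idl W \<subseteq> \<Theta> ` monomial_ideal W" using W
  proof (induction W rule: finite_induct)
    case empty
    have "(0::zpoly) \<in> \<Theta> ` monomial_ideal {}"
      by (rule image_eqI[of _ _ 0]) (simp_all add: monomial_ideal_def R.R_closed)
    then show ?case using R.genideal_empty by simp
  next
    case (insert v W)
    have v: "v \<in> V" and fW: "f ` W \<subseteq> P" using insert.prems fR by auto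
    show ?case
    proof
      fix a assume "a \<in> idl (insert v W)"
      then have "a \<in> R.extend_ideal (idl W) (f v)"
        using R.genideal_insert[OF fW fR[OF v]] by simp
      then obtain i r where a: "a = i + f v * r" "i \<in> idl W" "r \<in> P"
        unfolding R.extend_ideal_def by blast
      obtain p where p: "p \<in> monomial_ideal W" "i = \<Theta> p" using insert a(2) by blast
      obtain q where q: "q \<in> P" "r = \<Theta> q" by (rule \<Theta>_surj[OF a(3)])
      let ?s = "p + frag_of (sqf (D v)) * q"
      have "a = \<Theta> ?s" unfolding a(1) p(2) q(2) frag_extend_add \<Theta>_shift[OF v] ..
      moreover have "?s \<in> monomial_ideal (insert v W)"
        unfolding monomial_ideal_def
      proof (rule CollectI, intro conjI ballI)
        show "?s \<in> P" using p(1) sqf_mult_closed[OF v q(1)] by (intro R.R_closed(3)) (auto simp: monomial_ideal_def)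
        fix m assume "m \<in> supp ?s"
        then have "m \<in> supp p \<or> m \<in> supp (frag_of (sqf (D v)) * q)"
          using Poly_Mapping.keys_add[of p "frag_of (sqf (D v)) * q"] by blast
        then show "\<exists>u\<in>insert v W. D u \<subseteq> supp m"
          using p(1) keys_sqf_add[OF v] unfolding sqf_mult_keys monomial_ideal_def by auto
      qed
      ultimately show "a \<in> \<Theta> ` monomial_ideal (insert v W)" by blast
    qed
  qed
qed

text \<open>Pulled back along \<open>\<Theta>\<close> the claim concerns monomial ideals, where it
  holds because \<open>D u\<close> and \<open>D v\<close> are disjoint: if \<open>D u\<close> is
  contained in \<open>D v \<union> supp m\<close>, it is contained in \<open>supp m\<close>.\<close>

theorem regular:
  assumes W: "W \<subseteq> V" and v: "v \<in> V" "v \<notin> W" and a: "a \<in> P" and fa: "f v * a \<in> idl W"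
  shows "a \<in> idl W"
proof -
  obtain q where q: "q \<in> P" "a = \<Theta> q" by (rule \<Theta>_surj[OF a])
  obtain p where p: "p \<in> monomial_ideal W" "f v * a = \<Theta> p" using fa unfolding \<Theta>_monomial_ideal[OF W] by blast
  have "frag_of (sqf (D v)) * q = p" by (rule \<Theta>_inj) (use p(2) q(2) \<Theta>_shift[OF v(1)] in simp)
  then have k: "\<exists>u\<in>W. D u \<subseteq> D v \<union> supp m" if m: "m \<in> supp q" for m
  proof -
    have "sqf (D v) + m \<in> supp p" using \<open>_ = p\<close> sqf_mult_keys[of "sqf (D v)" q] m by blast
    moreover have "\<forall>m\<in>supp p. \<exists>u\<in>W. D u \<subseteq> supp m"
      using p(1) unfolding monomial_ideal_def by simp
    ultimately show ?thesis unfolding keys_sqf_add[OF v(1), symmetric] by (rule bspec[rotated])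
  qed
  have "\<exists>u\<in>W. D u \<subseteq> supp m" if m: "m \<in> supp q" for m
  proof -
    obtain u where u: "u \<in> W" "D u \<subseteq> D v \<union> supp m" using k[OF m] by blast
    have "D u \<inter> D v = {}" by (rule disj) (use u(1) W v in auto)
    then show ?thesis using u by blast
  qed
  then have "q \<in> monomial_ideal W" using q(1) unfolding monomial_ideal_def by blast
  then show ?thesis unfolding \<Theta>_monomial_ideal[OF W] q(2) by blast
qed

end

section \<open>Edges and weights of a braid resolution\<close>

locale braid_projection =
  fixes K :: decorated_braid
  assumes K: "decorated_braid_projection K"
begin

abbreviation "n \<equiv> crossings K"
abbreviation "E \<equiv> edge_at K"
text \<open>The first segment of the distinguished edge, along which the orientation reaches the cut
  point.\<close>

abbreviation "last_edge \<equiv> E 0 n"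

definition touches :: "nat \<Rightarrow> nat \<Rightarrow> bool"
  where "touches j t \<longleftrightarrow> j = left_col K t \<or> j = Suc (left_col K t)"

lemma strands_pos: "0 < strands K"
  using K unfolding decorated_braid_projection_def by simp

lemma left_col_less: "t < n \<Longrightarrow> Suc (left_col K t) < strands K"
proof -
  assume "t < n"
  then have "braid_word K ! t \<in> set (braid_word K)" unfolding crossings_def by simp
  then show ?thesis using K unfolding decorated_braid_projection_def left_col_def by (auto simp: case_prod_beta)
qed

lemma numbering: "is_edge_numbering K"
  using K unfolding decorated_braid_projection_def by simp

lemma E_image: "(\<lambda>(j, t). E j t) ` ({..<strands K} \<times> {..n}) = {..2 * n}"
  using numbering unfolding is_edge_numbering_def diagram_points_def by simp

lemma E_le: "j < strands K \<Longrightarrow> t \<le> n \<Longrightarrow> E j t \<le> 2 * n"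
  using E_image by (auto simp: set_eq_iff image_iff)

lemma E_00: "E 0 0 = 0"
  using numbering unfolding is_edge_numbering_def by simp

lemma E_eqI:
  assumes "((j, t), (j', t')) \<in> arc_steps K" "j < strands K" "t \<le> n" "j' < strands K" "t' \<le> n"
  shows "E j t = E j' t'"
proof -
  have "((j, t), (j', t')) \<in> same_edge K" unfolding same_edge_def using assms(1) by blast
  then show ?thesis using numbering assms unfolding is_edge_numbering_def diagram_points_def by fastforce
qed

lemma E_step: "j < strands K \<Longrightarrow> t < n \<Longrightarrow> \<not> touches j t \<Longrightarrow> E j (Suc t) = E j t"
  by (rule E_eqI[symmetric]) (auto simp: arc_steps_def touches_def)

lemma E_wrap: "0 < j \<Longrightarrow> j < strands K \<Longrightarrow> E j n = E j 0"
  by (rule E_eqI) (auto simp: arc_steps_def)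

text \<open>\<open>perm t i\<close> is the column at level \<open>t\<close> of the strand that
  starts in column \<open>i\<close>.\<close>

definition perm :: "nat \<Rightarrow> nat \<Rightarrow> nat"
  where "perm t = fold (\<lambda>(i, s) \<pi>. transpose i (Suc i) \<circ> \<pi>) (take t (braid_word K)) id"

lemma perm_0: "perm 0 = id" by (simp add: perm_def)

lemma perm_Suc: "t < n \<Longrightarrow> perm (Suc t) = transpose (left_col K t) (Suc (left_col K t)) \<circ> perm t"
  by (simp add: perm_def crossings_def take_Suc_conv_app_nth left_col_def case_prod_beta)

lemma perm_n: "perm n = braid_perm K"
  by (simp add: perm_def braid_perm_def crossings_def)

lemma perm_inj: "t \<le> n \<Longrightarrow> inj (perm t)"
  by (induction t) (auto simp: perm_0 perm_Suc intro!: inj_compose)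

lemma perm_less: "t \<le> n \<Longrightarrow> i < strands K \<Longrightarrow> perm t i < strands K"
proof (induction t)
  case (Suc t)
  then show ?case using left_col_less[of t] by (auto simp: perm_Suc transpose_def)
qed (simp add: perm_0)

lemma perm_surj:
  assumes "t \<le> n" "j < strands K"
  obtains i where "i < strands K" "perm t i = j"
proof -
  have "perm t ` {..<strands K} = {..<strands K}"
    by (rule endo_inj_surj) (use perm_less[OF assms(1)] perm_inj[OF assms(1)] in \<open>auto intro: inj_on_subset\<close>)
  then show ?thesis using assms(2) that by (metis imageE lessThan_iff)
qed

text \<open>A column without crossings would be fixed by the braid permutation and close up to a
  component of its own. Column 0 is exempt: a single strand has no crossing.\<close>

lemma column_touched:
  assumes j: "0 < j" "j < strands K"
  shows "\<exists>t<n. touches j t"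
proof (rule ccontr)
  assume "\<not> (\<exists>t<n. touches j t)"
  then have nt: "\<not> touches j t" if "t < n" for t using that by blast
  have "perm t j = j" if "t \<le> n" for t using that
    by (induction t) (use nt in \<open>auto simp: perm_0 perm_Suc touches_def transpose_def\<close>)
  then have bj: "braid_perm K j = j" using perm_n by (metis order_refl)
  have "closes_to_knot K" using K unfolding decorated_braid_projection_def by simp
  then obtain m where m: "(braid_perm K ^^ m) 0 = j" using j unfolding closes_to_knot_def by blast
  have "(braid_perm K ^^ m) j = j" using bj by (induction m) auto
  moreover have "inj (braid_perm K ^^ m)" using perm_inj[of n] perm_n by (auto intro: inj_fn)
  ultimately have "j = 0" using m by (metis injD)
  then show False using j by simp
qed

text \<open>A port is one of the two sides of a crossing, with \<open>True\<close> for the right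
  one, or \<open>None\<close> for the cut point of the distinguished edge, where
  \<open>e\<^sub>0\<close> starts and \<open>last_edge\<close> ends. Every edge starts at one port
  and ends at one port.\<close>

definition out_port :: "(nat \<times> bool) option \<Rightarrow> nat"
  where "out_port p = (case p of None \<Rightarrow> 0 | Some (t, r) \<Rightarrow> if r then edge_b K t else edge_a K t)"

definition in_port :: "(nat \<times> bool) option \<Rightarrow> nat"
  where "in_port p = (case p of None \<Rightarrow> last_edge | Some (t, r) \<Rightarrow> if r then edge_d K t else edge_c K t)"

definition ports :: "(nat \<times> bool) option set"
  where "ports = insert None (Some ` ({..<n} \<times> UNIV))"

lemma finite_ports: "finite ports" and card_ports: "card ports = 2 * n + 1"
proof -
  have "finite ({..<n} \<times> (UNIV :: bool set))" by simp
  then show "finite ports" unfolding ports_def by simp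
  have "card (Some ` ({..<n} \<times> (UNIV :: bool set))) = 2 * n"
    by (subst card_image) (auto simp: card_cartesian_product)
  then show "card ports = 2 * n + 1" unfolding ports_def by (subst card_insert_disjoint) auto
qed

lemma out_port_touch:
  assumes "t < n" "touches j t"
  shows "\<exists>r. E j (Suc t) = out_port (Some (t, r)) \<and> E j t = in_port (Some (t, r))"
  using assms unfolding touches_def
  by (auto simp: out_port_def in_port_def edge_a_def edge_b_def edge_c_def edge_d_def intro: exI[of _ True] exI[of _ False])

text \<open>Descending in a column from level \<open>t\<close> leads to a crossing or to the bottom.
  This locates the start of an edge, as \<open>edge_above\<close> locates its end.\<close>

lemma edge_below:
  assumes j: "j < strands K"
  shows "t \<le> n \<Longrightarrow> (\<exists>t'<t. touches j t' \<and> E j t = E j (Suc t')) \<or> ((\<forall>t'<t. \<not> touches j t') \<and> E j t = E j 0)"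
proof (induction t)
  case (Suc t)
  show ?case
  proof (cases "touches j t")
    case False
    then show ?thesis using Suc E_step[OF j, of t] by (auto simp: less_Suc_eq)
  qed auto
qed simp

lemma edge_above:
  assumes j: "j < strands K"
  shows "t \<le> n \<Longrightarrow> (\<exists>t'\<ge>t. t' < n \<and> touches j t' \<and> E j t = E j t') \<or> ((\<forall>t'\<ge>t. t' < n \<longrightarrow> \<not> touches j t') \<and> E j t = E j n)"
proof (induction "n - t" arbitrary: t)
  case 0
  then show ?case by auto
next
  case (Suc d)
  then have t: "t < n" "d = n - Suc t" "Suc t \<le> n" by auto
  show ?case
  proof (cases "touches j t")
    case True
    then show ?thesis using t by blast
  next
    case False
    then have "E j (Suc t) = E j t" using E_step[OF j t(1)] by simp
    moreover have "t' \<ge> t \<longleftrightarrow> t' = t \<or> t' \<ge> Suc t" for t' by auto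
    ultimately show ?thesis using Suc.hyps(1)[OF t(2,3)] False by (metis le_refl)
  qed
qed

lemma out_port_image: "out_port ` ports = {..2 * n}"
proof
  show "out_port ` ports \<subseteq> {..2 * n}"
    using left_col_less E_le by (auto simp: ports_def out_port_def edge_a_def edge_b_def less_imp_le Suc_lessD Suc_leI)
  have main: "E j t \<in> out_port ` ports" if j: "j < strands K" and t: "t \<le> n" for j t
  proof -
    have touched: "E j t \<in> out_port ` ports" if tt: "t' < n" "touches j t'" "E j t = E j (Suc t')" for t t'
    proof -
      obtain r where "E j (Suc t') = out_port (Some (t', r))" using out_port_touch[OF tt(1,2)] by blast
      moreover have "Some (t', r) \<in> ports" using tt(1) by (simp add: ports_def)
      ultimately show ?thesis using tt(3) by (metis imageI)
    qed
    from edge_below[OF j t] show ?thesis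
    proof
      assume "\<exists>t'<t. touches j t' \<and> E j t = E j (Suc t')"
      then obtain t' where "t' < t" "touches j t'" "E j t = E j (Suc t')" by blast
      then show ?thesis using touched[of t' t] t by simp
    next
      assume a: "(\<forall>t'<t. \<not> touches j t') \<and> E j t = E j 0"
      show ?thesis
      proof (cases "j = 0")
        case True
        then have "E j t = out_port None" using a by (simp add: E_00 out_port_def)
        moreover have "None \<in> ports" by (simp add: ports_def)
        ultimately show ?thesis by (metis imageI)
      next
        case False
        \<comment> \<open>No crossing lies below, so the edge comes around the closure from the top
          of the column, where \<open>column_touched\<close> provides the crossing at which it
          starts.\<close>
        then have e: "E j t = E j n" using a E_wrap[OF _ j] by simp
        obtain t' where "t' < n" "touches j t'" using column_touched[OF _ j] False by blast
        then obtain t'' where "t'' < n" "touches j t''" "E j n = E j (Suc t'')"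
          using edge_below[OF j, of n] by blast
        then show ?thesis using touched[of t'' n] e by simp
      qed
    qed
  qed
  then show "{..2 * n} \<subseteq> out_port ` ports" unfolding E_image[symmetric] by auto
qed

lemma in_port_image: "in_port ` ports = {..2 * n}"
proof
  show "in_port ` ports \<subseteq> {..2 * n}"
    using left_col_less E_le strands_pos by (auto simp: ports_def in_port_def edge_c_def edge_d_def less_imp_le Suc_lessD Suc_leI)
  have main: "E j t \<in> in_port ` ports" if j: "j < strands K" and t: "t \<le> n" for j t
  proof -
    have touched: "E j t \<in> in_port ` ports" if tt: "t' < n" "touches j t'" "E j t = E j t'" for t t'
    proof -
      obtain r where "E j t' = in_port (Some (t', r))" using out_port_touch[OF tt(1,2)] by blast
      moreover have "Some (t', r) \<in> ports" using tt(1) by (simp add: ports_def)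
      ultimately show ?thesis using tt(3) by (metis imageI)
    qed
    from edge_above[OF j t] show ?thesis
    proof
      assume "\<exists>t'\<ge>t. t' < n \<and> touches j t' \<and> E j t = E j t'"
      then show ?thesis using touched by blast
    next
      assume a: "(\<forall>t'\<ge>t. t' < n \<longrightarrow> \<not> touches j t') \<and> E j t = E j n"
      show ?thesis
      proof (cases "j = 0")
        case True
        then have "E j t = in_port None" using a by (simp add: in_port_def)
        moreover have "None \<in> ports" by (simp add: ports_def)
        ultimately show ?thesis by (metis imageI)
      next
        case False
        then have e: "E j t = E j 0" using a E_wrap[OF _ j] by simp
        obtain t' where "t' < n" "touches j t'" using column_touched[OF _ j] False by blast
        then obtain t'' where "t'' < n" "touches j t''" "E j 0 = E j t''"
          using edge_above[OF j, of 0] by blast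
        then show ?thesis using touched[of t'' 0] e by simp
      qed
    qed
  qed
  then show "{..2 * n} \<subseteq> in_port ` ports" unfolding E_image[symmetric] by auto
qed

text \<open>Both maps hit all \<open>2 n + 1\<close> edges and have as many arguments, so they are injective.\<close>

lemma out_port_inj: "inj_on out_port ports"
  by (rule eq_card_imp_inj_on) (simp_all add: finite_ports card_ports out_port_image)

lemma in_port_inj: "inj_on in_port ports"
  by (rule eq_card_imp_inj_on) (simp_all add: finite_ports card_ports in_port_image)

end

section \<open>Vertices and edges of a resolution\<close>

locale braid_resolution = braid_projection +
  fixes S :: "nat set" and pick :: "nat set \<Rightarrow> vertex"
  assumes S: "complete_resolution K S" and pick: "special_choice K S pick"
begin

lemma S_sub: "S \<subseteq> {..<n}" using S unfolding complete_resolution_def .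

fun vports :: "vertex \<Rightarrow> (nat \<times> bool) option set"
  where
    "vports (Four_Valent t) = {Some (t, False), Some (t, True)}"
  | "vports (Left_Vertex t) = {Some (t, False)}"
  | "vports (Right_Vertex t) = {Some (t, True)}"

abbreviation "VS \<equiv> vertices K S"

definition outs :: "vertex \<Rightarrow> nat set" where "outs v = out_port ` vports v"
definition ins :: "vertex \<Rightarrow> nat set" where "ins v = in_port ` vports v"

lemma incident_eq: "incident_edges K v = outs v \<union> ins v"
  by (cases v) (auto simp: outs_def ins_def out_port_def in_port_def)

lemma finite_VS: "finite VS"
  using S_sub finite_subset unfolding vertices_def right_vertices_def by blast

lemma vports_sub: "v \<in> VS \<Longrightarrow> vports v \<subseteq> ports"
proof -
  have "t \<in> S \<Longrightarrow> t < n" for t using S_sub by auto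
  then show "v \<in> VS \<Longrightarrow> vports v \<subseteq> ports"
    by (auto simp: vertices_def right_vertices_def ports_def inj_image_mem_iff)
qed

lemma vports_disj: "u \<in> VS \<Longrightarrow> v \<in> VS \<Longrightarrow> p \<in> vports u \<Longrightarrow> p \<in> vports v \<Longrightarrow> u = v"
  by (auto simp: vertices_def right_vertices_def)

lemma vports_finite: "finite (vports v)" by (cases v) auto

lemma vports_ne: "vports v \<noteq> {}" by (cases v) auto

lemma vports_None: "None \<notin> vports v" by (cases v) auto

lemma vports_cover: "p \<in> ports \<Longrightarrow> p \<noteq> None \<Longrightarrow> \<exists>v\<in>VS. p \<in> vports v"
proof -
  assume "p \<in> ports" "p \<noteq> None"
  then obtain t r where p: "p = Some (t, r)" "t < n" by (auto simp: ports_def)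
  show ?thesis
  proof (cases "t \<in> S")
    case True
    then show ?thesis using p by (intro bexI[of _ "Four_Valent t"]) (auto simp: vertices_def)
  next
    case False
    then show ?thesis using p
      by (intro bexI[of _ "if r then Right_Vertex t else Left_Vertex t"]) (auto simp: vertices_def right_vertices_def)
  qed
qed

lemma outs_unique:
  assumes "u \<in> VS" "v \<in> VS" "e \<in> outs u" "e \<in> outs v"
  shows "u = v"
proof -
  obtain p where p: "p \<in> vports u" "e = out_port p" using assms(3) unfolding outs_def by (rule imageE)
  obtain q where q: "q \<in> vports v" "e = out_port q" using assms(4) unfolding outs_def by (rule imageE)
  have "p \<in> ports" "q \<in> ports" using vports_sub[OF assms(1)] vports_sub[OF assms(2)] p(1) q(1) by auto
  then have "p = q" using inj_onD[OF out_port_inj] p(2) q(2) by simp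
  then show ?thesis using vports_disj[OF assms(1,2) p(1)] q(1) by simp
qed

lemma ins_unique:
  assumes "u \<in> VS" "v \<in> VS" "e \<in> ins u" "e \<in> ins v"
  shows "u = v"
proof -
  obtain p where p: "p \<in> vports u" "e = in_port p" using assms(3) unfolding ins_def by (rule imageE)
  obtain q where q: "q \<in> vports v" "e = in_port q" using assms(4) unfolding ins_def by (rule imageE)
  have "p \<in> ports" "q \<in> ports" using vports_sub[OF assms(1)] vports_sub[OF assms(2)] p(1) q(1) by auto
  then have "p = q" using inj_onD[OF in_port_inj] p(2) q(2) by simp
  then show ?thesis using vports_disj[OF assms(1,2) p(1)] q(1) by simp
qed

lemma outs_le: "v \<in> VS \<Longrightarrow> outs v \<subseteq> {..2 * n}"
  unfolding outs_def out_port_image[symmetric] using vports_sub by blast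

lemma ins_le: "v \<in> VS \<Longrightarrow> ins v \<subseteq> {..2 * n}"
  unfolding ins_def in_port_image[symmetric] using vports_sub by blast

lemma outs_finite: "finite (outs v)" unfolding outs_def by (rule finite_imageI[OF vports_finite])
lemma ins_finite: "finite (ins v)" unfolding ins_def by (rule finite_imageI[OF vports_finite])

lemma card_outs: "v \<in> VS \<Longrightarrow> card (outs v) = card (vports v)"
  unfolding outs_def by (rule card_image[OF inj_on_subset[OF out_port_inj vports_sub]])

lemma card_ins: "v \<in> VS \<Longrightarrow> card (ins v) = card (vports v)"
  unfolding ins_def by (rule card_image[OF inj_on_subset[OF in_port_inj vports_sub]])

lemma zero_not_out: "v \<in> VS \<Longrightarrow> 0 \<notin> outs v"
proof
  assume v: "v \<in> VS" "0 \<in> outs v"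
  then obtain p where p: "p \<in> vports v" "out_port p = out_port None" unfolding outs_def by (auto simp: out_port_def)
  have "p = None" by (rule inj_onD[OF out_port_inj p(2)]) (use p vports_sub[OF v(1)] in \<open>auto simp: ports_def\<close>)
  then show False using p vports_None by blast
qed

lemma last_not_in: "v \<in> VS \<Longrightarrow> last_edge \<notin> ins v"
proof
  assume v: "v \<in> VS" "last_edge \<in> ins v"
  then obtain p where p: "p \<in> vports v" "in_port p = in_port None" unfolding ins_def by (auto simp: in_port_def)
  have "p = None" by (rule inj_onD[OF in_port_inj p(2)]) (use p vports_sub[OF v(1)] in \<open>auto simp: ports_def\<close>)
  then show False using p vports_None by blast
qed

lemma out_exists:
  assumes "e \<le> 2 * n" "e \<noteq> 0"
  shows "\<exists>v\<in>VS. e \<in> outs v"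
proof -
  obtain p where p: "p \<in> ports" "e = out_port p" using out_port_image assms(1) by (metis atMost_iff imageE)
  have "p \<noteq> None" using assms(2) p(2) by (intro notI) (simp add: out_port_def)
  then show ?thesis using vports_cover[OF p(1)] p(2) unfolding outs_def by blast
qed

lemma in_exists:
  assumes "e \<le> 2 * n" "e \<noteq> last_edge"
  shows "\<exists>v\<in>VS. e \<in> ins v"
proof -
  obtain p where p: "p \<in> ports" "e = in_port p" using in_port_image assms(1) by (metis atMost_iff imageE)
  have "p \<noteq> None" using assms(2) p(2) by (intro notI) (simp add: in_port_def)
  then show ?thesis using vports_cover[OF p(1)] p(2) unfolding ins_def by blast
qed

section \<open>Connected components\<close>

abbreviation "Adj \<equiv> (adjacent_edges K S)\<^sup>*"

lemma adjacent_sym: "(a, b) \<in> adjacent_edges K S \<Longrightarrow> (b, a) \<in> adjacent_edges K S"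
  unfolding adjacent_edges_def by blast

lemma Adj_sym: "(a, b) \<in> Adj \<Longrightarrow> (b, a) \<in> Adj"
  by (meson adjacent_sym symI sym_rtrancl symD)

lemma Adj_le: "(a, b) \<in> Adj \<Longrightarrow> a \<le> 2 * n \<Longrightarrow> b \<le> 2 * n"
proof (induction rule: rtrancl_induct)
  case (step y z)
  have "z \<le> 2 * n" if "(y, z) \<in> adjacent_edges K S"
    using that outs_le ins_le E_le strands_pos unfolding adjacent_edges_def incident_eq
    by (fastforce simp: subset_iff)
  then show ?case using step by blast
qed

lemma componentE:
  assumes "C \<in> components K S"
  obtains e where "e \<le> 2 * n" "C = {e'. (e, e') \<in> Adj}"
  using assms unfolding components_def quotient_def by auto

lemma component_eq: "C \<in> components K S \<Longrightarrow> e \<in> C \<Longrightarrow> C = {e'. (e, e') \<in> Adj}"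
  by (elim componentE) (auto intro: rtrancl_trans Adj_sym)

lemma component_le: "C \<in> components K S \<Longrightarrow> C \<subseteq> {..2 * n}"
  by (elim componentE) (auto dest: Adj_le)

lemma component_vertex:
  assumes C: "C \<in> components K S" and v: "v \<in> VS" and e: "e \<in> incident_edges K v" "e \<in> C"
  shows "incident_edges K v \<subseteq> C"
proof
  fix e' assume "e' \<in> incident_edges K v"
  then have "(e, e') \<in> adjacent_edges K S" using v e unfolding adjacent_edges_def by blast
  then show "e' \<in> C" using component_eq[OF C e(2)] by blast
qed

lemma component_last: "C \<in> components K S \<Longrightarrow> last_edge \<in> C \<longleftrightarrow> 0 \<in> C"
proof -
  assume C: "C \<in> components K S"
  have "(0, last_edge) \<in> Adj" unfolding adjacent_edges_def using E_00 by auto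
  then show ?thesis using component_eq[OF C] Adj_sym by blast
qed

definition special :: "vertex set" where "special = pick ` free_components K S"

definition regulars :: "vertex set" where "regulars = VS - special"

lemma pick_props:
  assumes "C \<in> free_components K S"
  shows "pick C \<in> VS" "incident_edges K (pick C) \<subseteq> C" "\<exists>t. t < n \<and> t \<notin> S \<and> pick C = Right_Vertex t"
  using pick assms unfolding special_choice_def by (auto simp: vertices_def right_vertices_def)

lemma incident_ne: "incident_edges K v \<noteq> {}"
  by (cases v) auto

lemma special_component:
  assumes C: "C \<in> free_components K S" and C': "C' \<in> free_components K S" and i: "incident_edges K (pick C) \<subseteq> C'"
  shows "C = C'"
proof -
  obtain e where e: "e \<in> incident_edges K (pick C)" using incident_ne by blast
  have "e \<in> C" "e \<in> C'" using e pick_props(2)[OF C] i by auto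
  then show ?thesis using component_eq C C' unfolding free_components_def by blast
qed

lemma pick_inj: "inj_on pick (free_components K S)"
proof (rule inj_onI)
  fix C C' assume *: "C \<in> free_components K S" "C' \<in> free_components K S" "pick C = pick C'"
  then show "C = C'" using special_component[OF *(1,2)] pick_props(2)[OF *(2)] by simp
qed

section \<open>Paths to terminal vertices and weights\<close>

definition flow :: "(vertex \<times> vertex) set"
  where "flow = {(u, v). u \<in> VS \<and> v \<in> VS \<and> outs u \<inter> ins v \<noteq> {}}"

text \<open>A path may stop at a special vertex, whose relation is omitted, or at the vertex that
  emits the last edge, which enters no vertex.\<close>

definition terminal :: "vertex \<Rightarrow> bool" where "terminal v \<longleftrightarrow> v \<in> special \<or> last_edge \<in> outs v"

text \<open>A set of vertices closed under following edges has as many ingoing as outgoing edges, so it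
  is a union of components, unless it meets the last edge.\<close>

lemma reaches_terminal:
  assumes v: "v \<in> VS"
  shows "\<exists>u. (v, u) \<in> flow\<^sup>* \<and> terminal u"
proof (rule ccontr)
  assume nt: "\<not> (\<exists>u. (v, u) \<in> flow\<^sup>* \<and> terminal u)"
  define X where "X = {u. (v, u) \<in> flow\<^sup>*}"
  have XV: "X \<subseteq> VS"
  proof
    fix u assume "u \<in> X"
    then have "(v, u) \<in> flow\<^sup>*" by (simp add: X_def)
    then show "u \<in> VS" by (cases rule: rtrancl.cases) (use v in \<open>auto simp: flow_def\<close>)
  qed
  have fX: "finite X" using XV finite_VS finite_subset by blast
  define OX where "OX = (\<Union>u\<in>X. outs u)"
  define IX where "IX = (\<Union>u\<in>X. ins u)"
  have sub: "OX \<subseteq> IX"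
  proof
    fix e assume "e \<in> OX"
    then obtain u where u: "u \<in> X" "e \<in> outs u" unfolding OX_def by blast
    have "e \<noteq> last_edge" using nt u unfolding X_def terminal_def by blast
    moreover have "e \<le> 2 * n" using outs_le XV u by blast
    ultimately obtain u' where u': "u' \<in> VS" "e \<in> ins u'" using in_exists by blast
    have "(u, u') \<in> flow" using u u' XV unfolding flow_def by blast
    then have "u' \<in> X" using u(1) unfolding X_def by (auto intro: rtrancl_into_rtrancl)
    then show "e \<in> IX" unfolding IX_def using u'(2) by blast
  qed
  have "card OX = (\<Sum>u\<in>X. card (vports u))"
  proof -
    have "card OX = (\<Sum>u\<in>X. card (outs u))" unfolding OX_def
      by (rule card_UN_disjoint[OF fX]) (use outs_finite outs_unique XV in blast)+
    also have "\<dots> = (\<Sum>u\<in>X. card (vports u))" by (rule sum.cong[OF refl card_outs]) (use XV in blast)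
    finally show ?thesis .
  qed
  also have "\<dots> = card IX"
  proof -
    have "card IX = (\<Sum>u\<in>X. card (ins u))" unfolding IX_def
      by (rule card_UN_disjoint[OF fX]) (use ins_finite ins_unique XV in blast)+
    also have "\<dots> = (\<Sum>u\<in>X. card (vports u))" by (rule sum.cong[OF refl card_ins]) (use XV in blast)
    finally show ?thesis by simp
  qed
  finally have OI: "OX = IX"
    using sub card_subset_eq[of IX OX] fX ins_finite unfolding IX_def by auto
  have no0: "0 \<notin> OX" unfolding OX_def using zero_not_out XV by blast
  have noL: "last_edge \<notin> OX" unfolding OI IX_def using last_not_in XV by blast
  have closed: "e' \<in> OX" if ee: "e \<in> OX" "(e, e') \<in> adjacent_edges K S" for e e'
  proof -
    have "e \<noteq> 0" "e \<noteq> last_edge" using ee(1) no0 noL by (metis, metis)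
    then obtain u where u: "u \<in> VS" "e \<in> incident_edges K u" "e' \<in> incident_edges K u"
      using ee(2) E_00 unfolding adjacent_edges_def by auto
    have "u \<in> X"
    proof (cases "e \<in> outs u")
      case True
      then show ?thesis using outs_unique u(1) XV ee(1) unfolding OX_def by blast
    next
      case False
      then have "e \<in> ins u" using u(2) incident_eq by blast
      then show ?thesis using ins_unique u(1) XV ee(1)[unfolded OI] unfolding IX_def by blast
    qed
    then have "incident_edges K u \<subseteq> OX" unfolding incident_eq using OI unfolding OX_def IX_def by blast
    then show ?thesis using u(3) by blast
  qed
  obtain e where e: "e \<in> outs v" using vports_ne unfolding outs_def by blast
  have eX: "e \<in> OX" unfolding OX_def X_def using e by blast
  let ?C = "{e'. (e, e') \<in> Adj}"
  have sC: "?C \<subseteq> OX"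
  proof
    fix e' assume "e' \<in> ?C"
    then have "(e, e') \<in> Adj" by simp
    then show "e' \<in> OX" by (induction rule: rtrancl_induct) (use eX closed in auto)
  qed
  have "e \<le> 2 * n" using e outs_le[OF v] by blast
  then have "?C \<in> components K S" unfolding components_def by (auto intro!: quotientI simp: Image_singleton[symmetric])
  \<comment> \<open>The component avoids edge 0, so it carries a special vertex. All its edges leave
    vertices of \<open>X\<close>, so this vertex is in \<open>X\<close>, and it is terminal.\<close>
  then have C: "?C \<in> free_components K S" unfolding free_components_def using sC no0 by blast
  obtain p where p: "p \<in> outs (pick ?C)" using vports_ne unfolding outs_def by blast
  then have "p \<in> OX" using pick_props(2)[OF C] sC incident_eq by blast
  then have "pick ?C \<in> X" using outs_unique[OF pick_props(1)[OF C] _ p] XV unfolding OX_def by blast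
  then show False using nt C unfolding X_def terminal_def special_def by blast
qed

definition height :: "vertex \<Rightarrow> nat"
  where "height v = (LEAST k. \<exists>u. (v, u) \<in> flow ^^ k \<and> terminal u)"

lemma height_ex:
  assumes "v \<in> VS"
  shows "\<exists>u. (v, u) \<in> flow ^^ height v \<and> terminal u"
proof -
  have "\<exists>k u. (v, u) \<in> flow ^^ k \<and> terminal u" using reaches_terminal[OF assms] rtrancl_imp_relpow by blast
  then show ?thesis unfolding height_def by (rule LeastI_ex)
qed

lemma pivot_exists:
  assumes v: "v \<in> regulars"
  shows "\<exists>e. e \<in> outs v \<and> (e = last_edge \<or> (\<exists>u\<in>VS. e \<in> ins u \<and> height u < height v))"
proof -
  have vV: "v \<in> VS" "v \<notin> special" using v by (auto simp: regulars_def)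
  obtain u where u: "(v, u) \<in> flow ^^ height v" "terminal u" using height_ex[OF vV(1)] by blast
  show ?thesis
  proof (cases "height v")
    case 0
    then have "terminal v" using u by simp
    then show ?thesis using vV(2) unfolding terminal_def by blast
  next
    case (Suc k)
    then obtain v' where v': "(v, v') \<in> flow" "(v', u) \<in> flow ^^ k" using u(1) relpow_Suc_D2[of v u k flow] by auto
    have "height v' \<le> k" unfolding height_def by (rule Least_le) (use v'(2) u(2) in blast)
    then have "height v' < height v" using Suc by simp
    then show ?thesis using v'(1) unfolding flow_def by blast
  qed
qed

definition pivot :: "vertex \<Rightarrow> nat"
  where "pivot v = (SOME e. e \<in> outs v \<and> (e = last_edge \<or> (\<exists>u\<in>VS. e \<in> ins u \<and> height u < height v)))"

lemma pivot:
  assumes "v \<in> regulars"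
  shows "pivot v \<in> outs v" "pivot v = last_edge \<or> (\<exists>u\<in>VS. pivot v \<in> ins u \<and> height u < height v)"
proof -
  have "pivot v \<in> outs v \<and> (pivot v = last_edge \<or> (\<exists>u\<in>VS. pivot v \<in> ins u \<and> height u < height v))"
    unfolding pivot_def by (rule someI_ex[OF pivot_exists[OF assms]])
  then show "pivot v \<in> outs v" "pivot v = last_edge \<or> (\<exists>u\<in>VS. pivot v \<in> ins u \<and> height u < height v)"
    by blast+
qed

text \<open>Each pivot is weighted by a power of 3, larger the closer its vertex is to a terminal
  one, and all other edges by 0. The base exceeds 2 because two edges can enter a vertex, and their
  weights together have to stay below that of the pivot.\<close>

definition weight :: "nat \<Rightarrow> nat"
  where "weight e = (\<Sum>v\<in>regulars. if e = pivot v then 3 ^ (Max (height ` VS) - height v) else 0)"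

lemma regulars_VS: "v \<in> regulars \<Longrightarrow> v \<in> VS" by (simp add: regulars_def)

lemma finite_regulars: "finite regulars" unfolding regulars_def using finite_VS by simp

lemma weight_out:
  assumes v: "v \<in> regulars" and e: "e \<in> outs v"
  shows "weight e = (if e = pivot v then 3 ^ (Max (height ` VS) - height v) else 0)"
proof -
  have "weight e = (\<Sum>u\<in>regulars. if u = v then (if e = pivot v then 3 ^ (Max (height ` VS) - height v) else 0) else 0)"
    unfolding weight_def
  proof (rule sum.cong[OF refl])
    fix u assume u: "u \<in> regulars"
    have "e \<noteq> pivot u" if "u \<noteq> v" using outs_unique[OF regulars_VS[OF u] regulars_VS[OF v] _ e] pivot(1)[OF u] that by blast
    then show "(if e = pivot u then 3 ^ (Max (height ` VS) - height u) else 0)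
      = (if u = v then (if e = pivot v then 3 ^ (Max (height ` VS) - height v) else 0) else 0)" by auto
  qed
  then show ?thesis using v finite_regulars by (simp add: sum.delta)
qed

text \<open>An edge of positive weight that enters \<open>v\<close> is the pivot of a vertex
  \<open>u\<close>. Pivots lead to smaller height, so the exponent at \<open>u\<close> is at least
  one below the exponent at \<open>v\<close>.\<close>

lemma weight_in:
  assumes v: "v \<in> VS" and e: "e \<in> ins v"
  shows "2 * weight e < 3 ^ (Max (height ` VS) - height v)"
proof (cases "\<exists>u\<in>regulars. e = pivot u")
  case True
  then obtain u where u: "u \<in> regulars" "e = pivot u" by blast
  have we: "weight e = 3 ^ (Max (height ` VS) - height u)" using weight_out[OF u(1)] pivot(1)[OF u(1)] u(2) by simp
  have "e \<noteq> last_edge" using last_not_in[OF v] e by blast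
  then obtain u' where u': "u' \<in> VS" "e \<in> ins u'" "height u' < height u" using pivot(2)[OF u(1)] u(2) by blast
  then have "height v < height u" using ins_unique[OF v u'(1) e u'(2)] by simp
  moreover have "height u \<le> Max (height ` VS)" by (rule Max_ge) (use finite_VS regulars_VS[OF u(1)] in auto)
  ultimately have "Max (height ` VS) - height v = Suc (Max (height ` VS) - Suc (height v))"
    "Max (height ` VS) - height u \<le> Max (height ` VS) - Suc (height v)" by auto
  then have "(3::nat) ^ (Max (height ` VS) - height u) \<le> 3 ^ (Max (height ` VS) - Suc (height v))"
    "(3::nat) ^ (Max (height ` VS) - height v) = 3 * 3 ^ (Max (height ` VS) - Suc (height v))"
    by (simp_all only: power_increasing power_Suc one_le_numeral)
  moreover have "(0::nat) < 3 ^ (Max (height ` VS) - Suc (height v))" by simp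
  ultimately show ?thesis unfolding we by linarith
next
  case False
  then have "weight e = 0" unfolding weight_def by (intro sum.neutral) auto
  then show ?thesis by simp
qed

text \<open>In a component without the distinguished edge every edge leaves one vertex and enters
  one vertex of the component, so its two contributions cancel.\<close>

lemma flow_sum:
  assumes C: "C \<in> free_components K S"
  shows "(\<Sum>v\<in>{v \<in> VS. incident_edges K v \<subseteq> C}. (\<Sum>e\<in>outs v. h e) - (\<Sum>e\<in>ins v. h e)) = (0 :: zpoly)"
proof -
  let ?X = "{v \<in> VS. incident_edges K v \<subseteq> C}"
  have C': "C \<in> components K S" "0 \<notin> C" using C unfolding free_components_def by auto
  have fX: "finite ?X" using finite_VS by simp
  have "(\<Sum>v\<in>?X. \<Sum>e\<in>outs v. h e) = (\<Sum>e\<in>(\<Union>v\<in>?X. outs v). h e)"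
    by (rule sum.UNION_disjoint[symmetric, OF fX]) (use outs_finite outs_unique in blast)+
  also have "(\<Union>v\<in>?X. outs v) = C"
  proof
    show "C \<subseteq> (\<Union>v\<in>?X. outs v)"
    proof
      fix e assume e: "e \<in> C"
      then obtain v where v: "v \<in> VS" "e \<in> outs v" using out_exists[of e] component_le[OF C'(1)] C'(2) by (metis atMost_iff subsetD)
      then have "incident_edges K v \<subseteq> C" using component_vertex[OF C'(1) v(1) _ e] incident_eq by blast
      then show "e \<in> (\<Union>v\<in>?X. outs v)" using v by blast
    qed
  qed (use incident_eq in blast)
  finally have o: "(\<Sum>v\<in>?X. \<Sum>e\<in>outs v. h e) = sum h C" .
  have "(\<Sum>v\<in>?X. \<Sum>e\<in>ins v. h e) = (\<Sum>e\<in>(\<Union>v\<in>?X. ins v). h e)"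
    by (rule sum.UNION_disjoint[symmetric, OF fX]) (use ins_finite ins_unique in blast)+
  also have "(\<Union>v\<in>?X. ins v) = C"
  proof
    show "C \<subseteq> (\<Union>v\<in>?X. ins v)"
    proof
      fix e assume e: "e \<in> C"
      have "e \<noteq> last_edge" using e component_last[OF C'(1)] C'(2) by blast
      then obtain v where v: "v \<in> VS" "e \<in> ins v" using in_exists[of e] component_le[OF C'(1)] e by (metis atMost_iff subsetD)
      then have "incident_edges K v \<subseteq> C" using component_vertex[OF C'(1) v(1) _ e] incident_eq by blast
      then show "e \<in> (\<Union>v\<in>?X. ins v)" using v by blast
    qed
  qed (use incident_eq in blast)
  finally have i: "(\<Sum>v\<in>?X. \<Sum>e\<in>ins v. h e) = sum h C" .
  show ?thesis unfolding sum_subtractf o i by simp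
qed

end

section \<open>The fully singular resolution\<close>

context braid_projection
begin

lemma singular_vertex_edges:
  assumes "t < n" "touches i t" "touches j t"
  shows "(E i t, E j (Suc t)) \<in> adjacent_edges K {..<n}" "(E j (Suc t), E i t) \<in> adjacent_edges K {..<n}"
proof -
  have "Four_Valent t \<in> vertices K {..<n}" using assms(1) by (simp add: vertices_def)
  moreover have "E i t \<in> incident_edges K (Four_Valent t)" "E j (Suc t) \<in> incident_edges K (Four_Valent t)"
    using assms(2,3) by (auto simp: touches_def edge_a_def edge_b_def edge_c_def edge_d_def)
  ultimately show "(E i t, E j (Suc t)) \<in> adjacent_edges K {..<n}" "(E j (Suc t), E i t) \<in> adjacent_edges K {..<n}"
    unfolding adjacent_edges_def by blast+
qed

text \<open>A strand changes its edge only at a crossing, and the four edges at a singularized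
  crossing are adjacent.\<close>

lemma singular_strand:
  assumes i: "i < strands K"
  shows "t \<le> n \<Longrightarrow> (E i 0, E (perm t i) t) \<in> (adjacent_edges K {..<n})\<^sup>*"
proof (induction t)
  case (Suc t)
  then have t: "t < n" and IH: "(E i 0, E (perm t i) t) \<in> (adjacent_edges K {..<n})\<^sup>*" by auto
  have p: "perm (Suc t) i = transpose (left_col K t) (Suc (left_col K t)) (perm t i)" by (simp add: perm_Suc[OF t])
  show ?case
  proof (cases "touches (perm t i) t")
    case True
    have "touches (perm (Suc t) i) t" using True unfolding p by (auto simp: touches_def)
    then show ?thesis using IH singular_vertex_edges(1)[OF t True] by (auto intro: rtrancl_into_rtrancl)
  next
    case False
    then have "perm (Suc t) i = perm t i" unfolding p by (simp add: touches_def transpose_def)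
    then show ?thesis using IH E_step[OF perm_less[OF _ i] t] False t by simp
  qed
qed (simp add: perm_0)

text \<open>The strands are traversed in the order of the knot, from column 0 along the powers of
  the braid permutation, and so all columns are reached. The closure arc of column 0 is cut, but
  adjacency bridges the cut point.\<close>

lemma singular_all:
  assumes j: "j < strands K" and t: "t \<le> n"
  shows "(0, E j t) \<in> (adjacent_edges K {..<n})\<^sup>*"
proof -
  let ?A = "(adjacent_edges K {..<n})\<^sup>*"
  have b: "(0, E i 0) \<in> ?A" if "(braid_perm K ^^ m) 0 = i" for m i using that
  proof (induction m arbitrary: i)
    case 0
    then show ?case using E_00 by auto
  next
    case (Suc m)
    let ?j = "(braid_perm K ^^ m) 0"
    have less: "(braid_perm K ^^ m) 0 < strands K" for m
      by (induction m) (use strands_pos perm_less[of n] perm_n in auto)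
    have i: "i = braid_perm K ?j" "i < strands K" using Suc.prems less[of "Suc m"] by auto
    have "(E ?j 0, E i n) \<in> ?A" using singular_strand[OF less order_refl, of m] by (simp only: perm_n i(1))
    with Suc.IH[OF refl] have "(0, E i n) \<in> ?A" by (rule rtrancl_trans)
    moreover have "(E i n, E i 0) \<in> ?A"
    proof (cases "i = 0")
      case True
      then show ?thesis unfolding adjacent_edges_def by (intro r_into_rtrancl) simp
    next
      case False
      then show ?thesis using E_wrap[of i] i(2) by simp
    qed
    ultimately show ?case by (rule rtrancl_trans)
  qed
  obtain i where i: "i < strands K" "perm t i = j" by (rule perm_surj[OF t j])
  have "closes_to_knot K" using K unfolding decorated_braid_projection_def by simp
  then obtain m where m: "(braid_perm K ^^ m) 0 = i" using i(1) unfolding closes_to_knot_def by blast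
  show ?thesis by (rule rtrancl_trans[OF b[OF m] singular_strand[OF i(1) t, unfolded i(2)]])
qed

lemma singular_connected: "free_components K {..<n} = {}"
proof -
  have "0 \<in> C" if C: "C \<in> components K {..<n}" for C
  proof -
    obtain e where e: "e \<le> 2 * n" "C = {e'. (e, e') \<in> (adjacent_edges K {..<n})\<^sup>*}"
      using C unfolding components_def quotient_def by auto
    have "e \<in> (\<lambda>(j, t). E j t) ` ({..<strands K} \<times> {..n})" unfolding E_image using e(1) by simp
    then obtain j t where jt: "j < strands K" "t \<le> n" "e = E j t" by auto
    have 0: "(0, e) \<in> (adjacent_edges K {..<n})\<^sup>*" using singular_all[OF jt(1,2)] jt(3) by simp
    have "sym (adjacent_edges K {..<n})" unfolding adjacent_edges_def by (auto intro!: symI)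
    then show ?thesis using e(2) symD[OF sym_rtrancl 0] by simp
  qed
  then show ?thesis unfolding free_components_def by blast
qed

lemma singular_resolution: "braid_resolution K {..<n} pick"
  by unfold_locales (simp_all add: complete_resolution_def special_choice_def singular_connected)

end

section \<open>The Koszul comparison\<close>

context concrete_ring
begin

lemma genideal_eqI:
  assumes "A \<subseteq> carrier R" "B \<subseteq> carrier R" "A \<subseteq> Idl B" "B \<subseteq> Idl A"
  shows "Idl A = Idl B"
  using genideal_minimal[OF genideal_ideal[OF assms(1)] assms(4)]
    genideal_minimal[OF genideal_ideal[OF assms(2)] assms(3)] by (rule equalityI[rotated])

text \<open>Regularity in every order: entries leave and enter the ideal with different sets of
  relations \<open>W\<close> already present.\<close>

definition regular_family :: "'v set \<Rightarrow> ('v \<Rightarrow> 'r) \<Rightarrow> bool"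
  where "regular_family D f \<longleftrightarrow> f \<in> D \<rightarrow> carrier R \<and>
    (\<forall>W v a. W \<subseteq> D \<longrightarrow> v \<in> D \<longrightarrow> v \<notin> W \<longrightarrow> a \<in> carrier R \<longrightarrow> f v * a \<in> Idl (f ` W) \<longrightarrow> a \<in> Idl (f ` W))"

lemma regular_familyD:
  assumes "regular_family D f"
  shows "v \<in> D \<Longrightarrow> f v \<in> carrier R" "W \<subseteq> D \<Longrightarrow> f ` W \<subseteq> carrier R"
    "W \<subseteq> D \<Longrightarrow> v \<in> D \<Longrightarrow> v \<notin> W \<Longrightarrow> a \<in> carrier R \<Longrightarrow> f v * a \<in> Idl (f ` W) \<Longrightarrow> a \<in> Idl (f ` W)"
proof -
  have fc: "f \<in> D \<rightarrow> carrier R" using assms unfolding regular_family_def by (rule conjunct1)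
  show "v \<in> D \<Longrightarrow> f v \<in> carrier R" using fc by (rule Pi_mem)
  show "W \<subseteq> D \<Longrightarrow> f ` W \<subseteq> carrier R" using fc by auto
  show "W \<subseteq> D \<Longrightarrow> v \<in> D \<Longrightarrow> v \<notin> W \<Longrightarrow> a \<in> carrier R \<Longrightarrow> f v * a \<in> Idl (f ` W) \<Longrightarrow> a \<in> Idl (f ` W)"
    using assms unfolding regular_family_def by simp
qed

context
  fixes X Y :: "'i::linorder set" and x :: "'i \<Rightarrow> 'r" and \<phi> :: "'i \<Rightarrow> 'v" and f W0 D
  assumes fam: "regular_family D f"
    and Y: "finite Y" and X: "finite X" and XY: "X \<inter> Y = {}" and x: "x \<in> X \<union> Y \<rightarrow> carrier R"
    and W0: "W0 \<subseteq> D" and \<phi>: "inj_on \<phi> Y" "\<phi> ` Y \<subseteq> D - W0"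
    and xf: "\<And>i. i \<in> Y \<Longrightarrow> x i = f (\<phi> i) \<or> x i = - f (\<phi> i)"
begin

text \<open>Entries may differ from relations by a sign, as they do at a singularized crossing,
  where the entry is the negative of \<open>Q_poly\<close>; the generated ideals are the
  same.\<close>

lemma family_ideal:
  assumes Z: "Z \<subseteq> Y"
  shows "Idl (f ` W0 \<union> x ` Z) = Idl (f ` (W0 \<union> \<phi> ` Z))"
proof (rule genideal_eqI)
  have D: "W0 \<union> \<phi> ` Z \<subseteq> D" using W0 \<phi>(2) Z by blast
  note B = regular_familyD(2)[OF fam D]
  show A: "f ` W0 \<union> x ` Z \<subseteq> carrier R" using regular_familyD(2)[OF fam W0] Z x by auto
  show "f ` (W0 \<union> \<phi> ` Z) \<subseteq> carrier R" by (rule B)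
  note sA = genideal_self[OF A] and sB = genideal_self[OF B]
  note iA = idealE(4)[OF genideal_ideal[OF A]] and iB = idealE(4)[OF genideal_ideal[OF B]]
  show "f ` W0 \<union> x ` Z \<subseteq> Idl (f ` (W0 \<union> \<phi> ` Z))"
  proof
    fix r assume "r \<in> f ` W0 \<union> x ` Z"
    then show "r \<in> Idl (f ` (W0 \<union> \<phi> ` Z))"
    proof
      assume "r \<in> f ` W0"
      then show ?thesis using sB by blast
    next
      assume "r \<in> x ` Z"
      then obtain i where i: "i \<in> Z" "r = x i" by blast
      have "f (\<phi> i) \<in> Idl (f ` (W0 \<union> \<phi> ` Z))" using sB i(1) by blast
      moreover have "i \<in> Y" using i(1) Z by blast
      ultimately show ?thesis using xf[of i] iB[of "f (\<phi> i)"] i(2) by auto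
    qed
  qed
  show "f ` (W0 \<union> \<phi> ` Z) \<subseteq> Idl (f ` W0 \<union> x ` Z)"
  proof
    fix r assume "r \<in> f ` (W0 \<union> \<phi> ` Z)"
    then consider "r \<in> f ` W0" | i where "i \<in> Z" "r = f (\<phi> i)" by blast
    then show "r \<in> Idl (f ` W0 \<union> x ` Z)"
    proof cases
      case 1
      then show ?thesis using sA by blast
    next
      case 2
      have a: "x i \<in> Idl (f ` W0 \<union> x ` Z)" using sA 2(1) by blast
      have "i \<in> Y" using 2(1) Z by blast
      then have "r = x i \<or> r = - x i" using xf[of i] 2(2) by auto
      then show ?thesis using a iA[OF a] by auto
    qed
  qed
qed

lemma family_regular:
  assumes Z: "Z \<subseteq> Y" "i \<in> Y - Z" "a \<in> carrier R" and m: "x i * a \<in> Idl (f ` W0 \<union> x ` Z)"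
  shows "a \<in> Idl (f ` W0 \<union> x ` Z)"
proof -
  have D: "W0 \<union> \<phi> ` Z \<subseteq> D" using W0 \<phi>(2) Z by blast
  have n: "\<phi> i \<notin> W0 \<union> \<phi> ` Z" using \<phi>(2) Z inj_onD[OF \<phi>(1)] by blast
  have p: "\<phi> i \<in> D" using \<phi>(2) Z by blast
  have "f (\<phi> i) * a = x i * a \<or> f (\<phi> i) * a = - (x i * a)" using xf[of i] Z(2) by auto
  then have "f (\<phi> i) * a \<in> Idl (f ` (W0 \<union> \<phi> ` Z))"
    using m idealE(4)[OF genideal_ideal[OF regular_familyD(2)[OF fam D]]] unfolding family_ideal[OF Z(1)] by auto
  then show ?thesis using regular_familyD(3)[OF fam D p n Z(3)] unfolding family_ideal[OF Z(1)] by simp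
qed

text \<open>The exchange in the form used below: the entries with indices in \<open>Y\<close> become
  relations of a regular family, to which \<open>\<phi>\<close> assigns them, next to the relations
  in \<open>W0\<close> that are in the ideal before and after.\<close>

lemma kh_family: "kh (X \<union> Y) x (Idl (f ` W0)) M \<longleftrightarrow> kh X x (Idl (f ` (W0 \<union> \<phi> ` Y))) M"
  unfolding family_ideal[OF order_refl, symmetric]
  by (rule kh_union_iff[OF Y X XY regular_familyD(2)[OF fam W0] x]) (rule family_regular)

end

text \<open>Starting point for Koszul resolutions, with evaluation at \<open>{}\<close> as the map
  that becomes the augmentation.\<close>

lemma empty_covers:
  fixes x :: "'i::linorder \<Rightarrow> 'r"
  assumes I: "ideal I R"
  shows "covers R (HZ {} x I) (cyc I) (\<lambda>z. cls I (z {})) (HB {} x I)"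
proof -
  note c = coversD'[OF cls_covers[OF I]]
  have kd0: "kd {} x z A = 0" for z :: "'i::linorder set \<Rightarrow> 'r" and x A by (simp add: kd_def)
  have k: "z \<in> carrier (kos {}) \<longleftrightarrow> z {} \<in> carrier R \<and> (\<forall>A. A \<noteq> {} \<longrightarrow> z A = 0)" for z :: "'i::linorder set \<Rightarrow> 'r"
    unfolding kos_simps subset_empty using R_closed(1) by metis
  have z: "z \<in> carrier (HZ {} x I) \<longleftrightarrow> z {} \<in> carrier R \<and> (\<forall>A. A \<noteq> {} \<longrightarrow> z A = 0)" for z
    unfolding HZ_simps kd0 k using idealE(1)[OF I] by simp
  have b: "z \<in> HB {} x I \<longleftrightarrow> z \<in> carrier (HZ {} x I) \<and> z {} \<in> I" for z
  proof
    assume "z \<in> HB {} x I"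
    then have "z \<in> carrier (kos {})" "z {} - 0 \<in> I" unfolding HB_def kd0 by auto
    then show "z \<in> carrier (HZ {} x I) \<and> z {} \<in> I" unfolding k z by simp
  next
    assume a: "z \<in> carrier (HZ {} x I) \<and> z {} \<in> I"
    have "z A \<in> I" for A using a idealE(1)[OF I] unfolding z by (cases "A = {}") simp_all
    moreover have "z \<in> carrier (kos {})" using a unfolding HZ_simps by simp
    ultimately show "z \<in> HB {} x I" unfolding HB_def kd0 diff_0_right by auto
  qed
  show ?thesis
    unfolding covers_def
  proof (intro conjI)
    show "linear_map R (HZ {} x I) (cyc I) (\<lambda>z. cls I (z {}))"
      by (rule linear_mapI) (simp_all add: z HZ_simps(2-4) cls_closed[OF I] cls_add[OF I] cls_mult[OF I])
    show "(\<lambda>z. cls I (z {})) ` carrier (HZ {} x I) = carrier (cyc I)"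
    proof
      show "(\<lambda>z. cls I (z {})) ` carrier (HZ {} x I) \<subseteq> carrier (cyc I)" using z cls_closed[OF I] by auto
      show "carrier (cyc I) \<subseteq> (\<lambda>z. cls I (z {})) ` carrier (HZ {} x I)"
      proof
        fix y assume "y \<in> carrier (cyc I)"
        note r = rep[OF I this]
        show "y \<in> (\<lambda>z. cls I (z {})) ` carrier (HZ {} x I)"
          by (rule image_eqI[of _ _ "\<lambda>A. if A = {} then rep I y else 0"]) (simp_all add: r z)
      qed
    qed
    show "HB {} x I = {w \<in> carrier (HZ {} x I). cls I (w {}) = \<zero>\<^bsub>cyc I\<^esub>}"
      by (rule Set.set_eqI) (simp add: b z cls_zero_iff[OF I] cong: conj_cong)
  qed
qed

text \<open>All entries are moved out of the ideal, starting from the empty sequence with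
  coefficients in \<open>R\<close> modulo all of them. Restricting a function to the subsets of
  \<open>{}\<close> leaves its value at \<open>{}\<close>, which makes the covering map
  explicit.\<close>

lemma koszul_resolution_covers:
  fixes X :: "'i::linorder set"
  assumes fam: "regular_family D f" and X: "finite X" and x: "x \<in> X \<rightarrow> carrier R"
    and \<phi>: "inj_on \<phi> X" "\<phi> ` X \<subseteq> D" and xf: "\<And>i. i \<in> X \<Longrightarrow> x i = f (\<phi> i)"
  shows "covers R (HZ X x {0}) (cyc (Idl (f ` \<phi> ` X))) (\<lambda>z. cls (Idl (f ` \<phi> ` X)) (z {})) (HB X x {0})"
proof -
  have im: "x ` X = f ` \<phi> ` X" using xf by (auto simp: image_iff)
  have c: "x ` X \<subseteq> carrier R" using x by auto
  have reg: "a \<in> Idl ({} \<union> x ` Z)"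
    if "Z \<subseteq> X" "i \<in> X - Z" "a \<in> carrier R" "x i * a \<in> Idl ({} \<union> x ` Z)" for Z i a
    using family_regular[OF fam X finite.emptyI _ _ empty_subsetI \<phi>(1) _ _ that(1-3)] that(4) x \<phi>(2) xf by simp
  have "covers R (HZ ({} \<union> X) x (Idl {})) (cyc (Idl ({} \<union> x ` X)))
     (\<lambda>z. (\<lambda>z. cls (Idl ({} \<union> x ` X)) (z {})) (\<lambda>A. if A \<subseteq> {} then z A else 0)) (HB ({} \<union> X) x (Idl {}))"
    by (rule kh_union[OF X finite.emptyI _ empty_subsetI _ _ empty_covers])
      (use x reg genideal_ideal[OF c] in auto)
  then show ?thesis by (simp add: genideal_empty im)
qed

end

section \<open>Leading monomials of the relations at the vertices\<close>

lemma sqf_singleton: "sqf {e} = single e 1"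
  by (simp add: sqf_def)

lemma U_frag: "U e = frag_of (sqf {e})"
  by (simp add: U_def sqf_singleton)

lemma U_closed: "e \<in> I \<Longrightarrow> U e \<in> carrier (poly_ring I)"
  by (auto simp: U_def poly_ring_simps)

lemma wt_sqf: "finite A \<Longrightarrow> wt w (sqf A) = sum w A"
  by (simp add: sqf_def wt_sum wt_single)

lemma keys_sum_U: "finite A \<Longrightarrow> k \<in> supp (sum U A) \<Longrightarrow> \<exists>e\<in>A. k = sqf {e}"
proof (induction A rule: finite_induct)
  case (insert e A)
  have "k \<in> supp (U e) \<or> k \<in> supp (sum U A)"
    using insert.prems Poly_Mapping.keys_add[of "U e" "sum U A"] insert.hyps by auto
  then show ?case using insert.IH by (auto simp: U_frag)
qed simp

lemma keys_diff_cases: "k \<in> supp (p - q) \<Longrightarrow> k \<in> supp p \<or> k \<in> supp q"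
  for p q :: zpoly
  by (auto simp: in_keys_iff lookup_minus)

context leading_monomials
begin

lemma regular_family: "R.regular_family V f"
  unfolding R.regular_family_def using fR regular by blast

end

context braid_resolution
begin

sublocale P: concrete_ring "edge_ring K"
  unfolding edge_ring_def by (rule concrete_ring_poly_ring)

abbreviation "PI \<equiv> genideal (edge_ring K)"
abbreviation "PC \<equiv> carrier (edge_ring K)"

text \<open>A linear relation for every vertex: \<open>L_poly\<close> at a four-valent one and
  \<open>Q_poly\<close> at a two-valent one. The ideals are expressed by it as long as four-valent
  vertices enter through \<open>L_poly\<close>.\<close>

definition flux :: "vertex \<Rightarrow> zpoly" where "flux v = sum U (outs v) - sum U (ins v)"

lemma flux_closed: "v \<in> VS \<Longrightarrow> flux v \<in> PC"
  unfolding flux_def using outs_le[of v] ins_le[of v]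
  by (intro P.R_closed_minus P.R_sum_closed) (auto simp: edge_ring_def intro!: U_closed)

text \<open>\<open>sum U\<close> runs over a set, so the two outgoing edges, and likewise the two
  ingoing ones, have to be distinct for \<open>flux\<close> to be \<open>L_poly\<close>. Injectivity
  of the port maps gives this.\<close>

lemma outs_card2: "Four_Valent t \<in> VS \<Longrightarrow> edge_a K t \<noteq> edge_b K t \<and> edge_c K t \<noteq> edge_d K t"
  using card_outs[of "Four_Valent t"] card_ins[of "Four_Valent t"]
  by (auto simp: outs_def ins_def out_port_def in_port_def card_insert_if split: if_splits)

lemma flux_Four: "Four_Valent t \<in> VS \<Longrightarrow> flux (Four_Valent t) = L_poly K t"
  using outs_card2[of t] by (simp add: flux_def outs_def ins_def out_port_def in_port_def L_poly_def)

lemma flux_Left: "flux (Left_Vertex t) = Q_poly K (Left_Vertex t)"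
  and flux_Right: "flux (Right_Vertex t) = Q_poly K (Right_Vertex t)"
  by (simp_all add: flux_def outs_def ins_def out_port_def in_port_def)

lemma flux_leads:
  assumes v: "v \<in> regulars"
  shows "leads weight (flux v) (sqf {pivot v})"
  unfolding leads_def
proof
  note vV = regulars_VS[OF v]
  have po: "pivot v \<in> outs v" by (rule pivot(1)[OF v])
  have wp: "weight (pivot v) = 3 ^ (Max (height ` VS) - height v)" using weight_out[OF v po] by simp
  have e: "flux v - frag_of (sqf {pivot v}) = sum U (outs v - {pivot v}) - sum U (ins v)"
    using sum.remove[OF outs_finite po, of U] by (simp add: flux_def U_frag[symmetric])
  fix k assume "k \<in> supp (flux v - frag_of (sqf {pivot v}))"
  then have "k \<in> supp (sum U (outs v - {pivot v})) \<or> k \<in> supp (sum U (ins v))"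
    unfolding e by (rule keys_diff_cases)
  then obtain e where e: "k = sqf {e}" "e \<in> outs v \<and> e \<noteq> pivot v \<or> e \<in> ins v"
    using keys_sum_U[of "outs v - {pivot v}" k] keys_sum_U[of "ins v" k] outs_finite ins_finite by blast
  have "weight e < weight (pivot v)" using e(2)
  proof
    assume "e \<in> outs v \<and> e \<noteq> pivot v"
    then show ?thesis using weight_out[OF v, of e] wp by simp
  next
    assume "e \<in> ins v"
    then show ?thesis using weight_in[OF vV, of e] wp by simp
  qed
  then show "wt weight k < wt weight (sqf {pivot v})" by (simp add: e(1) wt_sqf)
qed

text \<open>At a four-valent vertex one outgoing edge is the pivot and the other has weight 0, so
  \<open>U\<^sub>a U\<^sub>b\<close> weighs as much as the pivot. It outweighs
  \<open>U\<^sub>c U\<^sub>d\<close>, whose factors each weigh less than half of that.\<close>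

lemma Q_leads:
  assumes v: "v \<in> regulars"
  shows "leads weight (Q_poly K v) (sqf (outs v))"
proof (cases v)
  case (Left_Vertex t)
  have "outs v = {pivot v}" using pivot(1)[OF v] by (simp add: Left_Vertex outs_def)
  then show ?thesis using flux_leads[OF v] by (simp add: Left_Vertex flux_Left)
next
  case (Right_Vertex t)
  have "outs v = {pivot v}" using pivot(1)[OF v] by (simp add: Right_Vertex outs_def)
  then show ?thesis using flux_leads[OF v] by (simp add: Right_Vertex flux_Right)
next
  case (Four_Valent t)
  note vV = regulars_VS[OF v]
  let ?a = "edge_a K t" and ?b = "edge_b K t" and ?c = "edge_c K t" and ?d = "edge_d K t"
  let ?N = "3 ^ (Max (height ` VS) - height v) :: nat"
  have ne: "?a \<noteq> ?b" using outs_card2 vV Four_Valent by blast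
  have o: "outs v = {?a, ?b}" by (auto simp: Four_Valent outs_def out_port_def)
  have i: "?c \<in> ins v" "?d \<in> ins v" by (auto simp: Four_Valent ins_def in_port_def)
  have s: "sqf (outs v) = sqf {?a} + sqf {?b}" unfolding o sqf_def using ne by simp
  have "weight ?a + weight ?b = ?N"
    using weight_out[OF v, of ?a] weight_out[OF v, of ?b] pivot(1)[OF v] ne unfolding o by auto
  then have w: "weight ?c + weight ?d < weight ?a + weight ?b"
    using weight_in[OF vV i(1)] weight_in[OF vV i(2)] by linarith
  have "Q_poly K v - frag_of (sqf (outs v)) = - frag_of (sqf {?c} + sqf {?d})"
    unfolding s frag_of_mult[symmetric] U_frag[symmetric] by (simp add: Four_Valent)
  then show ?thesis using w by (simp add: leads_def s wt_add wt_sqf)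
qed

lemma Q_poly_closed: "v \<in> VS \<Longrightarrow> Q_poly K v \<in> PC"
proof -
  assume v: "v \<in> VS"
  have "U e \<in> PC" if "e \<in> incident_edges K v" for e
    using that outs_le[OF v] ins_le[OF v] unfolding incident_eq edge_ring_def by (intro U_closed) blast
  then show ?thesis by (cases v) (auto intro!: P.R_closed P.R_closed_minus)
qed

lemma flux_family: "P.regular_family regulars flux"
proof -
  have 1: "{pivot u} \<inter> {pivot v} = {}" if "u \<in> regulars" "v \<in> regulars" "u \<noteq> v" for u v
    using outs_unique[OF regulars_VS regulars_VS, OF that(1,2) pivot(1)[OF that(1)]] pivot(1)[OF that(2)] that(3) by auto
  have 2: "{pivot v} \<subseteq> {..2 * n}" if "v \<in> regulars" for v
    using outs_le[OF regulars_VS] pivot(1) that by blast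
  show ?thesis unfolding edge_ring_def
    by (rule leading_monomials.regular_family[where w = weight and D = "\<lambda>v. {pivot v}"], unfold_locales)
      (simp_all add: finite_regulars 1[simplified] 2[simplified] finite.intros insert_not_empty flux_closed[OF regulars_VS, unfolded edge_ring_def] flux_leads)
qed

lemma Q_family: "P.regular_family regulars (Q_poly K)"
proof -
  have 1: "outs u \<inter> outs v = {}" if "u \<in> regulars" "v \<in> regulars" "u \<noteq> v" for u v
    using outs_unique[OF regulars_VS regulars_VS, OF that(1,2)] that(3) by blast
  have 2: "outs v \<noteq> {}" for v using vports_ne unfolding outs_def by simp
  show ?thesis unfolding edge_ring_def
    by (rule leading_monomials.regular_family[where w = weight and D = outs], unfold_locales)
      (simp_all add: finite_regulars 1[simplified] 2[simplified] outs_finite outs_le[OF regulars_VS] Q_poly_closed[OF regulars_VS, unfolded edge_ring_def] Q_leads)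
qed

lemma special_relation:
  assumes v: "v \<in> special"
  shows "flux v \<in> PI (flux ` regulars)"
proof -
  obtain C where C: "C \<in> free_components K S" "v = pick C" using v unfolding special_def by blast
  let ?X = "{u \<in> VS. incident_edges K u \<subseteq> C}"
  have vX: "v \<in> ?X" using pick_props[OF C(1)] C(2) by simp
  have "(\<Sum>u\<in>?X. flux u) = 0" unfolding flux_def by (rule flow_sum[OF C(1)])
  then have e: "flux v = - (\<Sum>u\<in>?X - {v}. flux u)"
    using sum.remove[OF _ vX, of flux] finite_VS by (simp add: eq_neg_iff_add_eq_0)
  have c: "flux ` regulars \<subseteq> PC" using flux_closed[OF regulars_VS] by blast
  note I = P.genideal_ideal[OF c]
  have "(\<Sum>u\<in>?X - {v}. flux u) \<in> PI (flux ` regulars)"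
  proof (rule P.ideal_sum[OF I])
    fix u assume u: "u \<in> ?X - {v}"
    \<comment> \<open>A free component carries only one special vertex, and in \<open>C\<close> this
      is \<open>v\<close>.\<close>
    have "u \<notin> special"
    proof
      assume "u \<in> special"
      then obtain C' where C': "C' \<in> free_components K S" "u = pick C'" unfolding special_def by blast
      have "C' = C" by (rule special_component[OF C'(1) C(1)]) (use u C'(2) in simp)
      then show False using u C C' by simp
    qed
    then have "u \<in> regulars" using u unfolding regulars_def by simp
    then show "flux u \<in> PI (flux ` regulars)" using P.genideal_self[OF c] by blast
  qed
  then show ?thesis unfolding e by (rule P.idealE(4)[OF I])
qed

end

lemma (in braid_projection) L_family:
  "concrete_ring.regular_family (edge_ring K) {..<n} (L_poly K)"
proof -
  \<comment> \<open>No component is free here, so any choice function is admissible, and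
    \<open>undefined\<close> serves as one.\<close>
  interpret B: braid_resolution K "{..<n}" undefined by (rule singular_resolution)
  have r: "Four_Valent t \<in> B.regulars" if "t < n" for t
    using that by (simp add: B.regulars_def B.special_def singular_connected vertices_def)
  note f = B.flux_family
  have e: "B.flux ` Four_Valent ` W = L_poly K ` W" if "W \<subseteq> {..<n}" for W
    using that by (auto simp: image_image B.flux_Four[OF B.regulars_VS[OF r]] intro!: image_cong)
  have e1: "B.flux (Four_Valent t) = L_poly K t" if "t < n" for t
    by (rule B.flux_Four[OF B.regulars_VS[OF r[OF that]]])
  show ?thesis
    unfolding B.P.regular_family_def
  proof (intro conjI allI impI)
    show "L_poly K \<in> {..<n} \<rightarrow> carrier (edge_ring K)"
      using B.P.regular_familyD(1)[OF f r] e1 by auto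
    fix W v a
    assume W: "W \<subseteq> {..<n}" and v: "v \<in> {..<n}" "v \<notin> W" and a: "a \<in> carrier (edge_ring K)"
      and m: "L_poly K v * a \<in> Idl\<^bsub>edge_ring K\<^esub> (L_poly K ` W)"
    have "a \<in> Idl\<^bsub>edge_ring K\<^esub> (B.flux ` Four_Valent ` W)"
      by (rule B.P.regular_familyD(3)[OF f, of _ "Four_Valent v"]) (use W v a m r e[OF W] e1 in auto)
    then show "a \<in> Idl\<^bsub>edge_ring K\<^esub> (L_poly K ` W)" unfolding e[OF W] .
  qed
qed

section \<open>The exchange of entries for a resolution\<close>

context braid_resolution
begin

definition q :: "nat \<Rightarrow> zpoly"
  where "q t = (if t \<in> S then (U (edge_a K t) - U (edge_c K t)) * (U (edge_a K t) - U (edge_d K t))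
    else U (edge_a K t) - U (edge_c K t))"

text \<open>The generator of the Koszul complexes for the crossing \<open>t\<close> has index \<open>t\<close>. The indices
  \<open>n + t\<close> and \<open>2 n + t\<close> stand for a second generator, for \<open>t\<close> in \<open>S\<close> and not in \<open>S\<close>,
  respectively; in the latter case it carries three successive values.\<close>

definition y :: "(nat \<Rightarrow> zpoly) \<Rightarrow> nat \<Rightarrow> zpoly"
  where "y r i = (if i < n then (if i \<in> S then - Q_poly K (Four_Valent i) else Q_poly K (Left_Vertex i))
    else if i < 2 * n then L_poly K (i - n) else r (i - 2 * n))"

text \<open>The value at the index of a smoothed crossing starts as \<open>L_poly\<close>, becomes
  \<open>r2\<close> once \<open>Q_poly\<close> of the left vertex is in the ideal, and
  \<open>r3\<close> once the non-special right vertices are there too.\<close>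

definition r2 :: "nat \<Rightarrow> zpoly" where "r2 t = Q_poly K (Right_Vertex t)"

definition r3 :: "nat \<Rightarrow> zpoly" where "r3 t = (if Right_Vertex t \<in> special then 0 else r2 t)"

text \<open>\<open>T\<close> consists of the smoothed crossings; \<open>RS\<close> and
  \<open>RN\<close> split \<open>RT\<close> according to whether the right vertex is special. The
  offsets keep the blocks of indices disjoint and put \<open>LS\<close> below \<open>RS\<close>, the
  order required by \<open>kh_exterior\<close>.\<close>

abbreviation "T \<equiv> {..<n} - S"
abbreviation "LS \<equiv> (+) n ` S"
abbreviation "RT \<equiv> (+) (2 * n) ` T"
abbreviation "RS \<equiv> (+) (2 * n) ` {t \<in> T. Right_Vertex t \<in> special}"
abbreviation "RN \<equiv> (+) (2 * n) ` {t \<in> T. Right_Vertex t \<notin> special}"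
abbreviation "NR \<equiv> Right_Vertex ` {t \<in> T. Right_Vertex t \<notin> special}"

lemma S_less: "t \<in> S \<Longrightarrow> t < n" using S_sub by auto

lemma special_right: "v \<in> special \<Longrightarrow> \<exists>t\<in>T. v = Right_Vertex t"
  using pick_props(3) unfolding special_def by blast

lemma regulars_eq: "regulars = Four_Valent ` S \<union> Left_Vertex ` T \<union> NR"
  unfolding regulars_def vertices_def right_vertices_def using special_right by blast

lemma mem_VS: "t \<in> S \<Longrightarrow> Four_Valent t \<in> VS" "t \<in> T \<Longrightarrow> Left_Vertex t \<in> VS" "t \<in> T \<Longrightarrow> Right_Vertex t \<in> VS"
  by (simp_all add: vertices_def right_vertices_def)

lemma edges_le:
  assumes "t < n"
  shows "edge_a K t \<le> 2 * n" "edge_b K t \<le> 2 * n" "edge_c K t \<le> 2 * n" "edge_d K t \<le> 2 * n"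
  using left_col_less[OF assms] assms E_le unfolding edge_a_def edge_b_def edge_c_def edge_d_def by simp_all

lemma U_edges: "e \<le> 2 * n \<Longrightarrow> U e \<in> PC" by (simp add: edge_ring_def U_closed)

lemma L_closed: "t < n \<Longrightarrow> L_poly K t \<in> PC"
  unfolding L_poly_def by (intro P.R_closed_minus P.R_closed U_edges edges_le)

lemma q_closed: "t < n \<Longrightarrow> q t \<in> PC"
  unfolding q_def by (simp add: P.R_closed_minus P.R_closed U_edges edges_le)

lemma y_closed:
  assumes r: "\<And>t. t \<in> T \<Longrightarrow> r t \<in> PC"
  shows "i \<in> {..<n} \<union> LS \<union> RT \<Longrightarrow> y r i \<in> PC"
proof -
  assume "i \<in> {..<n} \<union> LS \<union> RT"
  then consider "i < n" | t where "t \<in> S" "i = n + t" | t where "t \<in> T" "i = 2 * n + t" by blast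
  then show "y r i \<in> PC"
  proof cases
    case 1
    then show ?thesis using Q_poly_closed[OF mem_VS(1)] Q_poly_closed[OF mem_VS(2)]
      by (simp add: y_def P.R_closed_minus del: Q_poly.simps)
  next
    case 2
    then show ?thesis using L_closed S_less by (simp add: y_def)
  next
    case 3
    then show ?thesis using r by (simp add: y_def)
  qed
qed

lemma y_simps:
  "t \<in> S \<Longrightarrow> y r t = - Q_poly K (Four_Valent t)" "t \<in> T \<Longrightarrow> y r t = flux (Left_Vertex t)"
  "t \<in> S \<Longrightarrow> y r (n + t) = L_poly K t" "y r (2 * n + t) = r t"
  using S_less by (auto simp: y_def flux_Left)

lemma r_closed: "t \<in> T \<Longrightarrow> L_poly K t \<in> PC" "t \<in> T \<Longrightarrow> r2 t \<in> PC" "t \<in> T \<Longrightarrow> r3 t \<in> PC"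
  using L_closed Q_poly_closed[OF mem_VS(3)] P.R_closed(1) by (simp_all add: r3_def r2_def del: Q_poly.simps)

lemma index_disjoint: "{..<n} \<inter> RT = {}" "{..<n} \<inter> LS = {}" "LS \<inter> RT = {}"
  using S_less by fastforce+

lemma finite_indices: "finite S" "finite T" "finite LS" "finite RT" "finite RS" "finite RN"
  using finite_subset[OF S_sub] by auto

lemma ideal_flux_S: "PI (flux ` Four_Valent ` S) = L_ideal K S"
  unfolding L_ideal_def image_image by (rule arg_cong[of _ _ "\<lambda>A. PI A"])
    (rule image_cong[OF refl flux_Four[OF mem_VS(1)]])

lemma L_ideal_sub: "A \<subseteq> {..<n} \<Longrightarrow> L_poly K ` A \<subseteq> PC" using L_closed by auto

lemma kh_crossings: "P.kh {..<n} q (L_ideal K {..<n}) (total_homology (B_KR K S))"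
proof -
  have I: "ideal (L_ideal K {..<n}) (edge_ring K)"
    unfolding L_ideal_def by (rule P.genideal_ideal[OF L_ideal_sub[OF order_refl]])
  \<comment> \<open>Without crossings the tensor product is the ring itself, and the ideal is indeed
    zero.\<close>
  have z: "L_ideal K {..<n} = {0}" if "n = 0" using that P.genideal_empty by (simp add: L_ideal_def)
  have qc: "q \<in> {..<n} \<rightarrow> PC" using q_closed by simp
  have st: "P.steps (L_ideal K {..<n}) n q = map (\<lambda>t. two_step_complex (P.cyc (L_ideal K {..<n})) (q t)) [0..<n]"
    by (rule P.steps_def[OF I qc z])
  have e: "B_KR K S = tensor_complex (edge_ring K) (P.steps (L_ideal K {..<n}) n q)"
    unfolding st B_KR_def Q_complex_def cyclic_module_def P.cyc_def[OF I] by (simp add: q_def)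
  show ?thesis unfolding e by (rule P.kh_tensor_complex[OF I qc z])
qed

lemma kh_smoothings: "P.kh (S \<union> RT) (y (L_poly K)) (PI (flux ` (Four_Valent ` S \<union> Left_Vertex ` T)))
    (total_homology (B_KR K S))"
proof -
  let ?H = "total_homology (B_KR K S)" and ?y = "y (L_poly K)"
  have Lc: "L_poly K ` {..<n} \<subseteq> PC" by (rule L_ideal_sub[OF order_refl])
  have I: "ideal (L_ideal K {..<n}) (edge_ring K)" unfolding L_ideal_def by (rule P.genideal_ideal[OF Lc])
  have qc: "q \<in> {..<n} \<rightarrow> PC" using q_closed by simp
  have yc: "i \<in> {..<n} \<union> LS \<union> RT \<Longrightarrow> ?y i \<in> PC" for i by (rule y_closed[OF r_closed(1)])
  have "P.kh {..<n} ?y (L_ideal K {..<n}) ?H"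
  proof (rule iffD1[OF P.kh_cong[OF finite_lessThan qc I]])
    show "?y \<in> {..<n} \<rightarrow> PC" using yc by auto
    fix t assume "t \<in> {..<n}"
    then have t: "t < n" by simp
    show "q t - ?y t \<in> L_ideal K {..<n}"
    proof (cases "t \<in> S")
      case True
      have "L_poly K t \<in> L_ideal K {..<n}" unfolding L_ideal_def using P.genideal_self[OF Lc] t by blast
      then have "U (edge_a K t) * L_poly K t \<in> L_ideal K {..<n}"
        by (rule P.idealE(6)[OF I U_edges[OF edges_le(1)[OF t]]])
      \<comment> \<open>This is \<open>(U\<^sub>a - U\<^sub>c) (U\<^sub>a - U\<^sub>d) + U\<^sub>a
        U\<^sub>b - U\<^sub>c U\<^sub>d = U\<^sub>a L(p)\<close>, the reason why the quadratic entry
        is the negative of \<open>Q(p)\<close> modulo \<open>L(p)\<close>.\<close>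
      moreover have "q t - ?y t = U (edge_a K t) * L_poly K t"
        using True by (simp add: q_def y_simps(1) L_poly_def algebra_simps)
      ultimately show ?thesis by simp
    next
      case False
      then have "?y t = q t" using t by (simp add: q_def y_def)
      then show ?thesis using P.idealE(1)[OF I] by simp
    qed
  qed (rule kh_crossings)
  then have "P.kh {..<n} ?y (PI (L_poly K ` (S \<union> (\<lambda>i. i - 2 * n) ` RT))) ?H"
  proof -
    have "S \<union> (\<lambda>i. i - 2 * n) ` RT = {..<n}" using S_sub by (auto simp: image_image)
    then show "P.kh {..<n} ?y (L_ideal K {..<n}) ?H \<Longrightarrow> ?thesis" by (simp add: L_ideal_def)
  qed
  \<comment> \<open>The L(p) of the smoothed crossings leave the ideal and become entries with the
    new indices \<open>RT\<close>. Only relations L(p) are in the ideal at this point, so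
    \<open>L_family\<close> applies.\<close>
  then have "P.kh ({..<n} \<union> RT) ?y (PI (L_poly K ` S)) ?H"
  proof (rule iffD2[OF P.kh_family[OF L_family finite_indices(4) finite_lessThan index_disjoint(1) _ S_sub], rotated -1])
    show "?y \<in> {..<n} \<union> RT \<rightarrow> PC" using yc by auto
    show "inj_on (\<lambda>i. i - 2 * n) RT" by (auto intro!: inj_onI)
    show "(\<lambda>i. i - 2 * n) ` RT \<subseteq> {..<n} - S" by auto
    show "?y i = L_poly K (i - 2 * n) \<or> ?y i = - L_poly K (i - 2 * n)" if "i \<in> RT" for i
      using that by (auto simp: y_simps(4))
  qed
  then have "P.kh ((S \<union> RT) \<union> T) ?y (PI (flux ` Four_Valent ` S)) ?H"
  proof -
    have "(S \<union> RT) \<union> T = {..<n} \<union> RT" using S_sub by auto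
    then show "P.kh ({..<n} \<union> RT) ?y (PI (L_poly K ` S)) ?H \<Longrightarrow> ?thesis"
      by (simp add: ideal_flux_S L_ideal_def)
  qed
  \<comment> \<open>The entries at \<open>T\<close> are the \<open>Q_poly\<close> of left vertices.
    From here on regularity is that of the fluxes in the resolution \<open>S\<close>.\<close>
  then show ?thesis
  proof (rule iffD1[OF P.kh_family[OF flux_family finite_indices(2)], rotated -1])
    show "finite (S \<union> RT)" using finite_indices by simp
    show "(S \<union> RT) \<inter> T = {}" using index_disjoint(1) by auto
    show "?y \<in> S \<union> RT \<union> T \<rightarrow> PC" using yc S_sub by auto
    show "inj_on Left_Vertex T" by (rule inj_onI) simp
    show "Four_Valent ` S \<subseteq> regulars" "Left_Vertex ` T \<subseteq> regulars - Four_Valent ` S"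
      unfolding regulars_eq by auto
    show "?y i = flux (Left_Vertex i) \<or> ?y i = - flux (Left_Vertex i)" if "i \<in> T" for i
      by (rule disjI1[OF y_simps(2)[OF that]])
  qed
qed

lemma kh_right_vertices: "P.kh (S \<union> RS) (y r3) (PI (flux ` regulars)) (total_homology (B_KR K S))"
proof -
  let ?H = "total_homology (B_KR K S)" and ?B = "Four_Valent ` S \<union> Left_Vertex ` T"
  have Br: "?B \<subseteq> regulars" unfolding regulars_eq by blast
  note Bc = P.regular_familyD(2)[OF flux_family Br]
  note I = P.genideal_ideal[OF Bc]
  have c: "i \<in> {..<n} \<union> LS \<union> RT \<Longrightarrow> y (L_poly K) i \<in> PC" "i \<in> {..<n} \<union> LS \<union> RT \<Longrightarrow> y r2 i \<in> PC"
    "i \<in> {..<n} \<union> LS \<union> RT \<Longrightarrow> y r3 i \<in> PC" for i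
    by (rule y_closed; (rule r_closed; assumption)?; assumption)+
  have "P.kh (S \<union> RT) (y r2) (PI (flux ` ?B)) ?H"
  proof (rule iffD1[OF P.kh_cong[OF _ _ I]])
    show "finite (S \<union> RT)" using finite_indices by simp
    show "y (L_poly K) \<in> S \<union> RT \<rightarrow> PC" "y r2 \<in> S \<union> RT \<rightarrow> PC" using c S_sub by auto
    fix i assume "i \<in> S \<union> RT"
    then show "y (L_poly K) i - y r2 i \<in> PI (flux ` ?B)"
    proof
      assume "i \<in> S"
      then show ?thesis using P.idealE(1)[OF I] by (simp add: y_simps(1))
    next
      assume "i \<in> RT"
      then obtain t where t: "t \<in> T" "i = 2 * n + t" by blast
      \<comment> \<open>\<open>L(p)\<close> is the sum of \<open>U\<^sub>a - U\<^sub>c\<close>,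
        which is already in the ideal, and \<open>U\<^sub>b - U\<^sub>d\<close>.\<close>
      have "y (L_poly K) i - y r2 i = flux (Left_Vertex t)"
        unfolding t(2) y_simps(4) by (simp add: r2_def L_poly_def flux_Left)
      then show ?thesis using P.genideal_self[OF Bc] t(1) by auto
    qed
  qed (rule kh_smoothings)
  then have "P.kh ((S \<union> RS) \<union> RN) (y r2) (PI (flux ` ?B)) ?H"
  proof -
    have "(S \<union> RS) \<union> RN = S \<union> RT" by auto
    then show "P.kh (S \<union> RT) (y r2) (PI (flux ` ?B)) ?H \<Longrightarrow> ?thesis" by simp
  qed
  \<comment> \<open>The non-special right vertices complete the ideal to the one generated by the
    fluxes of all regular vertices.\<close>
  then have "P.kh (S \<union> RS) (y r2) (PI (flux ` (?B \<union> (\<lambda>i. Right_Vertex (i - 2 * n)) ` RN))) ?H"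
  proof (rule iffD1[OF P.kh_family[OF flux_family finite_indices(6)], rotated -1])
    show "finite (S \<union> RS)" using finite_indices by simp
    show "(S \<union> RS) \<inter> RN = {}" using index_disjoint(1) S_less by fastforce
    show "y r2 \<in> S \<union> RS \<union> RN \<rightarrow> PC" using c(2) S_sub by auto
    show "inj_on (\<lambda>i. Right_Vertex (i - 2 * n)) RN" by (auto intro!: inj_onI)
    show "?B \<subseteq> regulars" by (rule Br)
    show "(\<lambda>i. Right_Vertex (i - 2 * n)) ` RN \<subseteq> regulars - ?B" unfolding regulars_eq by auto
    show "y r2 i = flux (Right_Vertex (i - 2 * n)) \<or> y r2 i = - flux (Right_Vertex (i - 2 * n))" if "i \<in> RN" for i
      using that by (auto simp: y_simps(4) r2_def flux_Right)
  qed
  moreover have "?B \<union> (\<lambda>i. Right_Vertex (i - 2 * n)) ` RN = regulars" unfolding regulars_eq image_image by simp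
  ultimately have k: "P.kh (S \<union> RS) (y r2) (PI (flux ` regulars)) ?H" by simp
  note I' = P.genideal_ideal[OF P.regular_familyD(2)[OF flux_family order_refl]]
  show ?thesis
  proof (rule iffD1[OF P.kh_cong[OF _ _ I'] k])
    show "finite (S \<union> RS)" using finite_indices by simp
    show "y r2 \<in> S \<union> RS \<rightarrow> PC" "y r3 \<in> S \<union> RS \<rightarrow> PC" using c(2,3) S_sub by auto
    fix i assume "i \<in> S \<union> RS"
    then show "y r2 i - y r3 i \<in> PI (flux ` regulars)"
    proof
      assume "i \<in> S"
      then show ?thesis using P.idealE(1)[OF I'] by (simp add: y_simps(1))
    next
      assume "i \<in> RS"
      then obtain t where t: "Right_Vertex t \<in> special" "i = 2 * n + t" by blast
      \<comment> \<open>By \<open>special_relation\<close> this flux is in the ideal by now, so the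
        entry may be replaced by zero.\<close>
      have "y r2 i - y r3 i = flux (Right_Vertex t)"
        unfolding t(2) y_simps(4) using t(1) by (simp add: r3_def r2_def flux_Right)
      then show ?thesis using special_relation[OF t(1)] by simp
    qed
  qed
qed

lemma kh_singularizations:
  "P.kh (LS \<union> RS) (y r3) (Q_ideal K S pick) (total_homology (B_KR K S))"
proof -
  let ?H = "total_homology (B_KR K S)" and ?B = "Left_Vertex ` T \<union> NR"
  have Br: "?B \<subseteq> regulars" unfolding regulars_eq by blast
  have c: "i \<in> {..<n} \<union> LS \<union> RT \<Longrightarrow> y r3 i \<in> PC" for i by (rule y_closed[OF r_closed(3)])
  have e: "?B \<union> (\<lambda>i. Four_Valent (i - n)) ` LS = regulars" unfolding regulars_eq image_image by auto
  \<comment> \<open>The L(p) for \<open>S\<close> leave the ideal as entries with indices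
    \<open>LS\<close>, while the entries with indices in \<open>S\<close> stay; this makes room for
    the \<open>Q_poly\<close> of the four-valent vertices.\<close>
  have "P.kh ((S \<union> RS) \<union> LS) (y r3) (PI (flux ` ?B)) ?H"
  proof (rule iffD2[OF P.kh_family[OF flux_family finite_indices(3)]])
    show "P.kh (S \<union> RS) (y r3) (PI (flux ` (?B \<union> (\<lambda>i. Four_Valent (i - n)) ` LS))) ?H"
      unfolding e by (rule kh_right_vertices)
    show "finite (S \<union> RS)" using finite_indices by simp
    show "(S \<union> RS) \<inter> LS = {}" using index_disjoint S_sub by blast
    show "y r3 \<in> S \<union> RS \<union> LS \<rightarrow> PC" using c S_sub by auto
    show "inj_on (\<lambda>i. Four_Valent (i - n)) LS" by (auto intro!: inj_onI)
    show "?B \<subseteq> regulars" by (rule Br)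
    show "(\<lambda>i. Four_Valent (i - n)) ` LS \<subseteq> regulars - ?B" unfolding regulars_eq by auto
    show "y r3 i = flux (Four_Valent (i - n)) \<or> y r3 i = - flux (Four_Valent (i - n))" if "i \<in> LS" for i
      using that by (auto simp: y_simps(3) flux_Four[OF mem_VS(1)])
  qed
  \<comment> \<open>Only two-valent vertices are left in the ideal. There the two families coincide,
    which allows the change from \<open>flux_family\<close> to \<open>Q_family\<close>.\<close>
  moreover have "flux ` ?B = Q_poly K ` ?B"
    by (rule image_cong[OF refl]) (auto simp: flux_Left flux_Right)
  moreover have "(S \<union> RS) \<union> LS = (LS \<union> RS) \<union> S" by blast
  ultimately have "P.kh ((LS \<union> RS) \<union> S) (y r3) (PI (Q_poly K ` ?B)) ?H" by simp
  then have "P.kh (LS \<union> RS) (y r3) (PI (Q_poly K ` (?B \<union> Four_Valent ` S))) ?H"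
  proof (rule iffD1[OF P.kh_family[OF Q_family finite_indices(1)], rotated -1])
    show "finite (LS \<union> RS)" using finite_indices by simp
    show "(LS \<union> RS) \<inter> S = {}" using index_disjoint S_sub by blast
    show "y r3 \<in> LS \<union> RS \<union> S \<rightarrow> PC" using c S_sub by auto
    show "inj_on Four_Valent S" by (rule inj_onI) simp
    show "?B \<subseteq> regulars" by (rule Br)
    show "Four_Valent ` S \<subseteq> regulars - ?B" unfolding regulars_eq by auto
    show "y r3 i = Q_poly K (Four_Valent i) \<or> y r3 i = - Q_poly K (Four_Valent i)" if "i \<in> S" for i
      by (rule disjI2[OF y_simps(1)[OF that]])
  qed
  moreover have "?B \<union> Four_Valent ` S = VS - pick ` free_components K S"
    unfolding special_def[symmetric] regulars_def[symmetric] regulars_eq by blast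
  ultimately show ?thesis unfolding Q_ideal_def by simp
qed

lemma L_ideal_resolution:
  "covers (edge_ring K) (P.HZ LS (y r3) {0}) (P.cyc (L_ideal K S)) (\<lambda>z. P.cls (L_ideal K S) (z {})) (P.HB LS (y r3) {0})"
proof -
  have e: "L_poly K ` (\<lambda>i. i - n) ` LS = L_poly K ` S" by (simp add: image_image)
  show ?thesis
    unfolding L_ideal_def e[symmetric]
    by (rule P.koszul_resolution_covers[OF L_family finite_indices(3)])
      (use y_closed[OF r_closed(3)] S_sub in \<open>auto simp: y_simps(3) intro!: inj_onI\<close>)
qed

theorem homology_isomorphic:
  "modules_isomorphic (edge_ring K) (total_homology (B_KR K S))
    (tensor (edge_ring K)
      (total_Tor (edge_ring K) (cyclic_module K (L_ideal K S)) (cyclic_module K (Q_ideal K S pick)))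
      (exterior_algebra (edge_ring K) (V_module K S)))"
proof -
  let ?R = "edge_ring K" and ?Q = "Q_ideal K S pick"
  \<comment> \<open>The zero entries belong to the special vertices; \<open>pick\<close> matches
    these with the free components, that is, with the basis of \<open>V_module\<close>.\<close>
  let ?g = "\<lambda>i. inv_into (free_components K S) pick (Right_Vertex (i - 2 * n))"
  have L: "ideal (L_ideal K S) ?R" unfolding L_ideal_def by (rule P.genideal_ideal[OF L_ideal_sub[OF S_sub]])
  have Q: "ideal ?Q ?R" unfolding Q_ideal_def
    by (rule P.genideal_ideal) (use Q_poly_closed in blast)
  have c: "i \<in> {..<n} \<union> LS \<union> RT \<Longrightarrow> y r3 i \<in> PC" for i by (rule y_closed[OF r_closed(3)])
  have cL: "y r3 \<in> LS \<rightarrow> PC" and cU: "y r3 \<in> LS \<union> RS \<rightarrow> PC" using c by auto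
  have m: "cyclic_module K I = P.cyc I" if "ideal I ?R" for I
    by (simp add: cyclic_module_def P.cyc_def[OF that])
  have g: "bij_betw ?g RS (free_components K S)"
  proof -
    have 1: "bij_betw (\<lambda>i. Right_Vertex (i - 2 * n)) RS special"
      unfolding bij_betw_def
    proof
      show "inj_on (\<lambda>i. Right_Vertex (i - 2 * n)) RS" by (auto intro!: inj_onI)
      show "(\<lambda>i. Right_Vertex (i - 2 * n)) ` RS = special"
        unfolding image_image using special_right by auto
    qed
    have 2: "bij_betw (inv_into (free_components K S) pick) special (free_components K S)"
      by (rule bij_betw_inv_into) (simp add: bij_betw_def pick_inj special_def)
    show ?thesis using bij_betw_trans[OF 1 2] by (simp add: comp_def)
  qed
  have "P.kh LS (y r3) ?Q (total_Tor ?R (P.cyc (L_ideal K S)) (P.cyc ?Q))"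
    by (rule P.kh_total_Tor[OF finite_indices(3) cL L Q L_ideal_resolution])
  then have 1: "P.kh (LS \<union> RS) (y r3) ?Q
      (tensor ?R (total_Tor ?R (P.cyc (L_ideal K S)) (P.cyc ?Q)) (exterior_algebra ?R (V_module K S)))"
    unfolding V_module_def
  proof (rule P.kh_exterior[OF finite_indices(5) g finite_indices(3) cL Q, rotated -1])
    show "i < f" if "i \<in> LS" "f \<in> RS" for i f using that S_less by fastforce
    show "y r3 f = 0" if "f \<in> RS" for f using that by (auto simp: y_simps(4) r3_def)
  qed
  obtain p where p: "covers ?R (P.HZ (LS \<union> RS) (y r3) ?Q) (total_homology (B_KR K S)) p (P.HB (LS \<union> RS) (y r3) ?Q)"
    using kh_singularizations unfolding P.kh_def by blast
  obtain p' where p': "covers ?R (P.HZ (LS \<union> RS) (y r3) ?Q)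
      (tensor ?R (total_Tor ?R (P.cyc (L_ideal K S)) (P.cyc ?Q)) (exterior_algebra ?R (V_module K S))) p' (P.HB (LS \<union> RS) (y r3) ?Q)"
    using 1 unfolding P.kh_def by blast
  have f: "finite (LS \<union> RS)" using finite_indices by simp
  \<comment> \<open>Both sides are covered by the same cycles with the same boundaries.\<close>
  show ?thesis unfolding m[OF L] m[OF Q]
    by (rule covers_isomorphic[OF P.HZ_module[OF f cU Q] P.HB_zero[OF f cU Q] p p'])
qed

end

theorem theorem1p2:
  fixes K :: decorated_braid and S :: "nat set" and pick :: "nat set \<Rightarrow> vertex"
  assumes "decorated_braid_projection K"
    and "complete_resolution K S"
    and "special_choice K S pick"
  shows "modules_isomorphic (edge_ring K)
    (total_homology (B_KR K S))
    (tensor (edge_ring K)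
      (total_Tor (edge_ring K) (cyclic_module K (L_ideal K S)) (cyclic_module K (Q_ideal K S pick)))
      (exterior_algebra (edge_ring K) (V_module K S)))"
proof -
  interpret braid_resolution K S pick by unfold_locales (rule assms)+
  show ?thesis by (rule homology_isomorphic)
qed

end
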